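(* Let $2\le m\le26$, and let the real toll sequence $(t_n)_{n\ge0}$ satisfy $t_n\sim\sqrt n\,L(n)$ with $L$ slowly varying. Let $X_n$ be the corresponding additive functional on $m$-ary search trees on $n$ keys under the random permutation model, with mean $\mu_n$ and variance $\sigma_n^2$. Write $\rho:=\prod_{i=0}^{m-2}\left(\tfrac32+i\right)$. Then $$\mu_n=\mu n-\frac{\rho}{m!-\rho}\sqrt n\,L(n)+o\bigl(\sqrt n\,L(n)\bigr),\qquad\mu:=\frac{K_1}{H_m-1},\quad K_1:=\sum_{j=0}^\infty\frac{t_j}{(j+1)(j+2)} .$$ If $\sum_{k\ge 1}\frac{L^2(k)}k<\infty$, then $$\sigma_n^2=\sigma^2n+o(n),\qquad\sigma^2:=\frac1{H_m-1}\sum_{j=0}^\infty\frac{r_j}{(j+1)(j+2)},$$ where $r_j:=0$ for $0\le j\le m-2$ and, for $n\ge m-1$, $r_n:=\binom n{m-1}^{-1}\sum_{\mathbf j}[t_n+\mu_{j_1}+\cdots+\mu_{j_m}-\mu_n]^2$, the sum being over all $m$-tuples $(j_1,\dots,j_m)$ of nonnegative integers summing to $n-(m-1)$; in this case define $s^2(n):=\sigma^2n$. If $\sum_{k\ge1}\frac{L^2(k)}k=\infty$, then $$\sigma_n^2\sim s^2(n):=\sigma^2n\sum_{k\le n}\frac{L^2(k)}k,\qquad\text{where in this case}\quad\sigma^2:=\frac{\rho^2\left[\frac\pi4(m-1)+1\right]-(m!)^2}{(H_m-1)\,[m!-\rho]^2} .$$ Moreover, in either case $(X_n-\mu n)/s(n)$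 is asymptotically standard normal, and there is convergence of moments of every order.
   Context: Random permutation model and additive functionals. Fix an integer $m\ge 2$. From a sequence of $n$ distinct keys one builds an $m$-ary search tree $T$ with $|T|=n$ keys: if $n<m$, all keys are stored in the root (for $n=0$ the tree is empty; if $n\le m-1$ all subtrees of the root are empty); if $n\ge m$, the first $m-1$ keys are stored in the root in increasing order $\sigma_1<\dots<\sigma_{m-1}$, and for $1\le j\le m$ the remaining keys lying strictly between $\sigma_{j-1}$ and $\sigma_j$ (with $\sigma_0=-\infty$, $\sigma_m=+\infty$), taken in their original order, recursively form the $j$th subtree $L_j(T)$. Given a real sequence $(t_n)_{n\ge0}$ (toll sequence), the additive functional $f$ is defined by $f(T)=t_{|T|}$ if $0\le |T|\le m-2$ (arbitrary initial values) and $f(T)=\sum_{i=1}^m f(L_i(T))+t_{|T|}$ if $|T|\ge m-1$. $X_n:=f(T_n)$, where $T_n$ is the tree built from a uniformly random permutation of $\{1,\dots,n\}$. $H_m=\sum_{j=1}^m1/j$. A slowly varying function is a positive measurable function $L$ on $[1,\infty)$ with $L(cx)/L(x)\to1$ as $x\to\infty$ for every $c>0$. *)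

theory Defs
  imports "HOL-Probability.Probability" "HOL-Combinatorics.Multiset_Permutations"
    "HOL-Library.Landau_Symbols"
begin

text \<open>A node carries its keys and the list of its subtrees; the empty tree is a separate
  constructor.\<close>

datatype 'k mtree = Empty | Node (node_keys: "'k list") (subtrees: "'k mtree list")

primrec key_count :: "'k mtree \<Rightarrow> nat" where
  "key_count Empty = 0"
| "key_count (Node ks Ts) = length ks + sum_list (map key_count Ts)"

text \<open>For a sorted list \<open>ss\<close> the gaps between consecutive entries are numbered from \<open>0\<close> to
  \<open>length ss\<close>; the first gap is unbounded below, the last one above.\<close>

definition in_gap :: "'k::linorder list \<Rightarrow> nat \<Rightarrow> 'k \<Rightarrow> bool" where
  "in_gap ss j x \<longleftrightarrow> (0 < j \<longrightarrow> ss ! (j - 1) < x) \<and> (j < length ss \<longrightarrow> x < ss ! j)"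

text \<open>The case \<open>m < 2\<close> is a dummy that makes the recursion terminate.\<close>

function search_tree :: "nat \<Rightarrow> 'k::linorder list \<Rightarrow> 'k mtree" where
  "search_tree m ks =
    (if m < 2 \<or> ks = [] then Empty
     else if length ks < m then Node (sort ks) (replicate m Empty)
     else (let ss = sort (take (m - 1) ks); rest = drop (m - 1) ks
           in Node ss (map (\<lambda>j. search_tree m (filter (in_gap ss j) rest)) [0..<m])))"
  by pat_completeness auto
termination
proof (relation "Wellfounded.measure (\<lambda>(m, ks). length ks)", goal_cases)
  case 1
  show ?case by simp
next
  case (2 m ks ss rest j)
  then show ?case
    by (auto intro!: le_less_trans[OF length_filter_le])
qed

declare search_tree.simps [simp del]

text \<open>The additive functional with toll sequence \<open>t\<close> on \<open>m\<close>-ary search trees, \<open>m \<ge> 2\<close>.\<close>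

primrec additive :: "nat \<Rightarrow> (nat \<Rightarrow> real) \<Rightarrow> 'k mtree \<Rightarrow> real" where
  "additive m t Empty = t 0"
| "additive m t (Node ks Ts) =
    (if key_count (Node ks Ts) \<le> m - 2 then t (key_count (Node ks Ts))
     else sum_list (map (additive m t) Ts) + t (key_count (Node ks Ts)))"

definition random_perm :: "nat \<Rightarrow> nat list pmf" where
  "random_perm n = pmf_of_set (permutations_of_set {1..n})"

text \<open>The random variable \<open>X\<^sub>n\<close> is \<open>X_fun m t\<close> on the probability space \<open>random_perm n\<close>.\<close>

definition X_fun :: "nat \<Rightarrow> (nat \<Rightarrow> real) \<Rightarrow> nat list \<Rightarrow> real" where
  "X_fun m t ks = additive m t (search_tree m ks)"

definition mean_X :: "nat \<Rightarrow> (nat \<Rightarrow> real) \<Rightarrow> nat \<Rightarrow> real" where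
  "mean_X m t n = measure_pmf.expectation (random_perm n) (X_fun m t)"

definition var_X :: "nat \<Rightarrow> (nat \<Rightarrow> real) \<Rightarrow> nat \<Rightarrow> real" where
  "var_X m t n = measure_pmf.variance (random_perm n) (X_fun m t)"

definition slowly_varying :: "(real \<Rightarrow> real) \<Rightarrow> bool" where
  "slowly_varying L \<longleftrightarrow>
     (\<forall>x\<ge>1. 0 < L x) \<and> L \<in> borel_measurable (lebesgue_on {1..}) \<and>
     (\<forall>c>0. ((\<lambda>x. L (c * x) / L x) \<longlongrightarrow> 1) at_top)"

definition rho :: "nat \<Rightarrow> real" where
  "rho m = (\<Prod>i = 0..m - 2. 3 / 2 + real i)"

definition K1_term :: "(nat \<Rightarrow> real) \<Rightarrow> nat \<Rightarrow> real" where
  "K1_term t j = t j / ((real j + 1) * (real j + 2))"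

definition mean_slope :: "nat \<Rightarrow> (nat \<Rightarrow> real) \<Rightarrow> real" where
  "mean_slope m t = (\<Sum>j. K1_term t j) / (harm m - 1)"

definition var_toll :: "nat \<Rightarrow> (nat \<Rightarrow> real) \<Rightarrow> nat \<Rightarrow> real" where
  "var_toll m t n =
    (if n < m - 1 then 0
     else (\<Sum>js | length js = m \<and> sum_list js = n - (m - 1).
             (t n + sum_list (map (mean_X m t) js) - mean_X m t n)\<^sup>2) / real (n choose (m - 1)))"

definition var_term :: "nat \<Rightarrow> (nat \<Rightarrow> real) \<Rightarrow> nat \<Rightarrow> real" where
  "var_term m t j = var_toll m t j / ((real j + 1) * (real j + 2))"

text \<open>The constants called \<open>\<sigma>\<^sup>2\<close> when \<open>\<Sum>\<^sub>k L\<^sup>2(k)/k\<close> converges and when it diverges.\<close>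

definition sigma2_conv :: "nat \<Rightarrow> (nat \<Rightarrow> real) \<Rightarrow> real" where
  "sigma2_conv m t = (\<Sum>j. var_term m t j) / (harm m - 1)"

definition sigma2_div :: "nat \<Rightarrow> real" where
  "sigma2_div m = ((rho m)\<^sup>2 * (pi / 4 * (real m - 1) + 1) - (fact m)\<^sup>2)
                    / ((harm m - 1) * (fact m - rho m)\<^sup>2)"

text \<open>The \<open>k\<close>-th entry is the summand with index \<open>k + 1\<close>.\<close>

definition L2_term :: "(real \<Rightarrow> real) \<Rightarrow> nat \<Rightarrow> real" where
  "L2_term L k = (L (real (Suc k)))\<^sup>2 / real (Suc k)"

definition s2 :: "nat \<Rightarrow> (nat \<Rightarrow> real) \<Rightarrow> (real \<Rightarrow> real) \<Rightarrow> nat \<Rightarrow> real" where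
  "s2 m t L n =
    (if summable (L2_term L) then sigma2_conv m t * real n
     else sigma2_div m * real n * (\<Sum>k<n. L2_term L k))"

definition X_normalized ::
  "nat \<Rightarrow> (nat \<Rightarrow> real) \<Rightarrow> (real \<Rightarrow> real) \<Rightarrow> nat \<Rightarrow> nat list \<Rightarrow> real" where
  "X_normalized m t L n ks = (X_fun m t ks - mean_slope m t * real n) / sqrt (s2 m t L n)"

end

theory Submission
  imports Defs "HOL-Real_Asymp.Real_Asymp" "HOL-Computational_Algebra.Fundamental_Theorem_Algebra"
begin

text \<open>The subtree sizes of the root are uniform over the compositions of \<open>n - (m - 1)\<close>, and given them the
  subtrees are independent random search trees. Hence mean and variance satisfy the same linear recurrence,
  which turns the generating function into the solution of an Euler equation in \<open>1 - z\<close> with indicial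
  equation \<open>x (x + 1) \<cdots> (x + m - 2) = m!\<close>. For \<open>m \<le> 26\<close> every root other than \<open>2\<close> has real part below
  \<open>3/2\<close>, so peeling off the linear factors one at a time transfers regularly varying tolls of index
  \<open>1/2\<close> and above. The variance recurrence is driven by the second moment of the residual
  \<open>t\<^sub>n + \<mu>\<^sub>j\<^sub>1 + \<cdots> + \<mu>\<^sub>j\<^sub>m - \<mu>\<^sub>n\<close>, in which the linear parts of the means cancel; the remainder is a
  multiple of \<open>\<surd>n L(n)\<close>, whose second moment comes from the coefficients of \<open>(1 - z) powr (-3/2)\<close>.

  Normality: the residual is \<open>o(s(n))\<close> and the variances of the subtrees add up to \<open>s(n)\<^sup>2\<close> up to
  \<open>o(s(n)\<^sup>2)\<close>. The distance of the characteristic function from the Gaussian with the same variance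
  therefore satisfies the tree recurrence with tolls of order \<open>o(s(n)\<^sup>3)\<close> and \<open>o(s(n)\<^sup>4)\<close>, and on these orders
  the recurrence is a contraction, because the mean of \<open>\<Sum> (J\<^sub>i / n) powr q\<close> is below \<open>1\<close> for \<open>q > 1\<close>. The same
  contraction bounds all even moments, which upgrades weak convergence to convergence of moments.\<close>

section \<open>Roots of the indicial equation\<close>

text \<open>A merely slowly varying \<open>L\<close> gives no control over the differences of
  \<open>sqrt n * L n\<close>, while peeling off a linear factor needs a scale whose weighted
  differences are asymptotically proportional to it (\<open>reg\<close>). The transfer is therefore
  run with smoothed scales: \<open>n + 1\<close> times the tail of the series of weighted tolls for
  the mean and, if the sum of \<open>L^2 / k\<close> diverges, \<open>n + 1\<close> times the
  partial sums of that series for the variance. Both obey an exact first-order recurrence and are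
  compared with the scales of the theorem only afterwards. Dividing the indicial polynomial by its
  root \<open>2\<close> leaves a first-order equation that is solved in closed form. This is the
  origin of the weights \<open>1 / ((k + 1) * (k + 2))\<close>; the value
  \<open>m! * (H_m - 1)\<close> of the quotient at \<open>2\<close> is the origin of the
  denominators \<open>H_m - 1\<close>. In the normal approximation the argument \<open>u\<close> of
  the characteristic function moves with \<open>n\<close>. So the error is bounded by
  \<open>|u|^3 * A n + u^4 * B n\<close> with \<open>A\<close> and \<open>B\<close> free of
  \<open>u\<close>, and the contraction is applied to \<open>A\<close> and \<open>B\<close>.\<close>

lemma prod_add_cis_arctan:
  fixes x y :: real
  assumes "x > 0"
  shows "(\<Prod>k<n. complex_of_real (x + real k) + \<i> * complex_of_real y)
    = complex_of_real (\<Prod>k<n. sqrt ((x + real k)\<^sup>2 + y\<^sup>2)) * cis (\<Sum>k<n. arctan (y / (x + real k)))"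
proof (induction n)
  case (Suc n)
  let ?a = "x + real n"
  have a: "?a > 0" using assms by simp
  have s: "sqrt (?a\<^sup>2 + y\<^sup>2) = ?a * sqrt (1 + (y / ?a)\<^sup>2)"
  proof -
    have "?a\<^sup>2 + y\<^sup>2 = ?a\<^sup>2 * (1 + (y / ?a)\<^sup>2)" using a by (simp add: field_simps)
    then show ?thesis using a by (simp add: real_sqrt_mult)
  qed
  have p: "sqrt (1 + (y / ?a)\<^sup>2) > 0" by (smt (verit) real_sqrt_gt_0_iff zero_le_power2)
  have "complex_of_real ?a + \<i> * complex_of_real y = complex_of_real (sqrt (?a\<^sup>2 + y\<^sup>2)) * cis (arctan (y / ?a))"
    unfolding s using a p
    by (simp add: complex_eq_iff cos_arctan sin_arctan)
  then show ?case using Suc by (simp add: cis_mult[symmetric] mult_ac)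
qed simp

lemma prod_two_add: "(\<Prod>k<j. 2 + real k) = fact (Suc j)"
  by (induction j) (auto simp: algebra_simps)

text \<open>The quotient of the two sides starts at 1 and picks up the factor \<open>f k\<close>
  from \<open>j = k\<close> to \<open>j = k + 1\<close>. These factors exceed 1 exactly for
  \<open>k <= 3\<close>, so the quotient rises and then falls, and only the last value
  \<open>j = 25\<close> needs a numerical check.\<close>

lemma prefix_prod_gt:
  fixes j :: nat
  assumes "1 \<le> j" "j \<le> 25"
  shows "(fact (Suc j))\<^sup>2 < (\<Prod>k<j. (3 / 2 + real k)\<^sup>2 + (97 / 44)\<^sup>2)"
proof -
  define f where "f k = ((3 / 2 + real k)\<^sup>2 + (97 / 44)\<^sup>2) / (2 + real k)\<^sup>2" for k
  have f_pos: "f k > 0" for k unfolding f_def by (intro divide_pos_pos) (auto simp: add_pos_nonneg)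
  have f_iff: "f k > 1 \<longleftrightarrow> k \<le> 3" "f k < 1 \<longleftrightarrow> k \<ge> 4" for k
  proof -
    have "(2 + real k)\<^sup>2 > 0" by simp
    then show "f k > 1 \<longleftrightarrow> k \<le> 3" "f k < 1 \<longleftrightarrow> k \<ge> 4"
      unfolding f_def less_divide_eq_1_pos[OF \<open>(2 + real k)\<^sup>2 > 0\<close>] divide_less_eq_1_pos[OF \<open>(2 + real k)\<^sup>2 > 0\<close>]
      by (auto simp: power2_eq_square algebra_simps)
  qed
  have eq: "(\<Prod>k<j. (3 / 2 + real k)\<^sup>2 + (97 / 44)\<^sup>2) = (fact (Suc j))\<^sup>2 * prod f {..<j}" for j
  proof -
    have "(fact (Suc j))\<^sup>2 * prod f {..<j} = (\<Prod>k<j. (2 + real k)\<^sup>2 * f k)"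
      unfolding prod_two_add[symmetric] prod_power_distrib by (simp add: prod.distrib)
    also have "\<dots> = (\<Prod>k<j. (3 / 2 + real k)\<^sup>2 + (97 / 44)\<^sup>2)"
      by (intro prod.cong) (auto simp: f_def)
    finally show ?thesis ..
  qed
  have "prod f {..<j} > 1"
  proof (cases "j \<le> 4")
    case True
    have "prod f {..<j} > prod (\<lambda>_. 1) {..<j}"
      using True assms by (intro prod_mono_strict) (auto simp: f_iff f_pos lessThan_empty_iff intro!: less_imp_le[of 1])
    then show ?thesis by simp
  next
    case False
    have "(fact 26)\<^sup>2 < (\<Prod>k<25. (3 / 2 + real k)\<^sup>2 + (97 / 44)\<^sup>2)"
      by (simp add: fact_numeral lessThan_nat_numeral lessThan_Suc power2_eq_square)
    then have "(1 :: real) < prod f {..<25}" unfolding eq by simp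
    also have "prod f {..<25} = prod f {..<j} * prod f {j..<25}"
      using assms by (subst prod.union_disjoint[symmetric]) (auto intro!: prod.cong)
    also have "\<dots> \<le> prod f {..<j} * prod (\<lambda>_. 1) {j..<25}"
      using False f_pos f_iff(2) by (intro mult_left_mono prod_mono prod_nonneg) (auto intro!: less_imp_le)
    finally show ?thesis by simp
  qed
  then show ?thesis unfolding eq by simp
qed

text \<open>Scaling by 44 makes each factor \<open>3/2 + k + i * 97/44\<close> the Gaussian integer
  \<open>66 + 44 k + 97 i\<close>. The pair holds the real and the imaginary part of the scaled
  product, so that a sign can be decided by evaluation in the integers.\<close>

primrec gauss_prod :: "nat \<Rightarrow> int \<times> int" where
  "gauss_prod 0 = (1, 0)"
| "gauss_prod (Suc n) = (let (a, b) = gauss_prod n; c = 66 + 44 * int n in (a * c - 97 * b, 97 * a + b * c))"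

lemma prod_eq_gauss_prod:
  "(\<Prod>k<n. complex_of_real (3 / 2 + real k) + \<i> * complex_of_real (97 / 44)) * 44 ^ n
    = of_int (fst (gauss_prod n)) + \<i> * of_int (snd (gauss_prod n))"
proof (induction n)
  case (Suc n)
  let ?P = "\<Prod>k<n. complex_of_real (3 / 2 + real k) + \<i> * complex_of_real (97 / 44)"
  have "(\<Prod>k<Suc n. complex_of_real (3 / 2 + real k) + \<i> * complex_of_real (97 / 44)) * 44 ^ Suc n
    = (?P * 44 ^ n) * (of_nat (66 + 44 * n) + 97 * \<i>)"
    by (simp add: field_simps)
  also have "\<dots> = of_int (fst (gauss_prod (Suc n))) + \<i> * of_int (snd (gauss_prod (Suc n)))"
    unfolding Suc.IH by (simp add: Let_def case_prod_beta complex_eq_iff algebra_simps)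
  finally show ?case .
qed simp

text \<open>This exact sign stands in for a numerical estimate of the argument of the product, which
  lies very close to \<open>2 * pi\<close>.\<close>

lemma Im_prod_neg: "Im (\<Prod>k<25. complex_of_real (3 / 2 + real k) + \<i> * complex_of_real (97 / 44)) < 0"
proof -
  have "snd (gauss_prod 25) < 0" by code_simp
  moreover have "Im ((\<Prod>k<25. complex_of_real (3 / 2 + real k) + \<i> * complex_of_real (97 / 44)) * of_real (44 ^ 25))
      = real_of_int (snd (gauss_prod 25))"
    using prod_eq_gauss_prod[of 25] by simp
  moreover have "Im (z * of_real c) = Im z * c" for z c by simp
  ultimately have "Im (\<Prod>k<25. complex_of_real (3 / 2 + real k) + \<i> * complex_of_real (97 / 44)) * 44 ^ 25 < 0"
    by (metis of_int_less_0_iff)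
  then show ?thesis by (simp add: mult_less_0_iff)
qed

text \<open>The sum is coarsely below \<open>3 * pi\<close>, and on \<open>[2 * pi, 3 * pi]\<close> the imaginary part would be nonnegative.\<close>

lemma arctan_sum_lt_2pi: "(\<Sum>k<25. arctan ((97 / 44) / (3 / 2 + real k))) < 2 * pi"
proof (rule ccontr)
  let ?S = "\<Sum>k<25. arctan ((97 / 44) / (3 / 2 + real k))"
  assume "\<not> ?S < 2 * pi"
  then have ge: "?S \<ge> 2 * pi" by simp
  have "?S = arctan ((97 / 44) / (3 / 2)) + (\<Sum>k\<in>{1..<25}. arctan ((97 / 44) / (3 / 2 + real k)))"
    by (simp add: lessThan_atLeast0 sum.atLeast_Suc_lessThan)
  also have "(\<Sum>k\<in>{1..<25}. arctan ((97 / 44) / (3 / 2 + real k))) \<le> (\<Sum>k\<in>{1..<25}. (97 / 44) / (3 / 2 + real k))"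
    by (intro sum_mono arctan_le_self) simp
  also have "\<dots> \<le> 7"
    by (simp add: sum.atLeast_Suc_lessThan)
  finally have "?S \<le> pi / 2 + 7" using arctan_ubound[of "(97 / 44) / (3 / 2)"] by simp
  moreover have "pi > 3" using pi_approx by simp
  ultimately have "?S < 3 * pi" by simp
  have "sin ?S = sin (?S - 2 * pi)" by (simp add: sin_diff)
  also have "\<dots> \<ge> 0" using ge \<open>?S < 3 * pi\<close> by (intro sin_ge_zero) auto
  finally have "sin ?S \<ge> 0" .
  moreover have "(\<Prod>k<25. sqrt ((3 / 2 + real k)\<^sup>2 + (97 / 44)\<^sup>2)) \<ge> 0"
    by (intro prod_nonneg) simp
  moreover have "Im (complex_of_real R * cis S) = R * sin S" for R S by simp
  ultimately have "0 \<le> Im (complex_of_real (\<Prod>k<25. sqrt ((3 / 2 + real k)\<^sup>2 + (97 / 44)\<^sup>2)) * cis ?S)"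
    by (simp only: mult_nonneg_nonneg)
  also have "\<dots> = Im (\<Prod>k<25. complex_of_real (3 / 2 + real k) + \<i> * complex_of_real (97 / 44))"
    by (subst prod_add_cis_arctan) auto
  finally show False using Im_prod_neg by linarith
qed

text \<open>With \<open>y = Im z\<close> and \<open>Re z \<ge> 3/2\<close>: for \<open>y \<ge> 97/44\<close> the modulus of the product is too large, while for
  \<open>0 < y < 97/44\<close> its argument lies strictly between \<open>0\<close> and \<open>2 * pi\<close>. The height \<open>97/44\<close> serves both purposes
  up to \<open>m = 26\<close>.\<close>

lemma root_Re_less_pos:
  fixes z :: complex
  assumes "2 \<le> m" "m \<le> 26" "(\<Prod>k<m - 1. z + of_nat k) = fact m" "Im z > 0"
  shows "Re z < 3 / 2"
proof (rule ccontr)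
  assume "\<not> Re z < 3 / 2"
  define x y where "x = Re z" and "y = Im z"
  have x: "x \<ge> 3 / 2" and y: "y > 0" using \<open>\<not> Re z < 3 / 2\<close> assms by (simp_all add: x_def y_def)
  define j where "j = m - 1"
  have j: "1 \<le> j" "j \<le> 25" "m = Suc j" using assms by (auto simp: j_def)
  \<comment> \<open>The sum of arguments is not reduced modulo \<open>2 * pi\<close>. That the
    product is a positive real makes \<open>S\<close> a multiple of \<open>2 * pi\<close>, and
    strict bounds on \<open>S\<close> itself then exclude all multiples.\<close>
  define S where "S = (\<Sum>k<j. arctan (y / (x + real k)))"
  define R where "R = (\<Prod>k<j. sqrt ((x + real k)\<^sup>2 + y\<^sup>2))"
  have R: "R > 0" unfolding R_def using y by (intro prod_pos) (simp add: add_nonneg_pos)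
  have "(\<Prod>k<j. z + of_nat k) = (\<Prod>k<j. complex_of_real (x + real k) + \<i> * complex_of_real y)"
    by (intro prod.cong) (auto simp: complex_eq_iff x_def y_def)
  also have "\<dots> = of_real R * cis S"
    unfolding R_def S_def using x by (intro prod_add_cis_arctan) simp
  finally have eq: "of_real R * cis S = fact (Suc j)" using assms(3) j by simp
  then have "norm (of_real R * cis S) = norm (fact (Suc j) :: complex)" by (rule arg_cong)
  then have Rf: "R = fact (Suc j)" using R by (simp add: norm_mult norm_fact del: fact_Suc)
  then have "cis S = 1" using eq R by (metis mult_cancel_left2 of_real_eq_0_iff of_real_fact less_irrefl)
  have "y < 97 / 44"
  proof (rule ccontr)
    assume "\<not> y < 97 / 44"
    then have y': "y \<ge> 97 / 44" by simp
    have "R\<^sup>2 = (\<Prod>k<j. (x + real k)\<^sup>2 + y\<^sup>2)"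
      unfolding R_def prod_power_distrib by (intro prod.cong) auto
    also have "\<dots> \<ge> (\<Prod>k<j. (3 / 2 + real k)\<^sup>2 + (97 / 44)\<^sup>2)"
      using x y' by (intro prod_mono conjI add_mono power_mono) auto
    finally show False using prefix_prod_gt[OF j(1,2)] Rf by simp
  qed
  have "S \<le> (\<Sum>k<j. arctan ((97 / 44) / (3 / 2 + real k)))"
    unfolding S_def arctan_le_iff using x y \<open>y < 97 / 44\<close>
    by (intro sum_mono) (unfold arctan_le_iff, intro frac_le, auto)
  also have "\<dots> \<le> (\<Sum>k<25. arctan ((97 / 44) / (3 / 2 + real k)))"
    using j by (intro sum_mono2) auto
  finally have "S < 2 * pi" using arctan_sum_lt_2pi by simp
  moreover have "S > 0"
    unfolding S_def using j x y by (intro sum_pos) (auto simp: lessThan_empty_iff intro!: divide_pos_pos)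
  moreover have "cos S = 1" using \<open>cis S = 1\<close> by (simp add: complex_eq_iff)
  then obtain i :: int where "S = real_of_int i * 2 * pi" using cos_one_2pi_int by blast
  ultimately have "0 < i" "i < 1" by (auto simp: zero_less_mult_iff)
  then show False by simp
qed

text \<open>Conjugation moves the roots below the real axis to the upper half plane. On the real
  axis the product is strictly increasing from \<open>3/2\<close> on, so it takes the value
  \<open>fact m\<close> there only at 2.\<close>

lemma root_Re_less:
  fixes z :: complex
  assumes "2 \<le> m" "m \<le> 26" "(\<Prod>k<m - 1. z + of_nat k) = fact m" "z \<noteq> 2"
  shows "Re z < 3 / 2"
proof -
  consider "Im z > 0" | "Im z < 0" | "Im z = 0" by linarith
  then show ?thesis
  proof cases
    case 1
    then show ?thesis using root_Re_less_pos assms by blast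
  next
    case 2
    have "(\<Prod>k<m - 1. cnj z + of_nat k) = cnj (\<Prod>k<m - 1. z + of_nat k)" by simp
    also have "\<dots> = fact m" using assms by simp
    finally show ?thesis using root_Re_less_pos[of m "cnj z"] 2 assms by simp
  next
    case 3
    define x where "x = Re z"
    have z: "z = of_real x" using 3 by (simp add: complex_eq_iff x_def)
    have "complex_of_real (\<Prod>k<m - 1. x + real k) = of_real (fact m)"
      using assms(3) z by simp
    then have eq: "(\<Prod>k<m - 1. x + real k) = fact m" using of_real_eq_iff by blast
    have f: "(\<Prod>k<m - 1. 2 + real k) = fact m"
      using prod_two_add[of "m - 1"] assms(1) by simp
    have "x \<noteq> 2" using z assms(4) by auto
    show ?thesis
    proof (rule ccontr)
      assume "\<not> Re z < 3 / 2"
      then have x: "x \<ge> 3 / 2" by (simp add: x_def)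
      have ne: "{..<m - 1} \<noteq> {}" using assms(1) by (simp add: lessThan_empty_iff)
      show False
      proof (cases "x < 2")
        case True
        then have "(\<Prod>k<m - 1. x + real k) < (\<Prod>k<m - 1. 2 + real k)"
          using x ne by (intro prod_mono_strict) auto
        then show False using eq f by simp
      next
        case False
        then have "(\<Prod>k<m - 1. 2 + real k) < (\<Prod>k<m - 1. x + real k)"
          using x ne \<open>x \<noteq> 2\<close> by (intro prod_mono_strict) auto
        then show False using eq f by simp
      qed
    qed
  qed
qed

section \<open>Slowly varying functions\<close>

lemma slowly_varying_pos: "slowly_varying L \<Longrightarrow> x \<ge> 1 \<Longrightarrow> L x > 0"
  by (simp add: slowly_varying_def)

lemma slowly_varying_ln_tendsto:
  assumes "slowly_varying L" "c > 0"
  shows "((\<lambda>x. ln (L (c * x)) - ln (L x)) \<longlongrightarrow> 0) at_top"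
proof -
  have "((\<lambda>x. ln (L (c * x) / L x)) \<longlongrightarrow> ln 1) at_top"
    using assms by (intro tendsto_ln) (auto simp: slowly_varying_def)
  moreover have "\<forall>\<^sub>F x in at_top. ln (L (c * x) / L x) = ln (L (c * x)) - ln (L x)"
    using eventually_ge_at_top[of "max 1 (1 / c)"]
  proof eventually_elim
    case (elim x)
    then have "L (c * x) > 0" "L x > 0"
      using assms by (auto intro!: slowly_varying_pos[OF assms(1)] simp: field_simps)
    then show ?case by (simp add: ln_div)
  qed
  ultimately show ?thesis by (simp add: tendsto_cong)
qed

text \<open>The proof of uniform convergence measures this set of good dilations. As
  \<open>L\<close> is only Lebesgue measurable, and only on \<open>[1, \<infinity>)\<close>, it is
  extended by 0 and composed with a scaling, a map that respects Lebesgue measurability.\<close>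

lemma slowly_varying_measurable:
  assumes "slowly_varying L" "y \<ge> 1"
  shows "{c \<in> {1..b}. \<bar>ln (L (c * y)) - ln (L y)\<bar> < e} \<in> sets lebesgue"
proof -
  define L' where "L' = (\<lambda>x. if x \<in> {1..} then L x else 0)"
  have "L' \<in> borel_measurable lebesgue"
    unfolding L'_def using assms(1) by (intro borel_measurable_if_I) (auto simp: slowly_varying_def)
  moreover have "(\<lambda>c. y *\<^sub>R c) \<in> lebesgue \<rightarrow>\<^sub>M (lebesgue :: real measure)"
    by (rule lebesgue_measurable_scaling)
  ultimately have m: "(\<lambda>c. L' (y *\<^sub>R c)) \<in> borel_measurable lebesgue"
    by (rule measurable_compose[rotated])
  then have "(\<lambda>c. \<bar>ln (L' (y *\<^sub>R c)) - ln (L y)\<bar>) \<in> borel_measurable lebesgue"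
    by measurable
  from measurable_sets[OF this, of "{..<e}"]
  have "{1..b} \<inter> ((\<lambda>c. \<bar>ln (L' (y *\<^sub>R c)) - ln (L y)\<bar>) -` {..<e} \<inter> space lebesgue) \<in> sets lebesgue"
    by (intro sets.Int) auto
  also have "{1..b} \<inter> ((\<lambda>c. \<bar>ln (L' (y *\<^sub>R c)) - ln (L y)\<bar>) -` {..<e} \<inter> space lebesgue) =
    {c \<in> {1..b}. \<bar>ln (L (c * y)) - ln (L y)\<bar> < e}"
  proof -
    have "1 \<le> y * c" if "1 \<le> c" for c
      using mult_mono[of 1 y 1 c] that assms(2) by simp
    then have "L' (y *\<^sub>R c) = L (c * y)" if "c \<in> {1..b}" for c
      using that by (simp add: L'_def mult.commute[of c])
    then show ?thesis by (simp add: set_eq_iff cong: conj_cong)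
  qed
  finally show ?thesis .
qed

text \<open>The Csiszar-Erdos argument: if uniformity failed along \<open>x\<^sub>n\<close>, \<open>u\<^sub>n x\<^sub>n\<close>, then the set of good
  dilations of \<open>x\<^sub>n\<close> and the \<open>u\<^sub>n\<close>-multiple of the set of good dilations of \<open>u\<^sub>n x\<^sub>n\<close> would both
  nearly fill their intervals and hence meet.\<close>

lemma uniform_convergence_slowly_varying:
  assumes sv: "slowly_varying L" and "e > 0"
  obtains (unif) X where "X \<ge> 1" "\<And>x c. x \<ge> X \<Longrightarrow> 1 \<le> c \<Longrightarrow> c \<le> 2 \<Longrightarrow> \<bar>ln (L (c * x)) - ln (L x)\<bar> < e"
proof (rule ccontr)
  assume "\<not> thesis"
  then have "\<exists>x c. x \<ge> X \<and> 1 \<le> c \<and> c \<le> 2 \<and> \<not> \<bar>ln (L (c * x)) - ln (L x)\<bar> < e" if "X \<ge> 1" for X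
    using unif[OF that] \<open>\<not> thesis\<close> by blast
  then have "\<forall>n. \<exists>x c. x \<ge> 1 + real n \<and> 1 \<le> c \<and> c \<le> 2 \<and> \<not> \<bar>ln (L (c * x)) - ln (L x)\<bar> < e"
    by simp
  then obtain x u where x: "\<And>n. x n \<ge> 1 + real n" and u: "\<And>n. 1 \<le> u n" "\<And>n. u n \<le> 2"
    and bad: "\<And>n. \<not> \<bar>ln (L (u n * x n)) - ln (L (x n))\<bar> < e" by metis
  have x1: "x n \<ge> 1" for n using x[of n] by simp
  have ux: "u n * x n \<ge> 1 + real n" for n
    using mult_mono[of 1 "u n" "1 + real n" "x n"] u(1)[of n] x[of n] by simp
  have ux1: "u n * x n \<ge> 1" for n using order_trans[OF _ ux[of n], of 1] by simp
  have lim: "filterlim y at_top sequentially" if "\<And>n. y n \<ge> 1 + real n" for y :: "nat \<Rightarrow> real"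
    by (rule filterlim_at_top_mono[of "\<lambda>n. 1 + real n"]) (real_asymp, simp add: that)
  \<comment> \<open>The sets of dilations that are good from index \<open>n\<close> on increase to
    the whole interval, by pointwise convergence. Continuity of the measure from below makes them
    nearly full.\<close>
  have full: "\<exists>N. \<forall>n\<ge>N. measure lebesgue {c \<in> {1..b}. \<forall>k\<ge>n. \<bar>ln (L (c * y k)) - ln (L (y k))\<bar> < e / 2} > b - 1 - 1 / 2
      \<and> {c \<in> {1..b}. \<forall>k\<ge>n. \<bar>ln (L (c * y k)) - ln (L (y k))\<bar> < e / 2} \<in> sets lebesgue"
    if y: "\<And>n. y n \<ge> 1 + real n" and "b \<ge> 1" for y b
  proof -
    define V where "V n = {c \<in> {1..b}. \<forall>k\<ge>n. \<bar>ln (L (c * y k)) - ln (L (y k))\<bar> < e / 2}" for n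
    have y1: "y n \<ge> 1" for n using y[of n] by simp
    define ok where "ok c k \<longleftrightarrow> \<bar>ln (L (c * y k)) - ln (L (y k))\<bar> < e / 2" for c k
    have V_eq: "V n = (\<Inter>k\<in>{n..}. {c \<in> {1..b}. ok c k})" for n
      unfolding V_def ok_def[symmetric] by auto
    have "{c \<in> {1..b}. ok c k} \<in> sets lebesgue" for k
      unfolding ok_def by (rule slowly_varying_measurable[OF sv y1])
    then have sets: "V n \<in> sets lebesgue" for n
      unfolding V_eq by (intro sets.countable_INT'') auto
    have "incseq V" unfolding incseq_def V_eq by auto
    have "(\<Union>n. V n) = {1..b}"
    proof
      show "{1..b} \<subseteq> (\<Union>n. V n)"
      proof
        fix c assume c: "c \<in> {1..b}"
        then have "((\<lambda>x. ln (L (c * x)) - ln (L x)) \<longlongrightarrow> 0) at_top"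
          using slowly_varying_ln_tendsto[OF sv] by simp
        then have "(\<lambda>n. ln (L (c * y n)) - ln (L (y n))) \<longlonglongrightarrow> 0"
          by (rule filterlim_compose[OF _ lim[OF y]])
        then have "\<forall>\<^sub>F n in sequentially. \<bar>ln (L (c * y n)) - ln (L (y n))\<bar> < e / 2"
          using \<open>e > 0\<close> by (intro order_tendstoD(2)[OF tendsto_rabs_zero]) auto
        then show "c \<in> (\<Union>n. V n)" using c by (auto simp: V_def eventually_sequentially)
      qed
    qed (auto simp: V_def)
    then have "(\<lambda>n. measure lebesgue (V n)) \<longlonglongrightarrow> measure lebesgue {1..b}"
      using Lim_measure_incseq[of V lebesgue, OF image_subsetI[OF sets] \<open>incseq V\<close>]
        emeasure_lborel_Icc[OF \<open>b \<ge> 1\<close>] by simp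
    then have "\<forall>\<^sub>F n in sequentially. measure lebesgue (V n) > b - 1 - 1 / 2"
      by (rule order_tendstoD(1)) (use \<open>b \<ge> 1\<close> in simp)
    then obtain N where "\<And>n. n \<ge> N \<Longrightarrow> measure lebesgue (V n) > b - 1 - 1 / 2"
      unfolding eventually_sequentially by blast
    then show ?thesis unfolding V_def[symmetric] using sets by blast
  qed
  \<comment> \<open>Multiplication by \<open>u n\<close> in \<open>[1, 2]\<close> maps
    \<open>[1, 2]\<close> into \<open>[1, 4]\<close> and does not shrink measure. The parts of
    measure more than 5/2 and more than 1/2 exceed together the length 3 of \<open>[1, 4]\<close>,
    so they meet.\<close>
  define V where "V n = {c \<in> {1..4}. \<forall>k\<ge>n. \<bar>ln (L (c * x k)) - ln (L (x k))\<bar> < e / 2}" for n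
  define W where "W n = {c \<in> {1..2}. \<forall>k\<ge>n. \<bar>ln (L (c * (u k * x k))) - ln (L (u k * x k))\<bar> < e / 2}" for n
  have "\<exists>N. \<forall>n\<ge>N. measure lebesgue (V n) > 4 - 1 - 1 / 2 \<and> V n \<in> sets lebesgue"
    unfolding V_def by (rule full[OF x]) simp
  then obtain N1 where N1: "\<And>n. n \<ge> N1 \<Longrightarrow> measure lebesgue (V n) > 4 - 1 - 1 / 2 \<and> V n \<in> sets lebesgue"
    by blast
  have "\<exists>N. \<forall>n\<ge>N. measure lebesgue (W n) > 2 - 1 - 1 / 2 \<and> W n \<in> sets lebesgue"
    unfolding W_def by (rule full[OF ux]) simp
  then obtain N2 where N2: "\<And>n. n \<ge> N2 \<Longrightarrow> measure lebesgue (W n) > 2 - 1 - 1 / 2 \<and> W n \<in> sets lebesgue"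
    by blast
  define n where "n = max N1 N2"
  have V: "measure lebesgue (V n) > 5 / 2" "V n \<in> sets lebesgue" using N1[of n] by (auto simp: n_def)
  have W: "measure lebesgue (W n) > 1 / 2" "W n \<in> sets lebesgue" using N2[of n] by (auto simp: n_def)
  define W' where "W' = (\<lambda>c. u n *\<^sub>R c) ` W n"
  have W'_sub: "W' \<subseteq> {1..4}"
  proof
    fix z assume "z \<in> W'"
    then obtain c where "c \<in> W n" "z = u n * c" by (auto simp: W'_def)
    then show "z \<in> {1..4}" using u[of n] mult_mono[of 1 "u n" 1 c] mult_mono[of "u n" 2 c 2] by (auto simp: W_def)
  qed
  have W'_eq: "W' = (*\<^sub>R) (1 / u n) -` W n \<inter> space lebesgue"
  proof -
    have "u n \<noteq> 0" using u[of n] by auto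
    then have "z \<in> W' \<longleftrightarrow> z / u n \<in> W n" for z
    proof (intro iffI)
      assume "z \<in> W'"
      then obtain c where "c \<in> W n" "z = u n * c" unfolding W'_def by auto
      then show "z / u n \<in> W n" using \<open>u n \<noteq> 0\<close> by simp
    next
      assume z: "z / u n \<in> W n"
      have "z = u n *\<^sub>R (z / u n)" using \<open>u n \<noteq> 0\<close> by simp
      then show "z \<in> W'" unfolding W'_def by (rule image_eqI[OF _ z])
    qed
    then show ?thesis by (simp add: set_eq_iff)
  qed
  have "W' \<in> sets lebesgue"
    unfolding W'_eq by (rule measurable_sets[OF lebesgue_measurable_scaling W(2)])
  then have W'_lm: "W' \<in> lmeasurable"
    by (rule fmeasurableI2[OF _ W'_sub, rotated]) simp
  have "measure lebesgue W' = \<bar>u n\<bar> * measure lebesgue (W n)"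
    using measure_lebesgue_affine[of "u n" 0 "W n"] by (simp add: W'_def)
  also have "\<dots> \<ge> 1 * measure lebesgue (W n)"
    using u[of n] by (intro mult_right_mono) auto
  finally have mW': "measure lebesgue W' > 1 / 2" using W(1) by simp
  have V_lm: "V n \<in> lmeasurable"
    by (rule fmeasurableI2[OF _ _ V(2), of "{1..4}"]) (auto simp: V_def)
  have "V n \<inter> W' \<noteq> {}"
  proof
    assume "V n \<inter> W' = {}"
    then have "measure lebesgue (V n \<union> W') = measure lebesgue (V n) + measure lebesgue W'"
      using measure_Un3[OF V_lm W'_lm] by simp
    moreover have "measure lebesgue (V n \<union> W') \<le> measure lebesgue {1..4::real}"
    proof (rule measure_mono_fmeasurable)
      show "V n \<union> W' \<subseteq> {1..4}" using W'_sub unfolding V_def by blast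
      show "V n \<union> W' \<in> sets lebesgue" using V_lm W'_lm by (auto intro: fmeasurableD)
    qed simp
    ultimately show False using mW' V(1) by simp
  qed
  \<comment> \<open>The point \<open>u n * w * x n\<close> is a good dilation both of
    \<open>x n\<close> and of \<open>u n * x n\<close>; two errors of \<open>e / 2\<close>
    contradict the choice of \<open>u n\<close> and \<open>x n\<close>.\<close>
  then obtain w where w: "w \<in> W n" "u n * w \<in> V n" unfolding W'_def by auto
  then have "\<bar>ln (L (u n * w * x n)) - ln (L (x n))\<bar> < e / 2"
    and "\<bar>ln (L (w * (u n * x n))) - ln (L (u n * x n))\<bar> < e / 2"
    unfolding V_def W_def by blast+
  moreover have "u n * w * x n = w * (u n * x n)" by (simp add: mult_ac)
  ultimately have "\<bar>ln (L (u n * x n)) - ln (L (x n))\<bar> < e" by (smt (verit) field_sum_of_halves)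
  then show False using bad[of n] by blast
qed

text \<open>Potter's bound in logarithmic form. Going from \<open>x\<close> to \<open>y\<close>
  takes at most \<open>log 2 (y / x)\<close> doublings and one more dilation in
  \<open>[1, 2]\<close>; uniform convergence with tolerance \<open>d * ln 2\<close> pays for each of
  them.\<close>

lemma potter_slowly_varying:
  assumes sv: "slowly_varying L" and "d > 0"
  obtains X where "X \<ge> 1" "\<And>x y. x \<ge> X \<Longrightarrow> y \<ge> x \<Longrightarrow> \<bar>ln (L y) - ln (L x)\<bar> \<le> d * (1 + ln (y / x))"
proof -
  have ln2: "0 < ln (2::real)" "ln (2::real) < 1" using ln2_le_25_over_36 by auto
  obtain X where X: "X \<ge> 1" "\<And>x c. x \<ge> X \<Longrightarrow> 1 \<le> c \<Longrightarrow> c \<le> 2 \<Longrightarrow> \<bar>ln (L (c * x)) - ln (L x)\<bar> < d * ln 2"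
    using uniform_convergence_slowly_varying[OF sv, of "d * ln 2"] \<open>d > 0\<close> by auto
  have iter: "\<bar>ln (L (2 ^ j * x)) - ln (L x)\<bar> \<le> real j * (d * ln 2)" if "x \<ge> X" for x j
  proof (induction j)
    case (Suc j)
    have "x \<le> 2 ^ j * x" using that X(1) by simp
    then have "\<bar>ln (L (2 * (2 ^ j * x))) - ln (L (2 ^ j * x))\<bar> < d * ln 2"
      using that by (intro X(2)) auto
    then show ?case using Suc by (simp add: algebra_simps)
  qed simp
  have "\<bar>ln (L y) - ln (L x)\<bar> \<le> d * (1 + ln (y / x))" if "x \<ge> X" "y \<ge> x" for x y
  proof -
    have pos: "x > 0" using that X(1) by simp
    have yx: "y / x \<ge> 1" using that pos by simp
    define j where "j = nat \<lfloor>log 2 (y / x)\<rfloor>"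
    have l0: "log 2 (y / x) \<ge> 0" using yx by simp
    have jl: "real j \<le> log 2 (y / x)" "log 2 (y / x) < real j + 1" using l0 by (auto simp: j_def)
    have "2 powr real j \<le> y / x" "y / x < 2 powr (real j + 1)"
      using jl yx by (auto simp: le_log_iff log_less_iff)
    then have b: "2 ^ j \<le> y / x" "y / x < 2 ^ (Suc j)"
      by (simp_all add: powr_realpow powr_add mult.commute)
    define c where "c = y / (2 ^ j * x)"
    have c: "1 \<le> c" "c \<le> 2" "y = c * (2 ^ j * x)"
      using b pos by (auto simp: c_def field_simps)
    have "x \<le> 2 ^ j * x" using pos by simp
    then have "\<bar>ln (L y) - ln (L (2 ^ j * x))\<bar> < d * ln 2"
      unfolding c(3) using that c by (intro X(2)) auto
    then have "\<bar>ln (L y) - ln (L x)\<bar> \<le> real j * (d * ln 2) + d * ln 2"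
      using iter[OF that(1), of j] by simp
    also have "real j * (d * ln 2) \<le> log 2 (y / x) * (d * ln 2)"
      using jl \<open>d > 0\<close> ln2 by (intro mult_right_mono) auto
    also have "log 2 (y / x) * (d * ln 2) = d * ln (y / x)" using ln2 by (simp add: log_def)
    also have "d * ln 2 \<le> d" using ln2 \<open>d > 0\<close> by simp
    finally show ?thesis by (simp add: algebra_simps)
  qed
  then show ?thesis using that X(1) by blast
qed

text \<open>Potter's bound is taken as the definition of slow variation for sequences. It is all
  that the asymptotic analysis uses about \<open>L\<close>, so measurability is settled at this
  point.\<close>

definition sv_seq :: "(nat \<Rightarrow> real) \<Rightarrow> bool" where
  "sv_seq l \<longleftrightarrow> (\<forall>n\<ge>1. l n > 0) \<and>
    (\<forall>d>0. \<exists>N\<ge>1. \<forall>n\<ge>N. \<forall>k\<ge>n. \<bar>ln (l k) - ln (l n)\<bar> \<le> d * (1 + ln (real k / real n)))"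

lemma slowly_varying_imp_sv_seq:
  assumes "slowly_varying L"
  shows "sv_seq (\<lambda>n. L (real n))"
  unfolding sv_seq_def
proof (intro conjI allI impI)
  fix d :: real assume "d > 0"
  from potter_slowly_varying[OF assms this] obtain X where
    X: "X \<ge> 1" "\<And>x y. x \<ge> X \<Longrightarrow> y \<ge> x \<Longrightarrow> \<bar>ln (L y) - ln (L x)\<bar> \<le> d * (1 + ln (y / x))" by blast
  define N where "N = nat \<lceil>X\<rceil>"
  have "real N \<ge> X" "N \<ge> 1" using X(1) unfolding N_def by linarith+
  then show "\<exists>N\<ge>1. \<forall>n\<ge>N. \<forall>k\<ge>n. \<bar>ln (L (real k)) - ln (L (real n))\<bar> \<le> d * (1 + ln (real k / real n))"
    by (intro exI[of _ N]) (auto intro!: X(2))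
qed (use assms slowly_varying_pos in auto)

definition svg :: "(nat \<Rightarrow> real) \<Rightarrow> nat \<Rightarrow> real" where
  "svg l n = sqrt (real n) * l n"

lemma svg_0 [simp]: "svg l 0 = 0"
  by (simp add: svg_def)

lemma sv_seq_pos: "sv_seq l \<Longrightarrow> n \<ge> 1 \<Longrightarrow> l n > 0"
  by (simp add: sv_seq_def)

lemma sv_seqD:
  "sv_seq l \<Longrightarrow> d > 0 \<Longrightarrow>
    \<exists>N\<ge>1. \<forall>n\<ge>N. \<forall>k\<ge>n. \<bar>ln (l k) - ln (l n)\<bar> \<le> d * (1 + ln (real k / real n))"
  by (simp add: sv_seq_def)

lemma svg_pos: "sv_seq l \<Longrightarrow> n \<ge> 1 \<Longrightarrow> svg l n > 0"
  using sv_seq_pos by (simp add: svg_def)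

lemma svg_nonneg: "sv_seq l \<Longrightarrow> svg l n \<ge> 0"
  using svg_pos[of l n] by (cases "n = 0") auto

lemma sv_seq_potter:
  assumes "sv_seq l" "d > 0"
  shows "\<exists>N\<ge>1. \<forall>n\<ge>N. \<forall>k\<ge>n. l k \<le> exp d * (real k / real n) powr d * l n \<and>
    l n \<le> exp d * (real k / real n) powr d * l k"
proof -
  obtain N where N: "N \<ge> 1" "\<And>n k. n \<ge> N \<Longrightarrow> k \<ge> n \<Longrightarrow> \<bar>ln (l k) - ln (l n)\<bar> \<le> d * (1 + ln (real k / real n))"
    using sv_seqD[OF assms] by blast
  have "l k \<le> exp d * (real k / real n) powr d * l n \<and> l n \<le> exp d * (real k / real n) powr d * l k"
    if "N \<le> n" "n \<le> k" for n k
  proof -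
    have pos: "l n > 0" "l k > 0" "n > 0" "k > 0" using that N(1) sv_seq_pos[OF assms(1)] by auto
    have e: "exp d * (real k / real n) powr d = exp (d * (1 + ln (real k / real n)))"
      using pos by (simp add: powr_def exp_add[symmetric] algebra_simps)
    have "ln (l k) \<le> d * (1 + ln (real k / real n)) + ln (l n)" "ln (l n) \<le> d * (1 + ln (real k / real n)) + ln (l k)"
      using N(2)[OF that] by linarith+
    then have "exp (ln (l k)) \<le> exp (d * (1 + ln (real k / real n)) + ln (l n))"
      "exp (ln (l n)) \<le> exp (d * (1 + ln (real k / real n)) + ln (l k))" by simp_all
    then show ?thesis unfolding e using pos by (simp add: exp_add)
  qed
  then show ?thesis using N(1) by blast
qed

lemma sv_seq_uniform:
  assumes "sv_seq l" "h > 0" "e > 0"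
  obtains N where "N \<ge> 1" "\<And>n j. N \<le> n \<Longrightarrow> h * real n \<le> real j \<Longrightarrow> j \<le> n \<Longrightarrow> \<bar>l j - l n\<bar> \<le> e * l n"
proof -
  \<comment> \<open>If two logarithms differ by at most \<open>c\<close>, the quotient lies between
    \<open>1 - e\<close> and \<open>1 + e\<close>. The \<open>min e (1/2)\<close> keeps the argument
    of the second logarithm positive.\<close>
  define c where "c = min (ln (1 + e)) (- ln (1 - min e (1/2)))"
  have c: "c > 0" using \<open>e > 0\<close> by (simp add: c_def)
  define h' where "h' = min h 1"
  have h': "0 < h'" "h' \<le> 1" "h' \<le> h" using \<open>h > 0\<close> by (auto simp: h'_def)
  define d where "d = c / (1 + ln (1 / h'))"
  have "1 + ln (1 / h') > 0" using h' by (intro add_pos_nonneg) auto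
  then have d: "d > 0" "d * (1 + ln (1 / h')) = c" using c by (auto simp: d_def)
  obtain N where N: "N \<ge> 1" "\<And>n k. n \<ge> N \<Longrightarrow> k \<ge> n \<Longrightarrow> \<bar>ln (l k) - ln (l n)\<bar> \<le> d * (1 + ln (real k / real n))"
    using sv_seqD[OF assms(1) d(1)] by blast
  \<comment> \<open>Potter's bound must hold from the smaller index \<open>j\<close> on, so
    \<open>h' * n\<close> has to pass \<open>N\<close>.\<close>
  define N' where "N' = nat \<lceil>real N / h'\<rceil>"
  have N': "real N' \<ge> real N / h'" by (simp add: N'_def real_nat_ceiling_ge)
  have bound: "\<bar>l j - l n\<bar> \<le> e * l n" if "max 1 N' \<le> n" "h * real n \<le> real j" "j \<le> n" for n j
  proof -
    have "real N \<le> h' * real N'" using N' h' by (simp add: field_simps)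
    also have "\<dots> \<le> h' * real n" using that h' by (intro mult_left_mono) auto
    also have "\<dots> \<le> h * real n" using h' by (intro mult_right_mono) auto
    also have "\<dots> \<le> real j" by fact
    finally have "N \<le> j" by simp
    have pos: "l n > 0" "l j > 0" "n > 0" "j > 0" using that \<open>N \<le> j\<close> N(1) sv_seq_pos[OF assms(1)] by auto
    have "h' * real n \<le> real j" using \<open>h' * real n \<le> h * real n\<close> \<open>h * real n \<le> real j\<close> by (rule order_trans)
    then have "real n / real j \<le> 1 / h'" using pos h' by (simp add: field_simps)
    then have "ln (real n / real j) \<le> ln (1 / h')" using pos h' by (subst ln_le_cancel_iff) auto
    then have "d * (1 + ln (real n / real j)) \<le> c" unfolding d(2)[symmetric] using d(1) by simp
    then have "\<bar>ln (l n) - ln (l j)\<bar> \<le> c" using N(2)[OF \<open>N \<le> j\<close> that(3)] by simp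
    then have "ln (l j) \<le> ln (1 + e) + ln (l n)" "ln (1 - min e (1/2)) + ln (l n) \<le> ln (l j)"
      by (auto simp: c_def)
    then have "exp (ln (l j)) \<le> exp (ln (1 + e) + ln (l n))" "exp (ln (1 - min e (1/2)) + ln (l n)) \<le> exp (ln (l j))"
      by auto
    then have "l j \<le> (1 + e) * l n" "(1 - min e (1/2)) * l n \<le> l j"
      using pos \<open>e > 0\<close> by (auto simp: exp_add)
    moreover have "min e (1/2) * l n \<le> e * l n" using pos by (intro mult_right_mono) auto
    ultimately show ?thesis by (auto simp: abs_if algebra_simps)
  qed
  show ?thesis by (rule that[of "max 1 N'"]) (simp, rule bound)
qed

lemma zero_less_quarter: "(0::real) < 1 / 4" by simp

text \<open>Potter's bound with exponent 1/4 lets \<open>l\<close> decay no faster than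
  \<open>n powr (- 1/4)\<close>, which the square root outweighs.\<close>

lemma svg_at_top:
  assumes "sv_seq l"
  shows "filterlim (svg l) at_top at_top"
proof -
  obtain N where N: "N \<ge> 1" "\<And>n k. N \<le> n \<Longrightarrow> n \<le> k \<Longrightarrow> l n \<le> exp (1 / 4) * (real k / real n) powr (1 / 4) * l k"
    using sv_seq_potter[OF assms zero_less_quarter] by blast
  define c where "c = l N * exp (- 1/4) * real N powr (1 / 4)"
  have c: "c > 0" using N(1) sv_seq_pos[OF assms, of N] by (auto simp: c_def)
  have "filterlim (\<lambda>n. c * real n powr (1 / 4)) at_top at_top"
    using c by real_asymp
  moreover have "\<forall>\<^sub>F n in at_top. c * real n powr (1 / 4) \<le> svg l n"
    using eventually_ge_at_top[of N]
  proof eventually_elim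
    case (elim n)
    have n: "n > 0" using elim N(1) by simp
    have "l N \<le> exp (1 / 4) * (real n / real N) powr (1 / 4) * l n" using N(2)[OF order_refl elim] .
    then have "l N * (exp (- 1/4) * real N powr (1 / 4)) \<le>
        exp (1 / 4) * (real n / real N) powr (1 / 4) * l n * (exp (- 1/4) * real N powr (1 / 4))"
      by (intro mult_right_mono) auto
    also have "\<dots> = real n powr (1 / 4) * l n"
      using n N(1) by (simp add: powr_divide exp_minus field_simps)
    finally have "c \<le> real n powr (1 / 4) * l n" by (simp add: c_def mult_ac)
    then have "c * real n powr (1 / 4) \<le> real n powr (1 / 4) * l n * real n powr (1 / 4)"
      by (intro mult_right_mono) auto
    also have "\<dots> = (real n powr (1 / 4) * real n powr (1 / 4)) * l n" by simp
    also have "real n powr (1 / 4) * real n powr (1 / 4) = sqrt (real n)"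
      by (simp add: powr_add[symmetric] powr_half_sqrt)
    finally show ?case by (simp add: svg_def)
  qed
  ultimately show ?thesis by (rule filterlim_at_top_mono)
qed

text \<open>Below \<open>\<eta> n\<close> both terms are negligible, above it \<open>l\<close> is nearly constant.\<close>

lemma svg_uniform:
  assumes sv: "sv_seq l" and "e > 0"
  obtains N where "N \<ge> 1" "\<And>n j. N \<le> n \<Longrightarrow> j \<le> n \<Longrightarrow> \<bar>svg l j - sqrt (real j) * l n\<bar> \<le> e * svg l n"
proof -
  obtain N1 where N1: "N1 \<ge> 1" "\<And>n k. N1 \<le> n \<Longrightarrow> n \<le> k \<Longrightarrow> l n \<le> exp (1 / 4) * (real k / real n) powr (1 / 4) * l k"
    using sv_seq_potter[OF sv zero_less_quarter] by blast
  have lim: "((\<lambda>h::real. exp (1 / 4) * h powr (1 / 4)) \<longlongrightarrow> 0) (at_right 0)"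
    "((\<lambda>h::real. sqrt h) \<longlongrightarrow> 0) (at_right 0)" by real_asymp+
  have "\<forall>\<^sub>F h in at_right (0::real). exp (1 / 4) * h powr (1 / 4) < e / 2 \<and> sqrt h < e / 2 \<and> h > 0"
    using order_tendstoD(2)[OF lim(1), of "e/2"] order_tendstoD(2)[OF lim(2), of "e/2"] \<open>e > 0\<close>
      eventually_at_right_less[of 0] by (intro eventually_conj) auto
  then obtain h :: real where h: "exp (1 / 4) * h powr (1 / 4) < e / 2" "sqrt h < e / 2" "h > 0"
    using eventually_happens'[OF _ ] by (metis (no_types, lifting) trivial_limit_at_right_real eventually_happens)
  obtain N2 where N2: "N2 \<ge> 1" "\<And>n j. N2 \<le> n \<Longrightarrow> h * real n \<le> real j \<Longrightarrow> j \<le> n \<Longrightarrow> \<bar>l j - l n\<bar> \<le> e * l n"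
    using sv_seq_uniform[OF sv h(3) \<open>e > 0\<close>] by blast
  \<comment> \<open>Below the threshold \<open>N1\<close> of Potter's bound nothing is known about
    \<open>l\<close>. These finitely many values are outweighed because \<open>svg l n\<close> tends
    to infinity.\<close>
  define C where "C = (\<Sum>j<N1. svg l j)"
  have "\<forall>\<^sub>F n in at_top. svg l n \<ge> 2 * C / e"
    using svg_at_top[OF sv] by (simp add: filterlim_at_top)
  then obtain N3 where N3: "\<And>n. n \<ge> N3 \<Longrightarrow> svg l n \<ge> 2 * C / e"
    by (auto simp: eventually_at_top_linorder)
  define N where "N = max N2 N3"
  have bound: "\<bar>svg l j - sqrt (real j) * l n\<bar> \<le> e * svg l n" if "N \<le> n" "j \<le> n" for n j
  proof (cases "h * real n \<le> real j")
    case True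
    have "\<bar>svg l j - sqrt (real j) * l n\<bar> = sqrt (real j) * \<bar>l j - l n\<bar>"
      by (simp add: svg_def right_diff_distrib[symmetric] abs_mult)
    also have "\<dots> \<le> sqrt (real n) * (e * l n)"
      using N2(2)[of n j] True that by (intro mult_mono) (auto simp: N_def)
    finally show ?thesis by (simp add: svg_def mult_ac)
  next
    case False
    have npos: "n \<ge> 1" using that N2(1) by (simp add: N_def)
    have gn: "svg l n > 0" "l n > 0" using svg_pos[OF sv npos] sv_seq_pos[OF sv npos] .
    have "sqrt (real j) \<le> sqrt (h * real n)" using False by simp
    then have "sqrt (real j) * l n \<le> sqrt h * svg l n"
      using gn by (simp add: svg_def real_sqrt_mult)
    also have "\<dots> \<le> e / 2 * svg l n" using h gn by (intro mult_right_mono) auto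
    finally have a: "sqrt (real j) * l n \<le> e / 2 * svg l n" .
    have b: "svg l j \<le> e / 2 * svg l n"
    proof (cases "j < N1")
      case True
      have "svg l j \<le> C" unfolding C_def using True svg_nonneg[OF sv] by (intro member_le_sum) auto
      also have "\<dots> \<le> e / 2 * svg l n" using N3[of n] that \<open>e > 0\<close> by (simp add: N_def field_simps)
      finally show ?thesis .
    next
      case j: False
      then have jpos: "j > 0" using N1(1) by simp
      have "l j \<le> exp (1 / 4) * (real n / real j) powr (1 / 4) * l n" using N1(2)[of j n] j that(2) by (simp only: not_less)
      then have "svg l j \<le> sqrt (real j) * (exp (1 / 4) * (real n / real j) powr (1 / 4) * l n)"
        unfolding svg_def by (intro mult_left_mono) auto
      also have "\<dots> = exp (1 / 4) * (real j / real n) powr (1 / 4) * svg l n"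
      proof -
        have "sqrt (real j) = real j powr (1 / 4) * real j powr (1 / 4)" "sqrt (real n) = real n powr (1 / 4) * real n powr (1 / 4)"
          by (simp_all add: powr_add[symmetric] powr_half_sqrt)
        then show ?thesis using jpos npos by (simp add: svg_def powr_divide field_simps)
      qed
      also have "\<dots> \<le> exp (1 / 4) * h powr (1 / 4) * svg l n"
      proof -
        have "real j / real n \<le> h" using False npos by (simp add: field_simps)
        then show ?thesis using gn by (intro mult_right_mono mult_left_mono powr_mono2) auto
      qed
      also have "\<dots> \<le> e / 2 * svg l n" using h gn by (intro mult_right_mono) auto
      finally show ?thesis .
    qed
    have "\<bar>svg l j - sqrt (real j) * l n\<bar> \<le> svg l j + sqrt (real j) * l n"
      using svg_nonneg[OF sv, of j] gn by (intro order_trans[OF abs_triangle_ineq4]) (auto simp: abs_mult)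
    then show ?thesis using a b by simp
  qed
  show ?thesis by (rule that[of N]) (use N2(1) in \<open>simp add: N_def\<close>, rule bound)
qed

section \<open>Tails and partial sums of regularly varying series\<close>

lemma powr_tail_step:
  assumes "a > 0" "k \<ge> (1::nat)"
  shows "a * real (Suc k) powr (- 1 - a) \<le> real k powr (- a) - real (Suc k) powr (- a)"
    "real k powr (- a) - real (Suc k) powr (- a) \<le> a * real k powr (- 1 - a)"
proof -
  have "\<exists>z::real. real k < z \<and> z < real (Suc k) \<and>
    real (Suc k) powr (- a) - real k powr (- a) = (real (Suc k) - real k) * (- a * z powr (- a - 1))"
    using assms(2) by (intro MVT2) (auto intro!: derivative_eq_intros)
  then obtain z where z: "real k < z" "z < real (Suc k)"
    "real (Suc k) powr (- a) - real k powr (- a) = - a * z powr (- a - 1)" by auto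
  have e: "- a - 1 = - 1 - a" by simp
  have "real (Suc k) powr (- 1 - a) \<le> z powr (- a - 1)" "z powr (- a - 1) \<le> real k powr (- 1 - a)"
    unfolding e using z(1,2) assms by (intro powr_mono2'; simp)+
  then have "a * real (Suc k) powr (- 1 - a) \<le> a * z powr (- a - 1)"
    "a * z powr (- a - 1) \<le> a * real k powr (- 1 - a)"
    using assms(1) by (intro mult_left_mono; simp)+
  then show "a * real (Suc k) powr (- 1 - a) \<le> real k powr (- a) - real (Suc k) powr (- a)"
    "real k powr (- a) - real (Suc k) powr (- a) \<le> a * real k powr (- 1 - a)"
    using z(3) by linarith+
qed

text \<open>Comparison with the telescoping series of \<open>k powr (- a) / a\<close>, shifted by
  one place for the upper bound.\<close>

lemma powr_tail:
  assumes "a > 0" "n \<ge> (2::nat)"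
  shows "summable (\<lambda>i. real (i + n) powr (- 1 - a))"
    "real n powr (- a) / a \<le> (\<Sum>i. real (i + n) powr (- 1 - a))"
    "(\<Sum>i. real (i + n) powr (- 1 - a)) \<le> (real n - 1) powr (- a) / a"
proof -
  have lim: "(\<lambda>i. real (i + n') powr (- a)) \<longlonglongrightarrow> 0" for n' :: nat
    using assms(1) by real_asymp
  have s: "(\<lambda>i. real (i + n') powr (- a) - real (Suc i + n') powr (- a)) sums (real n' powr (- a))" for n' :: nat
    using telescope_sums'[OF lim[of n']] by simp
  have s1: "(\<lambda>i. (real (i + (n - 1)) powr (- a) - real (Suc i + (n - 1)) powr (- a)) / a) sums (real (n - 1) powr (- a) / a)"
    by (intro sums_divide s)
  have s2: "(\<lambda>i. (real (i + n) powr (- a) - real (Suc i + n) powr (- a)) / a) sums (real n powr (- a) / a)"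
    by (intro sums_divide s)
  have b1: "real (i + n) powr (- 1 - a) \<le> (real (i + (n - 1)) powr (- a) - real (Suc i + (n - 1)) powr (- a)) / a" for i
    using powr_tail_step(1)[OF assms(1), of "i + (n - 1)"] assms by (simp add: field_simps)
  have b2: "(real (i + n) powr (- a) - real (Suc i + n) powr (- a)) / a \<le> real (i + n) powr (- 1 - a)" for i
    using powr_tail_step(2)[OF assms(1), of "i + n"] assms by (simp add: field_simps)
  show sm: "summable (\<lambda>i. real (i + n) powr (- 1 - a))"
    by (rule summable_comparison_test'[OF sums_summable[OF s1]]) (use b1 in auto)
  have "(\<Sum>i. real (i + n) powr (- 1 - a)) \<le> real (n - 1) powr (- a) / a"
    using suminf_le[OF b1 sm sums_summable[OF s1]] sums_unique[OF s1] by simp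
  then show "(\<Sum>i. real (i + n) powr (- 1 - a)) \<le> (real n - 1) powr (- a) / a"
    using assms by (simp add: of_nat_diff)
  show "real n powr (- a) / a \<le> (\<Sum>i. real (i + n) powr (- 1 - a))"
    using suminf_le[OF b2 sums_summable[OF s2] sm] sums_unique[OF s2] by simp
qed

text \<open>Karamata's theorem for a tail: the terms behave like \<open>k powr (- 3/2) * l k\<close>
  and their tail like \<open>2 * n powr (- 1/2) * l n\<close>, where 2 is the inverse of the
  exponent 1/2. Potter's bound replaces \<open>l k\<close> by \<open>l n * (k / n) powr d\<close>
  from above and by \<open>l n * (k / n) powr (- d)\<close> from below, up to factors close to 1.
  The pure power tails are explicit, and \<open>d\<close> tends to 0 at the end.\<close>

lemma karamata_tail:
  assumes sv: "sv_seq l" and t: "t \<sim>[at_top] svg l"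
  defines "c \<equiv> (\<lambda>k. t k / ((real k + 1) * (real k + 2)))"
  shows "summable c" "(\<lambda>n. (real n + 1) * (\<Sum>i. c (i + n)) / svg l n) \<longlonglongrightarrow> 2"
proof -
  have ratio: "(\<lambda>k. c k / (real k powr (- 3 / 2) * l k)) \<longlonglongrightarrow> 1"
  proof -
    have "(\<lambda>k. t k / svg l k) \<longlonglongrightarrow> 1"
      using t by (rule asymp_equivD_strong) (auto simp: eventually_at_top_linorder intro!: exI[of _ 1] dest!: svg_pos[OF sv])
    moreover have "(\<lambda>k. real k ^ 2 / ((real k + 1) * (real k + 2))) \<longlonglongrightarrow> 1" by real_asymp
    ultimately have "(\<lambda>k. t k / svg l k * (real k ^ 2 / ((real k + 1) * (real k + 2)))) \<longlonglongrightarrow> 1 * 1"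
      by (rule tendsto_mult)
    then have "(\<lambda>k. t k / svg l k * (real k ^ 2 / ((real k + 1) * (real k + 2)))) \<longlonglongrightarrow> 1" by simp
    then show ?thesis
    proof (rule Lim_transform_eventually)
      show "\<forall>\<^sub>F k in sequentially. t k / svg l k * (real k ^ 2 / ((real k + 1) * (real k + 2))) =
        c k / (real k powr (- 3 / 2) * l k)"
        using eventually_ge_at_top[of 1]
      proof eventually_elim
        case (elim k)
        have e: "real k powr (- 3 / 2) = sqrt (real k) / real k ^ 2"
        proof -
          have "real k powr (- 3 / 2) = real k powr (1 / 2) * real k powr (- 2)"
            by (simp only: powr_add[symmetric]) simp
          also have "\<dots> = sqrt (real k) / real k ^ 2"
            using elim unfolding powr_minus_divide by (simp add: powr_half_sqrt)
          finally show ?thesis .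
        qed
        have "l k > 0" using sv_seq_pos[OF sv elim] .
        moreover have "real k > 0" using elim by simp
        ultimately show ?case unfolding e c_def svg_def by (simp add: field_simps)
      qed
    qed
  qed
  have main: "\<exists>N. \<forall>n\<ge>N. summable (\<lambda>i. c (i + n)) \<and>
      (1 - d) * exp (- d) / (1 / 2 + d) \<le> (real n + 1) * (\<Sum>i. c (i + n)) / svg l n \<and>
      (real n + 1) * (\<Sum>i. c (i + n)) / svg l n \<le>
        (1 + d) * exp d / (1 / 2 - d) * ((real n + 1) / real n * ((real n - 1) / real n) powr (- (1 / 2 - d)))"
    if d: "0 < d" "d < 1 / 2" for d
  proof -
    obtain N1 where N1: "N1 \<ge> 1" "\<And>n k. N1 \<le> n \<Longrightarrow> n \<le> k \<Longrightarrow>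
        l k \<le> exp d * (real k / real n) powr d * l n \<and> l n \<le> exp d * (real k / real n) powr d * l k"
      using sv_seq_potter[OF sv d(1)] by blast
    have "\<forall>\<^sub>F k in sequentially. c k / (real k powr (- 3 / 2) * l k) > 1 - d \<and> c k / (real k powr (- 3 / 2) * l k) < 1 + d"
      using d(1) by (intro eventually_conj order_tendstoD[OF ratio]) auto
    then obtain N2 where N2: "\<And>k. k \<ge> N2 \<Longrightarrow>
        c k / (real k powr (- 3 / 2) * l k) > 1 - d \<and> c k / (real k powr (- 3 / 2) * l k) < 1 + d"
      unfolding eventually_sequentially by blast
    have "summable (\<lambda>i. c (i + n)) \<and>
      (1 - d) * exp (- d) / (1 / 2 + d) \<le> (real n + 1) * (\<Sum>i. c (i + n)) / svg l n \<and>
      (real n + 1) * (\<Sum>i. c (i + n)) / svg l n \<le>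
        (1 + d) * exp d / (1 / 2 - d) * ((real n + 1) / real n * ((real n - 1) / real n) powr (- (1 / 2 - d)))"
      if n: "n \<ge> max 2 (max N1 N2)" for n
    proof -
      have n2: "n \<ge> 2" and npos: "real n > 0" using n by auto
      have ln: "l n > 0" using sv_seq_pos[OF sv, of n] n2 by simp
      have gn: "svg l n = real n powr (1 / 2) * l n" by (simp add: svg_def powr_half_sqrt)
      \<comment> \<open>Everything that does not depend on \<open>k\<close> is collected here and in
        \<open>V\<close>, so that \<open>k\<close> occurs only in a pure power.\<close>
      define U where "U = (1 + d) * exp d * real n powr (- d) * l n"
      define V where "V = (1 - d) * exp (- d) * real n powr d * l n"
      have bd: "c k \<le> U * real k powr (- 1 - (1 / 2 - d)) \<and> V * real k powr (- 1 - (1 / 2 + d)) \<le> c k" if "k \<ge> n" for k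
      proof -
        have k: "real k > 0" "k \<ge> N2" "l k > 0" using that n sv_seq_pos[OF sv, of k] by auto
        have pos: "real k powr (- 3 / 2) * l k > 0" using k by simp
        have c1: "c k \<le> (1 + d) * (real k powr (- 3 / 2) * l k)"
          using N2[OF k(2)] pos by (simp only: pos_divide_less_eq less_imp_le)
        have c2: "(1 - d) * (real k powr (- 3 / 2) * l k) \<le> c k"
          using N2[OF k(2)] pos by (simp only: pos_less_divide_eq less_imp_le)
        have l12: "l k \<le> exp d * (real k / real n) powr d * l n" "l n \<le> exp d * (real k / real n) powr d * l k"
          using N1(2)[of n k] n that by auto
        have "(1 + d) * (real k powr (- 3 / 2) * l k) \<le> (1 + d) * (real k powr (- 3 / 2) * (exp d * (real k / real n) powr d * l n))"
          using l12(1) d by (intro mult_left_mono) auto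
        also have "\<dots> = U * (real k powr (- 3 / 2) * real k powr d)"
          using k(1) npos by (simp add: U_def powr_divide powr_minus field_simps)
        also have "real k powr (- 3 / 2) * real k powr d = real k powr (- 1 - (1 / 2 - d))"
          by (simp only: powr_add[symmetric]) simp
        finally have r1: "c k \<le> U * real k powr (- 1 - (1 / 2 - d))" using c1 by linarith
        have "exp (- d) * (real k / real n) powr (- d) * l n \<le> exp (- d) * (real k / real n) powr (- d) * (exp d * (real k / real n) powr d * l k)"
          using l12(2) by (intro mult_left_mono) auto
        also have "\<dots> = (exp (- d) * exp d) * ((real k / real n) powr (- d) * (real k / real n) powr d) * l k" by (simp only: mult_ac)
        also have "\<dots> = l k" using k(1) npos by (simp add: exp_add[symmetric] powr_add[symmetric])
        finally have l3: "exp (- d) * (real k / real n) powr (- d) * l n \<le> l k" .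
        have "V * real k powr (- 1 - (1 / 2 + d)) = (1 - d) * (real k powr (- 3 / 2) * (exp (- d) * (real k / real n) powr (- d) * l n))"
        proof -
          have "real k powr (- 1 - (1 / 2 + d)) = real k powr (- 3 / 2) * real k powr (- d)"
            by (simp only: powr_add[symmetric]) simp
          moreover have "(real k / real n) powr (- d) = real k powr (- d) * real n powr d"
            using k(1) npos by (simp add: powr_divide powr_minus field_simps)
          ultimately show ?thesis by (simp add: V_def mult_ac)
        qed
        also have "\<dots> \<le> (1 - d) * (real k powr (- 3 / 2) * l k)"
          using l3 d by (intro mult_left_mono) auto
        finally show ?thesis using r1 c2 by linarith
      qed
      have t1: "summable (\<lambda>i. real (i + n) powr (- 1 - (1 / 2 - d)))"
        "(\<Sum>i. real (i + n) powr (- 1 - (1 / 2 - d))) \<le> (real n - 1) powr (- (1 / 2 - d)) / (1 / 2 - d)"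
        using powr_tail[of "1 / 2 - d" n] d n2 by auto
      have t2: "summable (\<lambda>i. real (i + n) powr (- 1 - (1 / 2 + d)))"
        "real n powr (- (1 / 2 + d)) / (1 / 2 + d) \<le> (\<Sum>i. real (i + n) powr (- 1 - (1 / 2 + d)))"
        using powr_tail[of "1 / 2 + d" n] d n2 by auto
      have Upos: "U > 0" and Vpos: "V > 0" using d ln npos by (auto simp: U_def V_def)
      have c_nonneg: "c (i + n) \<ge> 0" for i
      proof -
        have "0 \<le> V * real (i + n) powr (- 1 - (1 / 2 + d))" using Vpos by simp
        then show ?thesis using bd[of "i + n"] by linarith
      qed
      have sm: "summable (\<lambda>i. c (i + n))"
      proof (rule summable_comparison_test'[of "\<lambda>i. U * real (i + n) powr (- 1 - (1 / 2 - d))"])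
        show "summable (\<lambda>i. U * real (i + n) powr (- 1 - (1 / 2 - d)))" using t1(1) by (rule summable_mult)
        show "norm (c (i + n)) \<le> U * real (i + n) powr (- 1 - (1 / 2 - d))" if "i \<ge> 0" for i
          using bd[of "i + n"] c_nonneg[of i] by simp
      qed
      have "(\<Sum>i. c (i + n)) \<le> (\<Sum>i. U * real (i + n) powr (- 1 - (1 / 2 - d)))"
        by (rule suminf_le[OF _ sm summable_mult[OF t1(1)]]) (simp only: bd le_add2)
      also have "\<dots> = U * (\<Sum>i. real (i + n) powr (- 1 - (1 / 2 - d)))" by (rule suminf_mult[OF t1(1)])
      also have "\<dots> \<le> U * ((real n - 1) powr (- (1 / 2 - d)) / (1 / 2 - d))"
        using t1(2) Upos by (intro mult_left_mono) auto
      finally have up: "(\<Sum>i. c (i + n)) \<le> U * ((real n - 1) powr (- (1 / 2 - d)) / (1 / 2 - d))" .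
      have "V * (real n powr (- (1 / 2 + d)) / (1 / 2 + d)) \<le> V * (\<Sum>i. real (i + n) powr (- 1 - (1 / 2 + d)))"
        using t2(2) Vpos by (intro mult_left_mono) auto
      also have "\<dots> = (\<Sum>i. V * real (i + n) powr (- 1 - (1 / 2 + d)))" by (rule suminf_mult[OF t2(1), symmetric])
      also have "\<dots> \<le> (\<Sum>i. c (i + n))"
        by (rule suminf_le[OF _ summable_mult[OF t2(1)] sm]) (simp only: bd le_add2)
      finally have lo: "V * (real n powr (- (1 / 2 + d)) / (1 / 2 + d)) \<le> (\<Sum>i. c (i + n))" .
      have gpos: "svg l n > 0" using svg_pos[OF sv, of n] n2 by simp
      have "(real n + 1) * (\<Sum>i. c (i + n)) / svg l n \<le> (real n + 1) * (U * ((real n - 1) powr (- (1 / 2 - d)) / (1 / 2 - d))) / svg l n"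
        using up gpos by (intro divide_right_mono mult_left_mono) auto
      also have "\<dots> = (1 + d) * exp d / (1 / 2 - d) * ((real n + 1) * (real n powr (- d) * real n powr (- 1 / 2)) * (real n - 1) powr (- (1 / 2 - d)))"
      proof -
        have "real n powr (- 1 / 2) = 1 / real n powr (1 / 2)" by (simp add: powr_minus_divide)
        moreover have "n1 * (a * D * x * (X / Y)) / (P * x) = a / Y * (n1 * (D * (1 / P)) * X)"
          if "x \<noteq> 0" for n1 a D x X Y P :: real using that by (simp add: mult_ac)
        moreover have "l n \<noteq> 0" using ln by simp
        ultimately show ?thesis unfolding U_def gn by (simp only:)
      qed
      also have "real n powr (- d) * real n powr (- 1 / 2) = real n powr (- 1) * real n powr (1 / 2 - d)"
        unfolding powr_add[symmetric] by (rule arg_cong[of _ _ "(powr) (real n)"]) simp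
      also have "(real n + 1) * (real n powr (- 1) * real n powr (1 / 2 - d)) * (real n - 1) powr (- (1 / 2 - d)) =
        (real n + 1) / real n * ((real n - 1) / real n) powr (- (1 / 2 - d))"
      proof -
        have "((real n - 1) / real n) powr (- (1 / 2 - d)) = (real n - 1) powr (- (1 / 2 - d)) * real n powr (1 / 2 - d)"
          using n2 by (subst powr_divide) (simp_all add: powr_minus field_simps)
        moreover have "real n powr (- 1) = 1 / real n" using npos by (simp add: powr_minus_divide)
        ultimately show ?thesis by simp
      qed
      finally have R1: "(real n + 1) * (\<Sum>i. c (i + n)) / svg l n \<le>
        (1 + d) * exp d / (1 / 2 - d) * ((real n + 1) / real n * ((real n - 1) / real n) powr (- (1 / 2 - d)))" .
      have "(1 - d) * exp (- d) / (1 / 2 + d) \<le> (1 - d) * exp (- d) / (1 / 2 + d) * ((real n + 1) / real n)"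
      proof -
        have "1 \<le> (real n + 1) / real n" using npos by simp
        then show ?thesis using mult_left_mono[of 1 "(real n + 1) / real n" "(1 - d) * exp (- d) / (1 / 2 + d)"] d by simp
      qed
      also have "\<dots> = (real n + 1) * (V * (real n powr (- (1 / 2 + d)) / (1 / 2 + d))) / svg l n"
      proof -
        have "real n powr d * real n powr (- (1 / 2 + d)) = real n powr (1 / 2) / real n"
        proof -
          have "real n powr d * real n powr (- (1 / 2 + d)) = real n powr (1 / 2) * real n powr (- 1)"
            unfolding powr_add[symmetric] by (rule arg_cong[of _ _ "(powr) (real n)"]) simp
          then show ?thesis using npos by (simp add: powr_minus_divide)
        qed
        moreover have "V * (real n powr (- (1 / 2 + d)) / (1 / 2 + d)) =
          (1 - d) * exp (- d) * l n / (1 / 2 + d) * (real n powr d * real n powr (- (1 / 2 + d)))"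
          by (simp add: V_def)
        ultimately show ?thesis using ln npos by (simp add: gn)
      qed
      also have "\<dots> \<le> (real n + 1) * (\<Sum>i. c (i + n)) / svg l n"
        using lo gpos by (intro divide_right_mono mult_left_mono) auto
      finally show ?thesis using R1 sm by blast
    qed
    then show ?thesis by blast
  qed
  obtain N where "summable (\<lambda>i. c (i + N))" using main[of "1 / 4"] by auto
  then show "summable c" by (rule summable_iff_shift[THEN iffD1])
  show "(\<lambda>n. (real n + 1) * (\<Sum>i. c (i + n)) / svg l n) \<longlonglongrightarrow> 2"
  proof (rule order_tendstoI)
    fix a :: real assume "a < 2"
    have "((\<lambda>d::real. (1 - d) * exp (- d) / (1 / 2 + d)) \<longlongrightarrow> 2) (at_right 0)" by real_asymp
    then have "\<forall>\<^sub>F d in at_right 0. (1 - d) * exp (- d) / (1 / 2 + d) > a"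
      using \<open>a < 2\<close> by (rule order_tendstoD)
    moreover have "\<forall>\<^sub>F d in at_right 0. 0 < d \<and> d < (1 / 2 :: real)"
      by (simp add: eventually_at_right_less eventually_at_right_field exI[of _ "1/2"])
    ultimately have "\<forall>\<^sub>F d in at_right 0. (1 - d) * exp (- d) / (1 / 2 + d) > a \<and> 0 < d \<and> d < 1 / 2"
      by (rule eventually_conj)
    then obtain d where d: "(1 - d) * exp (- d) / (1 / 2 + d) > a" "0 < d" "d < 1 / 2"
      using eventually_happens'[OF trivial_limit_at_right_real] by blast
    from main[OF d(2,3)] obtain N where "\<And>n. n \<ge> N \<Longrightarrow> (1 - d) * exp (- d) / (1 / 2 + d) \<le> (real n + 1) * (\<Sum>i. c (i + n)) / svg l n" by blast
    then show "\<forall>\<^sub>F n in sequentially. a < (real n + 1) * (\<Sum>i. c (i + n)) / svg l n"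
      unfolding eventually_sequentially using d(1) less_le_trans by blast
  next
    fix a :: real assume "a > 2"
    have "((\<lambda>d::real. (1 + d) * exp d / (1 / 2 - d)) \<longlongrightarrow> 2) (at_right 0)" by real_asymp
    then have "\<forall>\<^sub>F d in at_right 0. (1 + d) * exp d / (1 / 2 - d) < a"
      using \<open>a > 2\<close> by (rule order_tendstoD)
    moreover have "\<forall>\<^sub>F d in at_right 0. 0 < d \<and> d < (1 / 2 :: real)"
      by (simp add: eventually_at_right_less eventually_at_right_field exI[of _ "1/2"])
    ultimately have "\<forall>\<^sub>F d in at_right 0. (1 + d) * exp d / (1 / 2 - d) < a \<and> 0 < d \<and> d < 1 / 2"
      by (rule eventually_conj)
    then obtain d where d: "(1 + d) * exp d / (1 / 2 - d) < a" "0 < d" "d < 1 / 2"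
      using eventually_happens'[OF trivial_limit_at_right_real] by blast
    from main[OF d(2,3)] obtain N where N: "\<And>n. n \<ge> N \<Longrightarrow> (real n + 1) * (\<Sum>i. c (i + n)) / svg l n \<le>
        (1 + d) * exp d / (1 / 2 - d) * ((real n + 1) / real n * ((real n - 1) / real n) powr (- (1 / 2 - d)))" by blast
    have l1: "(\<lambda>n. (real n + 1) / real n) \<longlonglongrightarrow> 1" and l2: "(\<lambda>n. (real n - 1) / real n) \<longlonglongrightarrow> 1"
      by real_asymp+
    have "(\<lambda>n. (1 + d) * exp d / (1 / 2 - d) * ((real n + 1) / real n * ((real n - 1) / real n) powr (- (1 / 2 - d))))
        \<longlonglongrightarrow> (1 + d) * exp d / (1 / 2 - d) * (1 * 1 powr (- (1 / 2 - d)))"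
      by (intro tendsto_mult tendsto_const tendsto_powr l1 l2) simp
    then have "\<forall>\<^sub>F n in sequentially. (1 + d) * exp d / (1 / 2 - d) * ((real n + 1) / real n * ((real n - 1) / real n) powr (- (1 / 2 - d))) < a"
      using d(1) by (intro order_tendstoD(2)) auto
    then show "\<forall>\<^sub>F n in sequentially. (real n + 1) * (\<Sum>i. c (i + n)) / svg l n < a"
      using eventually_ge_at_top[of N] by eventually_elim (use N le_less_trans in blast)
  qed
qed

lemma powr_diff_le:
  assumes "0 < a" "a \<le> 1" "k \<ge> (1::nat)"
  shows "real (Suc k) powr a - real k powr a \<le> a * real k powr (a - 1)"
proof -
  have "\<exists>z::real. real k < z \<and> z < real (Suc k) \<and>
    real (Suc k) powr a - real k powr a = (real (Suc k) - real k) * (a * z powr (a - 1))"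
    using assms by (intro MVT2) (auto intro!: derivative_eq_intros)
  then obtain z where z: "real k < z" "z < real (Suc k)"
    "real (Suc k) powr a - real k powr a = a * z powr (a - 1)" by auto
  have "z powr (a - 1) \<le> real k powr (a - 1)"
    using z(1) assms by (intro powr_mono2') auto
  then have "a * z powr (a - 1) \<le> a * real k powr (a - 1)" using assms by (intro mult_left_mono) auto
  then show ?thesis using z(3) by linarith
qed

definition sv_sum :: "(nat \<Rightarrow> real) \<Rightarrow> nat \<Rightarrow> real" where
  "sv_sum l n = (\<Sum>k<n. (l (Suc k))\<^sup>2 / real (Suc k))"

text \<open>Potter's bound with exponent \<open>a / 2\<close> gives
  \<open>(l k)^2 >= exp (- a) * (k / n) powr a * (l n)^2\<close> for \<open>N <= k <= n\<close>.
  Summing \<open>k powr (a - 1)\<close> then gains a factor of about \<open>1 / a\<close>, which is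
  arbitrarily large. So \<open>(l n)^2\<close> is negligible against its own logarithmic
  sum.\<close>

lemma sv_sum_large:
  assumes sv: "sv_seq l"
  shows "\<exists>N\<ge>1. \<forall>n\<ge>N. K * (l n)\<^sup>2 \<le> sv_sum l n"
proof -
  \<comment> \<open>Two factors 1/2 are lost below, one to \<open>exp (- a)\<close> and one to
    cutting off the terms before \<open>N\<close>; hence the 4.\<close>
  define a where "a = 1 / (4 * (\<bar>K\<bar> + 1))"
  have a: "0 < a" "a \<le> 1 / 4" "K \<le> 1 / (4 * a)" by (auto simp: a_def field_simps)
  have a2: "0 < a / 2" using a by simp
  obtain N where N: "N \<ge> 1" "\<And>n k. N \<le> n \<Longrightarrow> n \<le> k \<Longrightarrow>
        l k \<le> exp (a / 2) * (real k / real n) powr (a / 2) * l n \<and> l n \<le> exp (a / 2) * (real k / real n) powr (a / 2) * l k"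
    using sv_seq_potter[OF sv a2] by blast
  have "(\<lambda>n. (real N / real n) powr a) \<longlonglongrightarrow> 0" using a(1) N(1) by real_asymp
  then have "\<forall>\<^sub>F n in sequentially. (real N / real n) powr a < 1 / 2" by (rule order_tendstoD) simp
  then obtain N' where N': "\<And>n. n \<ge> N' \<Longrightarrow> (real N / real n) powr a < 1 / 2" unfolding eventually_sequentially by blast
  have "K * (l n)\<^sup>2 \<le> sv_sum l n" if n: "n \<ge> max N N'" for n
  proof -
    have npos: "real n > 0" using n N(1) by simp
    define c where "c = exp (- a) * real n powr (- a) * (l n)\<^sup>2"
    have c0: "c \<ge> 0" by (simp add: c_def)
    have summand: "c * real k powr (a - 1) \<le> (l k)\<^sup>2 / real k" if k: "N \<le> k" "k \<le> n" for k
    proof -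
      have kpos: "real k > 0" using k N(1) by simp
      have "l n \<le> exp (a / 2) * (real n / real k) powr (a / 2) * l k" using N(2)[OF k] by blast
      moreover have "l n > 0" using sv_seq_pos[OF sv, of n] npos by simp
      ultimately have "(l n)\<^sup>2 \<le> (exp (a / 2) * (real n / real k) powr (a / 2) * l k)\<^sup>2"
        by (intro power_mono) auto
      also have "\<dots> = (exp (a / 2) * exp (a / 2)) * ((real n / real k) powr (a / 2) * (real n / real k) powr (a / 2)) * (l k)\<^sup>2"
        by (simp add: power2_eq_square mult_ac)
      also have "\<dots> = exp a * (real n / real k) powr a * (l k)\<^sup>2"
        by (simp add: exp_add[symmetric] powr_add[symmetric])
      finally have le: "(l n)\<^sup>2 \<le> exp a * (real n / real k) powr a * (l k)\<^sup>2" .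
      have "c * real k powr (a - 1) \<le> exp (- a) * real n powr (- a) * (exp a * (real n / real k) powr a * (l k)\<^sup>2) * real k powr (a - 1)"
        unfolding c_def using le by (intro mult_right_mono mult_left_mono) auto
      also have "\<dots> = (l k)\<^sup>2 / real k"
      proof -
        have v: "real n powr (- a) * (real n / real k) powr a = real k powr (- a)"
          using npos kpos by (simp add: powr_divide powr_minus_divide)
        have w: "real k powr (- a) * real k powr (a - 1) = 1 / real k"
          using kpos unfolding powr_add[symmetric] by (simp add: powr_minus_divide)
        have u: "exp (- a) * exp a = 1" by (simp add: exp_add[symmetric])
        have "exp (- a) * real n powr (- a) * (exp a * (real n / real k) powr a * (l k)\<^sup>2) * real k powr (a - 1) =
          (exp (- a) * exp a) * (real n powr (- a) * (real n / real k) powr a) * real k powr (a - 1) * (l k)\<^sup>2"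
          by (simp only: mult_ac)
        also have "\<dots> = (l k)\<^sup>2 / real k" unfolding u v using w by simp
        finally show ?thesis .
      qed
      finally show ?thesis .
    qed
    have "real n powr a - real N powr a = (\<Sum>k\<in>{N..<n}. real (Suc k) powr a - real k powr a)"
      using n sum_Suc_diff'[of N n "\<lambda>k. real k powr a"] by simp
    also have "\<dots> \<le> (\<Sum>k\<in>{N..<n}. a * real k powr (a - 1))"
      using a N(1) by (intro sum_mono powr_diff_le) auto
    finally have "(real n powr a - real N powr a) / a \<le> (\<Sum>k\<in>{N..<n}. real k powr (a - 1))"
      using a(1) by (simp add: sum_distrib_left[symmetric] field_simps)
    then have "c * ((real n powr a - real N powr a) / a) \<le> c * (\<Sum>k\<in>{N..<n}. real k powr (a - 1))"
      using c0 by (rule mult_left_mono)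
    also have "\<dots> \<le> (\<Sum>k\<in>{N..<n}. (l k)\<^sup>2 / real k)"
      unfolding sum_distrib_left by (intro sum_mono summand) auto
    also have "\<dots> \<le> (\<Sum>k\<in>Suc ` {..<n}. (l k)\<^sup>2 / real k)"
    proof (rule sum_mono2)
      show "{N..<n} \<subseteq> Suc ` {..<n}"
      proof
        fix k assume "k \<in> {N..<n}"
        then show "k \<in> Suc ` {..<n}" using N(1) by (cases k) auto
      qed
    qed auto
    also have "\<dots> = sv_sum l n" by (simp add: sv_sum_def sum.reindex)
    finally have s: "c * ((real n powr a - real N powr a) / a) \<le> sv_sum l n" .
    have "K \<le> 1 / (4 * a)" by (rule a(3))
    also have "\<dots> \<le> exp (- a) * (1 - (real N / real n) powr a) / a"
    proof -
      have "1 - a \<le> exp (- a)" using exp_ge_add_one_self[of "- a"] by simp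
      then have "exp (- a) \<ge> 1 / 2" using a(2) by simp
      moreover have "1 - (real N / real n) powr a \<ge> 1 / 2" using N'[of n] n by simp
      ultimately have "1 / 2 * (1 / 2) \<le> exp (- a) * (1 - (real N / real n) powr a)" by (intro mult_mono) auto
      then have "1 / 2 * (1 / 2) / a \<le> exp (- a) * (1 - (real N / real n) powr a) / a"
        using a(1) by (intro divide_right_mono) auto
      then show ?thesis by simp
    qed
    finally have "K * (l n)\<^sup>2 \<le> exp (- a) * (1 - (real N / real n) powr a) / a * (l n)\<^sup>2"
      by (intro mult_right_mono) auto
    also have "\<dots> = c * ((real n powr a - real N powr a) / a)"
    proof -
      have "(E * (1 - A / B) / a) * x = E * (1 / B) * x * ((B - A) / a)" if "B \<noteq> 0" for A B E x :: real
        using that a(1) by (simp add: field_simps)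
      moreover have "(real N / real n) powr a = real N powr a / real n powr a" using npos by (simp add: powr_divide)
      moreover have "real n powr a \<noteq> 0" using npos by simp
      ultimately show ?thesis unfolding c_def powr_minus_divide by simp
    qed
    finally show ?thesis using s by simp
  qed
  then show ?thesis using N(1) by (intro exI[of _ "max N N'"]) auto
qed

text \<open>Between \<open>j\<close> and \<open>n\<close> there are at most \<open>n\<close> terms,
  and \<open>l k <= 2 * l n\<close> on \<open>[h * n, n]\<close> bounds each by
  \<open>(2 * l n)^2 / (h * n)\<close>.\<close>

lemma sv_sum_local:
  assumes sv: "sv_seq l" and h: "h > 0"
  shows "\<exists>N\<ge>1. \<forall>n\<ge>N. \<forall>j\<le>n. h * real n \<le> real j \<longrightarrow> sv_sum l n - sv_sum l j \<le> 4 / h * (l n)\<^sup>2"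
proof -
  obtain N where N: "N \<ge> 1" "\<And>n j. N \<le> n \<Longrightarrow> h * real n \<le> real j \<Longrightarrow> j \<le> n \<Longrightarrow> \<bar>l j - l n\<bar> \<le> 1 * l n"
    by (rule sv_seq_uniform[OF sv h zero_less_one]) blast
  have "sv_sum l n - sv_sum l j \<le> 4 / h * (l n)\<^sup>2" if n: "n \<ge> N" "j \<le> n" "h * real n \<le> real j" for n j
  proof -
    have npos: "real n > 0" using n N(1) by simp
    have "sv_sum l n - sv_sum l j = (\<Sum>k\<in>{j..<n}. (l (Suc k))\<^sup>2 / real (Suc k))"
      unfolding sv_sum_def using n(2) by (simp add: lessThan_atLeast0 sum_diff_nat_ivl)
    also have "\<dots> \<le> (\<Sum>k\<in>{j..<n}. (2 * l n)\<^sup>2 / (h * real n))"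
    proof (rule sum_mono)
      fix k assume k: "k \<in> {j..<n}"
      then have hk: "h * real n \<le> real (Suc k)" using n(3) by simp
      then have "\<bar>l (Suc k) - l n\<bar> \<le> 1 * l n" using k n by (intro N(2)) auto
      moreover have "l (Suc k) > 0" using sv_seq_pos[OF sv, of "Suc k"] by simp
      ultimately have "(l (Suc k))\<^sup>2 \<le> (2 * l n)\<^sup>2" by (intro power_mono) linarith+
      then show "(l (Suc k))\<^sup>2 / real (Suc k) \<le> (2 * l n)\<^sup>2 / (h * real n)"
        using hk h npos by (intro frac_le) auto
    qed
    also have "\<dots> = real (n - j) * ((2 * l n)\<^sup>2 / (h * real n))" by simp
    also have "\<dots> \<le> real n * ((2 * l n)\<^sup>2 / (h * real n))"
      using h npos by (intro mult_right_mono) auto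
    also have "\<dots> = 4 / h * (l n)\<^sup>2" using npos by (simp add: power2_eq_square)
    finally show ?thesis .
  qed
  then show ?thesis using N(1) by blast
qed

section \<open>The asymptotic transfer theorem\<close>

unbundle no vec_syntax
unbundle fps_syntax


section \<open>Sums over compositions as coefficients of power series\<close>

definition comps :: "nat \<Rightarrow> nat \<Rightarrow> nat list set" where
  "comps m N = {js. length js = m \<and> sum_list js = N}"

lemma comps_0: "comps 0 N = (if N = 0 then {[]} else {})"
  by (auto simp: comps_def)

lemma comps_Suc: "comps (Suc m) N = (\<Union>j\<le>N. (#) j ` comps m (N - j))"
  by (auto simp: comps_def length_Suc_conv image_iff)

lemma finite_comps [simp]: "finite (comps m N)"
  by (induction m arbitrary: N) (auto simp: comps_0 comps_Suc)

lemma sum_comps_Suc: "(\<Sum>js\<in>comps (Suc m) N. f js) = (\<Sum>j\<le>N. \<Sum>js\<in>comps m (N - j). f (j # js))"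
  unfolding comps_Suc by (subst sum.UNION_disjoint) (auto simp: sum.reindex)

lemma card_comps: "card (comps m N) = (N + m - 1) choose N"
  unfolding comps_def by (rule card_length_sum_list)

lemma card_comps_choose:
  assumes "1 \<le> m" "m - 1 \<le> n"
  shows "card (comps m (n - (m - 1))) = n choose (m - 1)"
proof -
  have "n - (m - 1) + m - 1 = n" using assms by simp
  then show ?thesis using binomial_symmetric[OF assms(2)] by (simp only: card_comps)
qed

definition ones :: "'a :: comm_ring_1 fps" where
  "ones = Abs_fps (\<lambda>_. 1)"

lemma ones_nth [simp]: "ones $ n = 1"
  by (simp add: ones_def)

lemma fps_mult_nth_atMost: "(F * G) $ n = (\<Sum>j\<le>n. F $ j * G $ (n - j))"
  by (simp add: fps_mult_nth atLeast0AtMost)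

lemma one_minus_X_mult_ones: "(1 - fps_X) * (ones :: 'a :: comm_ring_1 fps) = 1"
  by (rule fps_ext) (auto simp: left_diff_distrib)

lemma sum_comps_0: "(\<Sum>js\<in>comps m N. 1) = (ones ^ m) $ N"
proof (induction m arbitrary: N)
  case (Suc m)
  show ?case unfolding sum_comps_Suc Suc
    by (simp add: fps_mult_nth_atMost)
qed (simp add: comps_0)

lemma sum_comps_1: "(\<Sum>js\<in>comps m N. sum_list (map a js)) = (of_nat m * ones ^ (m - 1) * Abs_fps a) $ N"
proof (induction m arbitrary: N)
  case (Suc m)
  have "(\<Sum>js\<in>comps (Suc m) N. sum_list (map a js)) =
    (\<Sum>j\<le>N. a j * (\<Sum>js\<in>comps m (N - j). 1)) + (\<Sum>j\<le>N. \<Sum>js\<in>comps m (N - j). sum_list (map a js))"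
    unfolding sum_comps_Suc by (simp add: sum.distrib mult.commute)
  also have "\<dots> = (Abs_fps a * ones ^ m + ones * (of_nat m * ones ^ (m - 1) * Abs_fps a)) $ N"
    unfolding Suc sum_comps_0 by (simp only: fps_add_nth fps_mult_nth_atMost[of "Abs_fps a"] fps_mult_nth_atMost[of ones] ones_nth fps_nth_Abs_fps mult_1)
  also have "Abs_fps a * ones ^ m + ones * (of_nat m * ones ^ (m - 1) * Abs_fps a) = of_nat (Suc m) * ones ^ (Suc m - 1) * Abs_fps a"
    by (cases m) (simp_all add: algebra_simps)
  finally show ?case .
qed (simp add: comps_0)

text \<open>In the expanded square, a squared entry leaves \<open>m - 1\<close> positions free and a
  product of two different entries leaves \<open>m - 2\<close>. Every free position contributes a
  factor \<open>ones\<close>.\<close>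

lemma sum_comps_2:
  "(\<Sum>js\<in>comps m N. (sum_list (map a js))\<^sup>2) =
    (of_nat m * ones ^ (m - 1) * Abs_fps (\<lambda>n. (a n)\<^sup>2) + of_nat (m * (m - 1)) * ones ^ (m - 2) * (Abs_fps a)\<^sup>2) $ N"
proof (induction m arbitrary: N)
  case (Suc m)
  define A where "A = Abs_fps a"
  define B where "B = Abs_fps (\<lambda>n. (a n)\<^sup>2)"
  have "(\<Sum>js\<in>comps (Suc m) N. (sum_list (map a js))\<^sup>2) =
    (\<Sum>j\<le>N. (a j)\<^sup>2 * (\<Sum>js\<in>comps m (N - j). 1)) + ((\<Sum>j\<le>N. a j * (\<Sum>js\<in>comps m (N - j). sum_list (map a js))) + (\<Sum>j\<le>N. a j * (\<Sum>js\<in>comps m (N - j). sum_list (map a js))))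
     + (\<Sum>j\<le>N. \<Sum>js\<in>comps m (N - j). (sum_list (map a js))\<^sup>2)"
    unfolding sum_comps_Suc by (simp add: sum.distrib power2_sum sum_distrib_left algebra_simps)
  also have "\<dots> = (B * ones ^ m + (A * (of_nat m * ones ^ (m - 1) * A) + A * (of_nat m * ones ^ (m - 1) * A)) +
      ones * (of_nat m * ones ^ (m - 1) * B + of_nat (m * (m - 1)) * ones ^ (m - 2) * A\<^sup>2)) $ N"
    unfolding Suc sum_comps_0 sum_comps_1 A_def B_def
    by (simp only: fps_add_nth fps_mult_nth_atMost[of "Abs_fps _"] fps_mult_nth_atMost[of ones] ones_nth fps_nth_Abs_fps mult_1)
  also have "B * ones ^ m + (A * (of_nat m * ones ^ (m - 1) * A) + A * (of_nat m * ones ^ (m - 1) * A)) +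
      ones * (of_nat m * ones ^ (m - 1) * B + of_nat (m * (m - 1)) * ones ^ (m - 2) * A\<^sup>2) =
      of_nat (Suc m) * ones ^ (Suc m - 1) * B + of_nat (Suc m * (Suc m - 1)) * ones ^ (Suc m - 2) * A\<^sup>2"
  proof (cases m)
    case (Suc k)
    then show ?thesis by (cases k) (simp_all add: algebra_simps power2_eq_square)
  qed simp
  finally show ?case unfolding A_def B_def .
qed (simp add: comps_0)

section \<open>The Euler operator and polynomials in it\<close>

definition theta :: "complex fps \<Rightarrow> complex fps" where
  "theta F = (1 - fps_X) * fps_deriv F"

lemma theta_nth: "theta F $ n = of_nat (n + 1) * F $ (n + 1) - of_nat n * F $ n"
  by (cases n) (simp_all add: theta_def left_diff_distrib)

lemma theta_add: "theta (F + G) = theta F + theta G"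
  by (simp add: theta_def algebra_simps)

lemma theta_diff: "theta (F - G) = theta F - theta G"
  by (simp add: theta_def algebra_simps)

lemma theta_const_mult: "theta (fps_const c * F) = fps_const c * theta F"
  by (simp add: theta_def algebra_simps)

lemma theta_sum: "finite A \<Longrightarrow> theta (\<Sum>i\<in>A. f i) = (\<Sum>i\<in>A. theta (f i))"
  by (induction A rule: finite_induct) (simp_all add: theta_add, simp add: theta_def)

text \<open>The polynomial \<open>p\<close> evaluated at the operator \<open>theta\<close>. As
  \<open>theta\<close> multiplies \<open>(1 - z) powr (- c)\<close> by \<open>c\<close>, growth of
  order \<open>n powr (c - 1)\<close> corresponds to the argument \<open>c\<close> of
  \<open>p\<close>.\<close>

definition polyop :: "complex poly \<Rightarrow> complex fps \<Rightarrow> complex fps" where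
  "polyop p F = (\<Sum>i\<le>degree p. fps_const (coeff p i) * (theta ^^ i) F)"

lemma polyop_altdef:
  assumes "degree p \<le> n"
  shows "polyop p F = (\<Sum>i\<le>n. fps_const (coeff p i) * (theta ^^ i) F)"
  unfolding polyop_def using assms by (intro sum.mono_neutral_left) (auto simp: coeff_eq_0)

lemma polyop_theta: "polyop p (theta F) = theta (polyop p F)"
  unfolding polyop_def by (simp add: theta_sum theta_const_mult funpow_swap1)

lemma polyop_diff: "polyop (p - q) F = polyop p F - polyop q F"
proof -
  define n where "n = max (degree p) (degree q)"
  have "degree p \<le> n" "degree q \<le> n" "degree (p - q) \<le> n"
    by (auto simp: n_def degree_diff_le_max)
  then show ?thesis by (simp add: polyop_altdef[of _ n] algebra_simps sum_subtractf flip: fps_const_sub)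
qed

lemma polyop_smult: "polyop (smult c p) F = fps_const c * polyop p F"
proof -
  have "degree (smult c p) \<le> degree p" by (rule degree_smult_le)
  then show ?thesis by (simp add: polyop_altdef[of _ "degree p"] sum_distrib_left mult_ac flip: fps_const_mult)
qed

lemma polyop_pCons_0: "polyop (pCons 0 p) F = theta (polyop p F)"
proof -
  have "degree (pCons 0 p) \<le> Suc (degree p)" by (rule degree_pCons_le)
  then have "polyop (pCons 0 p) F = (\<Sum>i\<le>Suc (degree p). fps_const (coeff (pCons 0 p) i) * (theta ^^ i) F)"
    by (rule polyop_altdef)
  also have "\<dots> = polyop p (theta F)"
    unfolding sum.atMost_Suc_shift by (simp add: polyop_def funpow_swap1)
  finally show ?thesis by (simp add: polyop_theta)
qed

lemma polyop_linear_mult: "polyop ([:- x, 1:] * p) F = theta (polyop p F) - fps_const x * polyop p F"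
proof -
  have "[:- x, 1:] * p = pCons 0 p - smult x p" by simp
  then show ?thesis by (simp only: polyop_diff polyop_pCons_0 polyop_smult)
qed

lemma polyop_const: "polyop [:c:] F = fps_const c * F"
  by (simp add: polyop_def)

lemma polyop_diff_right: "polyop p (F - G) = polyop p F - polyop p G"
proof -
  have "(theta ^^ i) (F - G) = (theta ^^ i) F - (theta ^^ i) G" for i
    by (induction i) (simp_all add: theta_diff)
  then show ?thesis by (simp add: polyop_def right_diff_distrib sum_subtractf)
qed

lemma polyop_const_mult_right: "polyop p (fps_const c * F) = fps_const c * polyop p F"
proof -
  have "(theta ^^ i) (fps_const c * F) = fps_const c * (theta ^^ i) F" for i
    by (induction i) (simp_all add: theta_const_mult)
  then show ?thesis by (simp add: polyop_def sum_distrib_left mult_ac)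
qed

text \<open>Each application of \<open>theta\<close> looks one coefficient further, since
  \<open>theta_nth\<close> involves only the indices \<open>n\<close> and \<open>n + 1\<close>. This
  provides the initial value of the reduced first-order equation.\<close>

lemma polyop_nth_0:
  assumes "\<And>i. i \<le> degree p \<Longrightarrow> F $ i = 0"
  shows "polyop p F $ 0 = 0"
proof -
  have "(theta ^^ i) F $ n = 0" if "\<And>j. j \<le> n + i \<Longrightarrow> F $ j = 0" for i n
    using that by (induction i arbitrary: n) (auto simp: theta_nth)
  then have "(theta ^^ i) F $ 0 = 0" if "i \<le> degree p" for i
    using that assms by simp
  then show ?thesis by (simp add: polyop_def fps_sum_nth)
qed

lemma polyop_eigen:
  assumes "theta F = fps_const c * F"
  shows "polyop p F = fps_const (poly p c) * F"
proof -
  have iter: "(theta ^^ i) F = fps_const (c ^ i) * F" for i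
  proof (induction i)
    case (Suc i)
    have "(theta ^^ Suc i) F = fps_const (c ^ i) * (fps_const c * F)"
      using Suc by (simp add: theta_const_mult assms)
    also have "\<dots> = fps_const (c ^ i * c) * F"
      by (simp only: mult.assoc[symmetric] fps_const_mult)
    finally show ?case by (simp only: power_Suc2)
  qed simp
  have "polyop p F = (\<Sum>i\<le>degree p. fps_const (coeff p i * c ^ i)) * F"
    unfolding polyop_def sum_distrib_right iter
    by (simp only: mult.assoc[symmetric] fps_const_mult)
  also have "(\<Sum>i\<le>degree p. fps_const (coeff p i * c ^ i)) = fps_const (poly p c)"
  proof -
    have "(\<Sum>i\<in>I. fps_const (f i)) = fps_const (sum f I)" if "finite I" for f :: "nat \<Rightarrow> complex" and I
      using that by (induction I rule: finite_induct) auto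
    then show ?thesis by (simp add: poly_altdef)
  qed
  finally show ?thesis .
qed

definition rising_poly :: "nat \<Rightarrow> complex poly" where
  "rising_poly r = (\<Prod>k<r. [:of_nat k, 1:])"

text \<open>The classical factorization of \<open>(1 - z)^r * D^r\<close> into
  \<open>theta * (theta + 1) * ... * (theta + r - 1)\<close>. In the induction step the derivative
  of \<open>(1 - z) ^ r\<close> produces \<open>- r\<close> times the previous expression, which the
  new factor \<open>theta + r\<close> cancels.\<close>

lemma polyop_rising: "polyop (rising_poly r) F = (1 - fps_X) ^ r * (fps_deriv ^^ r) F"
proof (induction r)
  case 0
  show ?case by (simp add: rising_poly_def polyop_def)
next
  case (Suc r)
  have "rising_poly (Suc r) = [:- (- of_nat r), 1:] * rising_poly r"
    by (simp add: rising_poly_def)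
  then have "polyop (rising_poly (Suc r)) F = theta (polyop (rising_poly r) F) + of_nat r * polyop (rising_poly r) F"
    by (simp only: polyop_linear_mult) (simp add: fps_of_nat flip: fps_const_neg)
  also have "\<dots> = (1 - fps_X) ^ Suc r * (fps_deriv ^^ Suc r) F"
  proof (cases r)
    case (Suc k)
    have d: "fps_deriv ((1 - fps_X) ^ Suc k) = - of_nat (Suc k) * (1 - fps_X :: complex fps) ^ k"
      by (simp add: fps_deriv_power fps_of_nat algebra_simps del: power_Suc flip: fps_const_add)
    show ?thesis unfolding Suc.IH theta_def fps_deriv_mult unfolding Suc d by (simp add: algebra_simps)
  qed (simp add: theta_def rising_poly_def polyop_def)
  finally show ?case .
qed

lemma poly_rising: "poly (rising_poly r) z = (\<Prod>k<r. z + of_nat k)"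
  by (simp add: rising_poly_def poly_prod add.commute)

lemma fps_deriv_funpow_nth: "(fps_deriv ^^ r) F $ N = of_nat (fact (N + r) div fact N) * F $ (N + r)"
proof (induction r arbitrary: N)
  case (Suc r)
  have "(fps_deriv ^^ Suc r) F $ N = of_nat (Suc N) * ((fps_deriv ^^ r) F $ Suc N)" by simp
  also have "\<dots> = of_nat (Suc N * (fact (Suc N + r) div fact (Suc N))) * F $ (N + Suc r)"
    unfolding Suc of_nat_mult by (simp only: mult.assoc add_Suc add_Suc_right)
  also have "Suc N * (fact (Suc N + r) div fact (Suc N)) = (fact (N + Suc r) div fact N :: nat)"
  proof -
    obtain k where k: "fact (Suc N + r) = fact (Suc N) * (k::nat)" by (metis dvdE fact_dvd le_add1)
    then have "fact (N + Suc r) = fact N * (Suc N * k)" by (simp add: algebra_simps)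
    then have "fact (N + Suc r) div fact N = Suc N * k"
      by (simp only: nonzero_mult_div_cancel_left fact_nonzero not_False_eq_True)
    moreover have "fact (Suc N + r) div fact (Suc N) = k"
      unfolding k by (simp only: nonzero_mult_div_cancel_left fact_nonzero not_False_eq_True)
    ultimately show ?thesis by simp
  qed
  finally show ?case .
qed simp


text \<open>Regular growth of exponent \<open>s - 1\<close>: asymptotically \<open>g\<close> is an eigensequence of \<open>theta\<close>.\<close>

definition reg :: "(nat \<Rightarrow> real) \<Rightarrow> real \<Rightarrow> bool" where
  "reg g s \<longleftrightarrow> (\<forall>\<^sub>F n in sequentially. g n > 0) \<and>
     (\<lambda>n. (real (n + 1) * g (n + 1) - real n * g n) / g n) \<longlonglongrightarrow> s"

text \<open>\<open>1 - \<beta>/D \<le> (1 + 1/D) powr (-\<beta>)\<close> makes \<open>(e - \<epsilon>/2)\<^sup>+ D powr \<beta>\<close> nonincreasing.\<close>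

lemma contraction_seq:
  fixes e \<eta> :: "nat \<Rightarrow> real"
  assumes nonneg: "\<And>n. e n \<ge> 0" and "\<beta> > 0" and \<eta>: "\<eta> \<longlonglongrightarrow> 0"
    and rec: "\<forall>\<^sub>F n in sequentially. e (Suc n) \<le> (1 - \<beta> / (real n + c)) * e n + \<eta> n / (real n + c)"
  shows "e \<longlonglongrightarrow> 0"
proof (rule LIMSEQ_I)
  fix \<epsilon> :: real assume "\<epsilon> > 0"
  define D where "D n = real n + c" for n
  have "\<forall>\<^sub>F n in sequentially. \<eta> n < \<beta> * \<epsilon> / 2"
    using \<open>\<epsilon> > 0\<close> \<open>\<beta> > 0\<close> by (intro order_tendstoD(2)[OF \<eta>]) simp
  moreover have "\<forall>\<^sub>F n in sequentially. D n > max 1 \<beta>"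
    unfolding D_def by real_asymp
  ultimately have "\<forall>\<^sub>F n in sequentially. \<eta> n < \<beta> * \<epsilon> / 2 \<and> D n > max 1 \<beta> \<and>
      e (Suc n) \<le> (1 - \<beta> / D n) * e n + \<eta> n / D n"
    using rec unfolding D_def by eventually_elim simp
  then obtain N where N: "\<And>n. n \<ge> N \<Longrightarrow> \<eta> n < \<beta> * \<epsilon> / 2" "\<And>n. n \<ge> N \<Longrightarrow> D n > max 1 \<beta>"
      "\<And>n. n \<ge> N \<Longrightarrow> e (Suc n) \<le> (1 - \<beta> / D n) * e n + \<eta> n / D n"
    unfolding eventually_sequentially by blast
  define f where "f n = max 0 (e n - \<epsilon> / 2)" for n
  have f0: "f n \<ge> 0" for n by (simp add: f_def)
  have step: "f (Suc n) * D (Suc n) powr \<beta> \<le> f n * D n powr \<beta>" if "n \<ge> N" for n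
  proof -
    have Dn: "D n > 1" "D n > \<beta>" using N(2)[OF that] by auto
    have DS: "D (Suc n) = D n + 1" by (simp add: D_def)
    have q: "0 \<le> 1 - \<beta> / D n" using Dn by simp
    have "\<eta> n / D n \<le> (\<beta> * \<epsilon> / 2) / D n" using N(1)[OF that] Dn by (intro divide_right_mono) auto
    then have "e (Suc n) - \<epsilon> / 2 \<le> (1 - \<beta> / D n) * (e n - \<epsilon> / 2)"
      using N(3)[OF that] by (simp add: algebra_simps)
    also have "\<dots> \<le> (1 - \<beta> / D n) * f n" using q by (intro mult_left_mono) (simp_all add: f_def)
    finally have "f (Suc n) \<le> (1 - \<beta> / D n) * f n" using q f0[of n] by (simp add: f_def[of "Suc n"])
    also have "1 - \<beta> / D n \<le> (D n / D (Suc n)) powr \<beta>"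
    proof -
      have "ln (D (Suc n) / D n) \<le> D (Suc n) / D n - 1" using Dn DS by (intro ln_le_minus_one) simp
      also have "\<dots> = 1 / D n" using Dn DS by (simp add: field_simps)
      finally have "\<beta> * ln (D (Suc n) / D n) \<le> \<beta> / D n" using \<open>\<beta> > 0\<close> by (simp add: mult_left_mono divide_inverse)
      moreover have "ln (D n / D (Suc n)) = - ln (D (Suc n) / D n)" using Dn DS by (simp add: ln_div)
      ultimately have "1 - \<beta> / D n \<le> 1 + \<beta> * ln (D n / D (Suc n))" by simp
      also have "\<dots> \<le> exp (\<beta> * ln (D n / D (Suc n)))" by (rule exp_ge_add_one_self)
      also have "\<dots> = (D n / D (Suc n)) powr \<beta>" using Dn DS by (simp add: powr_def)
      finally show ?thesis .
    qed
    finally have "f (Suc n) \<le> (D n / D (Suc n)) powr \<beta> * f n" using f0 by (simp add: mult_right_mono)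
    then have "f (Suc n) * D (Suc n) powr \<beta> \<le> (D n / D (Suc n)) powr \<beta> * f n * D (Suc n) powr \<beta>"
      by (rule mult_right_mono) simp
    also have "\<dots> = f n * D n powr \<beta>" using Dn DS by (simp add: powr_divide)
    finally show ?thesis .
  qed
  define C where "C = f N * D N powr \<beta>"
  have bound: "f n * D n powr \<beta> \<le> C" if "n \<ge> N" for n
    using that by (induction n rule: dec_induct) (auto simp: C_def intro: order_trans[OF step])
  have "(\<lambda>n. C * (real n + c) powr (- \<beta>)) \<longlonglongrightarrow> 0"
    using \<open>\<beta> > 0\<close> by real_asymp
  then have "\<forall>\<^sub>F n in sequentially. C * D n powr (- \<beta>) < \<epsilon> / 2"
    unfolding D_def using \<open>\<epsilon> > 0\<close> by (intro order_tendstoD) auto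
  then obtain N' where N': "\<And>n. n \<ge> N' \<Longrightarrow> C * D n powr (- \<beta>) < \<epsilon> / 2"
    unfolding eventually_sequentially by blast
  have "norm (e n - 0) < \<epsilon>" if "n \<ge> max N N'" for n
  proof -
    have "D n > 1" using N(2)[of n] that by simp
    then have "f n \<le> C * D n powr (- \<beta>)" using bound[of n] that by (simp add: powr_minus field_simps)
    then have "f n < \<epsilon> / 2" using N'[of n] that by simp
    moreover have "e n - \<epsilon> / 2 \<le> f n" by (simp add: f_def)
    ultimately show ?thesis using nonneg[of n] by simp
  qed
  then show "\<exists>no. \<forall>n\<ge>no. norm (e n - 0) < \<epsilon>" by blast
qed

text \<open>After division by \<open>g\<close> the recurrence multiplies by roughly
  \<open>(n + x) / (n + s)\<close>, whose modulus is about \<open>1 - (s - Re x) / n\<close>. As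
  \<open>Re x < s\<close>, this is the situation of \<open>contraction_seq\<close>.\<close>

lemma first_order_little_o:
  fixes F y :: "nat \<Rightarrow> complex"
  assumes reg: "reg g s" and x: "Re x < s"
    and rec: "\<And>n. of_nat (n + 1) * F (n + 1) - (of_nat n + x) * F n = y n"
    and y: "(\<lambda>n. y n / of_real (g n)) \<longlonglongrightarrow> 0"
  shows "(\<lambda>n. F n / of_real (g n)) \<longlonglongrightarrow> 0"
proof -
  \<comment> \<open>A quarter of the gap between \<open>Re x\<close> and \<open>s\<close>: one
    \<open>\<delta>\<close> is spent on the limit in \<open>reg\<close>, one on the imaginary part
    of \<open>x\<close>, and \<open>2 * \<delta>\<close> remain for the contraction.\<close>
  define \<delta> where "\<delta> = (s - Re x) / 4"
  have \<delta>: "\<delta> > 0" "s = Re x + 4 * \<delta>" using x by (auto simp: \<delta>_def field_simps)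
  define e where "e n = norm (F n / of_real (g n))" for n
  define \<eta> where "\<eta> n = norm (y n / of_real (g n))" for n
  have \<eta>: "\<eta> \<longlonglongrightarrow> 0" unfolding \<eta>_def using tendsto_norm[OF y] by simp
  have "\<forall>\<^sub>F n in sequentially. g n > 0" using reg by (simp add: reg_def)
  then obtain N0 where N0: "\<And>n. n \<ge> N0 \<Longrightarrow> g n > 0" unfolding eventually_sequentially by blast
  have ev_s: "\<forall>\<^sub>F n in sequentially. (real (n + 1) * g (n + 1) - real n * g n) / g n > s - \<delta>"
    using reg \<delta> by (intro order_tendstoD(1)) (auto simp: reg_def)
  have ev_im: "\<forall>\<^sub>F n in sequentially. (Im x)\<^sup>2 \<le> 2 * \<delta> * (real n + Re x) \<and> real n + Re x > 0"
    using \<delta>(1) by (intro eventually_conj) real_asymp+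
  have "\<forall>\<^sub>F n in sequentially. e (Suc n) \<le> (1 - (2 * \<delta>) / (real n + (s - \<delta>))) * e n + \<eta> n / (real n + (s - \<delta>))"
    using ev_s ev_im eventually_ge_at_top[of N0]
  proof eventually_elim
    case (elim n)
    have g: "g n > 0" "g (n + 1) > 0" using N0 elim by auto
    define D where "D = real n + (s - \<delta>)"
    have D: "D > 0" using elim \<delta> by (simp add: D_def)
    have gD: "D * g n \<le> real (n + 1) * g (n + 1)"
      using elim(1) g by (simp add: D_def field_simps)
    have "norm (of_nat n + x) \<le> real n + Re x + \<delta>"
    proof -
      have "(norm (of_nat n + x))\<^sup>2 = (real n + Re x)\<^sup>2 + (Im x)\<^sup>2" by (simp add: cmod_power2)
      also have "\<dots> \<le> (real n + Re x)\<^sup>2 + 2 * \<delta> * (real n + Re x)" using elim by simp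
      also have "\<dots> \<le> (real n + Re x + \<delta>)\<^sup>2" by (simp add: power2_eq_square algebra_simps)
      finally show ?thesis by (rule power2_le_imp_le) (use elim \<delta> in simp)
    qed
    also have "\<dots> = D - 2 * \<delta>" by (simp add: D_def \<delta>(2))
    finally have nx: "norm (of_nat n + x) \<le> D - 2 * \<delta>" .
    have "of_nat (n + 1) * F (n + 1) = (of_nat n + x) * F n + y n" using rec[of n] by (simp add: algebra_simps)
    then have "real (n + 1) * norm (F (n + 1)) \<le> norm (of_nat n + x) * norm (F n) + norm (y n)"
      by (metis norm_mult norm_of_nat norm_triangle_ineq)
    also have "\<dots> \<le> (D - 2 * \<delta>) * norm (F n) + norm (y n)" using nx by (intro add_mono mult_right_mono) auto
    finally have "real (n + 1) * norm (F (n + 1)) \<le> (D - 2 * \<delta>) * norm (F n) + norm (y n)" .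
    then have "(real (n + 1) * norm (F (n + 1))) / (real (n + 1) * g (n + 1)) \<le>
        ((D - 2 * \<delta>) * norm (F n) + norm (y n)) / (real (n + 1) * g (n + 1))"
      using g by (intro divide_right_mono) auto
    moreover have "e (Suc n) = (real (n + 1) * norm (F (n + 1))) / (real (n + 1) * g (n + 1))"
      using g by (simp add: e_def norm_divide)
    ultimately have "e (Suc n) \<le> ((D - 2 * \<delta>) * norm (F n) + norm (y n)) / (real (n + 1) * g (n + 1))"
      by simp
    also have "\<dots> \<le> ((D - 2 * \<delta>) * norm (F n) + norm (y n)) / (D * g n)"
      using gD D g nx by (intro divide_left_mono) (auto intro!: add_nonneg_nonneg mult_nonneg_nonneg order_trans[OF norm_ge_zero nx])
    also have "\<dots> = (1 - (2 * \<delta>) / D) * e n + \<eta> n / D"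
      using D g by (simp add: e_def \<eta>_def norm_divide field_simps)
    finally show ?case by (simp add: D_def)
  qed
  then have "e \<longlonglongrightarrow> 0"
    using \<delta>(1) by (intro contraction_seq[OF _ _ \<eta>]) (auto simp: e_def)
  then show ?thesis unfolding e_def by (rule tendsto_norm_zero_cancel)
qed

text \<open>A multiple \<open>c * g\<close> solves the recurrence up to \<open>o(g)\<close> if
  \<open>c * (s - x) = \<kappa>\<close>. The difference between \<open>F\<close> and this multiple
  falls under \<open>first_order_little_o\<close>.\<close>

lemma first_order_asymp:
  fixes F y :: "nat \<Rightarrow> complex"
  assumes reg: "reg g s" and x: "Re x < s"
    and rec: "\<And>n. of_nat (n + 1) * F (n + 1) - (of_nat n + x) * F n = y n"
    and y: "(\<lambda>n. y n / of_real (g n)) \<longlonglongrightarrow> \<kappa>"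
  shows "(\<lambda>n. F n / of_real (g n)) \<longlonglongrightarrow> \<kappa> / (of_real s - x)"
proof -
  define c where "c = \<kappa> / (of_real s - x)"
  have sx: "of_real s - x \<noteq> 0" using x by (auto simp: complex_eq_iff)
  define F' where "F' n = F n - c * of_real (g n)" for n
  define y' where "y' n = y n - c * of_real ((real (n + 1) * g (n + 1) - real n * g n) - s * g n) - \<kappa> * of_real (g n)" for n
  have ev: "\<forall>\<^sub>F n in sequentially. g n > 0" using reg by (simp add: reg_def)
  have "(\<lambda>n. F' n / of_real (g n)) \<longlonglongrightarrow> 0"
  proof (rule first_order_little_o[OF reg x])
    have "c * (of_real s - x) = \<kappa>" using sx by (simp add: c_def)
    then have k: "\<kappa> = c * of_real s - c * x" by (simp add: algebra_simps)
    show "of_nat (n + 1) * F' (n + 1) - (of_nat n + x) * F' n = y' n" for n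
      using rec[of n, symmetric] unfolding F'_def y'_def k by (simp add: algebra_simps)
    have "(\<lambda>n. y n / of_real (g n) - c * (of_real ((real (n + 1) * g (n + 1) - real n * g n) / g n) - of_real s) - \<kappa>)
        \<longlonglongrightarrow> \<kappa> - c * (of_real s - of_real s) - \<kappa>"
      using reg by (intro tendsto_intros y) (auto simp: reg_def)
    then have "(\<lambda>n. y n / of_real (g n) - c * (of_real ((real (n + 1) * g (n + 1) - real n * g n) / g n) - of_real s) - \<kappa>)
        \<longlonglongrightarrow> 0" by simp
    then show "(\<lambda>n. y' n / of_real (g n)) \<longlonglongrightarrow> 0"
      by (rule Lim_transform_eventually) (use ev in eventually_elim, simp add: y'_def field_simps)
  qed
  then have "(\<lambda>n. F' n / of_real (g n) + c) \<longlonglongrightarrow> 0 + c" by (intro tendsto_intros)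
  then have "(\<lambda>n. F' n / of_real (g n) + c) \<longlonglongrightarrow> c" by simp
  then have "(\<lambda>n. F n / of_real (g n)) \<longlonglongrightarrow> c"
    by (rule Lim_transform_eventually) (use ev in eventually_elim, simp add: F'_def field_simps)
  then show ?thesis by (simp add: c_def)
qed

text \<open>Each factor divides the limiting constant by \<open>s - x\<close>, so the product
  divides it by its own value at \<open>s\<close>.\<close>

lemma polyop_prod_asymp:
  assumes reg: "reg g s" and "\<And>x. x \<in># A \<Longrightarrow> Re x < s"
    and "(\<lambda>n. polyop (\<Prod>x\<in>#A. [:- x, 1:]) F $ n / of_real (g n)) \<longlonglongrightarrow> \<kappa>"
  shows "(\<lambda>n. F $ n / of_real (g n)) \<longlonglongrightarrow> \<kappa> / poly (\<Prod>x\<in>#A. [:- x, 1:]) (of_real s)"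
  using assms(2,3)
proof (induction A arbitrary: \<kappa>)
  case empty
  then show ?case by (simp add: polyop_def)
next
  case (add x A)
  define G where "G = polyop (\<Prod>x\<in>#A. [:- x, 1:]) F"
  have P: "polyop (\<Prod>x\<in>#add_mset x A. [:- x, 1:]) F = theta G - fps_const x * G"
    unfolding G_def by (simp add: polyop_linear_mult[symmetric])
  have "(\<lambda>n. G $ n / of_real (g n)) \<longlonglongrightarrow> \<kappa> / (of_real s - x)"
    using add.prems by (intro first_order_asymp[OF reg, of x "fps_nth G" "fps_nth (theta G - fps_const x * G)"])
      (simp_all only: P, auto simp: theta_nth algebra_simps)
  then have "(\<lambda>n. F $ n / of_real (g n)) \<longlonglongrightarrow> (\<kappa> / (of_real s - x)) / poly (\<Prod>x\<in>#A. [:- x, 1:]) (of_real s)"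
    using add.prems unfolding G_def by (intro add.IH) auto
  then show ?case by (simp add: field_simps)
qed


section \<open>The transfer for the tree recurrence\<close>

definition tree_rec :: "nat \<Rightarrow> (nat \<Rightarrow> real) \<Rightarrow> (nat \<Rightarrow> real) \<Rightarrow> bool" where
  "tree_rec m a b \<longleftrightarrow> (\<forall>n<m - 1. a n = b n) \<and>
     (\<forall>n\<ge>m - 1. a n = b n + (\<Sum>js\<in>comps m (n - (m - 1)). sum_list (map a js)) / real (n choose (m - 1)))"

text \<open>The continuous extension to \<open>s = 2\<close> of the characteristic polynomial divided by \<open>s - 2\<close>.\<close>

definition char_quot :: "nat \<Rightarrow> real \<Rightarrow> real" where
  "char_quot m s = (if s = 2 then fact m * (harm m - 1) else ((\<Prod>k<m - 1. s + real k) - fact m) / (s - 2))"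

text \<open>At 2 the quotient takes the value of the derivative of the rising product, which is
  \<open>fact m\<close> times the sum of the \<open>1 / (2 + k)\<close>, that is
  \<open>fact m * (harm m - 1)\<close>.\<close>

lemma char_poly_factor:
  assumes "2 \<le> m"
  obtains q where "rising_poly (m - 1) - [:fact m:] = [:- 2, 1:] * q" "degree q = m - 2" "lead_coeff q = 1"
    "\<And>s. poly q (of_real s) = of_real (char_quot m s)"
proof -
  define p where "p = rising_poly (m - 1) - [:fact m:]"
  have "poly (rising_poly (m - 1)) 2 = of_real (\<Prod>k<m - 1. 2 + real k)"
    by (simp add: poly_rising)
  also have "\<dots> = fact m" using assms prod_two_add[of "m - 1"] by (simp add: of_real_fact)
  finally have rising_2: "poly (rising_poly (m - 1)) 2 = fact m" .
  then have "poly p 2 = 0" by (simp add: p_def)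
  then obtain q where q: "p = [:- 2, 1:] * q" unfolding poly_eq_0_iff_dvd by (elim dvdE)
  have deg_r: "degree (rising_poly r) = r" for r
    by (simp add: rising_poly_def degree_prod_eq_sum_degree)
  have lead_r: "lead_coeff (rising_poly r) = 1" for r
    unfolding rising_poly_def lead_coeff_prod by simp
  have deg_p: "degree p = m - 1"
    unfolding p_def diff_conv_add_uminus using assms deg_r[of "m - 1"] by (subst degree_add_eq_left) auto
  have lead_p: "lead_coeff p = 1"
  proof -
    have "coeff p (m - 1) = coeff (rising_poly (m - 1)) (m - 1)"
      using assms by (simp add: p_def coeff_pCons split: nat.splits)
    then show ?thesis using lead_r[of "m - 1"] by (simp add: deg_p deg_r)
  qed
  have "q \<noteq> 0" using q lead_p by auto
  have "degree p = 1 + degree q" unfolding q using \<open>q \<noteq> 0\<close> by (subst degree_mult_eq) auto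
  then have deg_q: "degree q = m - 2" using deg_p assms by simp
  have lead_q: "lead_coeff q = 1"
    using lead_p unfolding q lead_coeff_mult by simp
  have "poly q (of_real s) = of_real (char_quot m s)" for s
  proof (cases "s = 2")
    case False
    have "of_real ((\<Prod>k<m - 1. s + real k) - fact m) = poly p (of_real s)"
      by (simp add: p_def poly_rising of_real_fact)
    also have "\<dots> = (of_real s - 2) * poly q (of_real s)" unfolding q by (simp add: algebra_simps)
    finally have "of_real ((\<Prod>k<m - 1. s + real k) - fact m) = (of_real s - 2) * poly q (of_real s)" .
    moreover have "of_real s - 2 \<noteq> (0 :: complex)"
      using False by (metis eq_iff_diff_eq_0 of_real_eq_iff of_real_numeral)
    ultimately have "poly q (of_real s) = of_real ((\<Prod>k<m - 1. s + real k) - fact m) / (of_real s - 2)"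
      by (metis nonzero_mult_div_cancel_left)
    then show ?thesis using False by (simp only: char_quot_def if_False of_real_divide of_real_diff of_real_numeral)
  next
    case True
    have "pderiv p = [:- 2, 1:] * pderiv q + q * pderiv [:- 2, 1:]" unfolding q by (rule pderiv_mult)
    moreover have "pderiv [:- 2, 1:] = (1 :: complex poly)" by (simp add: pderiv_pCons)
    ultimately have "poly q 2 = poly (pderiv p) 2" by simp
    also have "\<dots> = (\<Sum>a<m - 1. \<Prod>k\<in>{..<m - 1} - {a}. 2 + of_nat k)"
      by (simp add: p_def rising_poly_def pderiv_diff pderiv_prod poly_sum poly_prod pderiv_pCons add.commute)
    also have "\<dots> = (\<Sum>a<m - 1. fact m / (2 + of_nat a))"
    proof (intro sum.cong refl)
      fix a assume "a \<in> {..<m - 1}"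
      then have "(\<Prod>k<m - 1. 2 + of_nat k) = (2 + of_nat a) * (\<Prod>k\<in>{..<m - 1} - {a}. 2 + of_nat k :: complex)"
        by (subst prod.remove) auto
      moreover have "(\<Prod>k<m - 1. 2 + of_nat k) = (fact m :: complex)"
        using rising_2 by (simp add: poly_rising)
      moreover have "2 + of_nat a \<noteq> (0 :: complex)" by (metis of_nat_add of_nat_eq_0_iff of_nat_numeral add_is_0 zero_neq_numeral)
      ultimately show "(\<Prod>k\<in>{..<m - 1} - {a}. 2 + of_nat k) = (fact m :: complex) / (2 + of_nat a)"
        by (simp add: field_simps)
    qed
    also have "\<dots> = of_real (fact m * (\<Sum>a<m - 1. 1 / (2 + real a)))"
      by (simp add: sum_distrib_left of_real_fact)
    also have "(\<Sum>a<m - 1. 1 / (2 + real a)) = harm m - 1"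
    proof -
      have "harm (Suc j) - 1 = (\<Sum>a<j. 1 / (2 + real a))" for j
      proof (induction j)
        case (Suc j)
        then show ?case by (simp add: harm_Suc[of "Suc j"] inverse_eq_divide add_ac)
      qed (simp add: harm_def)
      from this[of "m - 1"] show ?thesis using assms by simp
    qed
    finally show ?thesis using True by (simp add: char_quot_def)
  qed
  then show ?thesis using that q deg_q lead_q p_def by metis
qed

lemma harm_gt_1: "2 \<le> m \<Longrightarrow> harm m > (1 :: real)"
proof -
  assume "2 \<le> m"
  then have "harm m \<ge> (harm 2 :: real)" by (rule harm_mono)
  then show ?thesis by (simp add: harm_expand)
qed

text \<open>The root 2 is integrated exactly, all others only asymptotically. If the weighted toll
  sums converge, \<open>U\<close> is their limit, it yields the linear term, and \<open>g\<close>
  measures the speed of convergence. With \<open>U = 0\<close> the sums may diverge and are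
  themselves the leading term. The hypothesis \<open>sum\<close> is phrased to serve both
  uses.\<close>

theorem transfer:
  assumes m: "2 \<le> m" "m \<le> 26" and rec: "tree_rec m a b" and reg: "reg g s" and s: "s \<ge> 3 / 2"
    and sum: "(\<lambda>n. (real n + 1) * ((\<Sum>k<n. b k / ((real k + 1) * (real k + 2))) - U) / g n) \<longlonglongrightarrow> \<kappa>"
  shows "(\<lambda>n. (a n - b n - U / (harm m - 1) * (real n + 1)) / g n) \<longlonglongrightarrow> fact m * \<kappa> / char_quot m s"
proof -
  obtain q where q: "rising_poly (m - 1) - [:fact m:] = [:- 2, 1:] * q" "degree q = m - 2" "lead_coeff q = 1"
    "\<And>s. poly q (of_real s) = of_real (char_quot m s)"
    using char_poly_factor[OF m(1)] by blast
  define A where "A = Abs_fps (\<lambda>n. complex_of_real (a n))"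
  define B where "B = Abs_fps (\<lambda>n. complex_of_real (b n))"
  \<comment> \<open>Subtracting the tolls removes the first \<open>m - 1\<close> coefficients and
    leaves a pure average over compositions of the solution.\<close>
  define C where "C = A - B"
  define W where "W = polyop q C"
  define lin where "lin = Abs_fps (\<lambda>n. of_nat n + 1 :: complex)"
  have C_small: "C $ n = 0" if "n < m - 1" for n
    using rec that by (simp add: C_def A_def B_def tree_rec_def)
  have C_nth: "of_nat (n choose (m - 1)) * C $ n = (of_nat m * ones ^ (m - 1) * A) $ (n - (m - 1))" if "n \<ge> m - 1" for n
  proof -
    have "C $ n = of_real (\<Sum>js\<in>comps m (n - (m - 1)). sum_list (map a js)) / of_nat (n choose (m - 1))"
      using rec that by (simp add: C_def A_def B_def tree_rec_def)
    moreover have "n choose (m - 1) \<noteq> 0" using that by simp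
    ultimately have "of_nat (n choose (m - 1)) * C $ n = of_real (\<Sum>js\<in>comps m (n - (m - 1)). sum_list (map a js))"
      by simp
    also have "\<dots> = (\<Sum>js\<in>comps m (n - (m - 1)). sum_list (map (\<lambda>j. complex_of_real (a j)) js))"
    proof -
      have "of_real (sum_list (map a js)) = sum_list (map (\<lambda>j. complex_of_real (a j)) js)" for js
        by (induction js) auto
      then show ?thesis by simp
    qed
    also have "\<dots> = (of_nat m * ones ^ (m - 1) * A) $ (n - (m - 1))"
      unfolding sum_comps_1 A_def ..
    finally show ?thesis .
  qed
  \<comment> \<open>The factor \<open>(m - 1)! * (n choose (m - 1))\<close> produced by
    \<open>m - 1\<close> derivatives cancels the denominator of the recurrence, and
    \<open>(1 - z) ^ (m - 1)\<close> cancels the powers of \<open>ones\<close>.\<close>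
  have "polyop (rising_poly (m - 1)) C = fps_const (fact m) * A"
  proof -
    have "(fps_deriv ^^ (m - 1)) C = fps_const (fact m) * (ones ^ (m - 1) * A)"
    proof (rule fps_ext)
      fix N
      have "fact (N + (m - 1)) div fact N = (fact (m - 1) * ((N + (m - 1)) choose (m - 1)) :: nat)"
      proof -
        have "fact (m - 1) * fact N * ((N + (m - 1)) choose (m - 1)) = (fact (N + (m - 1)) :: nat)"
          using binomial_fact_lemma[of "m - 1" "N + (m - 1)"] by simp
        then have "fact (N + (m - 1)) = (fact N * (fact (m - 1) * ((N + (m - 1)) choose (m - 1))) :: nat)"
          by (simp only: mult_ac)
        then show ?thesis by (simp only: nonzero_mult_div_cancel_left fact_nonzero not_False_eq_True)
      qed
      then have "(fps_deriv ^^ (m - 1)) C $ N = of_nat (fact (m - 1)) * (of_nat ((N + (m - 1)) choose (m - 1)) * C $ (N + (m - 1)))"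
        unfolding fps_deriv_funpow_nth by (simp only: of_nat_mult mult.assoc)
      also have "\<dots> = of_nat (fact (m - 1)) * (of_nat m * ones ^ (m - 1) * A) $ N"
        using C_nth[of "N + (m - 1)"] by simp
      also have "\<dots> = fact m * (ones ^ (m - 1) * A) $ N"
      proof -
        have "fact m = (of_nat (fact (m - 1) * m) :: complex)" using m(1) by (cases m) (simp_all add: of_nat_fact algebra_simps)
        moreover have "(of_nat m * ones ^ (m - 1) * A) $ N = of_nat m * (ones ^ (m - 1) * A) $ N"
          by (simp only: mult.assoc fps_of_nat[symmetric] fps_mult_left_const_nth)
        ultimately show ?thesis by simp
      qed
      finally show "(fps_deriv ^^ (m - 1)) C $ N = (fps_const (fact m) * (ones ^ (m - 1) * A)) $ N" by simp
    qed
    then have "polyop (rising_poly (m - 1)) C = fps_const (fact m) * (((1 - fps_X) * ones) ^ (m - 1) * A)"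
      unfolding polyop_rising power_mult_distrib by (simp only: mult_ac)
    then show ?thesis by (simp add: one_minus_X_mult_ones)
  qed
  then have "polyop ([:- 2, 1:] * q) C = fps_const (fact m) * A - fps_const (fact m) * C"
    unfolding q(1)[symmetric] polyop_diff polyop_const by simp
  \<comment> \<open>Since \<open>A - C = B\<close>, only the operator \<open>theta - 2\<close> is
    left, acting on \<open>W\<close>, and the right-hand side is known.\<close>
  then have W_eq: "theta W - fps_const 2 * W = fps_const (fact m) * B"
    unfolding polyop_linear_mult W_def[symmetric] by (simp add: C_def algebra_simps)
  have W_0: "W $ 0 = 0"
    unfolding W_def using C_small m(1) by (intro polyop_nth_0) (auto simp: q(2))
  \<comment> \<open>Divided by \<open>(n + 1) * (n + 2)\<close>, the recurrence telescopes for
    \<open>W n / (n + 1)\<close>; this produces the weights of the toll sums.\<close>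
  have W_nth: "W $ n = of_real (fact m * (real n + 1) * (\<Sum>k<n. b k / ((real k + 1) * (real k + 2))))" for n
  proof (induction n)
    case (Suc n)
    have "theta W $ n - 2 * W $ n = fact m * of_real (b n)"
      using arg_cong[OF W_eq, of "\<lambda>F. F $ n"] by (simp add: B_def)
    then have "of_nat (n + 1) * W $ (n + 1) = of_nat (n + 2) * W $ n + of_real (fact m * b n)"
      by (simp add: theta_nth algebra_simps of_real_fact)
    also have "\<dots> = of_real (real (n + 2) * (fact m * (real n + 1) * (\<Sum>k<n. b k / ((real k + 1) * (real k + 2)))) + fact m * b n)"
      unfolding Suc by (simp only: of_real_add of_real_mult of_real_of_nat_eq)
    also have "\<dots> = of_real (real (n + 1)) * of_real (fact m * (real (Suc n) + 1) * (\<Sum>k<Suc n. b k / ((real k + 1) * (real k + 2))))"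
    proof -
      define d where "d = b n / ((real n + 1) * (real n + 2))"
      have "b n = (real n + 1) * (real n + 2) * d" by (simp add: d_def)
      then show ?thesis
        unfolding of_real_mult[symmetric] of_real_eq_iff sum.lessThan_Suc d_def[symmetric]
        by (simp add: algebra_simps)
    qed
    finally have "of_nat (n + 1) * W $ Suc n = of_nat (n + 1) * of_real (fact m * (real (Suc n) + 1) * (\<Sum>k<Suc n. b k / ((real k + 1) * (real k + 2))))"
      by simp
    moreover have "of_nat (n + 1) \<noteq> (0 :: complex)" using of_nat_neq_0[of n] by simp
    ultimately show ?case using mult_left_cancel by blast
  qed (simp add: W_0)
  \<comment> \<open>These are the coefficients of \<open>(1 - z) powr (- 2)\<close>, the eigenvector
    of the root that was divided out. Subtracting a multiple of it shifts the weighted toll sums by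
    the constant \<open>U\<close>.\<close>
  have lin: "polyop q lin = fps_const (of_real (fact m * (harm m - 1))) * lin"
  proof -
    have "theta lin = fps_const 2 * lin"
      by (rule fps_ext) (simp add: theta_nth lin_def algebra_simps)
    then have "polyop q lin = fps_const (poly q (of_real 2)) * lin" using polyop_eigen[of lin 2 q] by simp
    then show ?thesis unfolding q(4) by (simp add: char_quot_def)
  qed
  define h where "h = harm m - (1 :: real)"
  have h: "h > 0" using harm_gt_1[OF m(1)] by (simp add: h_def)
  define F where "F = C - fps_const (of_real (U / h)) * lin"
  have F: "polyop q F $ n = of_real (fact m * ((real n + 1) * ((\<Sum>k<n. b k / ((real k + 1) * (real k + 2))) - U)))" for n
  proof -
    have "polyop q F $ n = W $ n - of_real (U / h) * (of_real (fact m * h) * (of_nat n + 1))"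
      unfolding F_def polyop_diff_right polyop_const_mult_right lin by (simp add: W_def lin_def h_def)
    also have "\<dots> = of_real (fact m * ((real n + 1) * ((\<Sum>k<n. b k / ((real k + 1) * (real k + 2))) - U)))"
    proof -
      have "of_real (U / h) * (of_real (fact m * h) * (of_nat n + 1)) = complex_of_real (U / h * (fact m * h * (real n + 1)))"
        by (simp only: of_real_mult of_real_add of_real_of_nat_eq of_real_1)
      also have "U / h * (fact m * h * (real n + 1)) = fact m * (real n + 1) * U"
        using h by simp
      finally show ?thesis unfolding W_nth
        by (simp only: of_real_diff[symmetric] right_diff_distrib mult.assoc)
    qed
    finally show ?thesis .
  qed
  obtain M where M: "q = (\<Prod>x\<in>#M. [:- x, 1:])"
  proof -
    have "q \<noteq> 0" using q(3) by auto
    then obtain M where "q = smult (lead_coeff q) (\<Prod>x\<in>#M. [:- x, 1:])"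
      using alg_closed_imp_factorization by blast
    then show thesis using that q(3) by (metis smult_1_left)
  qed
  have "Re x < s" if "x \<in># M" for x
  proof -
    have "poly q x = 0" using that by (auto simp: M poly_prod_mset)
    then have "poly (rising_poly (m - 1) - [:fact m:]) x = 0" unfolding q(1) by simp
    then have "(\<Prod>k<m - 1. x + of_nat k) = fact m" by (simp add: poly_rising)
    moreover have "x \<noteq> 2"
    proof
      assume "x = 2"
      then have "poly q (of_real 2) = 0" using \<open>poly q x = 0\<close> by simp
      then have "complex_of_real (fact m * h) = 0" unfolding q(4) by (simp add: char_quot_def h_def)
      then show False using h by simp
    qed
    ultimately have "Re x < 3 / 2" using root_Re_less[OF m] by blast
    then show ?thesis using s by simp
  qed
  moreover have "(\<lambda>n. polyop (\<Prod>x\<in>#M. [:- x, 1:]) F $ n / of_real (g n)) \<longlonglongrightarrow> of_real (fact m * \<kappa>)"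
  proof -
    have "(\<lambda>n. complex_of_real (fact m * ((real n + 1) * ((\<Sum>k<n. b k / ((real k + 1) * (real k + 2))) - U) / g n)))
      \<longlonglongrightarrow> of_real (fact m * \<kappa>)"
      by (intro tendsto_of_real tendsto_mult sum tendsto_const)
    then show ?thesis unfolding M[symmetric] F by simp
  qed
  ultimately have "(\<lambda>n. F $ n / of_real (g n)) \<longlonglongrightarrow> of_real (fact m * \<kappa>) / poly q (of_real s)"
    unfolding M by (intro polyop_prod_asymp[OF reg])
  moreover have "F $ n / of_real (g n) = of_real ((a n - b n - U / (harm m - 1) * (real n + 1)) / g n)" for n
    by (simp add: F_def C_def A_def B_def lin_def h_def)
  ultimately have "(\<lambda>n. complex_of_real ((a n - b n - U / (harm m - 1) * (real n + 1)) / g n))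
      \<longlonglongrightarrow> of_real (fact m * \<kappa> / char_quot m s)"
    unfolding q(4) by simp
  then show ?thesis unfolding tendsto_of_real_iff .
qed

section \<open>The law of the additive functional\<close>

text \<open>A root with exactly \<open>m - 1\<close> keys is built by the branch with
  \<open>replicate\<close>, but it fits the general pattern: no keys remain, so all gaps are empty.
  Hence one recursion holds from \<open>m - 1\<close> keys on.\<close>

lemma search_tree_Node:
  assumes "2 \<le> m" "m - 1 \<le> length ks"
  shows "search_tree m ks = Node (sort (take (m - 1) ks))
    (map (\<lambda>j. search_tree m (filter (in_gap (sort (take (m - 1) ks)) j) (drop (m - 1) ks))) [0..<m])"
proof -
  have ne: "ks \<noteq> []" using assms by auto
  show ?thesis
  proof (cases "length ks < m")
    case True
    then have len: "length ks = m - 1" using assms by simp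
    have "search_tree m [] = (Empty :: 'a mtree)" by (simp add: search_tree.simps)
    then have "map (\<lambda>j. search_tree m (filter (in_gap (sort (take (m - 1) ks)) j) (drop (m - 1) ks))) [0..<m]
        = replicate m (Empty :: 'a mtree)"
      using len by (simp add: map_replicate_const)
    then show ?thesis using True ne assms len by (simp add: search_tree.simps)
  next
    case False
    then show ?thesis using ne assms by (subst search_tree.simps) (simp add: Let_def)
  qed
qed

lemma in_gap_unique:
  assumes "sorted ss" "i \<le> length ss" "j \<le> length ss" "in_gap ss i x" "in_gap ss j x"
  shows "i = j"
proof -
  have False if "i < j" "j \<le> length ss" "in_gap ss i x" "in_gap ss j x" for i j
  proof -
    have "x < ss ! i" "ss ! (j - 1) < x" using that by (auto simp: in_gap_def)
    moreover have "ss ! i \<le> ss ! (j - 1)" using assms(1) that by (intro sorted_nth_mono) auto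
    ultimately show False by simp
  qed
  then show ?thesis using assms by (metis linorder_neqE_nat)
qed

lemma in_gap_exists:
  assumes "x \<notin> set ss"
  shows "\<exists>j\<le>length ss. in_gap ss j x"
proof -
  define P where "P j \<longleftrightarrow> j = length ss \<or> (j < length ss \<and> x < ss ! j)" for j
  define j where "j = (LEAST j. P j)"
  have "P (length ss)" by (simp add: P_def)
  then have Pj: "P j" unfolding j_def by (rule LeastI)
  have "in_gap ss j x"
    unfolding in_gap_def
  proof (intro conjI impI)
    assume "0 < j"
    then have "\<not> P (j - 1)" unfolding j_def by (intro not_less_Least) (simp add: j_def[symmetric])
    then have "j - 1 < length ss" "\<not> x < ss ! (j - 1)" using Pj \<open>0 < j\<close> by (auto simp: P_def)
    then show "ss ! (j - 1) < x" using assms by (metis linorder_neqE nth_mem)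
  qed (use Pj in \<open>auto simp: P_def\<close>)
  then show ?thesis using Pj unfolding P_def by (metis less_imp_le order_refl)
qed

lemma sum_length_filter_gap:
  assumes "sorted ss" "set rest \<inter> set ss = {}"
  shows "(\<Sum>j\<leftarrow>[0..<Suc (length ss)]. length (filter (in_gap ss j) rest)) = length rest"
  using assms(2)
proof (induction rest)
  case (Cons x rest)
  have "x \<notin> set ss" using Cons.prems by auto
  then obtain j where j: "j \<le> length ss" "in_gap ss j x" using in_gap_exists by blast
  have eq: "length (filter (in_gap ss i) (x # rest)) = (if i = j then 1 else 0) + length (filter (in_gap ss i) rest)"
    if "i \<in> {0..<Suc (length ss)}" for i
  proof -
    have "in_gap ss i x \<longleftrightarrow> i = j" using in_gap_unique[OF assms(1), of i j x] j that by auto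
    then show ?thesis by simp
  qed
  have "(\<Sum>i\<leftarrow>[0..<Suc (length ss)]. length (filter (in_gap ss i) (x # rest)))
     = (\<Sum>i\<in>{0..<Suc (length ss)}. (if i = j then 1 else 0) + length (filter (in_gap ss i) rest))"
    unfolding interv_sum_list_conv_sum_set_nat by (intro sum.cong) (simp_all only: eq set_upt)
  also have "\<dots> = Suc (\<Sum>i\<in>{0..<Suc (length ss)}. length (filter (in_gap ss i) rest))"
    using j(1) by (simp add: sum.distrib sum.delta del: sum.op_ivl_Suc)
  also have "(\<Sum>i\<in>{0..<Suc (length ss)}. length (filter (in_gap ss i) rest)) = length rest"
    using Cons unfolding interv_sum_list_conv_sum_set_nat by simp
  finally show ?case by simp
qed (simp add: sum_list_0)

lemma key_count_search_tree:
  assumes "2 \<le> m" "distinct ks"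
  shows "key_count (search_tree m ks) = length ks"
  using assms(2)
proof (induction "length ks" arbitrary: ks rule: less_induct)
  case less
  show ?case
  proof (cases "m - 1 \<le> length ks")
    case False
    then show ?thesis using assms(1) by (subst search_tree.simps) (auto simp: sum_list_replicate)
  next
    case True
    define ss where "ss = sort (take (m - 1) ks)"
    define rest where "rest = drop (m - 1) ks"
    have len: "length ss = m - 1" using True by (simp add: ss_def)
    have "key_count (search_tree m (filter (in_gap ss j) rest)) = length (filter (in_gap ss j) rest)" for j
    proof (rule less.hyps)
      have "length (filter (in_gap ss j) rest) \<le> length rest" by (rule length_filter_le)
      also have "\<dots> < length ks" using True assms(1) by (simp add: rest_def)
      finally show "length (filter (in_gap ss j) rest) < length ks" .
      show "distinct (filter (in_gap ss j) rest)" using less.prems by (simp add: rest_def)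
    qed
    then have "key_count (search_tree m ks) = length ss + (\<Sum>j\<leftarrow>[0..<m]. length (filter (in_gap ss j) rest))"
      unfolding search_tree_Node[OF assms(1) True] ss_def[symmetric] rest_def[symmetric]
      by (simp add: o_def)
    also have "set rest \<inter> set ss = {}"
      using less.prems set_take_disj_set_drop_if_distinct[of ks "m - 1" "m - 1"] by (auto simp: ss_def rest_def)
    then have "(\<Sum>j\<leftarrow>[0..<m]. length (filter (in_gap ss j) rest)) = length rest"
    proof -
      assume "set rest \<inter> set ss = {}"
      moreover have "Suc (length ss) = m" using len assms(1) by simp
      ultimately show ?thesis using sum_length_filter_gap[of ss rest] by (simp only: ss_def sorted_sort)
    qed
    finally show ?thesis using True by (simp add: len rest_def)
  qed
qed

lemma X_fun_small:
  assumes "2 \<le> m" "length ks < m - 1"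
  shows "X_fun m t ks = t (length ks)"
  using assms unfolding X_fun_def by (subst search_tree.simps) (auto simp: sum_list_replicate)

lemma X_fun_rec:
  assumes "2 \<le> m" "m - 1 \<le> length ks" "distinct ks"
  shows "X_fun m t ks = t (length ks) +
    (\<Sum>j\<leftarrow>[0..<m]. X_fun m t (filter (in_gap (sort (take (m - 1) ks)) j) (drop (m - 1) ks)))"
proof -
  define T where "T = search_tree m ks"
  have T: "T = Node (sort (take (m - 1) ks))
    (map (\<lambda>j. search_tree m (filter (in_gap (sort (take (m - 1) ks)) j) (drop (m - 1) ks))) [0..<m])"
    unfolding T_def by (rule search_tree_Node[OF assms(1,2)])
  have k: "key_count T = length ks" unfolding T_def by (rule key_count_search_tree[OF assms(1,3)])
  have "additive m t (Node a b) = sum_list (map (additive m t) b) + t l"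
    if "key_count (Node a b) = l" "m - 1 \<le> l" for a :: "'a list" and b l
    using that assms(1) by (simp del: key_count.simps)
  then have "additive m t T = sum_list (map (additive m t) (subtrees T)) + t (length ks)"
    using k assms(2) unfolding T mtree.sel by blast
  then show ?thesis unfolding X_fun_def T_def[symmetric] unfolding T by (simp add: o_def)
qed

text \<open>The construction uses the keys only through comparisons, so an order-preserving
  relabelling leaves all subtree sizes unchanged. This brings a subtree on arbitrary keys back to
  \<open>{1..n}\<close>.\<close>

lemma X_fun_map:
  assumes "2 \<le> m" "distinct ks" "strict_mono_on (set ks) f"
  shows "X_fun m t (map f ks) = X_fun m t ks"
  using assms(2,3)
proof (induction "length ks" arbitrary: ks rule: less_induct)
  case less
  have inj: "inj_on f (set ks)" using less.prems(2) by (rule strict_mono_on_imp_inj_on)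
  show ?case
  proof (cases "m - 1 \<le> length ks")
    case False
    then show ?thesis using assms(1) by (simp add: X_fun_small)
  next
    case True
    define ss where "ss = sort (take (m - 1) ks)"
    define rest where "rest = drop (m - 1) ks"
    have sub: "set ss \<subseteq> set ks" "set rest \<subseteq> set ks" unfolding ss_def rest_def by (simp_all add: set_take_subset set_drop_subset)
    have mono: "f x < f y \<longleftrightarrow> x < y" if "x \<in> set ks" "y \<in> set ks" for x y
      using less.prems(2) that by (metis strict_mono_on_def linorder_neqE_nat order_less_asym less_irrefl)
    have sort_eq: "sort (take (m - 1) (map f ks)) = map f ss"
    proof (rule properties_for_sort)
      show "mset (map f ss) = mset (take (m - 1) (map f ks))" by (simp add: ss_def take_map)
      have "sorted_wrt (\<lambda>x y. x \<le> y) ss" by (simp add: ss_def)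
      then show "sorted (map f ss)"
        unfolding sorted_wrt_map
        by (rule sorted_wrt_mono_rel[rotated]) (use sub less.prems(2) in \<open>auto intro: strict_mono_on_leD\<close>)
    qed
    have gap: "in_gap (map f ss) j (f x) = in_gap ss j x" if "x \<in> set rest" "j \<le> length ss" for x j
      using that sub unfolding in_gap_def by (auto simp: mono subset_iff)
    have "X_fun m t (filter (in_gap (map f ss) j) (map f rest)) = X_fun m t (filter (in_gap ss j) rest)" if "j < m" for j
    proof -
      have "j \<le> length ss" using that True by (simp add: ss_def)
      then have "filter (in_gap (map f ss) j) (map f rest) = map f (filter (in_gap ss j) rest)"
        unfolding filter_map using gap by (intro arg_cong[of _ _ "map f"] filter_cong) auto
      moreover have "X_fun m t (map f (filter (in_gap ss j) rest)) = X_fun m t (filter (in_gap ss j) rest)"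
      proof (rule less.hyps)
        have "length (filter (in_gap ss j) rest) \<le> length rest" by (rule length_filter_le)
        also have "\<dots> < length ks" using True assms(1) by (simp add: rest_def)
        finally show "length (filter (in_gap ss j) rest) < length ks" .
        show "distinct (filter (in_gap ss j) rest)" using less.prems by (simp add: rest_def)
        show "strict_mono_on (set (filter (in_gap ss j) rest)) f"
          by (rule monotone_on_subset[OF less.prems(2)]) (use sub(2) in auto)
      qed
      ultimately show ?thesis by simp
    qed
    then have "(\<Sum>j\<leftarrow>[0..<m]. X_fun m t (filter (in_gap (map f ss) j) (map f rest)))
      = (\<Sum>j\<leftarrow>[0..<m]. X_fun m t (filter (in_gap ss j) rest))"
      by (intro arg_cong[of _ _ sum_list] map_cong) auto
    moreover have "distinct (map f ks)" using less.prems(1) inj by (simp add: distinct_map)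
    ultimately show ?thesis
      using True less.prems(1) X_fun_rec[OF assms(1) True less.prems(1), of t]
        X_fun_rec[OF assms(1), of "map f ks" t] sort_eq
      by (simp add: ss_def rest_def drop_map)
  qed
qed

definition X_law :: "nat \<Rightarrow> (nat \<Rightarrow> real) \<Rightarrow> nat \<Rightarrow> real pmf" where
  "X_law m t n = map_pmf (X_fun m t) (random_perm n)"

lemma X_law_set:
  assumes "2 \<le> m" "finite A"
  shows "map_pmf (X_fun m t) (pmf_of_set (permutations_of_set A)) = X_law m t (card A)"
proof -
  define n where "n = card A"
  define f where "f i = sorted_list_of_set A ! (i - 1)" for i
  have len: "length (sorted_list_of_set A) = n" by (simp add: n_def)
  have sw: "sorted_wrt (<) (sorted_list_of_set A)" by (rule strict_sorted_list_of_set)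
  have mono: "strict_mono_on {1..n} f"
    unfolding f_def by (rule strict_mono_onI, rule sorted_wrt_nth_less[OF sw]) (auto simp: n_def)
  have inj: "inj_on f {1..n}" using mono by (rule strict_mono_on_imp_inj_on)
  have "f ` {1..n} = A"
  proof -
    have "f ` {1..n} \<subseteq> A"
    proof
      fix x assume "x \<in> f ` {1..n}"
      then obtain i where "i \<in> {1..n}" "x = f i" by blast
      then have "x \<in> set (sorted_list_of_set A)" unfolding f_def by (auto intro!: nth_mem simp: n_def)
      then show "x \<in> A" using assms(2) by simp
    qed
    moreover have "card (f ` {1..n}) = card A" using inj by (simp add: card_image n_def)
    ultimately show ?thesis using assms(2) by (intro card_subset_eq) auto
  qed
  then have perms: "permutations_of_set A = map f ` permutations_of_set {1..n}"
    using permutations_of_set_image_inj[OF inj] by simp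
  have inj_map: "inj_on (map f) (permutations_of_set {1..n})"
    by (rule inj_on_mapI[THEN inj_on_subset, of f "UNIV \<inter> _"] inj_onI)
      (metis inj inj_on_map_eq_map permutations_of_setD(1) sup.idem)
  have "pmf_of_set (permutations_of_set A) = map_pmf (map f) (random_perm n)"
    unfolding perms random_perm_def by (intro map_pmf_of_set_inj[symmetric] inj_map) auto
  then have "map_pmf (X_fun m t) (pmf_of_set (permutations_of_set A)) = map_pmf (\<lambda>ks. X_fun m t (map f ks)) (random_perm n)"
    by (simp add: pmf.map_comp o_def)
  also have "\<dots> = X_law m t n"
    unfolding X_law_def
  proof (rule map_pmf_cong[OF refl])
    fix ks assume "ks \<in> set_pmf (random_perm n)"
    then have "ks \<in> permutations_of_set {1..n}" by (simp add: random_perm_def)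
    then show "X_fun m t (map f ks) = X_fun m t ks"
      using mono by (intro X_fun_map[OF assms(1)]) (auto dest: permutations_of_setD)
  qed
  finally show ?thesis by (simp add: n_def)
qed

section \<open>Independence of the subtrees and the distributional recurrence\<close>

primrec conv_list :: "real pmf list \<Rightarrow> real pmf" where
  "conv_list [] = return_pmf 0"
| "conv_list (p # ps) = map_pmf (\<lambda>(x, y). x + y) (pair_pmf p (conv_list ps))"

text \<open>Splitting a uniform permutation by one predicate gives two independent uniform
  permutations. The step can be repeated on the second part, because the predicates exclude each
  other and so the keys of all later blocks survive in it.\<close>

lemma filter_law:
  fixes X :: "'a list \<Rightarrow> real"
  assumes "finite B" "distinct js"
    and "\<And>x i j. x \<in> B \<Longrightarrow> i \<in> set js \<Longrightarrow> j \<in> set js \<Longrightarrow> P i x \<Longrightarrow> P j x \<Longrightarrow> i = j"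
  shows "map_pmf (\<lambda>ys. \<Sum>j\<leftarrow>js. X (filter (P j) ys)) (pmf_of_set (permutations_of_set B)) =
    conv_list (map (\<lambda>j. map_pmf X (pmf_of_set (permutations_of_set {x \<in> B. P j x}))) js)"
  using assms
proof (induction js arbitrary: B)
  case (Cons j js)
  define B' where "B' = {x \<in> B. \<not> P j x}"
  define g where "g = (\<lambda>(a, b). X a + (\<Sum>i\<leftarrow>js. X (filter (P i) b)))"
  have "map_pmf (\<lambda>ys. \<Sum>i\<leftarrow>j # js. X (filter (P i) ys)) (pmf_of_set (permutations_of_set B)) =
    map_pmf (\<lambda>ys. g (partition (P j) ys)) (pmf_of_set (permutations_of_set B))"
  proof (rule map_pmf_cong[OF refl])
    fix ys assume "ys \<in> set_pmf (pmf_of_set (permutations_of_set B))"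
    then have ys: "set ys = B" using Cons.prems(1) by (auto dest: permutations_of_setD)
    have "filter (P i) ys = filter (P i) (filter (Not \<circ> P j) ys)" if "i \<in> set js" for i
      unfolding filter_filter using that Cons.prems(2,3) ys by (intro filter_cong) auto
    then have "(\<Sum>i\<leftarrow>js. X (filter (P i) ys)) = (\<Sum>i\<leftarrow>js. X (filter (P i) (filter (Not \<circ> P j) ys)))"
      by (intro arg_cong[of _ _ sum_list] map_cong) auto
    then show "(\<Sum>i\<leftarrow>j # js. X (filter (P i) ys)) = g (partition (P j) ys)"
      by (simp add: g_def)
  qed
  also have "\<dots> = map_pmf g (map_pmf (partition (P j)) (pmf_of_set (permutations_of_set B)))"
    by (simp add: pmf.map_comp o_def)
  also have "\<dots> = map_pmf g (pair_pmf (pmf_of_set (permutations_of_set {x \<in> B. P j x})) (pmf_of_set (permutations_of_set B')))"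
    unfolding B'_def by (subst partition_random_permutations) (use Cons.prems in auto)
  also have "\<dots> = map_pmf (\<lambda>(x, y). x + y) (pair_pmf (map_pmf X (pmf_of_set (permutations_of_set {x \<in> B. P j x})))
      (map_pmf (\<lambda>ys. \<Sum>i\<leftarrow>js. X (filter (P i) ys)) (pmf_of_set (permutations_of_set B'))))"
    unfolding map_pair[symmetric] by (simp add: pmf.map_comp o_def g_def case_prod_unfold)
  also have "map_pmf (\<lambda>ys. \<Sum>i\<leftarrow>js. X (filter (P i) ys)) (pmf_of_set (permutations_of_set B')) =
    conv_list (map (\<lambda>i. map_pmf X (pmf_of_set (permutations_of_set {x \<in> B'. P i x}))) js)"
    by (rule Cons.IH) (use Cons.prems in \<open>auto simp: B'_def\<close>)
  also have "map (\<lambda>i. map_pmf X (pmf_of_set (permutations_of_set {x \<in> B'. P i x}))) js =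
    map (\<lambda>i. map_pmf X (pmf_of_set (permutations_of_set {x \<in> B. P i x}))) js"
  proof (rule map_cong[OF refl])
    fix i assume i: "i \<in> set js"
    have "{x \<in> B'. P i x} = {x \<in> B. P i x}" using i Cons.prems(2,3) by (auto simp: B'_def)
    then show "map_pmf X (pmf_of_set (permutations_of_set {x \<in> B'. P i x})) =
      map_pmf X (pmf_of_set (permutations_of_set {x \<in> B. P i x}))" by simp
  qed
  finally show ?case by simp
qed simp

text \<open>Grouped by the set of their first \<open>k\<close> entries, the permutations fall into
  disjoint blocks of equal size \<open>k! * (card A - k)!\<close>, and each block is a product. So
  this set is uniform, and given it the two parts are uniform and independent.\<close>

lemma perm_split:
  assumes "finite A" "k \<le> card A"
  shows "pmf_of_set (permutations_of_set A) =
    pmf_of_set {S. S \<subseteq> A \<and> card S = k} \<bind>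
      (\<lambda>S. map_pmf (\<lambda>(xs, ys). xs @ ys)
        (pair_pmf (pmf_of_set (permutations_of_set S)) (pmf_of_set (permutations_of_set (A - S)))))"
proof -
  define F where "F S = (\<lambda>(xs, ys). xs @ ys) ` (permutations_of_set S \<times> permutations_of_set (A - S))" for S
  define I where "I = {S. S \<subseteq> A \<and> card S = k}"
  have fin: "finite S" if "S \<in> I" for S using that assms(1) finite_subset by (auto simp: I_def)
  have inj: "inj_on (\<lambda>(xs, ys). xs @ ys) (permutations_of_set S \<times> permutations_of_set (A - S))" for S
  proof (rule inj_onI, clarify)
    fix xs ys xs' ys'
    assume "xs \<in> permutations_of_set S" "xs' \<in> permutations_of_set S" "xs @ ys = xs' @ ys'"
    then show "xs = xs' \<and> ys = ys'"
      by (metis append_eq_append_conv length_finite_permutations_of_set permutations_of_set_infinite empty_iff)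
  qed
  have set_take: "set (take k zs) = S" if z: "zs \<in> F S" and S: "S \<in> I" for zs S
  proof -
    obtain xs ys where z: "zs = xs @ ys" "xs \<in> permutations_of_set S" using z by (auto simp: F_def)
    then have "length xs = k" using S length_finite_permutations_of_set by (auto simp: I_def)
    then show ?thesis using \<open>zs = xs @ ys\<close> \<open>xs \<in> permutations_of_set S\<close> by (simp add: permutations_of_setD)
  qed
  have UN: "(\<Union>S\<in>I. F S) = permutations_of_set A"
  proof
    show "(\<Union>S\<in>I. F S) \<subseteq> permutations_of_set A"
      by (auto simp: F_def I_def permutations_of_set_def)
    show "permutations_of_set A \<subseteq> (\<Union>S\<in>I. F S)"
    proof
      fix zs assume zs: "zs \<in> permutations_of_set A"
      then have d: "distinct zs" "set zs = A" "length zs = card A"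
        using length_finite_permutations_of_set[OF zs] by (auto dest: permutations_of_setD)
      define S where "S = set (take k zs)"
      have "distinct (take k zs @ drop k zs)" using d by simp
      then have disj: "set (take k zs) \<inter> set (drop k zs) = {}" unfolding distinct_append by blast
      have un: "set (take k zs) \<union> set (drop k zs) = A" using d(2) by (metis append_take_drop_id set_append)
      have "card S = k" unfolding S_def using d assms(2) by (simp add: distinct_card)
      then have "S \<in> I" using un by (auto simp: I_def S_def)
      moreover have "zs \<in> F S"
        unfolding F_def
      proof (rule image_eqI[of _ _ "(take k zs, drop k zs)"])
        show "(take k zs, drop k zs) \<in> permutations_of_set S \<times> permutations_of_set (A - S)"
          using d disj un by (auto simp: permutations_of_set_def S_def)
      qed simp
      ultimately show "zs \<in> (\<Union>S\<in>I. F S)" by blast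
    qed
  qed
  have ne: "I \<noteq> {}" using assms obtain_subset_with_card_n[of k A] by (auto simp: I_def)
  have "pmf_of_set (\<Union>S\<in>I. F S) = pmf_of_set I \<bind> (\<lambda>S. pmf_of_set (F S))"
  proof (rule pmf_of_set_UN[where n = "fact k * fact (card A - k)"])
    show "finite (\<Union> (F ` I))" unfolding UN by simp
    show "F S \<noteq> {}" if "S \<in> I" for S using fin[OF that] assms(1) by (simp add: F_def)
    show "card (F S) = fact k * fact (card A - k)" if "S \<in> I" for S
      unfolding F_def card_image[OF inj] using that fin[OF that] assms(1)
      by (simp add: card_cartesian_product I_def card_Diff_subset)
    show "disjoint_family_on F I"
      unfolding disjoint_family_on_def using set_take by blast
  qed (rule ne)
  also have "\<dots> = pmf_of_set I \<bind> (\<lambda>S. map_pmf (\<lambda>(xs, ys). xs @ ys)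
        (pair_pmf (pmf_of_set (permutations_of_set S)) (pmf_of_set (permutations_of_set (A - S)))))"
  proof (rule bind_pmf_cong[OF refl])
    fix S assume "S \<in> set_pmf (pmf_of_set I)"
    then have S: "S \<in> I" using ne assms(1) by (simp add: I_def)
    have "pair_pmf (pmf_of_set (permutations_of_set S)) (pmf_of_set (permutations_of_set (A - S))) =
      pmf_of_set (permutations_of_set S \<times> permutations_of_set (A - S))"
      using fin[OF S] assms(1) by (intro pmf_eqI) (auto simp: pmf_pair indicator_def card_cartesian_product split: prod.splits)
    then show "pmf_of_set (F S) = map_pmf (\<lambda>(xs, ys). xs @ ys)
        (pair_pmf (pmf_of_set (permutations_of_set S)) (pmf_of_set (permutations_of_set (A - S))))"
      unfolding F_def using fin[OF S] assms(1) by (simp add: map_pmf_of_set_inj[OF inj])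
  qed
  finally show ?thesis unfolding UN unfolding I_def .
qed

definition gap_sizes :: "nat \<Rightarrow> nat set \<Rightarrow> nat list" where
  "gap_sizes n S = map (\<lambda>j. card {x \<in> {1..n} - S. in_gap (sorted_list_of_set S) j x}) [0..<Suc (card S)]"

text \<open>Recovers the elements of \<open>S\<close> one after the other from the gap sizes, which
  is the injectivity used next. The number 0 stands for the missing predecessor of the first
  element.\<close>

lemma gap_sizes_nth:
  assumes S: "S \<subseteq> {1..n}" and j: "j < card S"
  defines "ss \<equiv> sorted_list_of_set S"
  shows "ss ! j = (if j = 0 then 0 else ss ! (j - 1)) + gap_sizes n S ! j + 1"
proof -
  have fin: "finite S" using S finite_subset by blast
  have len: "length ss = card S" by (simp add: ss_def)
  have set: "set ss = S" using fin by (simp add: ss_def)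
  have sw: "sorted_wrt (<) ss" unfolding ss_def by (rule strict_sorted_list_of_set)
  define lo where "lo = (if j = 0 then 0 else ss ! (j - 1))"
  have mem: "ss ! j \<in> {1..n}" using S set len j nth_mem[of j ss] by auto
  have lt: "lo < ss ! j" using mem sw len j by (auto simp: lo_def intro: sorted_wrt_nth_less)
  have "{x \<in> {1..n} - S. in_gap ss j x} = {lo<..<ss ! j}"
  proof (intro set_eqI iffI)
    fix x assume "x \<in> {x \<in> {1..n} - S. in_gap ss j x}"
    then show "x \<in> {lo<..<ss ! j}" using j len by (auto simp: in_gap_def lo_def)
  next
    fix x assume x: "x \<in> {lo<..<ss ! j}"
    have "x \<notin> S"
    proof
      assume "x \<in> S"
      then obtain i where i: "i < length ss" "x = ss ! i" using set by (metis in_set_conv_nth)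
      have "i < j"
      proof (rule ccontr)
        assume "\<not> i < j"
        then have "ss ! j \<le> ss ! i" using sorted_wrt_nth_less[OF sw, of j i] i(1) by (cases "i = j") auto
        then show False using x i by simp
      qed
      have "ss ! i \<le> ss ! (j - 1)"
      proof (cases "i = j - 1")
        case False
        then have "i < j - 1" using \<open>i < j\<close> by linarith
        moreover have "j - 1 < length ss" using j len by linarith
        ultimately show ?thesis using sorted_wrt_nth_less[OF sw, of i "j - 1"] by simp
      qed simp
      then show False using x i \<open>i < j\<close> by (simp add: lo_def)
    qed
    then show "x \<in> {x \<in> {1..n} - S. in_gap ss j x}"
      using x mem j len by (auto simp: in_gap_def lo_def)
  qed
  then have "gap_sizes n S ! j = ss ! j - lo - 1"
    using j by (simp add: gap_sizes_def ss_def del: upt_Suc)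
  then show ?thesis using lt by (simp add: lo_def)
qed

text \<open>Surjectivity follows by counting, as both sets have \<open>n choose k\<close> elements.
  A uniform choice of root keys thereby becomes a uniform composition.\<close>

lemma gap_sizes_bij:
  assumes "k \<le> n"
  shows "bij_betw (gap_sizes n) {S. S \<subseteq> {1..n} \<and> card S = k} (comps (Suc k) (n - k))"
proof -
  define I where "I = {S. S \<subseteq> {1..n} \<and> card S = k}"
  have inj: "inj_on (gap_sizes n) I"
  proof (rule inj_onI)
    fix S S' assume S: "S \<in> I" and S': "S' \<in> I" and eq: "gap_sizes n S = gap_sizes n S'"
    have "sorted_list_of_set S ! j = sorted_list_of_set S' ! j" if "j < k" for j
      using that
    proof (induction j)
      case 0
      then show ?case using gap_sizes_nth[of S n 0] gap_sizes_nth[of S' n 0] S S' eq by (simp add: I_def)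
    next
      case (Suc j)
      then show ?case using gap_sizes_nth[of S n "Suc j"] gap_sizes_nth[of S' n "Suc j"] S S' eq by (simp add: I_def)
    qed
    then have "sorted_list_of_set S = sorted_list_of_set S'"
      using S S' by (intro nth_equalityI) (auto simp: I_def)
    moreover have "finite S" "finite S'" using S S' finite_subset by (auto simp: I_def)
    ultimately show "S = S'" by (metis sorted_list_of_set.set_sorted_key_list_of_set)
  qed
  have sub: "gap_sizes n ` I \<subseteq> comps (Suc k) (n - k)"
  proof
    fix js assume "js \<in> gap_sizes n ` I"
    then obtain S where S: "S \<subseteq> {1..n}" "card S = k" "js = gap_sizes n S" by (auto simp: I_def)
    have fin: "finite S" using S finite_subset by blast
    define ss where "ss = sorted_list_of_set S"
    have ss: "sorted ss" "length ss = k" "set ss = S" using fin S by (auto simp: ss_def)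
    define G where "G j = {x \<in> {1..n} - S. in_gap ss j x}" for j
    have "sum_list js = (\<Sum>j\<in>{0..<Suc k}. card (G j))"
      unfolding S(3) gap_sizes_def S(2) ss_def[symmetric] G_def[symmetric] interv_sum_list_conv_sum_set_nat by simp
    also have "\<dots> = card (\<Union>j\<in>{0..<Suc k}. G j)"
      using in_gap_unique[OF ss(1)] ss(2) by (intro card_UN_disjoint[symmetric]) (fastforce simp: G_def)+
    also have "(\<Union>j\<in>{0..<Suc k}. G j) = {1..n} - S"
      using in_gap_exists[of _ ss] ss by (fastforce simp: G_def)
    also have "card ({1..n} - S) = n - k" using S fin by (simp add: card_Diff_subset)
    finally show "js \<in> comps (Suc k) (n - k)" using S by (simp add: comps_def gap_sizes_def)
  qed
  have "card (gap_sizes n ` I) = card I" using inj by (rule card_image)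
  also have "\<dots> = n choose k" unfolding I_def using n_subsets[of "{1..n}" k] by simp
  also have "\<dots> = card (comps (Suc k) (n - k))" using card_comps_choose[of "Suc k" n] assms by simp
  finally have "gap_sizes n ` I = comps (Suc k) (n - k)"
    using sub by (intro card_subset_eq) auto
  then show ?thesis using inj by (simp add: bij_betw_def I_def)
qed

theorem X_law_small:
  assumes "2 \<le> m" "n < m - 1"
  shows "X_law m t n = return_pmf (t n)"
proof -
  have "X_law m t n = map_pmf (\<lambda>_. t n) (random_perm n)"
    unfolding X_law_def
  proof (rule map_pmf_cong[OF refl])
    fix ks assume "ks \<in> set_pmf (random_perm n)"
    then have "length ks = n" by (auto simp: random_perm_def length_finite_permutations_of_set)
    then show "X_fun m t ks = t n" using X_fun_small[OF assms(1), of ks t] assms(2) by simp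
  qed
  then show ?thesis by simp
qed

theorem X_law_rec:
  assumes m: "2 \<le> m" and n: "m - 1 \<le> n"
  shows "X_law m t n = pmf_of_set (comps m (n - (m - 1))) \<bind>
    (\<lambda>js. map_pmf ((+) (t n)) (conv_list (map (X_law m t) js)))"
proof -
  define k where "k = m - 1"
  have k: "Suc k = m" "k \<le> n" using m n by (auto simp: k_def)
  define I where "I = {S. S \<subseteq> {1..n} \<and> card S = k}"
  \<comment> \<open>The first \<open>m - 1\<close> keys are stored sorted, so only their set
    matters, together with the order of the remaining keys.\<close>
  have "X_law m t n = pmf_of_set I \<bind> (\<lambda>S. map_pmf (\<lambda>(xs, ys). X_fun m t (xs @ ys))
        (pair_pmf (pmf_of_set (permutations_of_set S)) (pmf_of_set (permutations_of_set ({1..n} - S)))))"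
    unfolding X_law_def random_perm_def I_def using k(2)
    by (subst perm_split[of _ k]) (auto simp: map_bind_pmf pmf.map_comp o_def case_prod_unfold)
  also have "\<dots> = pmf_of_set I \<bind> (\<lambda>S. map_pmf ((+) (t n)) (conv_list (map (X_law m t) (gap_sizes n S))))"
  proof (rule bind_pmf_cong[OF refl])
    fix S assume "S \<in> set_pmf (pmf_of_set I)"
    moreover have "I \<noteq> {}" "finite I" using k(2) obtain_subset_with_card_n[of k "{1..n}"] by (auto simp: I_def)
    ultimately have S: "S \<subseteq> {1..n}" "card S = k" by (auto simp: I_def)
    have fin: "finite S" using S finite_subset by blast
    define ss where "ss = sorted_list_of_set S"
    have ss: "sorted ss" "length ss = k" using S by (auto simp: ss_def)
    define h where "h ys = (\<Sum>j\<leftarrow>[0..<m]. X_fun m t (filter (in_gap ss j) ys))" for ys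
    have "map_pmf (\<lambda>(xs, ys). X_fun m t (xs @ ys)) (pair_pmf (pmf_of_set (permutations_of_set S)) (pmf_of_set (permutations_of_set ({1..n} - S)))) =
      map_pmf (\<lambda>(xs, ys). t n + h ys) (pair_pmf (pmf_of_set (permutations_of_set S)) (pmf_of_set (permutations_of_set ({1..n} - S))))"
    proof (rule map_pmf_cong[OF refl], clarify)
      fix xs ys assume "(xs, ys) \<in> set_pmf (pair_pmf (pmf_of_set (permutations_of_set S)) (pmf_of_set (permutations_of_set ({1..n} - S))))"
      then have x: "xs \<in> permutations_of_set S" and y: "ys \<in> permutations_of_set ({1..n} - S)"
        using fin by auto
      have lx: "length xs = k" "distinct xs" "set xs = S"
        using x S(2) length_finite_permutations_of_set[OF x] by (auto dest: permutations_of_setD)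
      have ly: "length ys = n - k" "distinct ys" "set ys = {1..n} - S"
        using y S fin length_finite_permutations_of_set[OF y] by (auto dest: permutations_of_setD simp: card_Diff_subset)
      have "sort xs = ss" unfolding ss_def using lx by (metis sorted_list_of_set_sort_remdups distinct_remdups_id)
      then show "X_fun m t (xs @ ys) = t n + h ys"
        using X_fun_rec[OF m, of "xs @ ys" t] lx ly k n by (auto simp: h_def k_def)
    qed
    also have "\<dots> = map_pmf ((+) (t n)) (map_pmf h (map_pmf snd (pair_pmf (pmf_of_set (permutations_of_set S)) (pmf_of_set (permutations_of_set ({1..n} - S))))))"
      by (simp add: pmf.map_comp o_def case_prod_unfold)
    also have "map_pmf h (map_pmf snd (pair_pmf (pmf_of_set (permutations_of_set S)) (pmf_of_set (permutations_of_set ({1..n} - S))))) =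
      conv_list (map (\<lambda>j. map_pmf (X_fun m t) (pmf_of_set (permutations_of_set {x \<in> {1..n} - S. in_gap ss j x}))) [0..<m])"
      unfolding map_snd_pair_pmf h_def
      using in_gap_unique[OF ss(1)] ss(2) k(1) by (intro filter_law) auto
    also have "map (\<lambda>j. map_pmf (X_fun m t) (pmf_of_set (permutations_of_set {x \<in> {1..n} - S. in_gap ss j x}))) [0..<m] =
      map (X_law m t) (gap_sizes n S)"
      unfolding gap_sizes_def S(2) k(1) ss_def by (simp add: X_law_set[OF m] o_def)
    finally show "map_pmf (\<lambda>(xs, ys). X_fun m t (xs @ ys)) (pair_pmf (pmf_of_set (permutations_of_set S)) (pmf_of_set (permutations_of_set ({1..n} - S)))) =
      map_pmf ((+) (t n)) (conv_list (map (X_law m t) (gap_sizes n S)))" .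
  qed
  also have "\<dots> = map_pmf (gap_sizes n) (pmf_of_set I) \<bind> (\<lambda>js. map_pmf ((+) (t n)) (conv_list (map (X_law m t) js)))"
    by (simp add: bind_map_pmf)
  also have "map_pmf (gap_sizes n) (pmf_of_set I) = pmf_of_set (comps m (n - (m - 1)))"
  proof -
    have "I \<noteq> {}" "finite I" using k(2) obtain_subset_with_card_n[of k "{1..n}"] by (auto simp: I_def)
    then show ?thesis
      using map_pmf_of_set_bij_betw[OF gap_sizes_bij[OF k(2), folded I_def]] k by (simp add: k_def)
  qed
  finally show ?thesis .
qed

section \<open>Moments and characteristic functions\<close>

abbreviation expect :: "'a pmf \<Rightarrow> ('a \<Rightarrow> 'b) \<Rightarrow> 'b :: {banach, second_countable_topology}" where
  "expect p f \<equiv> measure_pmf.expectation p f"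

lemma expect_add:
  fixes f g :: "'a \<Rightarrow> 'b :: {banach, second_countable_topology}"
  assumes "finite (set_pmf p)"
  shows "expect p (\<lambda>x. f x + g x) = expect p f + expect p g"
  using assms by (intro Bochner_Integration.integral_add integrable_measure_pmf_finite)

lemma expect_sum:
  fixes f :: "'i \<Rightarrow> 'a \<Rightarrow> 'b :: {banach, second_countable_topology}"
  assumes "finite (set_pmf p)"
  shows "expect p (\<lambda>x. \<Sum>i\<in>I. f i x) = (\<Sum>i\<in>I. expect p (f i))"
  using assms by (intro Bochner_Integration.integral_sum integrable_measure_pmf_finite)

lemma expect_mono:
  fixes f g :: "'a \<Rightarrow> real"
  assumes "finite (set_pmf p)" "\<And>x. f x \<le> g x"
  shows "expect p f \<le> expect p g"
  using assms by (intro integral_mono integrable_measure_pmf_finite)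

lemma expect_pair_mult:
  fixes f :: "'a \<Rightarrow> 'c :: {real_normed_field, banach, second_countable_topology}" and g :: "'b \<Rightarrow> 'c"
  assumes "finite (set_pmf p)" "finite (set_pmf q)"
  shows "expect (pair_pmf p q) (\<lambda>z. f (fst z) * g (snd z)) = expect p f * expect q g"
proof -
  have "expect (pair_pmf p q) (\<lambda>z. f (fst z) * g (snd z)) =
    (\<Sum>z\<in>set_pmf p \<times> set_pmf q. pmf (pair_pmf p q) z *\<^sub>R (f (fst z) * g (snd z)))"
    using assms by (intro integral_measure_pmf) auto
  also have "\<dots> = (\<Sum>x\<in>set_pmf p. \<Sum>y\<in>set_pmf q. (pmf p x *\<^sub>R f x) * (pmf q y *\<^sub>R g y))"
    unfolding sum.cartesian_product by (intro sum.cong) (auto simp: pmf_pair)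
  also have "\<dots> = (\<Sum>x\<in>set_pmf p. pmf p x *\<^sub>R f x) * (\<Sum>y\<in>set_pmf q. pmf q y *\<^sub>R g y)"
    by (simp only: sum_product)
  also have "(\<Sum>x\<in>set_pmf p. pmf p x *\<^sub>R f x) = expect p f"
    using assms by (intro integral_measure_pmf[symmetric]) auto
  also have "(\<Sum>y\<in>set_pmf q. pmf q y *\<^sub>R g y) = expect q g"
    using assms by (intro integral_measure_pmf[symmetric]) auto
  finally show ?thesis .
qed

lemma finite_conv_list:
  "(\<And>p. p \<in> set ps \<Longrightarrow> finite (set_pmf p)) \<Longrightarrow> finite (set_pmf (conv_list ps))"
  by (induction ps) auto

lemma expect_conv_Cons:
  fixes f :: "real \<Rightarrow> 'b :: {banach, second_countable_topology}"
  shows "expect (conv_list (p # ps)) f = expect (pair_pmf p (conv_list ps)) (\<lambda>z. f (fst z + snd z))"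
  by (simp add: case_prod_unfold)

lemma conv_list_mean:
  assumes "\<And>p. p \<in> set ps \<Longrightarrow> finite (set_pmf p)"
  shows "expect (conv_list ps) (\<lambda>x. x) = (\<Sum>p\<leftarrow>ps. expect p (\<lambda>x. x))"
  using assms
proof (induction ps)
  case (Cons p ps)
  have fin: "finite (set_pmf p)" "finite (set_pmf (conv_list ps))"
    using Cons.prems by (auto intro: finite_conv_list)
  then have "finite (set_pmf (pair_pmf p (conv_list ps)))" by simp
  then have "expect (conv_list (p # ps)) (\<lambda>x. x) = expect p (\<lambda>x. x) + expect (conv_list ps) (\<lambda>x. x)"
    unfolding expect_conv_Cons by (subst expect_add) (auto simp: expectation_pair_pmf_fst[of _ _ "\<lambda>x. x"] expectation_pair_pmf_snd[of _ _ "\<lambda>x. x"])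
  then show ?case using Cons by simp
qed simp

lemma conv_list_second_moment:
  assumes "\<And>p. p \<in> set ps \<Longrightarrow> finite (set_pmf p)" "\<And>p. p \<in> set ps \<Longrightarrow> expect p (\<lambda>x. x) = 0"
  shows "expect (conv_list ps) (\<lambda>x. x\<^sup>2) = (\<Sum>p\<leftarrow>ps. expect p (\<lambda>x. x\<^sup>2))"
  using assms
proof (induction ps)
  case (Cons p ps)
  have fin: "finite (set_pmf p)" "finite (set_pmf (conv_list ps))"
    using Cons.prems by (auto intro: finite_conv_list)
  then have finp: "finite (set_pmf (pair_pmf p (conv_list ps)))" by simp
  have "expect (conv_list (p # ps)) (\<lambda>x. x\<^sup>2) =
    expect (pair_pmf p (conv_list ps)) (\<lambda>z. (fst z)\<^sup>2 + ((2 * fst z) * snd z + (snd z)\<^sup>2))"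
    unfolding expect_conv_Cons by (simp add: power2_sum algebra_simps)
  also have "\<dots> = expect p (\<lambda>x. x\<^sup>2) + (expect p (\<lambda>x. 2 * x) * expect (conv_list ps) (\<lambda>x. x) + expect (conv_list ps) (\<lambda>x. x\<^sup>2))"
    unfolding expect_add[OF finp] expect_pair_mult[OF fin, of "\<lambda>x. 2 * x" "\<lambda>x. x"]
      expectation_pair_pmf_fst[of _ _ "\<lambda>x. x\<^sup>2"] expectation_pair_pmf_snd[of _ _ "\<lambda>x. x\<^sup>2"] ..
  finally show ?case using Cons by simp
qed simp

lemma conv_list_char:
  assumes "\<And>p. p \<in> set ps \<Longrightarrow> finite (set_pmf p)"
  shows "expect (conv_list ps) (\<lambda>x. cis (u * x)) = (\<Prod>p\<leftarrow>ps. expect p (\<lambda>x. cis (u * x)))"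
  using assms
proof (induction ps)
  case (Cons p ps)
  have fin: "finite (set_pmf p)" "finite (set_pmf (conv_list ps))"
    using Cons.prems by (auto intro: finite_conv_list)
  have "expect (conv_list (p # ps)) (\<lambda>x. cis (u * x)) =
    expect (pair_pmf p (conv_list ps)) (\<lambda>z. cis (u * fst z) * cis (u * snd z))"
    unfolding expect_conv_Cons by (simp add: cis_mult distrib_left)
  also have "\<dots> = expect p (\<lambda>x. cis (u * x)) * expect (conv_list ps) (\<lambda>x. cis (u * x))"
    by (rule expect_pair_mult[OF fin])
  finally show ?case using Cons by simp
qed simp

lemma conv_list_shift:
  "conv_list (map (\<lambda>j. map_pmf (\<lambda>x. x - c j) (P j)) js) = map_pmf (\<lambda>s. s - (\<Sum>j\<leftarrow>js. c j)) (conv_list (map P js))"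
proof (induction js)
  case (Cons j js)
  have "conv_list (map (\<lambda>j. map_pmf (\<lambda>x. x - c j) (P j)) (j # js)) =
    map_pmf (\<lambda>(x, y). x + y) (map_pmf (\<lambda>(x, y). (x - c j, y - (\<Sum>j\<leftarrow>js. c j))) (pair_pmf (P j) (conv_list (map P js))))"
    by (simp add: Cons map_pair)
  also have "\<dots> = map_pmf (\<lambda>s. s - (\<Sum>j\<leftarrow>j # js. c j)) (conv_list (map P (j # js)))"
    by (simp add: pmf.map_comp o_def case_prod_unfold algebra_simps)
  finally show ?case .
qed simp

text \<open>With \<open>M = max T |x|\<close> the product \<open>T ^ (2 * l - i) * |x| ^ i\<close>
  is at most \<open>M ^ (2 * l)\<close>. So one even moment at the scale \<open>T\<close> controls
  all lower ones at the same scale.\<close>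

lemma low_moment_bound:
  fixes T C :: real
  assumes fin: "finite (set_pmf p)" and "T > 0" and C: "expect p (\<lambda>x. x ^ (2 * l)) \<le> C * T ^ (2 * l)" and i: "i \<le> 2 * l"
  shows "\<bar>expect p (\<lambda>x. x ^ i)\<bar> \<le> (1 + C) * T ^ i"
proof -
  have pw: "T ^ (2 * l - i) * \<bar>x\<bar> ^ i \<le> T ^ (2 * l) + x ^ (2 * l)" for x :: real
  proof -
    define M where "M = max T \<bar>x\<bar>"
    have "T ^ (2 * l - i) * \<bar>x\<bar> ^ i \<le> M ^ (2 * l - i) * M ^ i"
      using \<open>T > 0\<close> by (intro mult_mono power_mono) (auto simp: M_def)
    also have "\<dots> = M ^ (2 * l)" using i by (simp add: power_add[symmetric])
    also have "\<dots> \<le> T ^ (2 * l) + \<bar>x\<bar> ^ (2 * l)" using \<open>T > 0\<close> by (auto simp: M_def max_def)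
    also have "\<bar>x\<bar> ^ (2 * l) = x ^ (2 * l)" by (simp add: power_mult)
    finally show ?thesis .
  qed
  have "\<bar>expect p (\<lambda>x. x ^ i)\<bar> \<le> expect p (\<lambda>x. \<bar>x ^ i\<bar>)"
    by (rule integral_abs_bound)
  then have "T ^ (2 * l - i) * \<bar>expect p (\<lambda>x. x ^ i)\<bar> \<le> T ^ (2 * l - i) * expect p (\<lambda>x. \<bar>x\<bar> ^ i)"
    using \<open>T > 0\<close> by (intro mult_left_mono) (auto simp: power_abs)
  also have "\<dots> = expect p (\<lambda>x. T ^ (2 * l - i) * \<bar>x\<bar> ^ i)" by simp
  also have "\<dots> \<le> expect p (\<lambda>x. T ^ (2 * l) + x ^ (2 * l))" by (rule expect_mono[OF fin pw])
  also have "\<dots> = T ^ (2 * l) + expect p (\<lambda>x. x ^ (2 * l))" by (simp add: expect_add[OF fin])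
  also have "\<dots> \<le> (1 + C) * T ^ (2 * l)" using C by (simp add: algebra_simps)
  also have "T ^ (2 * l) = T ^ (2 * l - i) * T ^ i" using i by (simp add: power_add[symmetric])
  finally have "T ^ (2 * l - i) * \<bar>expect p (\<lambda>x. x ^ i)\<bar> \<le> T ^ (2 * l - i) * ((1 + C) * T ^ i)"
    by (simp only: mult_ac)
  then show ?thesis using \<open>T > 0\<close> by (simp only: mult_le_cancel_left_pos zero_less_power)
qed

text \<open>In the binomial expansion the two extreme terms are kept exactly, their neighbours
  vanish because both laws are centred, and every other term is a product of two moments of order at
  most \<open>2 * l\<close>.\<close>

lemma pair_moment:
  fixes T C :: real
  assumes fin: "finite (set_pmf p)" "finite (set_pmf q)"
    and mean: "expect p (\<lambda>x. x) = 0" "expect q (\<lambda>x. x) = 0" and "T > 0" and l: "l \<ge> 1"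
    and C: "expect p (\<lambda>x. x ^ (2 * l)) \<le> C * T ^ (2 * l)" "expect q (\<lambda>x. x ^ (2 * l)) \<le> C * T ^ (2 * l)"
  shows "expect (pair_pmf p q) (\<lambda>z. (fst z + snd z) ^ (2 * l + 2)) \<le>
    expect p (\<lambda>x. x ^ (2 * l + 2)) + expect q (\<lambda>x. x ^ (2 * l + 2)) + 2 ^ (2 * l + 2) * ((1 + C)\<^sup>2 * T ^ (2 * l + 2))"
proof -
  define k where "k = 2 * l + 2"
  define P where "P i = expect p (\<lambda>x. x ^ i)" for i
  define Q where "Q i = expect q (\<lambda>x. x ^ i)" for i
  define B where "B = (1 + C)\<^sup>2 * T ^ k"
  have B0: "B \<ge> 0" using \<open>T > 0\<close> by (simp add: B_def)
  have PQ: "P 0 = 1" "Q 0 = 1" "P 1 = 0" "Q 1 = 0" using mean by (simp_all add: P_def Q_def)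
  have C1: "1 + C \<ge> 0" using low_moment_bound[OF fin(1) \<open>T > 0\<close> C(1), of 0] by simp
  have tm: "P i * Q (k - i) \<le> (if i = 0 then Q k else if i = k then P k else 0) + B" if "i \<le> k" for i
  proof -
    have "i = 0 \<or> i = k \<or> i = 1 \<or> i = k - 1 \<or> (2 \<le> i \<and> i \<le> k - 2)" using that by linarith
    then consider "i = 0" | "i = k" | "i = 1" | "i = k - 1" | "2 \<le> i" "i \<le> k - 2" by blast
    then show ?thesis
    proof cases
      case 5
      have "P i * Q (k - i) \<le> \<bar>P i\<bar> * \<bar>Q (k - i)\<bar>" by (metis abs_ge_self abs_mult)
      also have "\<dots> \<le> ((1 + C) * T ^ i) * ((1 + C) * T ^ (k - i))"
        unfolding P_def Q_def using 5 C1 \<open>T > 0\<close>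
        by (intro mult_mono low_moment_bound[OF fin(1) \<open>T > 0\<close> C(1)] low_moment_bound[OF fin(2) \<open>T > 0\<close> C(2)])
          (auto simp: k_def)
      also have "\<dots> = (1 + C)\<^sup>2 * (T ^ i * T ^ (k - i))" by (simp add: power2_eq_square mult_ac)
      also have "\<dots> = B" using that by (simp add: B_def power_add[symmetric])
      finally show ?thesis using 5 l by (simp add: k_def)
    qed (use B0 PQ l in \<open>auto simp: k_def\<close>)
  qed
  have "expect (pair_pmf p q) (\<lambda>z. (fst z + snd z) ^ k) =
    expect (pair_pmf p q) (\<lambda>z. \<Sum>i\<le>k. (real (k choose i) * fst z ^ i) * snd z ^ (k - i))"
    by (simp add: binomial_ring)
  also have "\<dots> = (\<Sum>i\<le>k. expect (pair_pmf p q) (\<lambda>z. (real (k choose i) * fst z ^ i) * snd z ^ (k - i)))"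
    using fin by (intro expect_sum) simp
  also have "\<dots> = (\<Sum>i\<le>k. expect p (\<lambda>x. real (k choose i) * x ^ i) * Q (k - i))"
    unfolding Q_def by (intro sum.cong refl expect_pair_mult[OF fin, of "\<lambda>x. real (k choose _) * x ^ _" "\<lambda>x. x ^ (k - _)"])
  also have "\<dots> = (\<Sum>i\<le>k. real (k choose i) * (P i * Q (k - i)))" by (simp add: P_def mult.assoc)
  also have "\<dots> \<le> (\<Sum>i\<le>k. real (k choose i) * ((if i = 0 then Q k else if i = k then P k else 0) + B))"
    by (intro sum_mono mult_left_mono tm) auto
  also have "\<dots> = (\<Sum>i\<le>k. real (k choose i) * (if i = 0 then Q k else if i = k then P k else 0)) + (\<Sum>i\<le>k. real (k choose i)) * B"
    by (simp add: distrib_left sum.distrib sum_distrib_right)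
  also have "(\<Sum>i\<le>k. real (k choose i)) = 2 ^ k"
    using choose_row_sum[of k] by (metis of_nat_numeral of_nat_power of_nat_sum)
  also have "(\<Sum>i\<le>k. real (k choose i) * (if i = 0 then Q k else if i = k then P k else 0)) = Q k + P k"
  proof -
    have "(\<Sum>i\<le>k. real (k choose i) * (if i = 0 then Q k else if i = k then P k else 0)) =
      (\<Sum>i\<in>{0, k}. real (k choose i) * (if i = 0 then Q k else if i = k then P k else 0))"
      by (intro sum.mono_neutral_right) auto
    then show ?thesis by (simp add: k_def)
  qed
  finally show ?thesis by (simp add: P_def Q_def B_def k_def)
qed

text \<open>The point is the coefficient 1 in front of the sum of the moments of order
  \<open>2 * l + 2\<close>: it leaves the averaged tree recurrence for these moments a contraction.
  The cruder bound on the moment of order \<open>2 * l\<close> is carried along to feed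
  \<open>pair_moment\<close>.\<close>

lemma conv_list_moment:
  assumes l: "l \<ge> 1"
  shows "\<exists>D\<ge>0. \<forall>ps T. length ps = q \<longrightarrow> T > 0 \<longrightarrow>
    (\<forall>p\<in>set ps. finite (set_pmf p) \<and> expect p (\<lambda>x. x) = 0 \<and> expect p (\<lambda>x. x ^ (2 * l)) \<le> C * T ^ (2 * l)) \<longrightarrow>
    expect (conv_list ps) (\<lambda>x. x ^ (2 * l)) \<le> D * T ^ (2 * l) \<and>
    expect (conv_list ps) (\<lambda>x. x ^ (2 * l + 2)) \<le> (\<Sum>p\<leftarrow>ps. expect p (\<lambda>x. x ^ (2 * l + 2))) + D * T ^ (2 * l + 2)"
proof (induction q)
  case 0
  then show ?case using l by (intro exI[of _ 0]) (auto simp: power_0_left)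
next
  case (Suc q)
  then obtain D where "D \<ge> 0" and D: "\<And>ps T. length ps = q \<Longrightarrow> T > 0 \<Longrightarrow>
    \<forall>p\<in>set ps. finite (set_pmf p) \<and> expect p (\<lambda>x. x) = 0 \<and> expect p (\<lambda>x. x ^ (2 * l)) \<le> C * T ^ (2 * l) \<Longrightarrow>
    expect (conv_list ps) (\<lambda>x. x ^ (2 * l)) \<le> D * T ^ (2 * l) \<and>
    expect (conv_list ps) (\<lambda>x. x ^ (2 * l + 2)) \<le> (\<Sum>p\<leftarrow>ps. expect p (\<lambda>x. x ^ (2 * l + 2))) + D * T ^ (2 * l + 2)"
    by blast
  define D1 where "D1 = 2 ^ (2 * l) * (\<bar>C\<bar> + D)"
  define D2 where "D2 = D + 2 ^ (2 * l + 2) * (1 + max C D)\<^sup>2"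
  have D12: "D1 \<ge> 0" "D2 \<ge> 0" using \<open>D \<ge> 0\<close> by (auto simp: D1_def D2_def)
  show ?case
  proof (intro exI[of _ "max D1 D2"] conjI allI impI)
    fix ps :: "real pmf list" and T :: real
    assume len: "length ps = Suc q" and T: "T > 0"
      and ass: "\<forall>p\<in>set ps. finite (set_pmf p) \<and> expect p (\<lambda>x. x) = 0 \<and> expect p (\<lambda>x. x ^ (2 * l)) \<le> C * T ^ (2 * l)"
    obtain p ps' where ps: "ps = p # ps'" "length ps' = q" using len by (cases ps) auto
    have IH: "expect (conv_list ps') (\<lambda>x. x ^ (2 * l)) \<le> D * T ^ (2 * l)"
      "expect (conv_list ps') (\<lambda>x. x ^ (2 * l + 2)) \<le> (\<Sum>p\<leftarrow>ps'. expect p (\<lambda>x. x ^ (2 * l + 2))) + D * T ^ (2 * l + 2)"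
      using D[OF ps(2) T] ass ps by auto
    have fin: "finite (set_pmf p)" "finite (set_pmf (conv_list ps'))"
      using ass ps by (auto intro!: finite_conv_list)
    then have finp: "finite (set_pmf (pair_pmf p (conv_list ps')))" by simp
    have mean: "expect p (\<lambda>x. x) = 0" "expect (conv_list ps') (\<lambda>x. x) = 0"
    proof -
      show "expect p (\<lambda>x. x) = 0" using ass ps by auto
      have "expect (conv_list ps') (\<lambda>x. x) = (\<Sum>p\<leftarrow>ps'. expect p (\<lambda>x. x))"
        using ass ps by (intro conv_list_mean) auto
      also have "\<dots> = (\<Sum>p\<leftarrow>ps'. 0)" using ass ps by (intro arg_cong[of _ _ sum_list] map_cong) auto
      finally show "expect (conv_list ps') (\<lambda>x. x) = 0" by simp
    qed
    have T2: "T ^ (2 * l) > 0" "T ^ (2 * l + 2) > 0" using T by auto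
    have pw: "(x + y) ^ (2 * l) \<le> 2 ^ (2 * l) * (x ^ (2 * l) + y ^ (2 * l))" for x y :: real
    proof -
      have "(x + y) ^ (2 * l) = \<bar>x + y\<bar> ^ (2 * l)" by (simp add: power_mult)
      also have "\<dots> \<le> (2 * max \<bar>x\<bar> \<bar>y\<bar>) ^ (2 * l)" by (intro power_mono) auto
      also have "\<dots> = 2 ^ (2 * l) * (max \<bar>x\<bar> \<bar>y\<bar>) ^ (2 * l)" by (rule power_mult_distrib)
      also have "(max \<bar>x\<bar> \<bar>y\<bar>) ^ (2 * l) \<le> \<bar>x\<bar> ^ (2 * l) + \<bar>y\<bar> ^ (2 * l)" by (auto simp: max_def)
      also have "\<bar>x\<bar> ^ (2 * l) + \<bar>y\<bar> ^ (2 * l) = x ^ (2 * l) + y ^ (2 * l)" by (simp add: power_mult)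
      finally show ?thesis by simp
    qed
    have p_le: "expect p (\<lambda>x. x ^ (2 * l)) \<le> C * T ^ (2 * l)" using ass ps by auto
    have "expect (conv_list ps) (\<lambda>x. x ^ (2 * l)) \<le>
      expect (pair_pmf p (conv_list ps')) (\<lambda>z. 2 ^ (2 * l) * (fst z ^ (2 * l) + snd z ^ (2 * l)))"
      unfolding ps(1) expect_conv_Cons by (intro expect_mono finp pw)
    also have "\<dots> = 2 ^ (2 * l) * (expect p (\<lambda>x. x ^ (2 * l)) + expect (conv_list ps') (\<lambda>x. x ^ (2 * l)))"
      by (simp add: expect_add[OF finp] expectation_pair_pmf_fst[of _ _ "\<lambda>x. x ^ (2 * l)"]
          expectation_pair_pmf_snd[of _ _ "\<lambda>x. x ^ (2 * l)"])
    also have "\<dots> \<le> 2 ^ (2 * l) * (\<bar>C\<bar> * T ^ (2 * l) + D * T ^ (2 * l))"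
    proof (intro mult_left_mono add_mono IH)
      have "C * T ^ (2 * l) \<le> \<bar>C\<bar> * T ^ (2 * l)" using T2 by (intro mult_right_mono) auto
      then show "expect p (\<lambda>x. x ^ (2 * l)) \<le> \<bar>C\<bar> * T ^ (2 * l)" using p_le by linarith
    qed simp
    also have "\<dots> = D1 * T ^ (2 * l)" by (simp add: D1_def algebra_simps)
    also have "\<dots> \<le> max D1 D2 * T ^ (2 * l)" using T2 by (intro mult_right_mono) auto
    finally show "expect (conv_list ps) (\<lambda>x. x ^ (2 * l)) \<le> max D1 D2 * T ^ (2 * l)" .
    have "expect (conv_list ps) (\<lambda>x. x ^ (2 * l + 2)) \<le> expect p (\<lambda>x. x ^ (2 * l + 2)) + expect (conv_list ps') (\<lambda>x. x ^ (2 * l + 2))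
        + 2 ^ (2 * l + 2) * ((1 + max C D)\<^sup>2 * T ^ (2 * l + 2))"
      unfolding ps(1) expect_conv_Cons
    proof (rule pair_moment[OF fin mean T l])
      have "C * T ^ (2 * l) \<le> max C D * T ^ (2 * l)" "D * T ^ (2 * l) \<le> max C D * T ^ (2 * l)"
        using T2 by (intro mult_right_mono; simp)+
      then show "expect p (\<lambda>x. x ^ (2 * l)) \<le> max C D * T ^ (2 * l)"
        "expect (conv_list ps') (\<lambda>x. x ^ (2 * l)) \<le> max C D * T ^ (2 * l)"
        using p_le IH(1) by linarith+
    qed
    also have "\<dots> \<le> (\<Sum>p\<leftarrow>ps. expect p (\<lambda>x. x ^ (2 * l + 2))) + D2 * T ^ (2 * l + 2)"
      using IH(2) by (simp add: ps(1) D2_def algebra_simps)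
    also have "D2 * T ^ (2 * l + 2) \<le> max D1 D2 * T ^ (2 * l + 2)" using T2 by (intro mult_right_mono) auto
    finally show "expect (conv_list ps) (\<lambda>x. x ^ (2 * l + 2)) \<le>
      (\<Sum>p\<leftarrow>ps. expect p (\<lambda>x. x ^ (2 * l + 2))) + max D1 D2 * T ^ (2 * l + 2)" by simp
  qed (use D12 in auto)
qed

lemma finite_random_perm: "finite (set_pmf (random_perm n))"
  by (simp add: random_perm_def)

lemma finite_X_law: "finite (set_pmf (X_law m t n))"
  by (simp add: X_law_def finite_random_perm)

section \<open>Centred laws and their recurrences\<close>

definition Y_law :: "nat \<Rightarrow> (nat \<Rightarrow> real) \<Rightarrow> nat \<Rightarrow> real pmf" where
  "Y_law m t n = map_pmf (\<lambda>x. x - mean_X m t n) (X_law m t n)"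

text \<open>The conditional mean of the functional given the subtree sizes, minus its mean.\<close>

definition resid :: "nat \<Rightarrow> (nat \<Rightarrow> real) \<Rightarrow> nat \<Rightarrow> nat list \<Rightarrow> real" where
  "resid m t n js = t n + sum_list (map (mean_X m t) js) - mean_X m t n"

lemma finite_Y_law: "finite (set_pmf (Y_law m t n))"
  by (simp add: Y_law_def finite_X_law)

lemma mean_X_law: "mean_X m t n = expect (X_law m t n) (\<lambda>x. x)"
  by (simp add: mean_X_def X_law_def)

lemma Y_law_mean: "expect (Y_law m t n) (\<lambda>x. x) = 0"
  using finite_X_law[of m t n] by (simp add: Y_law_def mean_X_law integrable_measure_pmf_finite)

lemma var_X_law: "var_X m t n = expect (Y_law m t n) (\<lambda>x. x\<^sup>2)"
  by (simp add: var_X_def Y_law_def X_law_def mean_X_def)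

lemma comps_nonempty: "1 \<le> m \<Longrightarrow> comps m N \<noteq> {}"
  using card_comps[of m N] by (metis binomial_eq_0_iff card.empty le_add1 ordered_cancel_comm_monoid_diff_class.add_diff_assoc not_less)

lemma Y_law_small:
  assumes "2 \<le> m" "n < m - 1"
  shows "Y_law m t n = return_pmf 0"
  using X_law_small[OF assms] by (simp add: Y_law_def mean_X_law)

lemma Y_law_rec:
  assumes m: "2 \<le> m" and n: "m - 1 \<le> n"
  shows "Y_law m t n = pmf_of_set (comps m (n - (m - 1))) \<bind>
    (\<lambda>js. map_pmf ((+) (resid m t n js)) (conv_list (map (Y_law m t) js)))"
proof -
  have "map_pmf (\<lambda>x. x - mean_X m t n) (map_pmf ((+) (t n)) (conv_list (map (X_law m t) js))) =
    map_pmf ((+) (resid m t n js)) (conv_list (map (Y_law m t) js))" for js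
    unfolding Y_law_def conv_list_shift by (simp add: pmf.map_comp o_def resid_def algebra_simps)
  then show ?thesis
    unfolding Y_law_def[of m t n] X_law_rec[OF assms] by (simp add: map_bind_pmf)
qed

lemma expect_Y_rec:
  fixes f :: "real \<Rightarrow> 'b :: {banach, second_countable_topology}"
  assumes m: "2 \<le> m" and n: "m - 1 \<le> n"
  shows "expect (Y_law m t n) f = (\<Sum>js\<in>comps m (n - (m - 1)).
    expect (conv_list (map (Y_law m t) js)) (\<lambda>s. f (resid m t n js + s)) /\<^sub>R real (n choose (m - 1)))"
proof -
  have "card (comps m (n - (m - 1))) = n choose (m - 1)" using m n by (intro card_comps_choose) auto
  moreover have "comps m (n - (m - 1)) \<noteq> {}" using m by (intro comps_nonempty) simp
  ultimately show ?thesis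
    unfolding Y_law_rec[OF assms]
    by (subst pmf_expectation_bind_pmf_of_set) (auto intro!: finite_conv_list finite_Y_law)
qed

lemma tree_rec_mean:
  assumes "2 \<le> m"
  shows "tree_rec m (mean_X m t) t"
  unfolding tree_rec_def
proof (intro conjI allI impI)
  fix n assume "n < m - 1"
  then show "mean_X m t n = t n" using X_law_small[OF assms] by (simp add: mean_X_law)
next
  fix n assume n: "m - 1 \<le> n"
  have c: "card (comps m (n - (m - 1))) = n choose (m - 1)" using assms n by (intro card_comps_choose) auto
  have ne: "comps m (n - (m - 1)) \<noteq> {}" using assms by (intro comps_nonempty) simp
  have c0: "real (n choose (m - 1)) > 0" using n by simp
  have "mean_X m t n = (\<Sum>js\<in>comps m (n - (m - 1)). expect (conv_list (map (X_law m t) js)) (\<lambda>x. t n + x) /\<^sub>R real (n choose (m - 1)))"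
    unfolding mean_X_law[of m t n] X_law_rec[OF assms n] using ne
    by (subst pmf_expectation_bind_pmf_of_set) (auto intro!: finite_conv_list finite_X_law simp: c simp del: One_nat_def)
  also have "\<dots> = (\<Sum>js\<in>comps m (n - (m - 1)). (t n + sum_list (map (mean_X m t) js)) / real (n choose (m - 1)))"
  proof (intro sum.cong refl)
    fix js
    have fin: "finite (set_pmf (conv_list (map (X_law m t) js)))" by (auto intro!: finite_conv_list finite_X_law)
    have "expect (conv_list (map (X_law m t) js)) (\<lambda>x. x) = sum_list (map (mean_X m t) js)"
      by (subst conv_list_mean) (auto simp: finite_X_law o_def simp flip: mean_X_law)
    then show "expect (conv_list (map (X_law m t) js)) (\<lambda>x. t n + x) /\<^sub>R real (n choose (m - 1)) =
      (t n + sum_list (map (mean_X m t) js)) / real (n choose (m - 1))"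
      by (simp add: expect_add[OF fin] divide_inverse)
  qed
  also have "\<dots> = (\<Sum>js\<in>comps m (n - (m - 1)). t n) / real (n choose (m - 1)) +
      (\<Sum>js\<in>comps m (n - (m - 1)). sum_list (map (mean_X m t) js)) / real (n choose (m - 1))"
    by (simp only: sum_divide_distrib[symmetric] sum.distrib add_divide_distrib)
  finally show "mean_X m t n = t n + (\<Sum>js\<in>comps m (n - (m - 1)). sum_list (map (mean_X m t) js)) / real (n choose (m - 1))"
    using c0 by (simp add: c del: One_nat_def)
qed

lemma sum_resid:
  assumes m: "2 \<le> m" and n: "m - 1 \<le> n"
  shows "(\<Sum>js\<in>comps m (n - (m - 1)). resid m t n js) = 0"
proof -
  have c: "card (comps m (n - (m - 1))) = n choose (m - 1)" using assms n by (intro card_comps_choose) auto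
  have c0: "real (n choose (m - 1)) > 0" using n by simp
  have "mean_X m t n = t n + (\<Sum>js\<in>comps m (n - (m - 1)). sum_list (map (mean_X m t) js)) / real (n choose (m - 1))"
    using tree_rec_mean[OF m] n unfolding tree_rec_def by blast
  then have "(\<Sum>js\<in>comps m (n - (m - 1)). sum_list (map (mean_X m t) js)) = real (n choose (m - 1)) * (mean_X m t n - t n)"
    using c0 by (simp add: field_simps)
  then show ?thesis by (simp add: resid_def sum.distrib sum_subtractf c algebra_simps del: One_nat_def)
qed

lemma var_toll_resid:
  "n \<ge> m - 1 \<Longrightarrow> var_toll m t n = (\<Sum>js\<in>comps m (n - (m - 1)). (resid m t n js)\<^sup>2) / real (n choose (m - 1))"
  by (simp add: var_toll_def comps_def resid_def)

lemma conv_Y_mean: "expect (conv_list (map (Y_law m t) js)) (\<lambda>x. x) = 0"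
  by (subst conv_list_mean) (auto simp: finite_Y_law Y_law_mean o_def)

text \<open>Given the split, the centred functional is \<open>resid\<close> plus independent centred
  summands. All mixed terms vanish, and the squared residual remains as the toll.\<close>

lemma tree_rec_var:
  assumes "2 \<le> m"
  shows "tree_rec m (var_X m t) (var_toll m t)"
  unfolding tree_rec_def
proof (intro conjI allI impI)
  fix n assume "n < m - 1"
  then show "var_X m t n = var_toll m t n" using Y_law_small[OF assms] by (simp add: var_X_law var_toll_def)
next
  fix n assume n: "m - 1 \<le> n"
  have "var_X m t n = (\<Sum>js\<in>comps m (n - (m - 1)). ((resid m t n js)\<^sup>2 + sum_list (map (var_X m t) js)) / real (n choose (m - 1)))"
    unfolding var_X_law[of m t n] expect_Y_rec[OF assms n]
  proof (intro sum.cong refl)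
    fix js
    have fin: "finite (set_pmf (conv_list (map (Y_law m t) js)))" by (auto intro!: finite_conv_list finite_Y_law)
    have "expect (conv_list (map (Y_law m t) js)) (\<lambda>s. (resid m t n js + s)\<^sup>2) =
      expect (conv_list (map (Y_law m t) js)) (\<lambda>s. (resid m t n js)\<^sup>2 + (2 * resid m t n js * s + s\<^sup>2))"
      by (simp add: power2_sum algebra_simps)
    also have "\<dots> = (resid m t n js)\<^sup>2 + (2 * resid m t n js * expect (conv_list (map (Y_law m t) js)) (\<lambda>x. x)
        + expect (conv_list (map (Y_law m t) js)) (\<lambda>x. x\<^sup>2))"
      by (simp add: expect_add[OF fin])
    also have "expect (conv_list (map (Y_law m t) js)) (\<lambda>x. x\<^sup>2) = sum_list (map (var_X m t) js)"
      by (subst conv_list_second_moment) (auto simp: finite_Y_law Y_law_mean o_def simp flip: var_X_law)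
    finally show "expect (conv_list (map (Y_law m t) js)) (\<lambda>s. (resid m t n js + s)\<^sup>2) /\<^sub>R real (n choose (m - 1)) =
      ((resid m t n js)\<^sup>2 + sum_list (map (var_X m t) js)) / real (n choose (m - 1))"
      by (simp add: conv_Y_mean divide_inverse)
  qed
  then show "var_X m t n = var_toll m t n + (\<Sum>js\<in>comps m (n - (m - 1)). sum_list (map (var_X m t) js)) / real (n choose (m - 1))"
    by (simp only: var_toll_resid[OF n] sum_divide_distrib[symmetric] sum.distrib add_divide_distrib)
qed

definition phi :: "nat \<Rightarrow> (nat \<Rightarrow> real) \<Rightarrow> nat \<Rightarrow> real \<Rightarrow> complex" where
  "phi m t n u = expect (Y_law m t n) (\<lambda>x. cis (u * x))"

lemma norm_phi_le_1: "norm (phi m t n u) \<le> 1"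
proof -
  have "norm (phi m t n u) \<le> expect (Y_law m t n) (\<lambda>x. norm (cis (u * x)))"
    unfolding phi_def by (rule integral_norm_bound)
  then show ?thesis by simp
qed

lemma phi_rec:
  assumes m: "2 \<le> m" and n: "m - 1 \<le> n"
  shows "phi m t n u = (\<Sum>js\<in>comps m (n - (m - 1)). cis (u * resid m t n js) * (\<Prod>j\<leftarrow>js. phi m t j u)) / of_nat (n choose (m - 1))"
proof -
  have "expect (conv_list (map (Y_law m t) js)) (\<lambda>s. cis (u * (resid m t n js + s))) =
    cis (u * resid m t n js) * (\<Prod>j\<leftarrow>js. phi m t j u)" for js
  proof -
    have "expect (conv_list (map (Y_law m t) js)) (\<lambda>s. cis (u * (resid m t n js + s))) =
      expect (conv_list (map (Y_law m t) js)) (\<lambda>s. cis (u * resid m t n js) * cis (u * s))"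
      by (simp add: cis_mult distrib_left)
    also have "\<dots> = cis (u * resid m t n js) * expect (conv_list (map (Y_law m t) js)) (\<lambda>s. cis (u * s))" by simp
    also have "expect (conv_list (map (Y_law m t) js)) (\<lambda>s. cis (u * s)) = (\<Prod>j\<leftarrow>js. phi m t j u)"
      by (subst conv_list_char) (auto simp: finite_Y_law o_def phi_def)
    finally show ?thesis .
  qed
  then show ?thesis unfolding phi_def[of m t n] expect_Y_rec[OF assms]
    by (simp add: sum_distrib_left scaleR_conv_of_real divide_inverse mult.commute)
qed

section \<open>Averages over the root split\<close>

text \<open>The coefficients of \<open>(1 - z) powr (-a)\<close>.\<close>

definition rising_coeff :: "real \<Rightarrow> nat \<Rightarrow> real" where
  "rising_coeff a n = (- 1) ^ n * ((- a) gchoose n)"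

lemma rising_coeff_mult: "Abs_fps (rising_coeff a) * Abs_fps (rising_coeff b) = Abs_fps (rising_coeff (a + b))"
proof (rule fps_ext)
  fix n
  have "(Abs_fps (rising_coeff a) * Abs_fps (rising_coeff b)) $ n =
    (\<Sum>k\<le>n. (- 1) ^ n * (((- a) gchoose k) * ((- b) gchoose (n - k))))"
    unfolding fps_mult_nth_atMost rising_coeff_def fps_nth_Abs_fps
  proof (intro sum.cong refl)
    fix k assume "k \<in> {..n}"
    then have "(- 1 :: real) ^ n = (- 1) ^ k * (- 1) ^ (n - k)" by (simp flip: power_add)
    then show "(- 1) ^ k * (- a gchoose k) * ((- 1) ^ (n - k) * (- b gchoose (n - k))) =
      (- 1) ^ n * ((- a gchoose k) * (- b gchoose (n - k)))" by simp
  qed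
  also have "\<dots> = (- 1) ^ n * ((- a + - b) gchoose n)"
    unfolding sum_distrib_left[symmetric] atMost_atLeast0 gbinomial_Vandermonde ..
  finally show "(Abs_fps (rising_coeff a) * Abs_fps (rising_coeff b)) $ n = Abs_fps (rising_coeff (a + b)) $ n"
    by (simp add: rising_coeff_def)
qed

lemma rising_coeff_0: "Abs_fps (rising_coeff 0) = 1"
  by (rule fps_ext) (auto simp: rising_coeff_def gbinomial_0_left)

lemma rising_coeff_1: "Abs_fps (rising_coeff 1) = ones"
proof (rule fps_ext)
  fix n
  have "((- 1 :: real) gchoose n) = (- 1) ^ n"
    using gbinomial_minus[of "1 :: real" n] by (simp add: binomial_gbinomial[symmetric])
  then show "Abs_fps (rising_coeff 1) $ n = ones $ n"
    by (simp add: rising_coeff_def power_mult_distrib[symmetric])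
qed

lemma ones_power: "ones ^ r = Abs_fps (rising_coeff (real r))"
proof (induction r)
  case (Suc r)
  then show ?case using rising_coeff_mult[of 1 "real r"] by (simp add: rising_coeff_1 add.commute)
qed (simp add: rising_coeff_0)

lemma rising_coeff_asymp:
  "(\<lambda>n. rising_coeff a n * real n powr (1 - a)) \<longlonglongrightarrow> inverse (Gamma a)"
proof -
  have "(\<lambda>n. ((- a) gchoose n) / ((- 1) ^ n / exp ((- a + 1) * of_real (ln (real n))))) \<longlonglongrightarrow> inverse (Gamma (- (- a)))"
    by (rule gbinomial_asymptotic)
  then have "(\<lambda>n. ((- a) gchoose n) / ((- 1) ^ n / exp ((- a + 1) * ln (real n)))) \<longlonglongrightarrow> inverse (Gamma a)" by simp
  moreover have "\<forall>\<^sub>F n in sequentially. ((- a) gchoose n) / ((- 1) ^ n / exp ((- a + 1) * ln (real n))) = rising_coeff a n * real n powr (1 - a)"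
    using eventually_gt_at_top[of 0]
  proof eventually_elim
    case (elim n)
    have "x / (- 1) ^ n = (- 1) ^ n * x" for x :: real by (cases "even n") auto
    then show ?case using elim by (simp add: rising_coeff_def powr_def divide_divide_eq_right add.commute)
  qed
  ultimately show ?thesis by (rule Lim_transform_eventually)
qed

lemma rising_coeff_ratio:
  assumes "a > 0" "b > 0"
  shows "(\<lambda>n. rising_coeff a n / rising_coeff b n * real n powr (b - a)) \<longlonglongrightarrow> Gamma b / Gamma a"
proof -
  have G: "Gamma a > 0" "Gamma b > 0" using assms by (auto intro: Gamma_real_pos)
  have "(\<lambda>n. (rising_coeff a n * real n powr (1 - a)) / (rising_coeff b n * real n powr (1 - b))) \<longlonglongrightarrow>
      inverse (Gamma a) / inverse (Gamma b)"
    using G by (intro tendsto_divide rising_coeff_asymp) auto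
  moreover have "\<forall>\<^sub>F n in sequentially. (rising_coeff a n * real n powr (1 - a)) / (rising_coeff b n * real n powr (1 - b)) =
      rising_coeff a n / rising_coeff b n * real n powr (b - a)"
    using eventually_gt_at_top[of 0]
  proof eventually_elim
    case (elim n)
    have "real n powr (1 - a) / real n powr (1 - b) = real n powr (b - a)"
      by (simp add: powr_diff[symmetric])
    then show ?case by (simp add: times_divide_times_eq[symmetric] del: times_divide_times_eq)
  qed
  ultimately have "(\<lambda>n. rising_coeff a n / rising_coeff b n * real n powr (b - a)) \<longlonglongrightarrow> inverse (Gamma a) / inverse (Gamma b)"
    by (rule Lim_transform_eventually)
  then show ?thesis by (simp add: field_simps)
qed

text \<open>The coefficients of \<open>Gamma (3/2) * (1 - z) powr (- 3/2)\<close>, normalised to be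
  asymptotic to \<open>sqrt n\<close>. Their convolutions with themselves and with powers of
  \<open>ones\<close> are again explicit coefficients, unlike those of the square roots.\<close>

definition hseq :: "nat \<Rightarrow> real" where
  "hseq n = Gamma (3 / 2) * rising_coeff (3 / 2) n"

lemma pos_notin_nonpos_Ints: "x > 0 \<Longrightarrow> (x :: real) \<notin> \<int>\<^sub>\<le>\<^sub>0"
  by (auto elim!: nonpos_Ints_cases)

lemma Gamma_3_2: "Gamma (3 / 2 :: real) > 0" "(Gamma (3 / 2 :: real))\<^sup>2 = pi / 4"
proof -
  have "Gamma (1 / 2 + 1 :: real) = 1 / 2 * Gamma (1 / 2)" by (rule Gamma_plus1) (simp add: pos_notin_nonpos_Ints)
  then have g: "Gamma (3 / 2 :: real) = sqrt pi / 2" by (simp add: Gamma_one_half_real)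
  show "Gamma (3 / 2 :: real) > 0" "(Gamma (3 / 2 :: real))\<^sup>2 = pi / 4"
    unfolding g by (simp_all add: power_divide)
qed

lemma hseq_asymp: "(\<lambda>n. hseq n / sqrt (real n)) \<longlonglongrightarrow> 1"
proof -
  have "(\<lambda>n. Gamma (3 / 2) * (rising_coeff (3 / 2) n * real n powr (1 - 3 / 2))) \<longlonglongrightarrow> Gamma (3 / 2) * inverse (Gamma (3 / 2))"
    by (intro tendsto_mult tendsto_const rising_coeff_asymp)
  then have "(\<lambda>n. hseq n * real n powr (- 1 / 2)) \<longlonglongrightarrow> 1"
    using Gamma_3_2(1) by (simp add: hseq_def mult.assoc)
  moreover have "hseq n * real n powr (- 1 / 2) = hseq n / sqrt (real n)" for n
    using powr_minus_divide[of "real n" "1 / 2"] by (simp add: powr_half_sqrt)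
  ultimately show ?thesis by simp
qed

lemma choose_rising_coeff:
  assumes "1 \<le> m" "m - 1 \<le> n"
  shows "real (n choose (m - 1)) = rising_coeff (real m) (n - (m - 1))"
proof -
  have "real (card (comps m (n - (m - 1)))) = (\<Sum>js\<in>comps m (n - (m - 1)). 1)" by simp
  also have "\<dots> = rising_coeff (real m) (n - (m - 1))" unfolding sum_comps_0 ones_power by simp
  finally show ?thesis using card_comps_choose[OF assms] by simp
qed

definition avg :: "nat \<Rightarrow> nat \<Rightarrow> (nat list \<Rightarrow> real) \<Rightarrow> real" where
  "avg m n f = (\<Sum>js\<in>comps m (n - (m - 1)). f js) / real (n choose (m - 1))"

lemma avg_const: "1 \<le> m \<Longrightarrow> m - 1 \<le> n \<Longrightarrow> avg m n (\<lambda>_. c) = c"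
  using card_comps_choose[of m n] by (simp add: avg_def del: One_nat_def)

lemma avg_add: "avg m n (\<lambda>js. f js + g js) = avg m n f + avg m n g"
  by (simp add: avg_def sum.distrib add_divide_distrib)

lemma avg_diff: "avg m n (\<lambda>js. f js - g js) = avg m n f - avg m n g"
  by (simp add: avg_def sum_subtractf diff_divide_distrib)

lemma avg_mult: "avg m n (\<lambda>js. c * f js) = c * avg m n f"
  by (simp add: avg_def sum_distrib_left)

lemma avg_mono: "(\<And>js. js \<in> comps m (n - (m - 1)) \<Longrightarrow> f js \<le> g js) \<Longrightarrow> avg m n f \<le> avg m n g"
  by (auto simp: avg_def intro!: divide_right_mono sum_mono)

lemma avg_abs: "\<bar>avg m n f\<bar> \<le> avg m n (\<lambda>js. \<bar>f js\<bar>)"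
  by (auto simp: avg_def abs_divide intro!: divide_right_mono sum_abs)

lemma avg_bound:
  assumes "1 \<le> m" "m - 1 \<le> n" "\<And>js. js \<in> comps m (n - (m - 1)) \<Longrightarrow> \<bar>f js\<bar> \<le> c"
  shows "\<bar>avg m n f\<bar> \<le> c"
proof -
  have "\<bar>avg m n f\<bar> \<le> avg m n (\<lambda>js. \<bar>f js\<bar>)" by (rule avg_abs)
  also have "\<dots> \<le> avg m n (\<lambda>_. c)" using assms by (intro avg_mono)
  finally show ?thesis using assms by (simp add: avg_const)
qed

lemma comps_member:
  assumes "js \<in> comps m (n - (m - 1))" "j \<in> set js"
  shows "j \<le> n"
proof -
  have "j \<le> sum_list js" using assms(2) by (auto intro!: member_le_sum_list)
  then show ?thesis using assms(1) by (simp add: comps_def)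
qed

lemma sum_list_comps_bound:
  fixes f g :: "nat \<Rightarrow> real"
  assumes "js \<in> comps m (n - (m - 1))" "\<And>j. j \<le> n \<Longrightarrow> \<bar>f j - g j\<bar> \<le> c"
  shows "\<bar>sum_list (map f js) - sum_list (map g js)\<bar> \<le> real m * c"
proof -
  have "\<bar>sum_list (map f xs) - sum_list (map g xs)\<bar> \<le> real (length xs) * c" if "\<And>j. j \<in> set xs \<Longrightarrow> \<bar>f j - g j\<bar> \<le> c" for xs
    using that
  proof (induction xs)
    case (Cons x xs)
    have "\<bar>f x - g x\<bar> \<le> c" "\<bar>sum_list (map f xs) - sum_list (map g xs)\<bar> \<le> real (length xs) * c"
      using Cons by auto
    then have "\<bar>(f x - g x) + (sum_list (map f xs) - sum_list (map g xs))\<bar> \<le> c + real (length xs) * c"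
      by linarith
    then show ?case by (simp add: algebra_simps)
  qed simp
  moreover have "length js = m" using assms(1) by (simp add: comps_def)
  ultimately show ?thesis using assms comps_member by blast
qed

text \<open>Approximating a sequence by multiples of an unbounded, almost monotone one is automatically
  uniform over initial segments.\<close>

lemma uniform_approx:
  fixes f q :: "nat \<Rightarrow> real"
  assumes lim: "(\<lambda>n. f n / q n) \<longlonglongrightarrow> c" and q: "filterlim q at_top at_top"
    and q2: "\<And>n j. n \<ge> N0 \<Longrightarrow> j \<le> n \<Longrightarrow> q j \<le> 2 * q n" and "e > 0"
  shows "\<exists>N. \<forall>n\<ge>N. \<forall>j\<le>n. \<bar>f j - c * q j\<bar> \<le> e * q n"
proof -
  have "(\<lambda>n. \<bar>f n / q n - c\<bar>) \<longlonglongrightarrow> \<bar>c - c\<bar>" by (intro tendsto_intros lim)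
  note abs_lim = this
  have "\<forall>\<^sub>F n in sequentially. \<bar>f n / q n - c\<bar> < e / 2 \<and> q n > 0"
  proof (rule eventually_conj)
    show "\<forall>\<^sub>F n in sequentially. \<bar>f n / q n - c\<bar> < e / 2"
      using abs_lim by (rule order_tendstoD(2)) (use \<open>e > 0\<close> in simp)
    show "\<forall>\<^sub>F n in sequentially. q n > 0" using q unfolding filterlim_at_top_dense by blast
  qed
  then obtain N1 where N1: "\<And>n. n \<ge> N1 \<Longrightarrow> \<bar>f n / q n - c\<bar> < e / 2 \<and> q n > 0"
    unfolding eventually_sequentially by blast
  define C where "C = (\<Sum>j<N1. \<bar>f j - c * q j\<bar>)"
  have "\<forall>\<^sub>F n in sequentially. q n \<ge> C / e" using q by (simp add: filterlim_at_top)
  then obtain N2 where N2: "\<And>n. n \<ge> N2 \<Longrightarrow> q n \<ge> C / e" unfolding eventually_sequentially by blast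
  have "\<bar>f j - c * q j\<bar> \<le> e * q n" if n: "n \<ge> max N0 N2" and j: "j \<le> n" for n j
  proof (cases "j < N1")
    case True
    then have "\<bar>f j - c * q j\<bar> \<le> C" unfolding C_def by (intro member_le_sum) auto
    also have "\<dots> \<le> e * q n" using N2[of n] n \<open>e > 0\<close> by (simp add: field_simps)
    finally show ?thesis .
  next
    case False
    then have qj: "\<bar>f j / q j - c\<bar> < e / 2" "q j > 0" using N1[of j] by auto
    have "\<bar>f j - c * q j\<bar> = \<bar>f j / q j - c\<bar> * q j"
    proof -
      have "f j - c * q j = (f j / q j - c) * q j" using qj by (simp add: left_diff_distrib)
      then show ?thesis using qj by (simp add: abs_mult)
    qed
    also have "\<dots> \<le> e / 2 * q j" using qj by (intro mult_right_mono) auto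
    also have "\<dots> \<le> e / 2 * (2 * q n)" using q2[of n j] n j \<open>e > 0\<close> by (intro mult_left_mono) auto
    finally show ?thesis by simp
  qed
  then show ?thesis by blast
qed

lemma hseq_uniform:
  assumes "e > 0"
  shows "\<exists>N. \<forall>n\<ge>N. \<forall>j\<le>n. \<bar>hseq j - sqrt (real j)\<bar> \<le> e * sqrt (real n)"
proof -
  have "filterlim (\<lambda>n. sqrt (real n)) at_top at_top" by real_asymp
  moreover have "sqrt (real j) \<le> 2 * sqrt (real n)" if "j \<le> n" for j n
  proof -
    have "sqrt (real j) \<le> sqrt (real n)" "0 \<le> sqrt (real n)" using that by auto
    then show ?thesis by linarith
  qed
  ultimately show ?thesis using uniform_approx[OF hseq_asymp, of 0 e] assms by simp
qed

lemma hseq_sq_uniform: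
  assumes "e > 0"
  shows "\<exists>N. \<forall>n\<ge>N. \<forall>j\<le>n. \<bar>(hseq j)\<^sup>2 - real j\<bar> \<le> e * real n"
proof -
  have "(\<lambda>n. (hseq n / sqrt (real n))\<^sup>2) \<longlonglongrightarrow> 1\<^sup>2" by (intro tendsto_power hseq_asymp)
  then have "(\<lambda>n. (hseq n)\<^sup>2 / real n) \<longlonglongrightarrow> 1" by (simp add: power_divide)
  moreover have "filterlim (\<lambda>n. real n) at_top at_top" by real_asymp
  ultimately show ?thesis using uniform_approx[of "\<lambda>n. (hseq n)\<^sup>2" real 1 0 e] assms by simp
qed

lemma rho_lessThan: "2 \<le> m \<Longrightarrow> rho m = (\<Prod>k<m - 1. 3 / 2 + real k)"
  unfolding rho_def by (rule prod.cong) auto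

lemma rho_pos: "rho m > 0"
  unfolding rho_def by (intro prod_pos) (simp add: add_pos_nonneg)

lemma rho_less_fact: "2 \<le> m \<Longrightarrow> rho m < fact m"
proof -
  assume m: "2 \<le> m"
  have "rho m < (\<Prod>k<m - 1. 2 + real k)"
    unfolding rho_lessThan[OF m] by (rule prod_mono_strict[where i = 0]) (use m in auto)
  also have "\<dots> = fact m" using prod_two_add[of "m - 1"] m by simp
  finally show ?thesis .
qed

text \<open>The functional equation of \<open>Gamma\<close>, iterated from \<open>3/2\<close> up to
  \<open>m + 1/2\<close>. This is how \<open>rho\<close> enters the averages.\<close>

lemma Gamma_rho:
  assumes "2 \<le> m"
  shows "Gamma (real m + 1 / 2) = Gamma (3 / 2) * rho m"
proof -
  have "Gamma (3 / 2 + real j) = Gamma (3 / 2) * (\<Prod>k<j. 3 / 2 + real k)" for j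
  proof (induction j)
    case (Suc j)
    have "Gamma ((3 / 2 + real j) + 1) = (3 / 2 + real j) * Gamma (3 / 2 + real j)"
      by (rule Gamma_plus1, rule pos_notin_nonpos_Ints) (simp add: add_pos_nonneg)
    then show ?case using Suc by (simp add: add_ac mult_ac)
  qed simp
  moreover have "3 / 2 + real (m - 1) = real m + 1 / 2" using assms by (simp add: of_nat_diff)
  ultimately show ?thesis by (metis rho_lessThan[OF assms])
qed

lemma shifted_filterlim: "filterlim (\<lambda>n::nat. n - c) at_top at_top"
  by (rule filterlim_at_top_mono[of "\<lambda>n. n - c"]) (auto simp: filterlim_minus_const_nat_at_top)

text \<open>The average is \<open>m * Gamma (3/2)\<close> times the quotient of the coefficients of
  \<open>(1 - z) powr (- (m + 1/2))\<close> and \<open>(1 - z) powr (- m)\<close> at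
  \<open>n - (m - 1)\<close>. Their growth contributes \<open>Gamma m / Gamma (m + 1/2)\<close>, and
  \<open>m * Gamma m = m!\<close> gives the limit.\<close>

lemma avg_hseq:
  assumes m: "2 \<le> m"
  shows "(\<lambda>n. avg m n (\<lambda>js. sum_list (map hseq js)) / sqrt (real n)) \<longlonglongrightarrow> fact m / rho m"
proof -
  define a where "a = real m + 1 / 2"
  have "(\<lambda>N. rising_coeff a N / rising_coeff (real m) N * real N powr (real m - a)) \<longlonglongrightarrow> Gamma (real m) / Gamma a"
    using m by (intro rising_coeff_ratio) (auto simp: a_def)
  then have "(\<lambda>n. rising_coeff a (n - (m - 1)) / rising_coeff (real m) (n - (m - 1)) * real (n - (m - 1)) powr (real m - a))
      \<longlonglongrightarrow> Gamma (real m) / Gamma a"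
    by (rule filterlim_compose) (rule shifted_filterlim)
  moreover have "(\<lambda>n. sqrt (real (n - (m - 1)) / real n)) \<longlonglongrightarrow> sqrt 1"
  proof (intro tendsto_real_sqrt)
    have "(\<lambda>n. (real n - real (m - 1)) / real n) \<longlonglongrightarrow> 1" by real_asymp
    then show "(\<lambda>n. real (n - (m - 1)) / real n) \<longlonglongrightarrow> 1"
      by (rule Lim_transform_eventually) (use eventually_ge_at_top[of "m - 1"] in eventually_elim, simp add: of_nat_diff)
  qed
  ultimately have "(\<lambda>n. (real m * Gamma (3 / 2)) * (rising_coeff a (n - (m - 1)) / rising_coeff (real m) (n - (m - 1)) * real (n - (m - 1)) powr (real m - a)
      * sqrt (real (n - (m - 1)) / real n))) \<longlonglongrightarrow> (real m * Gamma (3 / 2)) * (Gamma (real m) / Gamma a * sqrt 1)"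
    by (intro tendsto_mult tendsto_const)
  also have "(real m * Gamma (3 / 2)) * (Gamma (real m) / Gamma a * sqrt 1) = fact m / rho m"
  proof -
    have "Gamma (real m + 1) = real m * Gamma (real m)" using m by (intro Gamma_plus1 pos_notin_nonpos_Ints) simp
    then have "real m * Gamma (real m) = fact m" using Gamma_fact[of m, where ?'a = real] by (simp add: add.commute)
    then show ?thesis using Gamma_rho[OF m] less_imp_neq[OF Gamma_3_2(1)] rho_pos[of m] by (simp add: a_def field_simps)
  qed
  finally show ?thesis
  proof (rule Lim_transform_eventually)
    show "\<forall>\<^sub>F n in sequentially. (real m * Gamma (3 / 2)) * (rising_coeff a (n - (m - 1)) / rising_coeff (real m) (n - (m - 1)) * real (n - (m - 1)) powr (real m - a)
      * sqrt (real (n - (m - 1)) / real n)) = avg m n (\<lambda>js. sum_list (map hseq js)) / sqrt (real n)"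
      using eventually_ge_at_top[of m]
    proof eventually_elim
      case (elim n)
      define N where "N = n - (m - 1)"
      have N: "real N > 0" using elim m by (simp add: N_def)
      have "Abs_fps hseq = fps_const (Gamma (3 / 2)) * Abs_fps (rising_coeff (3 / 2))"
        by (rule fps_ext) (simp add: hseq_def)
      then have "of_nat m * ones ^ (m - 1) * Abs_fps hseq =
        fps_const (real m * Gamma (3 / 2)) * (ones ^ (m - 1) * Abs_fps (rising_coeff (3 / 2)))"
        by (simp only: fps_of_nat[symmetric] fps_const_mult[symmetric] mult_ac)
      also have "ones ^ (m - 1) * Abs_fps (rising_coeff (3 / 2)) = Abs_fps (rising_coeff a)"
        using m by (simp only: ones_power rising_coeff_mult) (simp add: a_def of_nat_diff add.commute)
      finally have "avg m n (\<lambda>js. sum_list (map hseq js)) = real m * Gamma (3 / 2) * rising_coeff a N / rising_coeff (real m) N"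
        using m elim unfolding avg_def sum_comps_1 N_def by (subst choose_rising_coeff) auto
      moreover have "real N powr (real m - a) * sqrt (real N / real n) = 1 / sqrt (real n)"
      proof -
        have "real N powr (real m - a) = 1 / sqrt (real N)"
          using powr_minus_divide[of "real N" "1 / 2"] by (simp add: a_def powr_half_sqrt)
        then show ?thesis using N by (simp add: real_sqrt_divide)
      qed
      ultimately show ?case unfolding N_def[symmetric] by (simp add: mult.assoc)
    qed
  qed
qed

text \<open>On the diagonal \<open>(hseq j)^2\<close> is close to \<open>j\<close>, and the subtree
  sizes add up to \<open>n - (m - 1)\<close>, so this part tends to 1. The
  \<open>m * (m - 1)\<close> mixed products form a coefficient of
  \<open>(Gamma (3/2))^2 * (1 - z) powr (- (m + 1))\<close>, where
  \<open>(Gamma (3/2))^2 = pi / 4\<close> and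
  \<open>Gamma m / Gamma (m + 1) = 1 / m\<close>.\<close>

lemma avg_hseq_sq:
  assumes m: "2 \<le> m"
  shows "(\<lambda>n. avg m n (\<lambda>js. (sum_list (map hseq js))\<^sup>2) / real n) \<longlonglongrightarrow> 1 + (real m - 1) * (pi / 4)"
proof -
  define b where "b = real m + 1"
  have shift: "(\<lambda>n. real (n - (m - 1)) / real n) \<longlonglongrightarrow> 1"
  proof -
    have "(\<lambda>n. (real n - real (m - 1)) / real n) \<longlonglongrightarrow> 1" by real_asymp
    then show ?thesis
      by (rule Lim_transform_eventually) (use eventually_ge_at_top[of "m - 1"] in eventually_elim, simp add: of_nat_diff)
  qed
  have diag: "(\<lambda>n. avg m n (\<lambda>js. sum_list (map (\<lambda>j. (hseq j)\<^sup>2) js)) / real n) \<longlonglongrightarrow> 1"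
  proof -
    have "(\<lambda>n. avg m n (\<lambda>js. sum_list (map (\<lambda>j. (hseq j)\<^sup>2) js)) / real n - real (n - (m - 1)) / real n) \<longlonglongrightarrow> 0"
    proof (rule LIMSEQ_I)
      fix e :: real assume "e > 0"
      define d where "d = e / (2 * real m)"
      have "d > 0" using \<open>e > 0\<close> m by (simp add: d_def)
      then obtain N where N: "\<And>n j. n \<ge> N \<Longrightarrow> j \<le> n \<Longrightarrow> \<bar>(hseq j)\<^sup>2 - real j\<bar> \<le> d * real n"
        using hseq_sq_uniform by blast
      have "norm (avg m n (\<lambda>js. sum_list (map (\<lambda>j. (hseq j)\<^sup>2) js)) / real n - real (n - (m - 1)) / real n - 0) < e"
        if n: "n \<ge> max N m" for n
      proof -
        have npos: "real n > 0" using n m by simp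
        have "\<bar>avg m n (\<lambda>js. sum_list (map (\<lambda>j. (hseq j)\<^sup>2) js) - real (n - (m - 1)))\<bar> \<le> real m * (d * real n)"
        proof (rule avg_bound)
          fix js assume js: "js \<in> comps m (n - (m - 1))"
          have "sum_list (map real js) = real (n - (m - 1))"
          proof -
            have "sum_list (map real xs) = real (sum_list xs)" for xs by (induction xs) auto
            then show ?thesis using js by (simp add: comps_def)
          qed
          moreover have "\<bar>sum_list (map (\<lambda>j. (hseq j)\<^sup>2) js) - sum_list (map real js)\<bar> \<le> real m * (d * real n)"
            by (rule sum_list_comps_bound[OF js]) (use N n in auto)
          ultimately show "\<bar>sum_list (map (\<lambda>j. (hseq j)\<^sup>2) js) - real (n - (m - 1))\<bar> \<le> real m * (d * real n)"
            by (simp only:)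
        qed (use n m in auto)
        then have "\<bar>avg m n (\<lambda>js. sum_list (map (\<lambda>j. (hseq j)\<^sup>2) js)) - real (n - (m - 1))\<bar> \<le> real m * (d * real n)"
          using n m by (simp add: avg_diff avg_const)
        then have "\<bar>avg m n (\<lambda>js. sum_list (map (\<lambda>j. (hseq j)\<^sup>2) js)) - real (n - (m - 1))\<bar> / real n \<le> real m * d"
          using npos by (simp add: field_simps)
        also have "\<dots> < e" using \<open>e > 0\<close> m by (simp add: d_def)
        finally show ?thesis using npos by (simp add: diff_divide_distrib[symmetric] abs_divide)
      qed
      then show "\<exists>no. \<forall>n\<ge>no. norm (avg m n (\<lambda>js. sum_list (map (\<lambda>j. (hseq j)\<^sup>2) js)) / real n - real (n - (m - 1)) / real n - 0) < e"
        by blast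
    qed
    from tendsto_add[OF this shift] show ?thesis by simp
  qed
  have "(\<lambda>N. rising_coeff b N / rising_coeff (real m) N * real N powr (real m - b)) \<longlonglongrightarrow> Gamma (real m) / Gamma b"
    using m by (intro rising_coeff_ratio) (auto simp: b_def)
  then have "(\<lambda>n. rising_coeff b (n - (m - 1)) / rising_coeff (real m) (n - (m - 1)) * real (n - (m - 1)) powr (real m - b))
      \<longlonglongrightarrow> Gamma (real m) / Gamma b"
    by (rule filterlim_compose) (rule shifted_filterlim)
  then have "(\<lambda>n. (real (m * (m - 1)) * (pi / 4)) * (rising_coeff b (n - (m - 1)) / rising_coeff (real m) (n - (m - 1)) * real (n - (m - 1)) powr (real m - b)
      * (real (n - (m - 1)) / real n))) \<longlonglongrightarrow> (real (m * (m - 1)) * (pi / 4)) * (Gamma (real m) / Gamma b * 1)"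
    by (intro tendsto_mult tendsto_const shift)
  also have "(real (m * (m - 1)) * (pi / 4)) * (Gamma (real m) / Gamma b * 1) = (real m - 1) * (pi / 4)"
  proof -
    have "Gamma (real m + 1) = real m * Gamma (real m)" using m by (intro Gamma_plus1 pos_notin_nonpos_Ints) simp
    moreover have "Gamma (real m) > 0" using m by (intro Gamma_real_pos) simp
    ultimately have "Gamma (real m) / Gamma b = 1 / real m" by (simp add: b_def)
    then show ?thesis using m by (simp add: of_nat_diff)
  qed
  finally have cross: "(\<lambda>n. (real (m * (m - 1)) * (pi / 4)) * (rising_coeff b (n - (m - 1)) / rising_coeff (real m) (n - (m - 1)) * real (n - (m - 1)) powr (real m - b)
      * (real (n - (m - 1)) / real n))) \<longlonglongrightarrow> (real m - 1) * (pi / 4)" .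
  have "(\<lambda>n. avg m n (\<lambda>js. sum_list (map (\<lambda>j. (hseq j)\<^sup>2) js)) / real n +
    (real (m * (m - 1)) * (pi / 4)) * (rising_coeff b (n - (m - 1)) / rising_coeff (real m) (n - (m - 1)) * real (n - (m - 1)) powr (real m - b)
      * (real (n - (m - 1)) / real n))) \<longlonglongrightarrow> 1 + (real m - 1) * (pi / 4)"
    by (rule tendsto_add[OF diag cross])
  then show ?thesis
  proof (rule Lim_transform_eventually)
    show "\<forall>\<^sub>F n in sequentially. avg m n (\<lambda>js. sum_list (map (\<lambda>j. (hseq j)\<^sup>2) js)) / real n +
    (real (m * (m - 1)) * (pi / 4)) * (rising_coeff b (n - (m - 1)) / rising_coeff (real m) (n - (m - 1)) * real (n - (m - 1)) powr (real m - b)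
      * (real (n - (m - 1)) / real n)) = avg m n (\<lambda>js. (sum_list (map hseq js))\<^sup>2) / real n"
      using eventually_ge_at_top[of m]
    proof eventually_elim
      case (elim n)
      define N where "N = n - (m - 1)"
      have N: "real N > 0" using elim m by (simp add: N_def)
      have H: "Abs_fps hseq = fps_const (Gamma (3 / 2)) * Abs_fps (rising_coeff (3 / 2))"
        by (rule fps_ext) (simp add: hseq_def)
      have "(Abs_fps hseq)\<^sup>2 = fps_const (pi / 4) * Abs_fps (rising_coeff 3)"
      proof -
        have "(Abs_fps hseq)\<^sup>2 = fps_const (Gamma (3 / 2) * Gamma (3 / 2)) * (Abs_fps (rising_coeff (3 / 2)) * Abs_fps (rising_coeff (3 / 2)))"
          unfolding H power2_eq_square fps_const_mult[symmetric] by (simp only: mult_ac)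
        then show ?thesis unfolding rising_coeff_mult by (simp add: Gamma_3_2(2)[symmetric] power2_eq_square)
      qed
      then have "of_nat (m * (m - 1)) * ones ^ (m - 2) * (Abs_fps hseq)\<^sup>2 =
        fps_const (real (m * (m - 1)) * (pi / 4)) * (ones ^ (m - 2) * Abs_fps (rising_coeff 3))"
        by (simp only: fps_of_nat[symmetric] fps_const_mult[symmetric] mult_ac)
      also have "ones ^ (m - 2) * Abs_fps (rising_coeff 3) = Abs_fps (rising_coeff b)"
        using m by (simp only: ones_power rising_coeff_mult) (simp add: b_def of_nat_diff add.commute)
      finally have "avg m n (\<lambda>js. (sum_list (map hseq js))\<^sup>2) = avg m n (\<lambda>js. sum_list (map (\<lambda>j. (hseq j)\<^sup>2) js)) +
          real (m * (m - 1)) * (pi / 4) * rising_coeff b N / rising_coeff (real m) N"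
        using m elim choose_rising_coeff[of m n] unfolding avg_def sum_comps_1 sum_comps_2 N_def fps_add_nth
        by (simp add: add_divide_distrib del: One_nat_def)
      moreover have "real N powr (real m - b) * (real N / real n) = 1 / real n"
        using N powr_minus_divide[of "real N" 1] by (simp add: b_def)
      moreover have "n \<noteq> 0" using m elim by simp
      ultimately show ?case unfolding N_def[symmetric] using m by (simp add: add_divide_distrib mult.assoc)
    qed
  qed
qed

section \<open>Mean\<close>

text \<open>The Stolz-Cesaro theorem.\<close>

lemma sum_ratio_tendsto:
  fixes a b :: "nat \<Rightarrow> real"
  assumes lim: "(\<lambda>k. a k / b k) \<longlonglongrightarrow> c" and pos: "\<And>k. b k > 0"
    and div: "filterlim (\<lambda>n. \<Sum>k<n. b k) at_top at_top"
  shows "(\<lambda>n. (\<Sum>k<n. a k) / (\<Sum>k<n. b k)) \<longlonglongrightarrow> c"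
proof (rule LIMSEQ_I)
  fix e :: real assume "e > 0"
  define B where "B n = (\<Sum>k<n. b k)" for n
  have "\<exists>N. \<forall>k\<ge>N. norm (a k / b k - c) < e / 2" using lim \<open>e > 0\<close> by (intro LIMSEQ_D) auto
  then obtain N where N: "\<And>k. k \<ge> N \<Longrightarrow> \<bar>a k / b k - c\<bar> < e / 2" by auto
  define C where "C = (\<Sum>k<N. \<bar>a k - c * b k\<bar>)"
  have "\<forall>\<^sub>F n in sequentially. B n > 2 * C / e" using div unfolding B_def filterlim_at_top_dense by blast
  moreover have "\<forall>\<^sub>F n in sequentially. B n > 0" using div unfolding B_def filterlim_at_top_dense by blast
  ultimately have "\<forall>\<^sub>F n in sequentially. B n > 2 * C / e \<and> B n > 0 \<and> n \<ge> N"
    by (intro eventually_conj eventually_ge_at_top)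
  then obtain N' where N': "\<And>n. n \<ge> N' \<Longrightarrow> B n > 2 * C / e \<and> B n > 0 \<and> n \<ge> N"
    unfolding eventually_sequentially by blast
  have "norm ((\<Sum>k<n. a k) / (\<Sum>k<n. b k) - c) < e" if "n \<ge> N'" for n
  proof -
    note n = N'[OF that]
    have term_le: "\<bar>a k - c * b k\<bar> \<le> e / 2 * b k" if "k \<ge> N" for k
    proof -
      have "a k - c * b k = (a k / b k - c) * b k" using pos[of k] by (simp add: left_diff_distrib)
      then have "\<bar>a k - c * b k\<bar> = \<bar>a k / b k - c\<bar> * b k" using pos[of k] by (simp add: abs_mult)
      also have "\<dots> \<le> e / 2 * b k" using N[OF that] pos[of k] by (intro mult_right_mono) auto
      finally show ?thesis .
    qed
    have "\<bar>(\<Sum>k<n. a k) - c * B n\<bar> = \<bar>\<Sum>k<n. a k - c * b k\<bar>"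
      by (simp add: B_def sum_subtractf sum_distrib_left)
    also have "\<dots> \<le> (\<Sum>k<n. \<bar>a k - c * b k\<bar>)" by (rule sum_abs)
    also have "(\<Sum>k<n. \<bar>a k - c * b k\<bar>) = C + (\<Sum>k\<in>{N..<n}. \<bar>a k - c * b k\<bar>)"
      unfolding C_def lessThan_atLeast0 using n by (simp add: sum.atLeastLessThan_concat)
    also have "(\<Sum>k\<in>{N..<n}. \<bar>a k - c * b k\<bar>) \<le> (\<Sum>k\<in>{N..<n}. e / 2 * b k)"
      by (intro sum_mono term_le) auto
    also have "\<dots> \<le> (\<Sum>k<n. e / 2 * b k)"
      using pos \<open>e > 0\<close> by (intro sum_mono2) (auto intro: less_imp_le)
    also have "\<dots> = e / 2 * B n" by (simp add: B_def sum_distrib_left)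
    finally have "\<bar>(\<Sum>k<n. a k) - c * B n\<bar> \<le> C + e / 2 * B n" by simp
    moreover have "C < e / 2 * B n" using n \<open>e > 0\<close> by (simp add: field_simps)
    ultimately have "\<bar>(\<Sum>k<n. a k) - c * B n\<bar> < e * B n" by simp
    moreover have "(\<Sum>k<n. a k) / B n - c = ((\<Sum>k<n. a k) - c * B n) / B n" using n by (simp add: diff_divide_distrib)
    ultimately show ?thesis using n unfolding B_def[symmetric] by (simp add: abs_divide pos_divide_less_eq)
  qed
  then show "\<exists>no. \<forall>n\<ge>no. norm ((\<Sum>k<n. a k) / (\<Sum>k<n. b k) - c) < e" by blast
qed

text \<open>With \<open>\<pi>\<close> replaced by a rational lower bound, the ratio below is decreasing in \<open>m\<close>, so that
  only \<open>m = 26\<close> needs to be computed.\<close>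

lemma sigma2_div_pos:
  assumes "2 \<le> m" "m \<le> 26"
  shows "sigma2_div m > 0"
proof -
  define c :: real where "c = 3.1415 / 4"
  define q where "q m = (rho m)\<^sup>2 * (c * (real m - 1) + 1) / (fact m)\<^sup>2" for m
  have q_step: "q (Suc m) \<le> q m" if "m \<ge> 2" for m
  proof -
    have r: "rho (Suc m) = rho m * (real m + 1 / 2)"
      using that by (cases m) (simp_all add: rho_lessThan algebra_simps)
    have "(real m + 1 / 2)\<^sup>2 * (c * real m + 1) \<le> (real m + 1)\<^sup>2 * (c * (real m - 1) + 1)"
    proof -
      have "(real m + 1)\<^sup>2 * (c * (real m - 1) + 1) - (real m + 1 / 2)\<^sup>2 * (c * real m + 1) = real m * (1 - 5 * c / 4) + (3 / 4 - c)"
        by (simp add: power2_eq_square field_simps)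
      also have "\<dots> \<ge> 2 * (1 - 5 * c / 4) + (3 / 4 - c)"
        using that by (intro add_mono mult_right_mono) (auto simp: c_def)
      finally show ?thesis by (simp add: c_def)
    qed
    then have "(real m + 1 / 2)\<^sup>2 * (c * real m + 1) / (real m + 1)\<^sup>2 \<le> c * (real m - 1) + 1"
      by (simp add: pos_divide_le_eq mult.commute)
    then have "(rho m)\<^sup>2 / (fact m)\<^sup>2 * ((real m + 1 / 2)\<^sup>2 * (c * real m + 1) / (real m + 1)\<^sup>2) \<le>
      (rho m)\<^sup>2 / (fact m)\<^sup>2 * (c * (real m - 1) + 1)" by (intro mult_left_mono) auto
    then show ?thesis by (simp add: q_def r power_mult_distrib mult_ac add.commute)
  qed
  have r26: "rho 26 = (\<Prod>k<25. 3 / 2 + real k)" by (simp add: rho_lessThan)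
  have "q 26 > 1"
    unfolding q_def r26 by (simp add: c_def fact_numeral lessThan_nat_numeral lessThan_Suc power2_eq_square)
  also have "q 26 \<le> q m"
    using assms(2,1) by (induction m rule: inc_induct) (auto intro: order_trans[OF _ q_step])
  finally have "(fact m)\<^sup>2 < (rho m)\<^sup>2 * (c * (real m - 1) + 1)" by (simp add: q_def)
  also have "\<dots> \<le> (rho m)\<^sup>2 * (pi / 4 * (real m - 1) + 1)"
    using pi_approx assms by (intro mult_left_mono add_mono mult_right_mono) (auto simp: c_def)
  finally have "(rho m)\<^sup>2 * (pi / 4 * (real m - 1) + 1) - (fact m)\<^sup>2 > 0" by simp
  moreover have "(harm m - 1) * (fact m - rho m)\<^sup>2 > 0"
    using harm_gt_1[OF assms(1)] rho_less_fact[OF assms(1)] by (intro mult_pos_pos) auto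
  ultimately show ?thesis unfolding sigma2_div_def by (rule divide_pos_pos)
qed

locale tree_asymp =
  fixes m :: nat and t l :: "nat \<Rightarrow> real"
  assumes m2: "2 \<le> m" and m26: "m \<le> 26" and sv: "sv_seq l" and t: "t \<sim>[at_top] svg l"
begin

abbreviation "G \<equiv> svg l"

definition "kappa = - rho m / (fact m - rho m)"
text \<open>Centred by a multiple of \<open>n + 1\<close> and not of \<open>n\<close>, because the
  subtree sizes, each increased by 1, add up to \<open>n + 1\<close>. The linear parts then cancel
  exactly in the residual.\<close>

definition "nu n = mean_X m t n - mean_slope m t * (real n + 1)"
text \<open>A smoothed version of \<open>2 * G\<close>. It satisfies an exact recurrence, which
  yields \<open>reg\<close> although nothing is known about the differences of
  \<open>l\<close>.\<close>

definition "gtail n = (real n + 1) * (\<Sum>i. K1_term t (i + n))"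

lemma K1_term_eq: "K1_term t = (\<lambda>k. t k / ((real k + 1) * (real k + 2)))"
  by (simp add: K1_term_def fun_eq_iff)

lemma summable_K1: "summable (K1_term t)"
  using karamata_tail(1)[OF sv t] by (simp add: K1_term_eq)

lemma gtail_lim: "(\<lambda>n. gtail n / G n) \<longlonglongrightarrow> 2"
  using karamata_tail(2)[OF sv t] unfolding gtail_def K1_term_eq .

lemma eventually_G_pos: "\<forall>\<^sub>F n in sequentially. G n > 0"
  using eventually_ge_at_top[of 1] by eventually_elim (rule svg_pos[OF sv])

lemma t_lim: "(\<lambda>n. t n / G n) \<longlonglongrightarrow> 1"
  using t by (rule asymp_equivD_strong) (use eventually_G_pos in eventually_elim, simp)

lemma eventually_gtail_pos: "\<forall>\<^sub>F n in sequentially. gtail n > 0"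
proof -
  have "\<forall>\<^sub>F n in sequentially. gtail n / G n > 0" by (rule order_tendstoD(1)[OF gtail_lim]) simp
  then show ?thesis using eventually_G_pos by eventually_elim (simp add: zero_less_divide_iff)
qed

lemma gtail_rec: "(real n + 1) * gtail (n + 1) = (real n + 2) * gtail n - t n"
proof -
  have "(\<Sum>i. K1_term t (Suc i + n)) = (\<Sum>i. K1_term t (i + n)) - K1_term t (0 + n)"
    using summable_K1 by (intro suminf_split_head) (simp add: summable_iff_shift)
  then have "(\<Sum>i. K1_term t (i + (n + 1))) = (\<Sum>i. K1_term t (i + n)) - K1_term t n" by simp
  moreover have "(real n + 1) * (real n + 2) * K1_term t n = t n"
  proof -
    have "(real n + 1) * (real n + 2) \<noteq> 0" by (simp add: add_nonneg_pos)
    then show ?thesis by (simp add: K1_term_def)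
  qed
  moreover have "(x + 1) * ((x + 2) * (S - K)) = (x + 2) * ((x + 1) * S) - (x + 1) * (x + 2) * K" for x S K :: real
    by (simp add: algebra_simps)
  moreover have "real (n + 1) + 1 = real n + 2" by simp
  ultimately show ?thesis unfolding gtail_def by (simp only:)
qed

text \<open>The recurrence turns the weighted difference into \<open>2 * gtail n - t n\<close>, and
  \<open>t n / gtail n\<close> tends to 1/2.\<close>

lemma reg_gtail: "reg gtail (3 / 2)"
proof -
  have "(\<lambda>n. 2 - (t n / G n) / (gtail n / G n)) \<longlonglongrightarrow> 2 - 1 / 2"
    by (intro tendsto_intros t_lim gtail_lim) simp
  moreover have "\<forall>\<^sub>F n in sequentially. 2 - (t n / G n) / (gtail n / G n) =
      (real (n + 1) * gtail (n + 1) - real n * gtail n) / gtail n"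
    using eventually_G_pos eventually_gtail_pos
  proof eventually_elim
    case (elim n)
    have "real (n + 1) * gtail (n + 1) - real n * gtail n = 2 * gtail n - t n"
      using gtail_rec[of n] by (simp add: algebra_simps)
    then show ?case using elim by (simp add: diff_divide_distrib)
  qed
  ultimately have "(\<lambda>n. (real (n + 1) * gtail (n + 1) - real n * gtail n) / gtail n) \<longlonglongrightarrow> 2 - 1 / 2"
    by (rule Lim_transform_eventually)
  then show ?thesis using eventually_gtail_pos by (simp add: reg_def)
qed

text \<open>With \<open>U\<close> the full series, the weighted toll sums minus \<open>U\<close>,
  times \<open>n + 1\<close>, are exactly \<open>- gtail n\<close>, so the constant in the transfer
  is \<open>- 1\<close>. The denominator is
  \<open>char_quot m (3/2) = 2 * (fact m - rho m)\<close>.\<close>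

lemma mean_transfer:
  "(\<lambda>n. (mean_X m t n - t n - mean_slope m t * (real n + 1)) / gtail n) \<longlonglongrightarrow> - fact m / (2 * (fact m - rho m))"
proof -
  have "(\<lambda>n. (real n + 1) * ((\<Sum>k<n. t k / ((real k + 1) * (real k + 2))) - (\<Sum>k. K1_term t k)) / gtail n) \<longlonglongrightarrow> - 1"
  proof (rule Lim_transform_eventually[OF tendsto_const])
    show "\<forall>\<^sub>F n in sequentially. - 1 = (real n + 1) * ((\<Sum>k<n. t k / ((real k + 1) * (real k + 2))) - (\<Sum>k. K1_term t k)) / gtail n"
      using eventually_gtail_pos
    proof eventually_elim
      case (elim n)
      have "(\<Sum>k. K1_term t k) = (\<Sum>i. K1_term t (i + n)) + (\<Sum>k<n. K1_term t k)"
        by (rule suminf_split_initial_segment[OF summable_K1])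
      then have "(real n + 1) * ((\<Sum>k<n. t k / ((real k + 1) * (real k + 2))) - (\<Sum>k. K1_term t k)) = - gtail n"
        by (simp add: K1_term_eq gtail_def)
      then show ?case using elim by simp
    qed
  qed
  then have "(\<lambda>n. (mean_X m t n - t n - (\<Sum>k. K1_term t k) / (harm m - 1) * (real n + 1)) / gtail n) \<longlonglongrightarrow>
      fact m * (- 1) / char_quot m (3 / 2)"
    by (rule transfer[OF m2 m26 tree_rec_mean[OF m2] reg_gtail order_refl])
  moreover have "fact m * (- 1) / char_quot m (3 / 2) = - fact m / (2 * (fact m - rho m))"
    by (simp add: char_quot_def rho_lessThan[OF m2] minus_divide_left[symmetric] field_simps)
  ultimately show ?thesis by (simp add: mean_slope_def)
qed

text \<open>The toll itself contributes 1. The transfer contributes twice its limit, because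
  \<open>gtail\<close> is asymptotic to \<open>2 * G\<close>.\<close>

lemma nu_lim: "(\<lambda>n. nu n / G n) \<longlonglongrightarrow> kappa"
proof -
  have "(\<lambda>n. t n / G n + (mean_X m t n - t n - mean_slope m t * (real n + 1)) / gtail n * (gtail n / G n))
      \<longlonglongrightarrow> 1 + - fact m / (2 * (fact m - rho m)) * 2"
    by (intro tendsto_intros t_lim mean_transfer gtail_lim)
  also have "1 + - fact m / (2 * (fact m - rho m)) * 2 = kappa"
    using rho_less_fact[OF m2] by (simp add: kappa_def field_simps)
  finally show ?thesis
  proof (rule Lim_transform_eventually)
    show "\<forall>\<^sub>F n in sequentially. t n / G n + (mean_X m t n - t n - mean_slope m t * (real n + 1)) / gtail n * (gtail n / G n) = nu n / G n"
      using eventually_G_pos eventually_gtail_pos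
      by eventually_elim (simp add: nu_def add_divide_distrib[symmetric])
  qed
qed

lemma inverse_G_lim: "(\<lambda>n. c / G n) \<longlonglongrightarrow> 0"
  using svg_at_top[OF sv] by (intro tendsto_divide_0[OF tendsto_const] filterlim_at_top_imp_at_infinity)

lemma mean_lim: "(\<lambda>n. (mean_X m t n - mean_slope m t * real n) / G n) \<longlonglongrightarrow> kappa"
proof -
  have "(\<lambda>n. nu n / G n + mean_slope m t / G n) \<longlonglongrightarrow> kappa + 0"
    by (intro tendsto_add nu_lim inverse_G_lim)
  then show ?thesis by (simp add: nu_def add_divide_distrib[symmetric] algebra_simps)
qed

lemma mean_expansion:
  "(\<lambda>n. mean_X m t n - (mean_slope m t * real n - rho m / (fact m - rho m) * G n)) \<in> o[at_top](G)"
proof (rule smalloI_tendsto)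
  have "(\<lambda>n. (mean_X m t n - mean_slope m t * real n) / G n - kappa) \<longlonglongrightarrow> kappa - kappa"
    by (intro tendsto_diff mean_lim tendsto_const)
  also have "kappa - kappa = 0" by simp
  finally show "(\<lambda>n. (mean_X m t n - (mean_slope m t * real n - rho m / (fact m - rho m) * G n)) / G n) \<longlonglongrightarrow> 0"
  proof (rule Lim_transform_eventually)
    show "\<forall>\<^sub>F n in sequentially. (mean_X m t n - mean_slope m t * real n) / G n - kappa =
      (mean_X m t n - (mean_slope m t * real n - rho m / (fact m - rho m) * G n)) / G n"
      using eventually_G_pos
    proof eventually_elim
      case (elim n)
      have "mean_X m t n - (mean_slope m t * real n - rho m / (fact m - rho m) * G n) = (mean_X m t n - mean_slope m t * real n) - kappa * G n"
        by (simp add: kappa_def)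
      then show ?case using elim by (simp only: diff_divide_distrib[of _ "kappa * G n"]) simp
    qed
  qed
  show "\<forall>\<^sub>F n in sequentially. G n \<noteq> 0" using eventually_G_pos by eventually_elim simp
qed

lemma G_almost_mono: "\<exists>N. \<forall>n\<ge>N. \<forall>j\<le>n. G j \<le> 2 * G n"
proof -
  obtain N where N: "N \<ge> 1" "\<And>n j. N \<le> n \<Longrightarrow> j \<le> n \<Longrightarrow> \<bar>G j - sqrt (real j) * l n\<bar> \<le> 1 * G n"
    by (rule svg_uniform[OF sv zero_less_one]) blast
  have "G j \<le> 2 * G n" if "n \<ge> N" "j \<le> n" for n j
  proof -
    have "l n > 0" using sv_seq_pos[OF sv, of n] that N(1) by simp
    then have "sqrt (real j) * l n \<le> sqrt (real n) * l n" using that by (intro mult_right_mono) auto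
    then show ?thesis using N(2)[OF that] by (simp add: svg_def[of l n] abs_le_iff)
  qed
  then show ?thesis by blast
qed

text \<open>Three replacements at the cost of \<open>e / 3\<close> each: \<open>nu j\<close> by
  \<open>kappa * G j\<close>, then \<open>l j\<close> by \<open>l n\<close>, then
  \<open>sqrt j\<close> by \<open>hseq j\<close>. Afterwards the slowly varying factor no longer
  depends on the subtree and can be taken out of averages.\<close>

lemma nu_uniform:
  assumes "e > 0"
  shows "\<exists>N. \<forall>n\<ge>N. \<forall>j\<le>n. \<bar>nu j - kappa * (hseq j * l n)\<bar> \<le> e * G n"
proof -
  define K where "K = \<bar>kappa\<bar> + 1"
  have K: "K > 0" "\<bar>kappa\<bar> \<le> K" by (simp_all add: K_def add_nonneg_pos)
  define d where "d = e / (3 * K)"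
  have d: "d > 0" "\<bar>kappa\<bar> * d \<le> e / 3"
  proof -
    show "d > 0" using \<open>e > 0\<close> K(1) by (simp add: d_def)
    then have "\<bar>kappa\<bar> * d \<le> K * d" using K(2) by (intro mult_right_mono) auto
    also have "\<dots> = e / 3" using K(1) by (simp add: d_def)
    finally show "\<bar>kappa\<bar> * d \<le> e / 3" .
  qed
  obtain N0 where N0: "\<And>n j. n \<ge> N0 \<Longrightarrow> j \<le> n \<Longrightarrow> G j \<le> 2 * G n" using G_almost_mono by blast
  have "e / 3 > 0" using \<open>e > 0\<close> by simp
  then obtain N1 where N1: "\<And>n j. n \<ge> N1 \<Longrightarrow> j \<le> n \<Longrightarrow> \<bar>nu j - kappa * G j\<bar> \<le> e / 3 * G n"
    using uniform_approx[OF nu_lim svg_at_top[OF sv] N0] by blast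
  obtain N2 where N2: "N2 \<ge> 1" "\<And>n j. N2 \<le> n \<Longrightarrow> j \<le> n \<Longrightarrow> \<bar>G j - sqrt (real j) * l n\<bar> \<le> d * G n"
    by (rule svg_uniform[OF sv d(1)]) blast
  obtain N3 where N3: "\<And>n j. N3 \<le> n \<Longrightarrow> j \<le> n \<Longrightarrow> \<bar>hseq j - sqrt (real j)\<bar> \<le> d * sqrt (real n)"
    using hseq_uniform[OF d(1)] by blast
  have "\<bar>nu j - kappa * (hseq j * l n)\<bar> \<le> e * G n" if n: "n \<ge> max N1 (max N2 N3)" and j: "j \<le> n" for n j
  proof -
    have ln: "l n > 0" using sv_seq_pos[OF sv, of n] n N2(1) by simp
    have Gn: "G n \<ge> 0" by (rule svg_nonneg[OF sv])
    have a1: "\<bar>nu j - kappa * G j\<bar> \<le> e / 3 * G n" using N1 n j by simp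
    have "\<bar>kappa * G j - kappa * (sqrt (real j) * l n)\<bar> = \<bar>kappa\<bar> * \<bar>G j - sqrt (real j) * l n\<bar>"
      by (simp only: right_diff_distrib[symmetric] abs_mult)
    also have "\<dots> \<le> \<bar>kappa\<bar> * (d * G n)" using N2(2)[of n j] n j by (intro mult_left_mono) auto
    also have "\<dots> \<le> e / 3 * G n" using mult_right_mono[OF d(2) Gn] by (simp add: mult.assoc)
    finally have a2: "\<bar>kappa * G j - kappa * (sqrt (real j) * l n)\<bar> \<le> e / 3 * G n" .
    have "\<bar>kappa * (sqrt (real j) * l n) - kappa * (hseq j * l n)\<bar> = \<bar>kappa\<bar> * (\<bar>hseq j - sqrt (real j)\<bar> * l n)"
    proof -
      have "kappa * (sqrt (real j) * l n) - kappa * (hseq j * l n) = - (kappa * ((hseq j - sqrt (real j)) * l n))"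
        by (simp add: algebra_simps)
      then show ?thesis using ln by (simp add: abs_mult)
    qed
    also have "\<dots> \<le> \<bar>kappa\<bar> * (d * sqrt (real n) * l n)"
      using N3[of n j] n j ln by (intro mult_left_mono mult_right_mono) auto
    also have "\<dots> = \<bar>kappa\<bar> * d * G n" by (simp add: svg_def)
    also have "\<dots> \<le> e / 3 * G n" by (rule mult_right_mono[OF d(2) Gn])
    finally have a3: "\<bar>kappa * (sqrt (real j) * l n) - kappa * (hseq j * l n)\<bar> \<le> e / 3 * G n" .
    show ?thesis using a1 a2 a3 by linarith
  qed
  then show ?thesis by blast
qed

text \<open>The leading part of the residual divided by \<open>G n\<close>: the 1 comes from the
  toll, \<open>- kappa\<close> from the mean at \<open>n\<close>, and the last term from the means
  of the subtrees.\<close>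

definition "Z n js = 1 - kappa + kappa * (sum_list (map hseq js) / sqrt (real n))"

lemma resid_nu:
  assumes "n \<ge> m - 1" "js \<in> comps m (n - (m - 1))"
  shows "resid m t n js = t n + sum_list (map nu js) - nu n"
proof -
  have "sum_list (map nu xs) = sum_list (map (mean_X m t) xs) - mean_slope m t * (real (sum_list xs) + real (length xs))" for xs
    by (induction xs) (simp_all add: nu_def algebra_simps)
  moreover have "real (sum_list js) + real (length js) = real n + 1"
    using assms m2 by (simp add: comps_def of_nat_diff)
  ultimately show ?thesis by (simp add: resid_def nu_def)
qed

lemma resid_uniform:
  assumes "e > 0"
  shows "\<exists>N. \<forall>n\<ge>N. \<forall>js\<in>comps m (n - (m - 1)). \<bar>resid m t n js - G n * Z n js\<bar> \<le> e * G n"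
proof -
  define d where "d = e / (real m + 2)"
  have d: "d > 0" "(real m + 2) * d = e" using \<open>e > 0\<close> by (simp_all add: d_def add_nonneg_pos)
  obtain N1 where N1: "\<And>n j. n \<ge> N1 \<Longrightarrow> j \<le> n \<Longrightarrow> \<bar>nu j - kappa * (hseq j * l n)\<bar> \<le> d * G n"
    using nu_uniform[OF d(1)] by blast
  have "\<forall>\<^sub>F n in sequentially. \<bar>t n / G n - 1\<bar> < d"
    using LIMSEQ_D[OF t_lim d(1)] by (auto simp: eventually_sequentially)
  moreover have "\<forall>\<^sub>F n in sequentially. \<bar>nu n / G n - kappa\<bar> < d"
    using LIMSEQ_D[OF nu_lim d(1)] by (auto simp: eventually_sequentially)
  ultimately have "\<forall>\<^sub>F n in sequentially. \<bar>t n / G n - 1\<bar> < d \<and> \<bar>nu n / G n - kappa\<bar> < d"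
    by (rule eventually_conj)
  then obtain N2 where N2: "\<And>n. n \<ge> N2 \<Longrightarrow> \<bar>t n / G n - 1\<bar> < d \<and> \<bar>nu n / G n - kappa\<bar> < d"
    unfolding eventually_sequentially by blast
  have "\<bar>resid m t n js - G n * Z n js\<bar> \<le> e * G n" if n: "n \<ge> max m (max N1 N2)" and js: "js \<in> comps m (n - (m - 1))" for n js
  proof -
    have n1: "n \<ge> 1" using n m2 by simp
    have Gn: "G n > 0" by (rule svg_pos[OF sv n1])
    have "sum_list (map (\<lambda>j. c * (hseq j * x)) xs) = c * (sum_list (map hseq xs) * x)" for c x xs
      by (induction xs) (simp_all add: algebra_simps)
    moreover have "\<bar>sum_list (map nu js) - sum_list (map (\<lambda>j. kappa * (hseq j * l n)) js)\<bar> \<le> real m * (d * G n)"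
      by (rule sum_list_comps_bound[OF js]) (use N1 n in auto)
    ultimately have a: "\<bar>sum_list (map nu js) - kappa * (sum_list (map hseq js) * l n)\<bar> \<le> real m * (d * G n)" by simp
    have b: "\<bar>t n - G n\<bar> \<le> d * G n" "\<bar>nu n - kappa * G n\<bar> \<le> d * G n"
    proof -
      have "t n - G n = (t n / G n - 1) * G n" "nu n - kappa * G n = (nu n / G n - kappa) * G n"
        using Gn by (simp_all add: left_diff_distrib)
      then show "\<bar>t n - G n\<bar> \<le> d * G n" "\<bar>nu n - kappa * G n\<bar> \<le> d * G n"
        using N2[of n] n Gn by (simp_all add: abs_mult mult_right_mono less_imp_le)
    qed
    have c: "G n * Z n js = G n - kappa * G n + kappa * (sum_list (map hseq js) * l n)"
      using n1 by (simp add: Z_def svg_def algebra_simps)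
    have r: "resid m t n js = t n + sum_list (map nu js) - nu n" using js n by (intro resid_nu) auto
    have "\<bar>resid m t n js - G n * Z n js\<bar> \<le> real m * (d * G n) + (d * G n + d * G n)"
      unfolding c r using a b by linarith
    also have "\<dots> = ((real m + 2) * d) * G n" by (simp add: algebra_simps)
    finally show ?thesis unfolding d(2) .
  qed
  then show ?thesis by blast
qed

lemma Z_bound: "\<exists>B>0. \<exists>N. \<forall>n\<ge>N. \<forall>js\<in>comps m (n - (m - 1)). \<bar>Z n js\<bar> \<le> B"
proof -
  obtain N where N: "\<And>n j. n \<ge> N \<Longrightarrow> j \<le> n \<Longrightarrow> \<bar>hseq j - sqrt (real j)\<bar> \<le> 1 * sqrt (real n)"
    using hseq_uniform[of 1] by auto
  define B where "B = 1 + \<bar>kappa\<bar> + \<bar>kappa\<bar> * (real m * 2)"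
  have "\<bar>Z n js\<bar> \<le> B" if n: "n \<ge> max 1 N" and js: "js \<in> comps m (n - (m - 1))" for n js
  proof -
    have "\<bar>hseq j - 0\<bar> \<le> 2 * sqrt (real n)" if "j \<le> n" for j
    proof -
      have "sqrt (real j) \<le> sqrt (real n)" using that by simp
      moreover have "\<bar>hseq j - sqrt (real j)\<bar> \<le> 1 * sqrt (real n)" using N n that by simp
      moreover have "0 \<le> sqrt (real j)" by simp
      ultimately show ?thesis by linarith
    qed
    then have "\<bar>sum_list (map hseq js) - sum_list (map (\<lambda>_. 0) js)\<bar> \<le> real m * (2 * sqrt (real n))"
      by (rule sum_list_comps_bound[OF js])
    then have "\<bar>sum_list (map hseq js)\<bar> / sqrt (real n) \<le> real m * 2"
      using n by (simp add: pos_divide_le_eq)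
    then have "\<bar>sum_list (map hseq js) / sqrt (real n)\<bar> \<le> real m * 2" by (simp add: abs_divide)
    then have "\<bar>kappa * (sum_list (map hseq js) / sqrt (real n))\<bar> \<le> \<bar>kappa\<bar> * (real m * 2)"
      unfolding abs_mult by (intro mult_left_mono) auto
    then show ?thesis unfolding Z_def B_def by linarith
  qed
  moreover have "B > 0" unfolding B_def by (intro add_pos_nonneg) auto
  ultimately show ?thesis by blast
qed

lemma resid_bound: "\<exists>B>0. \<exists>N. \<forall>n\<ge>N. \<forall>js\<in>comps m (n - (m - 1)). \<bar>resid m t n js\<bar> \<le> B * G n"
proof -
  obtain B N1 where B: "B > 0" "\<And>n js. n \<ge> N1 \<Longrightarrow> js \<in> comps m (n - (m - 1)) \<Longrightarrow> \<bar>Z n js\<bar> \<le> B" using Z_bound by blast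
  obtain N2 where N2: "\<And>n js. n \<ge> N2 \<Longrightarrow> js \<in> comps m (n - (m - 1)) \<Longrightarrow> \<bar>resid m t n js - G n * Z n js\<bar> \<le> 1 * G n"
    using resid_uniform[of 1] by auto
  have "\<bar>resid m t n js\<bar> \<le> (B + 1) * G n" if n: "n \<ge> max N1 N2" and js: "js \<in> comps m (n - (m - 1))" for n js
  proof -
    have Gn: "G n \<ge> 0" by (rule svg_nonneg[OF sv])
    have "\<bar>G n * Z n js\<bar> \<le> G n * B" unfolding abs_mult using Gn B(2)[of n js] n js by (intro mult_mono) auto
    then show ?thesis using N2[of n js] n js by (simp add: algebra_simps)
  qed
  moreover have "B + 1 > 0" using B(1) by simp
  ultimately show ?thesis by blast
qed

text \<open>Meant to be the limit of \<open>var_toll m t n / (G n)^2\<close>; that it agrees with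
  the constant \<open>sigma2_div\<close> up to the factor \<open>harm m - 1\<close> is verified in
  \<open>avg_Z_sq\<close>.\<close>

definition "ctoll = sigma2_div m * (harm m - 1)"

lemma ctoll_pos: "ctoll > 0"
  unfolding ctoll_def using sigma2_div_pos[OF m2 m26] harm_gt_1[OF m2] by simp

text \<open>Expanding the square leaves the two averages of \<open>hseq\<close>. With
  \<open>D = m! - rho\<close> one has \<open>kappa = - rho / D\<close> and
  \<open>1 - kappa = m! / D\<close>, so the mixed term is \<open>- 2 * (m!)^2 / D^2\<close> and
  turns \<open>(m!)^2\<close> into \<open>- (m!)^2\<close>.\<close>

lemma avg_Z_sq: "(\<lambda>n. avg m n (\<lambda>js. (Z n js)\<^sup>2)) \<longlonglongrightarrow> ctoll"
proof -
  have "(\<lambda>n. (1 - kappa)\<^sup>2 + (2 * (1 - kappa) * kappa * (avg m n (\<lambda>js. sum_list (map hseq js)) / sqrt (real n))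
      + kappa\<^sup>2 * (avg m n (\<lambda>js. (sum_list (map hseq js))\<^sup>2) / real n)))
    \<longlonglongrightarrow> (1 - kappa)\<^sup>2 + (2 * (1 - kappa) * kappa * (fact m / rho m) + kappa\<^sup>2 * (1 + (real m - 1) * (pi / 4)))"
    by (intro tendsto_intros avg_hseq avg_hseq_sq m2)
  also have "(1 - kappa)\<^sup>2 + (2 * (1 - kappa) * kappa * (fact m / rho m) + kappa\<^sup>2 * (1 + (real m - 1) * (pi / 4))) = ctoll"
  proof -
    define D where "D = fact m - rho m"
    have D: "D \<noteq> 0" using rho_less_fact[OF m2] by (simp add: D_def)
    have H: "harm m - (1 :: real) \<noteq> 0" using harm_gt_1[OF m2] by simp
    have k: "kappa = - rho m / D" "1 - kappa = fact m / D" using D by (simp_all add: kappa_def D_def field_simps)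
    have r: "rho m \<noteq> 0" using rho_pos[of m] by simp
    have "(1 - kappa)\<^sup>2 + (2 * (1 - kappa) * kappa * (fact m / rho m) + kappa\<^sup>2 * (1 + (real m - 1) * (pi / 4)))
      = ((fact m)\<^sup>2 + (- 2 * (fact m)\<^sup>2 + (rho m)\<^sup>2 * (1 + (real m - 1) * (pi / 4)))) / D\<^sup>2"
    proof -
      have "(a / D)\<^sup>2 + (2 * (a / D) * (- r / D) * (a / r) + (- r / D)\<^sup>2 * W) = (a\<^sup>2 + (- 2 * a\<^sup>2 + r\<^sup>2 * W)) / D\<^sup>2"
        if "r \<noteq> 0" for a r W :: real
        using that D by (simp add: field_simps power2_eq_square)
      then show ?thesis unfolding k(2) unfolding k(1) using r by blast
    qed
    also have "\<dots> = ctoll"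
    proof -
      have "(fact m)\<^sup>2 + (- 2 * (fact m)\<^sup>2 + (rho m)\<^sup>2 * (1 + (real m - 1) * (pi / 4))) =
        (rho m)\<^sup>2 * (pi / 4 * (real m - 1) + 1) - (fact m)\<^sup>2"
        by (simp add: algebra_simps)
      moreover have cancel: "x / (h * y) * h = x / y" if "h \<noteq> 0" for x y h :: real using that by simp
      ultimately show ?thesis unfolding ctoll_def sigma2_div_def D_def[symmetric] cancel[OF H] by (simp only:)
    qed
    finally show ?thesis .
  qed
  finally show ?thesis
  proof (rule Lim_transform_eventually)
    show "\<forall>\<^sub>F n in sequentially. (1 - kappa)\<^sup>2 + (2 * (1 - kappa) * kappa * (avg m n (\<lambda>js. sum_list (map hseq js)) / sqrt (real n))
      + kappa\<^sup>2 * (avg m n (\<lambda>js. (sum_list (map hseq js))\<^sup>2) / real n)) = avg m n (\<lambda>js. (Z n js)\<^sup>2)"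
      using eventually_ge_at_top[of m]
    proof eventually_elim
      case (elim n)
      have sq: "(Z n js)\<^sup>2 = (1 - kappa)\<^sup>2 + ((2 * (1 - kappa) * kappa / sqrt (real n)) * sum_list (map hseq js)
        + (kappa\<^sup>2 / real n) * (sum_list (map hseq js))\<^sup>2)" for js
      proof -
        have "(a + k * (S / w))\<^sup>2 = a\<^sup>2 + ((2 * a * k / w) * S + (k\<^sup>2 / w\<^sup>2) * S\<^sup>2)" for a k S w :: real
          by (simp add: power2_sum power_mult_distrib power_divide)
        from this[of "1 - kappa" kappa "sum_list (map hseq js)" "sqrt (real n)"] show ?thesis
          unfolding Z_def by (simp only: real_sqrt_pow2 of_nat_0_le_iff)
      qed
      show ?case unfolding sq avg_add avg_mult using m2 elim by (simp add: avg_const)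
    qed
  qed
qed

lemma var_toll_lim: "(\<lambda>n. var_toll m t n / (G n)\<^sup>2) \<longlonglongrightarrow> ctoll"
proof -
  obtain B N1 where B: "B > 0" "\<And>n js. n \<ge> N1 \<Longrightarrow> js \<in> comps m (n - (m - 1)) \<Longrightarrow> \<bar>Z n js\<bar> \<le> B" using Z_bound by blast
  have "(\<lambda>n. var_toll m t n / (G n)\<^sup>2 - avg m n (\<lambda>js. (Z n js)\<^sup>2)) \<longlonglongrightarrow> 0"
  proof (rule LIMSEQ_I)
    fix \<epsilon> :: real assume "\<epsilon> > 0"
    define e where "e = min 1 (\<epsilon> / (2 * (1 + 2 * B)))"
    have e: "e > 0" "e \<le> 1" "e * (1 + 2 * B) < \<epsilon>"
    proof -
      show "e > 0" "e \<le> 1" using \<open>\<epsilon> > 0\<close> B(1) by (auto simp: e_def)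
      have "e * (1 + 2 * B) \<le> \<epsilon> / (2 * (1 + 2 * B)) * (1 + 2 * B)" using B(1) by (intro mult_right_mono) (auto simp: e_def)
      also have "\<dots> = \<epsilon> / 2" using B(1) by (simp add: field_simps)
      finally show "e * (1 + 2 * B) < \<epsilon>" using \<open>\<epsilon> > 0\<close> by simp
    qed
    obtain N2 where N2: "\<And>n js. n \<ge> N2 \<Longrightarrow> js \<in> comps m (n - (m - 1)) \<Longrightarrow> \<bar>resid m t n js - G n * Z n js\<bar> \<le> e * G n"
      using resid_uniform[OF e(1)] by blast
    have "norm (var_toll m t n / (G n)\<^sup>2 - avg m n (\<lambda>js. (Z n js)\<^sup>2) - 0) < \<epsilon>" if n: "n \<ge> max m (max N1 N2)" for n
    proof -
      have Gn: "G n > 0" using svg_pos[OF sv, of n] n m2 by simp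
      have "n \<ge> m" using n by simp
      then have nm: "n \<ge> m - 1" by linarith
      have "var_toll m t n / (G n)\<^sup>2 = avg m n (\<lambda>js. (resid m t n js / G n)\<^sup>2)"
        unfolding var_toll_resid[OF nm] avg_def by (simp add: power_divide sum_divide_distrib mult.commute)
      then have "var_toll m t n / (G n)\<^sup>2 - avg m n (\<lambda>js. (Z n js)\<^sup>2) = avg m n (\<lambda>js. (resid m t n js / G n)\<^sup>2 - (Z n js)\<^sup>2)"
        by (simp add: avg_diff)
      also have "\<bar>\<dots>\<bar> \<le> e * (1 + 2 * B)"
      proof (rule avg_bound)
        fix js assume js: "js \<in> comps m (n - (m - 1))"
        have "resid m t n js / G n - Z n js = (resid m t n js - G n * Z n js) / G n" using Gn by (simp add: diff_divide_distrib)
        then have a: "\<bar>resid m t n js / G n - Z n js\<bar> \<le> e"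
          using N2[of n js] n js Gn by (simp add: abs_divide pos_divide_le_eq)
        moreover have zb: "\<bar>Z n js\<bar> \<le> B" using B(2) n js by simp
        ultimately have b: "\<bar>resid m t n js / G n + Z n js\<bar> \<le> 1 + 2 * B" using e(2) by linarith
        have "(resid m t n js / G n)\<^sup>2 - (Z n js)\<^sup>2 = (resid m t n js / G n - Z n js) * (resid m t n js / G n + Z n js)"
          by (simp add: power2_eq_square algebra_simps)
        then have "\<bar>(resid m t n js / G n)\<^sup>2 - (Z n js)\<^sup>2\<bar> = \<bar>resid m t n js / G n - Z n js\<bar> * \<bar>resid m t n js / G n + Z n js\<bar>"
          by (simp only: abs_mult)
        also have "\<dots> \<le> e * (1 + 2 * B)" using a b e(1) by (intro mult_mono) auto
        finally show "\<bar>(resid m t n js / G n)\<^sup>2 - (Z n js)\<^sup>2\<bar> \<le> e * (1 + 2 * B)" .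
      qed (use m2 nm in auto)
      finally show ?thesis using e(3) by simp
    qed
    then show "\<exists>no. \<forall>n\<ge>no. norm (var_toll m t n / (G n)\<^sup>2 - avg m n (\<lambda>js. (Z n js)\<^sup>2) - 0) < \<epsilon>" by blast
  qed
  from tendsto_add[OF this avg_Z_sq] show ?thesis by simp
qed

end

section \<open>Variance\<close>

context tree_asymp
begin

abbreviation "L2sum \<equiv> (\<lambda>k. (l (Suc k))\<^sup>2 / real (Suc k))"

lemma three_halves_le_2: "3 / 2 \<le> (2 :: real)" by simp

lemma sv_sum_pos: "n \<ge> 1 \<Longrightarrow> sv_sum l n > 0"
proof -
  assume "n \<ge> 1"
  then show ?thesis unfolding sv_sum_def
    by (intro sum_pos divide_pos_pos zero_less_power) (auto simp: lessThan_empty_iff intro: sv_seq_pos[OF sv])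
qed

lemma sv_sum_mono: "j \<le> n \<Longrightarrow> sv_sum l j \<le> sv_sum l n"
  unfolding sv_sum_def by (intro sum_mono2) auto

lemma l_sq_sv_sum: "(\<lambda>n. (l n)\<^sup>2 / sv_sum l n) \<longlonglongrightarrow> 0"
proof (rule LIMSEQ_I)
  fix e :: real assume "e > 0"
  obtain N where N: "N \<ge> 1" "\<And>n. n \<ge> N \<Longrightarrow> (2 / e) * (l n)\<^sup>2 \<le> sv_sum l n"
    using sv_sum_large[OF sv, of "2 / e"] by blast
  have "norm ((l n)\<^sup>2 / sv_sum l n - 0) < e" if "n \<ge> N" for n
  proof -
    have p: "sv_sum l n > 0" using sv_sum_pos that N(1) by simp
    have "(l n)\<^sup>2 \<le> e / 2 * sv_sum l n" using N(2)[OF that] \<open>e > 0\<close> by (simp add: field_simps)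
    then have "(l n)\<^sup>2 / sv_sum l n \<le> e / 2" using p by (simp add: pos_divide_le_eq)
    moreover have "0 \<le> (l n)\<^sup>2 / sv_sum l n" using p by simp
    ultimately have "\<bar>(l n)\<^sup>2 / sv_sum l n\<bar> < e" using \<open>e > 0\<close> by linarith
    then show ?thesis by simp
  qed
  then show "\<exists>no. \<forall>n\<ge>no. norm ((l n)\<^sup>2 / sv_sum l n - 0) < e" by blast
qed

lemma G_sq: "(G n)\<^sup>2 = real n * (l n)\<^sup>2"
  by (simp add: svg_def power_mult_distrib)

lemma var_term_nonneg: "var_term m t k \<ge> 0"
  by (auto simp: var_term_def var_toll_def intro!: divide_nonneg_nonneg sum_nonneg)

text \<open>The shift by one matches the indexing of \<open>L2sum\<close>. Since the limit is
  positive, the variance series inherits convergence from \<open>L2sum\<close>, and in the divergent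
  case its partial sums are proportional to those of \<open>L2sum\<close>.\<close>

lemma var_term_lim: "(\<lambda>k. var_term m t (Suc k) / L2sum k) \<longlonglongrightarrow> ctoll"
proof -
  have "(\<lambda>n. var_toll m t n / (G n)\<^sup>2 * (real n * real n / ((real n + 1) * (real n + 2)))) \<longlonglongrightarrow> ctoll * 1"
    by (intro tendsto_mult var_toll_lim) real_asymp
  then have "(\<lambda>k. var_toll m t (Suc k) / (G (Suc k))\<^sup>2 * (real (Suc k) * real (Suc k) / ((real (Suc k) + 1) * (real (Suc k) + 2)))) \<longlonglongrightarrow> ctoll * 1"
    by (rule LIMSEQ_Suc)
  moreover have "var_toll m t (Suc k) / (G (Suc k))\<^sup>2 * (real (Suc k) * real (Suc k) / ((real (Suc k) + 1) * (real (Suc k) + 2)))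
    = var_term m t (Suc k) / L2sum k" for k
  proof -
    have "l (Suc k) \<noteq> 0" using sv_seq_pos[OF sv, of "Suc k"] by simp
    moreover have "real (Suc k) \<noteq> 0" by simp
    moreover have "v / (x * y) * (x * x / d) = v / d / (y / x)" if "x \<noteq> 0" for v x y d :: real using that by simp
    ultimately show ?thesis unfolding G_sq var_term_def by blast
  qed
  ultimately show ?thesis by simp
qed

text \<open>The toll is of order \<open>n * (l n)^2\<close>, and \<open>(l n)^2\<close> is
  negligible against its logarithmic sum. This serves the convergent case as well, where that sum is
  bounded.\<close>

lemma var_toll_over_n: "(\<lambda>n. var_toll m t n / ((real n + 1) * sv_sum l n)) \<longlonglongrightarrow> 0"
proof -
  have "(\<lambda>n. var_toll m t n / (G n)\<^sup>2 * (real n / (real n + 1)) * ((l n)\<^sup>2 / sv_sum l n)) \<longlonglongrightarrow> ctoll * 1 * 0"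
    by (intro tendsto_mult var_toll_lim l_sq_sv_sum) real_asymp
  then have "(\<lambda>n. var_toll m t n / (G n)\<^sup>2 * (real n / (real n + 1)) * ((l n)\<^sup>2 / sv_sum l n)) \<longlonglongrightarrow> 0" by simp
  then show ?thesis
  proof (rule Lim_transform_eventually)
    show "\<forall>\<^sub>F n in sequentially. var_toll m t n / (G n)\<^sup>2 * (real n / (real n + 1)) * ((l n)\<^sup>2 / sv_sum l n) = var_toll m t n / ((real n + 1) * sv_sum l n)"
      using eventually_ge_at_top[of 1]
    proof eventually_elim
      case (elim n)
      have "l n \<noteq> 0" using sv_seq_pos[OF sv elim] by simp
      then show ?case using elim unfolding G_sq by simp
    qed
  qed
qed

text \<open>The transfer runs with the scale \<open>n + 1\<close> of exponent 2 and the constant 0,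
  so it only asks that the weighted toll sums converge. The slope is positive because all terms are
  nonnegative and the limit \<open>ctoll > 0\<close> forces some of them to be positive.\<close>

lemma var_conv:
  assumes "summable L2sum"
  shows "summable (var_term m t)"
    and "(\<lambda>n. (var_X m t n - sigma2_conv m t * real n) / real n) \<longlonglongrightarrow> 0"
    and "sigma2_conv m t > 0"
proof -
  have "(\<lambda>k. \<bar>var_term m t (Suc k) / L2sum k\<bar>) \<longlonglongrightarrow> \<bar>ctoll\<bar>" by (intro tendsto_rabs var_term_lim)
  then have "\<forall>\<^sub>F k in sequentially. \<bar>var_term m t (Suc k) / L2sum k\<bar> < \<bar>ctoll\<bar> + 1" by (rule order_tendstoD) simp
  then obtain N where N: "\<And>k. k \<ge> N \<Longrightarrow> \<bar>var_term m t (Suc k) / L2sum k\<bar> < \<bar>ctoll\<bar> + 1"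
    unfolding eventually_sequentially by blast
  have Lpos: "L2sum k > 0" for k using sv_seq_pos[OF sv, of "Suc k"] by simp
  have "summable (\<lambda>k. var_term m t (Suc k))"
  proof (rule summable_comparison_test'[OF summable_mult[OF assms, of "\<bar>ctoll\<bar> + 1"]])
    fix k assume "k \<ge> N"
    have "\<bar>v\<bar> = \<bar>v / L\<bar> * L" if "L > 0" for v L :: real using that by (simp add: abs_divide)
    then have "\<bar>var_term m t (Suc k)\<bar> = \<bar>var_term m t (Suc k) / L2sum k\<bar> * L2sum k"
      using Lpos[of k] by blast
    also have "\<dots> \<le> (\<bar>ctoll\<bar> + 1) * L2sum k" using N[OF \<open>k \<ge> N\<close>] Lpos[of k] by (intro mult_right_mono) auto
    finally show "norm (var_term m t (Suc k)) \<le> (\<bar>ctoll\<bar> + 1) * L2sum k" by simp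
  qed
  then show sm: "summable (var_term m t)" by (simp only: summable_Suc_iff)
  define V where "V = (\<Sum>k. var_term m t k)"
  have "\<forall>\<^sub>F k in sequentially. var_term m t (Suc k) / L2sum k > 0"
    by (rule order_tendstoD(1)[OF var_term_lim ctoll_pos])
  then obtain k where "var_term m t (Suc k) / L2sum k > 0" using eventually_happens'[OF sequentially_bot] by blast
  moreover have "v > 0" if "v / L > 0" "L > 0" for v L :: real using that by (simp add: zero_less_divide_iff)
  ultimately have "var_term m t (Suc k) > 0" using Lpos[of k] by blast
  then have Vpos: "V > 0" unfolding V_def by (rule suminf_pos2[OF sm var_term_nonneg])
  then show "sigma2_conv m t > 0" using harm_gt_1[OF m2] by (simp add: sigma2_conv_def V_def)
  have reg: "reg (\<lambda>n. real n + 1) 2"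
  proof -
    have "(real (n + 1) * (real (n + 1) + 1) - real n * (real n + 1)) / (real n + 1) = 2" for n
      by (simp add: field_simps add_nonneg_eq_0_iff)
    then show ?thesis by (simp add: reg_def)
  qed
  have "(\<lambda>n. (\<Sum>k<n. var_term m t k) - V) \<longlonglongrightarrow> V - V"
    unfolding V_def by (intro tendsto_intros summable_LIMSEQ sm)
  moreover have "(real n + 1) * ((\<Sum>k<n. var_toll m t k / ((real k + 1) * (real k + 2))) - V) / (real n + 1) = (\<Sum>k<n. var_term m t k) - V" for n
    by (simp add: var_term_def)
  ultimately have "(\<lambda>n. (real n + 1) * ((\<Sum>k<n. var_toll m t k / ((real k + 1) * (real k + 2))) - V) / (real n + 1)) \<longlonglongrightarrow> 0"
    by simp
  then have "(\<lambda>n. (var_X m t n - var_toll m t n - V / (harm m - 1) * (real n + 1)) / (real n + 1)) \<longlonglongrightarrow> fact m * 0 / char_quot m 2"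
    by (rule transfer[OF m2 m26 tree_rec_var[OF m2] reg three_halves_le_2])
  then have a: "(\<lambda>n. (var_X m t n - var_toll m t n - sigma2_conv m t * (real n + 1)) / (real n + 1)) \<longlonglongrightarrow> 0"
    by (simp add: sigma2_conv_def V_def)
  have S: "(\<lambda>n. sv_sum l n) \<longlonglongrightarrow> suminf L2sum"
    unfolding sv_sum_def using assms by (rule summable_LIMSEQ)
  have b: "(\<lambda>n. var_toll m t n / ((real n + 1) * sv_sum l n) * sv_sum l n) \<longlonglongrightarrow> 0 * suminf L2sum"
    by (intro tendsto_mult var_toll_over_n S)
  have "(\<lambda>n. ((var_X m t n - var_toll m t n - sigma2_conv m t * (real n + 1)) / (real n + 1) + var_toll m t n / ((real n + 1) * sv_sum l n) * sv_sum l n)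
      * ((real n + 1) / real n) + sigma2_conv m t / real n) \<longlonglongrightarrow> (0 + 0 * suminf L2sum) * 1 + 0"
    by (rule tendsto_add[OF tendsto_mult[OF tendsto_add[OF a b]] lim_const_over_n]) real_asymp
  then have "(\<lambda>n. ((var_X m t n - var_toll m t n - sigma2_conv m t * (real n + 1)) / (real n + 1) + var_toll m t n / ((real n + 1) * sv_sum l n) * sv_sum l n)
      * ((real n + 1) / real n) + sigma2_conv m t / real n) \<longlonglongrightarrow> 0" by simp
  then show "(\<lambda>n. (var_X m t n - sigma2_conv m t * real n) / real n) \<longlonglongrightarrow> 0"
  proof (rule Lim_transform_eventually)
    show "\<forall>\<^sub>F n in sequentially. ((var_X m t n - var_toll m t n - sigma2_conv m t * (real n + 1)) / (real n + 1) + var_toll m t n / ((real n + 1) * sv_sum l n) * sv_sum l n)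
      * ((real n + 1) / real n) + sigma2_conv m t / real n = (var_X m t n - sigma2_conv m t * real n) / real n"
      using eventually_ge_at_top[of 1]
    proof eventually_elim
      case (elim n)
      have p: "sv_sum l n \<noteq> 0" using sv_sum_pos[OF elim] by simp
      have q: "real n + 1 \<noteq> 0" by simp
      have alg: "((v - r - s * (x + 1)) / (x + 1) + r / ((x + 1) * w) * w) * ((x + 1) / x) + s / x = (v - s * x) / x"
        if "w \<noteq> 0" "x + 1 \<noteq> 0" for v r s x w :: real
      proof -
        have "(v - r - s * (x + 1)) / (x + 1) + r / ((x + 1) * w) * w = (v - s * (x + 1)) / (x + 1)"
          using that by (simp add: add_divide_distrib[symmetric])
        then have "((v - r - s * (x + 1)) / (x + 1) + r / ((x + 1) * w) * w) * ((x + 1) / x) = (v - s * (x + 1)) / x"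
          using that by simp
        then show ?thesis by (simp add: add_divide_distrib[symmetric] algebra_simps)
      qed
      show ?case by (rule alg[OF p q])
    qed
  qed
qed

lemma sv_sum_at_top:
  assumes "\<not> summable L2sum"
  shows "filterlim (sv_sum l) at_top at_top"
proof -
  have "\<not> bounded (range (\<lambda>n. \<Sum>k<n. L2sum k))" 
  proof
    assume "bounded (range (\<lambda>n. \<Sum>k<n. L2sum k))"
    then obtain B where "\<And>n. norm (\<Sum>k<n. L2sum k) \<le> B" by (auto simp: bounded_iff)
    then have "summable L2sum" by (intro summableI_nonneg_bounded[of _ B]) (auto simp: abs_le_iff)
    then show False using assms by blast
  qed
  show ?thesis
    unfolding filterlim_at_top
  proof
    fix Z :: real
    have "\<exists>n. sv_sum l n \<ge> Z"
    proof (rule ccontr)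
      assume "\<not> (\<exists>n. sv_sum l n \<ge> Z)"
      then have "(\<Sum>k<n. L2sum k) \<le> Z" for n by (simp add: sv_sum_def not_le less_imp_le)
      then have "summable L2sum" by (intro summableI_nonneg_bounded[of _ Z]) auto
      then show False using assms by blast
    qed
    then obtain N where "sv_sum l N \<ge> Z" by blast
    then show "\<forall>\<^sub>F n in sequentially. Z \<le> sv_sum l n"
      unfolding eventually_sequentially using sv_sum_mono order_trans by blast
  qed
qed

text \<open>The scale is \<open>n + 1\<close> times the partial sum of the weighted tolls, with
  \<open>U = 0\<close> and the constant 1. It has exponent 2 because a single toll is negligible
  against it. The value of \<open>char_quot\<close> at 2 supplies the denominator
  \<open>harm m - 1\<close>.\<close>

lemma var_div:
  assumes "\<not> summable L2sum"
  shows "(\<lambda>n. var_X m t n / (real n * sv_sum l n)) \<longlonglongrightarrow> sigma2_div m"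
proof -
  define s where "s n = (\<Sum>k<n. var_term m t k)" for n
  define gg where "gg n = (real n + 1) * s n" for n
  note top = sv_sum_at_top[OF assms]
  have Lpos: "L2sum k > 0" for k using sv_seq_pos[OF sv, of "Suc k"] by simp
  have sv_pos_ev: "\<forall>\<^sub>F n in sequentially. sv_sum l n > 0"
    using eventually_ge_at_top[of 1] by eventually_elim (rule sv_sum_pos)
  have lim1: "(\<lambda>n. (\<Sum>k<n. var_term m t (Suc k)) / sv_sum l n) \<longlonglongrightarrow> ctoll"
    unfolding sv_sum_def by (rule sum_ratio_tendsto[OF var_term_lim Lpos]) (use top in \<open>simp add: sv_sum_def[abs_def]\<close>)
  have inv: "(\<lambda>n. c / sv_sum l n) \<longlonglongrightarrow> 0" for c
    using top by (intro tendsto_divide_0[OF tendsto_const] filterlim_at_top_imp_at_infinity)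
  have lim2: "(\<lambda>n. var_term m t n / sv_sum l n) \<longlonglongrightarrow> 0"
  proof -
    have "(\<lambda>n. var_toll m t n / ((real n + 1) * sv_sum l n) * (1 / (real n + 2))) \<longlonglongrightarrow> 0 * 0"
      by (intro tendsto_mult var_toll_over_n) real_asymp
    then show ?thesis by (simp add: var_term_def mult_ac)
  qed
  have "(\<lambda>n. var_term m t 0 / sv_sum l n + (\<Sum>k<n. var_term m t (Suc k)) / sv_sum l n - var_term m t n / sv_sum l n) \<longlonglongrightarrow> 0 + ctoll - 0"
    by (intro tendsto_intros inv lim1 lim2)
  moreover have "var_term m t 0 / sv_sum l n + (\<Sum>k<n. var_term m t (Suc k)) / sv_sum l n - var_term m t n / sv_sum l n = s n / sv_sum l n" for n
  proof -
    have "(\<Sum>k<Suc n. var_term m t k) = var_term m t 0 + (\<Sum>k<n. var_term m t (Suc k))" by (rule sum.lessThan_Suc_shift)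
    then show ?thesis by (simp add: s_def diff_divide_distrib[symmetric] add_divide_distrib[symmetric])
  qed
  ultimately have s_lim: "(\<lambda>n. s n / sv_sum l n) \<longlonglongrightarrow> ctoll" by simp
  have "\<forall>\<^sub>F n in sequentially. s n / sv_sum l n > 0" by (rule order_tendstoD(1)[OF s_lim ctoll_pos])
  then have s_pos: "\<forall>\<^sub>F n in sequentially. s n > 0" using sv_pos_ev
    by eventually_elim (simp add: zero_less_divide_iff)
  have toll_gg: "(\<lambda>n. var_toll m t n / gg n) \<longlonglongrightarrow> 0"
  proof -
    have "(\<lambda>n. var_toll m t n / ((real n + 1) * sv_sum l n) / (s n / sv_sum l n)) \<longlonglongrightarrow> 0 / ctoll"
      using ctoll_pos by (intro tendsto_divide var_toll_over_n s_lim) simp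
    then have "(\<lambda>n. var_toll m t n / ((real n + 1) * sv_sum l n) / (s n / sv_sum l n)) \<longlonglongrightarrow> 0" by simp
    then show ?thesis
      by (rule Lim_transform_eventually) (use sv_pos_ev in eventually_elim, simp add: gg_def)
  qed
  have gg_pos: "\<forall>\<^sub>F n in sequentially. gg n > 0" using s_pos by eventually_elim (simp add: gg_def add_nonneg_pos)
  have reg: "reg gg 2"
  proof -
    have "(\<lambda>n. 2 + var_toll m t n / gg n) \<longlonglongrightarrow> 2 + 0" by (intro tendsto_intros toll_gg)
    then have "(\<lambda>n. 2 + var_toll m t n / gg n) \<longlonglongrightarrow> 2" by simp
    then have "(\<lambda>n. (real (n + 1) * gg (n + 1) - real n * gg n) / gg n) \<longlonglongrightarrow> 2"
    proof (rule Lim_transform_eventually)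
      show "\<forall>\<^sub>F n in sequentially. 2 + var_toll m t n / gg n = (real (n + 1) * gg (n + 1) - real n * gg n) / gg n"
        using gg_pos
      proof eventually_elim
        case (elim n)
        have v: "(real n + 1) * (real n + 2) * var_term m t n = var_toll m t n"
        proof -
          have "(real n + 1) * (real n + 2) \<noteq> 0" by (simp add: add_nonneg_pos)
          then show ?thesis by (simp add: var_term_def)
        qed
        have alg: "(x + 1) * ((x + 2) * (S + v)) - x * ((x + 1) * S) = 2 * ((x + 1) * S) + (x + 1) * (x + 2) * v" for x S v :: real
          by (simp add: algebra_simps)
        have "real (n + 1) * gg (n + 1) - real n * gg n = (real n + 1) * ((real n + 2) * (s n + var_term m t n)) - real n * ((real n + 1) * s n)"
          by (simp add: gg_def s_def add_ac)
        also have "\<dots> = 2 * gg n + var_toll m t n" unfolding alg v by (simp add: gg_def)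
        finally show ?case using elim by (simp add: add_divide_distrib)
      qed
    qed
    then show ?thesis using gg_pos by (simp add: reg_def)
  qed
  have "(\<lambda>n. (real n + 1) * ((\<Sum>k<n. var_toll m t k / ((real k + 1) * (real k + 2))) - 0) / gg n) \<longlonglongrightarrow> 1"
  proof (rule Lim_transform_eventually[OF tendsto_const])
    show "\<forall>\<^sub>F n in sequentially. 1 = (real n + 1) * ((\<Sum>k<n. var_toll m t k / ((real k + 1) * (real k + 2))) - 0) / gg n"
      using gg_pos
    proof eventually_elim
      case (elim n)
      have "(real n + 1) * ((\<Sum>k<n. var_toll m t k / ((real k + 1) * (real k + 2))) - 0) = gg n"
        by (simp add: gg_def s_def var_term_def)
      then show ?case using elim by simp
    qed
  qed
  then have "(\<lambda>n. (var_X m t n - var_toll m t n - 0 / (harm m - 1) * (real n + 1)) / gg n) \<longlonglongrightarrow> fact m * 1 / char_quot m 2"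
    by (rule transfer[OF m2 m26 tree_rec_var[OF m2] reg three_halves_le_2])
  then have vlim: "(\<lambda>n. (var_X m t n - var_toll m t n) / gg n) \<longlonglongrightarrow> 1 / (harm m - 1)"
    by (simp add: char_quot_def)
  have "(\<lambda>n. ((var_X m t n - var_toll m t n) / gg n + var_toll m t n / gg n) * (s n / sv_sum l n) * ((real n + 1) / real n))
     \<longlonglongrightarrow> (1 / (harm m - 1) + 0) * ctoll * 1"
    by (intro tendsto_mult tendsto_add vlim toll_gg s_lim) real_asymp
  also have "(1 / (harm m - 1) + 0) * ctoll * 1 = sigma2_div m"
    using harm_gt_1[OF m2] by (simp add: ctoll_def)
  finally show ?thesis
  proof (rule Lim_transform_eventually)
    show "\<forall>\<^sub>F n in sequentially. ((var_X m t n - var_toll m t n) / gg n + var_toll m t n / gg n) * (s n / sv_sum l n) * ((real n + 1) / real n) =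
      var_X m t n / (real n * sv_sum l n)"
      using s_pos sv_pos_ev eventually_ge_at_top[of 1]
    proof eventually_elim
      case (elim n)
      have "(v - r) / ((x + 1) * S) + r / ((x + 1) * S) = v / ((x + 1) * S)" for v r x S :: real
        by (simp add: add_divide_distrib[symmetric])
      moreover have "v / ((x + 1) * S) * (S / w) * ((x + 1) / x) = v / (x * w)" if "S \<noteq> 0" "x + 1 \<noteq> 0" for v S w x :: real
        using that by (simp add: mult.commute)
      moreover have "s n \<noteq> 0" "real n + 1 \<noteq> 0" using elim by auto
      ultimately show ?case unfolding gg_def by presburger
    qed
  qed
qed

definition "S2 n = (if summable L2sum then sigma2_conv m t * real n else sigma2_div m * real n * sv_sum l n)"
text \<open>The slope of \<open>S2\<close>. It is nondecreasing and locally almost constant whether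
  \<open>L2sum\<close> converges or not, which lets the normal approximation treat both cases at
  once.\<close>

definition "MM n = (if summable L2sum then sigma2_conv m t else sigma2_div m * sv_sum l n)"

lemma S2_MM: "S2 n = real n * MM n"
  by (simp add: S2_def MM_def)

lemma MM_mono: "j \<le> n \<Longrightarrow> MM j \<le> MM n"
  using sv_sum_mono sigma2_div_pos[OF m2 m26] by (simp add: MM_def mult_left_mono)

lemma MM_pos: "n \<ge> 1 \<Longrightarrow> MM n > 0"
  using sv_sum_pos sigma2_div_pos[OF m2 m26] var_conv(3) by (simp add: MM_def)

lemma MM_nonneg: "MM n \<ge> 0"
  using MM_pos[of n] sigma2_div_pos[OF m2 m26] var_conv(3)
  by (cases "n \<ge> 1") (auto simp: MM_def sv_sum_def intro!: mult_nonneg_nonneg sum_nonneg)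

lemma S2_pos: "n \<ge> 1 \<Longrightarrow> S2 n > 0"
  using MM_pos by (simp add: S2_MM)

lemma var_S2: "(\<lambda>n. var_X m t n / S2 n) \<longlonglongrightarrow> 1"
proof (cases "summable L2sum")
  case True
  have s: "sigma2_conv m t > 0" by (rule var_conv(3)[OF True])
  have "(\<lambda>n. (var_X m t n - sigma2_conv m t * real n) / real n / sigma2_conv m t + 1) \<longlonglongrightarrow> 0 / sigma2_conv m t + 1"
    using s by (intro tendsto_intros var_conv(2)[OF True]) simp
  then have "(\<lambda>n. (var_X m t n - sigma2_conv m t * real n) / real n / sigma2_conv m t + 1) \<longlonglongrightarrow> 1" by simp
  then show ?thesis
  proof (rule Lim_transform_eventually)
    show "\<forall>\<^sub>F n in sequentially. (var_X m t n - sigma2_conv m t * real n) / real n / sigma2_conv m t + 1 = var_X m t n / S2 n"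
      using eventually_ge_at_top[of 1]
    proof eventually_elim
      case (elim n)
      have "(v - s * x) / x / s + 1 = v / (s * x)" if "x \<noteq> 0" "s \<noteq> 0" for v s x :: real
        using that by (simp add: diff_divide_distrib mult.commute)
      then show ?case using elim s True by (simp add: S2_def)
    qed
  qed
next
  case False
  have s: "sigma2_div m > 0" by (rule sigma2_div_pos[OF m2 m26])
  have "(\<lambda>n. var_X m t n / (real n * sv_sum l n) / sigma2_div m) \<longlonglongrightarrow> sigma2_div m / sigma2_div m"
    using s by (intro tendsto_divide var_div[OF False] tendsto_const) simp
  then show ?thesis using s False by (simp add: S2_def mult_ac)
qed

lemma l_sq_MM: "(\<lambda>n. (l n)\<^sup>2 / MM n) \<longlonglongrightarrow> 0"
proof (cases "summable L2sum")
  case True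
  have "(\<lambda>n. sv_sum l n) \<longlonglongrightarrow> suminf L2sum"
    unfolding sv_sum_def using True by (rule summable_LIMSEQ)
  then have "(\<lambda>n. (l n)\<^sup>2 / sv_sum l n * sv_sum l n / sigma2_conv m t) \<longlonglongrightarrow> 0 * suminf L2sum / sigma2_conv m t"
    using var_conv(3)[OF True] by (intro tendsto_intros l_sq_sv_sum) auto
  then have "(\<lambda>n. (l n)\<^sup>2 / sv_sum l n * sv_sum l n / sigma2_conv m t) \<longlonglongrightarrow> 0" by simp
  then show ?thesis
  proof (rule Lim_transform_eventually)
    show "\<forall>\<^sub>F n in sequentially. (l n)\<^sup>2 / sv_sum l n * sv_sum l n / sigma2_conv m t = (l n)\<^sup>2 / MM n"
      using eventually_ge_at_top[of 1]
    proof eventually_elim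
      case (elim n)
      then have "sv_sum l n \<noteq> 0" using sv_sum_pos[OF elim] by simp
      then show ?case using True by (simp add: MM_def)
    qed
  qed
next
  case False
  have "(\<lambda>n. (l n)\<^sup>2 / sv_sum l n / sigma2_div m) \<longlonglongrightarrow> 0 / sigma2_div m"
    using sigma2_div_pos[OF m2 m26] by (intro tendsto_divide l_sq_sv_sum tendsto_const) simp
  then show ?thesis using False by (simp add: MM_def mult_ac)
qed

lemma G_sq_S2: "(\<lambda>n. (G n)\<^sup>2 / S2 n) \<longlonglongrightarrow> 0"
  using l_sq_MM
  by (rule Lim_transform_eventually) (use eventually_ge_at_top[of 1] in eventually_elim, simp add: G_sq S2_MM)

text \<open>The increment of the logarithmic sum over \<open>[h * n, n]\<close> is of order
  \<open>(l n)^2\<close> and thus negligible against the sum. In the convergent case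
  \<open>MM\<close> is constant.\<close>

lemma MM_local:
  assumes "h > 0" "e > 0"
  shows "\<exists>N. \<forall>n\<ge>N. \<forall>j\<le>n. h * real n \<le> real j \<longrightarrow> MM n - MM j \<le> e * MM n"
proof (cases "summable L2sum")
  case True
  then show ?thesis using MM_nonneg \<open>e > 0\<close> by (simp add: MM_def)
next
  case False
  obtain N1 where N1: "\<And>n j. n \<ge> N1 \<Longrightarrow> j \<le> n \<Longrightarrow> h * real n \<le> real j \<Longrightarrow> sv_sum l n - sv_sum l j \<le> 4 / h * (l n)\<^sup>2"
    using sv_sum_local[OF sv \<open>h > 0\<close>] by blast
  have "\<forall>\<^sub>F n in sequentially. (l n)\<^sup>2 / sv_sum l n < e * h / 4"
    using assms by (intro order_tendstoD(2)[OF l_sq_sv_sum]) auto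
  then obtain N2 where N2: "\<And>n. n \<ge> N2 \<Longrightarrow> (l n)\<^sup>2 / sv_sum l n < e * h / 4" unfolding eventually_sequentially by blast
  have "MM n - MM j \<le> e * MM n" if n: "n \<ge> max 1 (max N1 N2)" and j: "j \<le> n" "h * real n \<le> real j" for n j
  proof -
    have p: "sv_sum l n > 0" using sv_sum_pos n by simp
    have "(l n)\<^sup>2 \<le> e * h / 4 * sv_sum l n" using N2[of n] n p by (simp add: pos_divide_less_eq less_imp_le)
    then have "4 / h * (l n)\<^sup>2 \<le> 4 / h * (e * h / 4 * sv_sum l n)" using \<open>h > 0\<close> by (intro mult_left_mono) auto
    also have "\<dots> = e * sv_sum l n" using \<open>h > 0\<close> by simp
    finally have "sv_sum l n - sv_sum l j \<le> e * sv_sum l n" using N1[of n j] n j by simp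
    then have "sigma2_div m * (sv_sum l n - sv_sum l j) \<le> sigma2_div m * (e * sv_sum l n)"
      using sigma2_div_pos[OF m2 m26] by (intro mult_left_mono) auto
    then show ?thesis using False by (simp add: MM_def algebra_simps)
  qed
  then show ?thesis by blast
qed

end

section \<open>Normal approximation\<close>

text \<open>Clamping changes nothing inside \<open>[- R, R]\<close>. Outside, the difference is at
  most \<open>|x| ^ k\<close>, and a factor \<open>|x| ^ k / R ^ k >= 1\<close> can be
  inserted.\<close>

lemma power_clamp_diff:
  fixes x R :: real
  assumes "R > 0"
  shows "\<bar>x ^ k - (max (- R) (min R x)) ^ k\<bar> \<le> x ^ (2 * k) / R ^ k"
proof (cases "\<bar>x\<bar> \<le> R")
  case True
  then have "max (- R) (min R x) = x" by auto
  then show ?thesis using assms by (simp add: power_mult)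
next
  case False
  define y where "y = max (- R) (min R x)"
  have y: "\<bar>y\<bar> \<le> \<bar>x\<bar>" "x * y \<ge> 0"
  proof -
    show "\<bar>y\<bar> \<le> \<bar>x\<bar>" using False assms by (auto simp: y_def)
    show "x * y \<ge> 0" using assms by (auto simp: y_def zero_le_mult_iff)
  qed
  have "\<bar>x ^ k - y ^ k\<bar> \<le> \<bar>x ^ k\<bar>"
  proof -
    have "\<bar>y ^ k\<bar> \<le> \<bar>x ^ k\<bar>" unfolding power_abs using y(1) by (intro power_mono) auto
    moreover have "x ^ k * y ^ k \<ge> 0" using y(2) by (simp flip: power_mult_distrib)
    moreover have "\<bar>X - Y\<bar> \<le> \<bar>X\<bar>" if "\<bar>Y\<bar> \<le> \<bar>X\<bar>" "X * Y \<ge> 0" for X Y :: real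
      using that by (auto simp: abs_if zero_le_mult_iff split: if_splits)
    ultimately show ?thesis by blast
  qed
  also have "\<dots> \<le> x ^ (2 * k) / R ^ k"
  proof -
    have "R ^ k \<le> \<bar>x\<bar> ^ k" using False assms by (intro power_mono) auto
    then have "\<bar>x\<bar> ^ k * R ^ k \<le> \<bar>x\<bar> ^ k * \<bar>x\<bar> ^ k" by (intro mult_left_mono) auto
    also have "\<dots> = x ^ (2 * k)" by (simp only: power_mult_distrib[symmetric] abs_mult_self_eq power_mult power2_eq_square)
    finally show ?thesis using assms by (simp add: power_abs pos_le_divide_eq)
  qed
  finally show ?thesis unfolding y_def .
qed

text \<open>The clamped power is bounded and continuous, so its integrals converge. The bound on the
  moments of order \<open>2 * k\<close> keeps the clamping error below \<open>C' / R ^ k\<close>,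
  uniformly in \<open>n\<close> and also for the limit.\<close>

theorem weak_conv_moments:
  fixes M :: "nat \<Rightarrow> real measure"
  assumes M: "\<And>n. real_distribution (M n)" and N: "real_distribution N" and conv: "weak_conv_m M N"
    and intM: "\<And>n k. integrable (M n) (\<lambda>x. x ^ k)" and intN: "\<And>k. integrable N (\<lambda>x. x ^ k)"
    and bound: "\<forall>\<^sub>F n in sequentially. (LINT x|M n. x ^ (2 * k)) \<le> C"
  shows "(\<lambda>n. LINT x|M n. x ^ k) \<longlonglongrightarrow> (LINT x|N. x ^ k)"
proof (cases "k = 0")
  case True
  have "(LINT x|M n. x ^ k) = 1" for n
  proof -
    interpret real_distribution "M n" by (rule M)
    show ?thesis using True by (simp add: prob_space del: space_eq_univ)
  qed
  moreover have "(LINT x|N. x ^ k) = 1"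
  proof -
    interpret real_distribution N by (rule N)
    show ?thesis using True by (simp add: prob_space del: space_eq_univ)
  qed
  ultimately show ?thesis by simp
next
  case False
  define C' where "C' = max C (LINT x|N. x ^ (2 * k))"
  define f where "f R x = (max (- R) (min R x)) ^ k" for R x :: real
  have cont: "continuous_on UNIV (f R)" for R unfolding f_def by (intro continuous_intros)
  have bnd: "\<bar>f R x\<bar> \<le> R ^ k" if "R > 0" for R x
    unfolding f_def power_abs using that by (intro power_mono) auto
  have diff: "\<bar>(LINT x|P. x ^ k) - (LINT x|P. f R x)\<bar> \<le> D / R ^ k"
    if P: "real_distribution P" and int: "\<And>k. integrable P (\<lambda>x. x ^ k)" and D: "(LINT x|P. x ^ (2 * k)) \<le> D" and R: "R > 0" for P D R
  proof -
    interpret real_distribution P by (rule P)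
    have intf: "integrable P (f R)"
    proof (rule integrable_const_bound[of _ "R ^ k"])
      show "AE x in P. norm (f R x) \<le> R ^ k" using bnd[OF R] by simp
      have "f R \<in> borel_measurable borel" using cont by (rule borel_measurable_continuous_onI)
      then show "f R \<in> borel_measurable P" by simp
    qed
    have "(LINT x|P. x ^ k) - (LINT x|P. f R x) = (LINT x|P. x ^ k - f R x)"
      using intf int by simp
    also have "\<bar>\<dots>\<bar> \<le> (LINT x|P. \<bar>x ^ k - f R x\<bar>)" by (rule integral_abs_bound)
    also have "\<dots> \<le> (LINT x|P. x ^ (2 * k) / R ^ k)"
    proof (rule integral_mono)
      show "integrable P (\<lambda>x. \<bar>x ^ k - f R x\<bar>)" using intf int by (intro integrable_abs Bochner_Integration.integrable_diff)
      show "integrable P (\<lambda>x. x ^ (2 * k) / R ^ k)" using int by simp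
      show "\<bar>x ^ k - f R x\<bar> \<le> x ^ (2 * k) / R ^ k" for x unfolding f_def by (rule power_clamp_diff[OF R])
    qed
    also have "\<dots> = (LINT x|P. x ^ (2 * k)) / R ^ k" by simp
    also have "\<dots> \<le> D / R ^ k" using D R by (intro divide_right_mono) auto
    finally show ?thesis .
  qed
  show ?thesis
  proof (rule LIMSEQ_I)
    fix e :: real assume "e > 0"
    have "((\<lambda>R. C' / R ^ k) \<longlongrightarrow> 0) at_top"
      using False by (intro tendsto_divide_0[OF tendsto_const] filterlim_at_top_imp_at_infinity filterlim_pow_at_top filterlim_ident) auto
    then have "\<forall>\<^sub>F R in at_top. C' / R ^ k < e / 4 \<and> R > 0"
      using \<open>e > 0\<close> by (intro eventually_conj order_tendstoD eventually_gt_at_top) auto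
    then obtain R where R: "C' / R ^ k < e / 4" "R > 0" using eventually_happens'[OF trivial_limit_at_top_linorder] by blast
    have "(\<lambda>n. LINT x|M n. f R x) \<longlonglongrightarrow> (LINT x|N. f R x)"
    proof (rule weak_conv_imp_integral_bdd_continuous_conv[OF M N conv])
      show "isCont (f R) x" for x using cont[of R] by (simp add: continuous_on_eq_continuous_at)
      show "norm (f R x) \<le> R ^ k" for x using bnd[OF R(2)] by simp
    qed
    then obtain n1 where n1: "\<And>n. n \<ge> n1 \<Longrightarrow> norm ((LINT x|M n. f R x) - (LINT x|N. f R x)) < e / 4"
      using LIMSEQ_D[of _ _ "e / 4"] \<open>e > 0\<close> by (metis divide_pos_pos zero_less_numeral)
    obtain n2 where n2: "\<And>n. n \<ge> n2 \<Longrightarrow> (LINT x|M n. x ^ (2 * k)) \<le> C" using bound unfolding eventually_sequentially by blast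
    have "norm ((LINT x|M n. x ^ k) - (LINT x|N. x ^ k)) < e" if n: "n \<ge> max n1 n2" for n
    proof -
      have "\<bar>(LINT x|M n. x ^ k) - (LINT x|M n. f R x)\<bar> \<le> C' / R ^ k"
        by (rule diff[OF M intM _ R(2)]) (use n2[of n] n in \<open>simp add: C'_def\<close>)
      moreover have "\<bar>(LINT x|N. x ^ k) - (LINT x|N. f R x)\<bar> \<le> C' / R ^ k"
        by (rule diff[OF N intN _ R(2)]) (simp add: C'_def)
      moreover have "\<bar>(LINT x|M n. f R x) - (LINT x|N. f R x)\<bar> < e / 4" using n1[of n] n by simp
      ultimately show ?thesis using R(1) unfolding real_norm_def by linarith
    qed
    then show "\<exists>no. \<forall>n\<ge>no. norm ((LINT x|M n. x ^ k) - (LINT x|N. x ^ k)) < e" by blast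
  qed
qed

text \<open>After averaging over the root split, the subtracted expansion collapses to its leading term: \<open>r\<close> has mean
  zero, and by the variance recurrence so has \<open>v - s + r\<^sup>2\<close>.\<close>

lemma char_pointwise:
  fixes u r v s :: real
  assumes "v \<ge> 0" "s \<ge> 0"
  defines "d \<equiv> \<bar>v - s\<bar>"
  shows "norm (cis (u * r) * of_real (exp (- u\<^sup>2 * v / 2))
      - of_real (exp (- u\<^sup>2 * s / 2)) * (1 - of_real (u\<^sup>2 / 2 * (v - s)) + \<i> * of_real (u * r) - of_real (u\<^sup>2 * r\<^sup>2 / 2)))
    \<le> \<bar>u\<bar> ^ 3 * (\<bar>r\<bar> ^ 3 + \<bar>r\<bar> * d) + u ^ 4 * (d\<^sup>2 + r\<^sup>2 * d)"
proof -
  define a where "a = u\<^sup>2 * v / 2"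
  define b where "b = u\<^sup>2 * s / 2"
  have ab: "a \<ge> 0" "b \<ge> 0" using assms by (auto simp: a_def b_def)
  have ea: "exp (- a) \<le> 1" "exp (- b) \<le> 1" using ab by auto
  have abd: "\<bar>a - b\<bar> = u\<^sup>2 / 2 * d"
  proof -
    have "a - b = u\<^sup>2 / 2 * (v - s)" by (simp add: a_def b_def algebra_simps)
    then have "\<bar>a - b\<bar> = \<bar>u\<^sup>2 / 2\<bar> * \<bar>v - s\<bar>" by (simp only: abs_mult)
    moreover have "\<bar>u\<^sup>2 / 2\<bar> = u\<^sup>2 / 2" by simp
    ultimately show ?thesis by (simp only: d_def)
  qed
  \<comment> \<open>The larger of the two exponentials is factored out in each case, since the
    one-sided estimates in \<open>base\<close> need a nonnegative argument.\<close>
  have taylor: "\<bar>exp (- a) - exp (- b) * (1 - (a - b))\<bar> \<le> (a - b)\<^sup>2"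
    and lip: "\<bar>exp (- a) - exp (- b)\<bar> \<le> \<bar>a - b\<bar>"
  proof -
    have base: "\<bar>exp (- x) - 1 + x\<bar> \<le> x\<^sup>2 \<and> \<bar>exp (- x) - 1\<bar> \<le> x" if "x \<ge> 0" for x :: real
    proof -
      have l: "1 - x \<le> exp (- x)" using exp_ge_add_one_self[of "- x"] by simp
      have "(1 + x) * exp (- x) \<le> exp x * exp (- x)" by (intro mult_right_mono exp_ge_add_one_self) simp
      then have "(1 + x) * exp (- x) \<le> 1" by (simp add: exp_minus)
      then have "exp (- x) \<le> 1 / (1 + x)" using that by (simp add: field_simps)
      also have "1 / (1 + x) \<le> 1 - x + x\<^sup>2"
      proof -
        have "1 \<le> (1 - x + x\<^sup>2) * (1 + x)" using that by (simp add: algebra_simps power2_eq_square)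
        then show ?thesis using that by (simp add: pos_divide_le_eq)
      qed
      finally have h: "exp (- x) \<le> 1 - x + x\<^sup>2" .
      have "exp (- x) \<le> 1" using that by simp
      then show ?thesis using l h by (simp add: abs_le_iff)
    qed
    have "\<bar>exp (- a) - exp (- b) * (1 - (a - b))\<bar> \<le> (a - b)\<^sup>2 \<and> \<bar>exp (- a) - exp (- b)\<bar> \<le> \<bar>a - b\<bar>"
    proof (cases "a \<ge> b")
      case True
      define x where "x = a - b"
      have x: "x \<ge> 0" "exp (- a) = exp (- b) * exp (- x)" using True by (simp_all add: x_def flip: exp_add)
      have "\<bar>exp (- a) - exp (- b) * (1 - x)\<bar> = exp (- b) * \<bar>exp (- x) - 1 + x\<bar>"
      proof -
        have "exp (- a) - exp (- b) * (1 - x) = exp (- b) * (exp (- x) - 1 + x)" unfolding x(2) by (simp add: algebra_simps)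
        then show ?thesis by (simp add: abs_mult)
      qed
      also have "\<dots> \<le> 1 * x\<^sup>2" using base[OF x(1)] ea by (intro mult_mono) auto
      finally have A: "\<bar>exp (- a) - exp (- b) * (1 - x)\<bar> \<le> x\<^sup>2" by simp
      have "\<bar>exp (- a) - exp (- b)\<bar> = exp (- b) * \<bar>exp (- x) - 1\<bar>"
      proof -
        have "exp (- a) - exp (- b) = exp (- b) * (exp (- x) - 1)" unfolding x(2) by (simp add: algebra_simps)
        then show ?thesis by (simp add: abs_mult)
      qed
      also have "\<dots> \<le> 1 * x" using base[OF x(1)] ea by (intro mult_mono) auto
      finally show ?thesis using A x(1) by (simp add: x_def)
    next
      case False
      define x where "x = b - a"
      have x: "x \<ge> 0" "exp (- b) = exp (- a) * exp (- x)" "a - b = - x" using False by (simp_all add: x_def flip: exp_add)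
      have B: "\<bar>1 - exp (- x)\<bar> \<le> x" using base[OF x(1)] by (simp add: abs_minus_commute)
      have "\<bar>exp (- a) - exp (- b) * (1 + x)\<bar> = exp (- a) * \<bar>1 - exp (- x) * (1 + x)\<bar>"
      proof -
        have "exp (- a) - exp (- b) * (1 + x) = exp (- a) * (1 - exp (- x) * (1 + x))" unfolding x(2) by (simp add: algebra_simps)
        then show ?thesis by (simp add: abs_mult)
      qed
      also have "\<bar>1 - exp (- x) * (1 + x)\<bar> \<le> x\<^sup>2"
      proof -
        have p: "(1 + x) * (1 - x) \<le> (1 + x) * exp (- x)" using x(1) exp_ge_add_one_self[of "- x"] by (intro mult_left_mono) auto
        have "(1 + x) * exp (- x) \<le> exp x * exp (- x)" by (intro mult_right_mono exp_ge_add_one_self) simp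
        then have "(1 + x) * exp (- x) \<le> 1" by (simp add: exp_minus)
        then show ?thesis using p by (simp add: abs_le_iff algebra_simps power2_eq_square)
      qed
      then have "exp (- a) * \<bar>1 - exp (- x) * (1 + x)\<bar> \<le> 1 * x\<^sup>2" using ea by (intro mult_mono) auto
      finally have A: "\<bar>exp (- a) - exp (- b) * (1 + x)\<bar> \<le> x\<^sup>2" by simp
      have "\<bar>exp (- a) - exp (- b)\<bar> = exp (- a) * \<bar>1 - exp (- x)\<bar>"
      proof -
        have "exp (- a) - exp (- b) = exp (- a) * (1 - exp (- x))" unfolding x(2) by (simp add: algebra_simps)
        then show ?thesis by (simp add: abs_mult)
      qed
      also have "\<dots> \<le> 1 * x" using B ea by (intro mult_mono) auto
      finally show ?thesis using A x by simp
    qed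
    then show "\<bar>exp (- a) - exp (- b) * (1 - (a - b))\<bar> \<le> (a - b)\<^sup>2" "\<bar>exp (- a) - exp (- b)\<bar> \<le> \<bar>a - b\<bar>" by auto
  qed
  define lin where "lin = \<i> * of_real (u * r) - of_real (u\<^sup>2 * r\<^sup>2 / 2)"
  have cis_t: "norm (cis (u * r) - (1 + lin)) \<le> \<bar>u * r\<bar> ^ 3 / 6"
  proof -
    have "norm (iexp (u * r) - (\<Sum>k\<le>2. (\<i> * of_real (u * r)) ^ k / fact k)) \<le> \<bar>u * r\<bar> ^ Suc 2 / fact (Suc 2)"
      by (rule iexp_approx1)
    moreover have "(\<Sum>k\<le>2. (\<i> * of_real (u * r)) ^ k / fact k) = 1 + lin"
    proof -
      have "(\<i> * X) * (\<i> * X) = - (X * X)" for X by (simp add: complex_eq_iff algebra_simps)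
      then show ?thesis by (simp add: numeral_2_eq_2 lin_def power2_eq_square mult_ac)
    qed
    moreover have "iexp (u * r) = cis (u * r)" by (simp add: cis_conv_exp)
    moreover have "\<bar>u * r\<bar> ^ Suc 2 / fact (Suc 2) = \<bar>u * r\<bar> ^ 3 / 6" by (simp add: eval_nat_numeral)
    ultimately show ?thesis by (simp only:)
  qed
  have nlin: "norm lin \<le> \<bar>u * r\<bar> + u\<^sup>2 * r\<^sup>2 / 2"
  proof -
    have "norm lin \<le> norm (\<i> * of_real (u * r)) + norm (of_real (u\<^sup>2 * r\<^sup>2 / 2) :: complex)"
      unfolding lin_def by (rule norm_triangle_ineq4)
    moreover have "norm (of_real (u\<^sup>2 * r\<^sup>2 / 2) :: complex) = u\<^sup>2 * r\<^sup>2 / 2" by (simp only: norm_of_real abs_mult power_abs abs_divide) simp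
    moreover have "norm (\<i> * of_real (u * r)) = \<bar>u * r\<bar>" by (simp only: norm_mult norm_ii norm_of_real mult_1)
    ultimately show ?thesis by linarith
  qed
  \<comment> \<open>Three errors: Taylor for \<open>cis\<close>, Taylor for the Gaussian factor, and
    the low-order part of \<open>cis\<close> times the change of the Gaussian factor.\<close>
  have eq: "cis (u * r) * of_real (exp (- a)) - of_real (exp (- b)) * (1 - of_real (u\<^sup>2 / 2 * (v - s)) + \<i> * of_real (u * r) - of_real (u\<^sup>2 * r\<^sup>2 / 2))
    = (cis (u * r) - (1 + lin)) * of_real (exp (- a)) + of_real (exp (- a) - exp (- b) * (1 - (a - b))) + lin * of_real (exp (- a) - exp (- b))"
  proof -
    have "u\<^sup>2 / 2 * (v - s) = a - b" by (simp add: a_def b_def right_diff_distrib)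
    then have "of_real (u\<^sup>2 / 2 * (v - s)) = complex_of_real (a - b)" by (rule arg_cong)
    moreover have "C * A - B * (1 - W + P - Q) = (C - (1 + (P - Q))) * A + (A - B * (1 - W)) + (P - Q) * (A - B)" for A B C W P Q :: complex
      by (simp add: algebra_simps)
    moreover have "complex_of_real (exp (- a) - exp (- b) * (1 - (a - b))) = of_real (exp (- a)) - of_real (exp (- b)) * (1 - of_real (a - b))"
      "complex_of_real (exp (- a) - exp (- b)) = of_real (exp (- a)) - of_real (exp (- b))" by simp_all
    ultimately show ?thesis unfolding lin_def by (simp only:)
  qed
  have "norm (cis (u * r) * of_real (exp (- a)) - of_real (exp (- b)) * (1 - of_real (u\<^sup>2 / 2 * (v - s)) + \<i> * of_real (u * r) - of_real (u\<^sup>2 * r\<^sup>2 / 2)))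
    \<le> norm ((cis (u * r) - (1 + lin)) * of_real (exp (- a))) + norm (complex_of_real (exp (- a) - exp (- b) * (1 - (a - b))))
      + norm (lin * of_real (exp (- a) - exp (- b)))"
    unfolding eq by (rule order_trans[OF norm_triangle_ineq add_right_mono[OF norm_triangle_ineq]])
  also have "\<dots> \<le> \<bar>u * r\<bar> ^ 3 / 6 * 1 + (a - b)\<^sup>2 + (\<bar>u * r\<bar> + u\<^sup>2 * r\<^sup>2 / 2) * \<bar>a - b\<bar>"
  proof (intro add_mono)
    show "norm ((cis (u * r) - (1 + lin)) * of_real (exp (- a))) \<le> \<bar>u * r\<bar> ^ 3 / 6 * 1"
      unfolding norm_mult using cis_t ea by (intro mult_mono) auto
    show "norm (complex_of_real (exp (- a) - exp (- b) * (1 - (a - b)))) \<le> (a - b)\<^sup>2"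
      unfolding norm_of_real by (rule taylor)
    show "norm (lin * of_real (exp (- a) - exp (- b))) \<le> (\<bar>u * r\<bar> + u\<^sup>2 * r\<^sup>2 / 2) * \<bar>a - b\<bar>"
      unfolding norm_mult norm_of_real using nlin lip by (intro mult_mono) auto
  qed
  also have "(a - b)\<^sup>2 = (u\<^sup>2 / 2 * d)\<^sup>2" using abd by (metis power2_abs)
  also have "\<bar>u * r\<bar> ^ 3 / 6 * 1 + (u\<^sup>2 / 2 * d)\<^sup>2 + (\<bar>u * r\<bar> + u\<^sup>2 * r\<^sup>2 / 2) * \<bar>a - b\<bar> =
    \<bar>u\<bar> ^ 3 * (\<bar>r\<bar> ^ 3 / 6 + \<bar>r\<bar> * d / 2) + u ^ 4 * (d\<^sup>2 / 4 + r\<^sup>2 * d / 4)"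
  proof -
    have "u\<^sup>2 = \<bar>u\<bar>\<^sup>2" "u ^ 4 = \<bar>u\<bar> ^ 4" by (simp_all add: power_even_abs)
    then show ?thesis unfolding abd by (simp add: abs_mult power_mult_distrib algebra_simps power2_eq_square power3_eq_cube power4_eq_xxxx)
  qed
  also have "\<dots> \<le> \<bar>u\<bar> ^ 3 * (\<bar>r\<bar> ^ 3 + \<bar>r\<bar> * d) + u ^ 4 * (d\<^sup>2 + r\<^sup>2 * d)"
    by (intro add_mono mult_left_mono) (auto simp: d_def)
  finally show ?thesis by (simp add: a_def b_def)
qed

lemma norm_prod_list_diff:
  fixes f g :: "'a \<Rightarrow> complex"
  assumes "\<And>x. norm (f x) \<le> 1" "\<And>x. norm (g x) \<le> 1"
  shows "norm ((\<Prod>x\<leftarrow>xs. f x) - (\<Prod>x\<leftarrow>xs. g x)) \<le> (\<Sum>x\<leftarrow>xs. norm (f x - g x))"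
proof (induction xs)
  case (Cons x xs)
  have p: "norm (\<Prod>x\<leftarrow>xs. g x) \<le> 1" for xs
    by (induction xs) (auto simp: norm_mult intro!: mult_le_one assms)
  have "(\<Prod>x\<leftarrow>x # xs. f x) - (\<Prod>x\<leftarrow>x # xs. g x) =
    f x * ((\<Prod>x\<leftarrow>xs. f x) - (\<Prod>x\<leftarrow>xs. g x)) + (f x - g x) * (\<Prod>x\<leftarrow>xs. g x)"
    by (simp add: algebra_simps)
  also have "norm \<dots> \<le> norm (f x) * norm ((\<Prod>x\<leftarrow>xs. f x) - (\<Prod>x\<leftarrow>xs. g x)) + norm (f x - g x) * norm (\<Prod>x\<leftarrow>xs. g x)"
    by (metis norm_mult norm_triangle_ineq)
  also have "\<dots> \<le> 1 * norm ((\<Prod>x\<leftarrow>xs. f x) - (\<Prod>x\<leftarrow>xs. g x)) + norm (f x - g x) * 1"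
    by (intro add_mono mult_right_mono mult_left_mono assms p) auto
  finally show ?case using Cons by simp
qed simp

text \<open>The solution of the tree recurrence for a prescribed toll. It serves as a majorant for
  recursive inequalities, in particular with tolls that do not involve the argument of the
  characteristic function.\<close>

function tree_solve :: "nat \<Rightarrow> (nat \<Rightarrow> real) \<Rightarrow> nat \<Rightarrow> real" where
  "tree_solve m b n = (if m < 2 \<or> n < m - 1 then b n
    else b n + (\<Sum>js\<in>comps m (n - (m - 1)). sum_list (map (tree_solve m b) js)) / real (n choose (m - 1)))"
  by pat_completeness auto
termination
proof (relation "Wellfounded.measure (\<lambda>(m, b, n). n)", goal_cases)
  case (2 m b n js j)
  have "j \<le> sum_list js" using 2(3) by (auto intro!: member_le_sum_list)
  then show ?case using 2 by (auto simp: comps_def)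
qed simp

declare tree_solve.simps [simp del]

lemma tree_rec_solve: "2 \<le> m \<Longrightarrow> tree_rec m (tree_solve m b) b"
  unfolding tree_rec_def by (auto simp: tree_solve.simps[of m b])

lemma tree_solve_nonneg:
  assumes "\<And>n. b n \<ge> 0"
  shows "tree_solve m b n \<ge> 0"
proof (induction n rule: less_induct)
  case (less n)
  show ?case
  proof (cases "m < 2 \<or> n < m - 1")
    case True
    then show ?thesis using assms by (simp add: tree_solve.simps)
  next
    case False
    have "sum_list (map (tree_solve m b) js) \<ge> 0" if js: "js \<in> comps m (n - (m - 1))" for js
    proof (rule sum_list_nonneg)
      fix x assume "x \<in> set (map (tree_solve m b) js)"
      then obtain j where j: "j \<in> set js" "x = tree_solve m b j" by auto
      have "j \<le> sum_list js" using j(1) by (auto intro!: member_le_sum_list)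
      then have "j < n" using js False by (auto simp: comps_def)
      then show "0 \<le> x" using less j by simp
    qed
    then show ?thesis using False assms[of n]
      by (subst tree_solve.simps) (auto intro!: add_nonneg_nonneg divide_nonneg_nonneg sum_nonneg)
  qed
qed

lemma sum_list_linear: "(\<Sum>j\<leftarrow>js. c * (real j + 1)) = c * (real (sum_list js) + real (length js))"
  by (induction js) (simp_all add: algebra_simps)

lemma comps_linear:
  assumes "2 \<le> m" "m - 1 \<le> n" "js \<in> comps m (n - (m - 1))"
  shows "(\<Sum>j\<leftarrow>js. c * (real j + 1)) = c * (real n + 1)"
  unfolding sum_list_linear using assms by (simp add: comps_def of_nat_diff)

text \<open>\<open>(j + 2) choose 2\<close> is the coefficient sequence of
  \<open>(1 - z) powr (- 3)\<close>, so its sum over compositions is again a binomial coefficient.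
  It serves as a substitute for \<open>j^2 / 2\<close> whose average is exact.\<close>

lemma avg_choose_2:
  assumes "2 \<le> m" "m - 1 \<le> n"
  shows "avg m n (\<lambda>js. sum_list (map (\<lambda>j. real ((j + 2) choose 2)) js)) = (real n + 2) * (real n + 1) / (real m + 1)"
proof -
  define N where "N = n - (m - 1)"
  have "(ones ^ 3 :: real fps) = Abs_fps (\<lambda>j. real ((j + 2) choose 2))"
  proof (rule fps_ext)
    fix j
    have "fps_nth (ones ^ 3 :: real fps) j = real (card (comps 3 j))" by (simp only: sum_comps_0[symmetric] sum_constant mult_1_right)
    also have "card (comps 3 j) = (j + 2) choose 2" using card_comps_choose[of 3 "j + 2"] by simp
    finally show "fps_nth (ones ^ 3 :: real fps) j = fps_nth (Abs_fps (\<lambda>j. real ((j + 2) choose 2))) j" by simp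
  qed
  then have "(\<Sum>js\<in>comps m N. sum_list (map (\<lambda>j. real ((j + 2) choose 2)) js)) = fps_nth (of_nat m * (ones ^ (m - 1) * ones ^ 3)) N"
    unfolding sum_comps_1 by (simp add: mult.assoc)
  also have "\<dots> = real m * fps_nth (ones ^ (m + 2)) N"
  proof -
    have "m - 1 + 3 = m + 2" using assms by simp
    then show ?thesis by (simp add: power_add[symmetric] flip: fps_of_nat)
  qed
  also have "fps_nth (ones ^ (m + 2) :: real fps) N = real (card (comps (m + 2) N))" by (simp only: sum_comps_0[symmetric] sum_constant mult_1_right)
  also have "card (comps (m + 2) N) = (n + 2) choose (m + 1)"
    using card_comps_choose[of "m + 2" "n + 2"] assms by (simp add: N_def)
  finally have s: "(\<Sum>js\<in>comps m N. sum_list (map (\<lambda>j. real ((j + 2) choose 2)) js)) = real m * real ((n + 2) choose (m + 1))" .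
  have "(m + 1) * (m * ((n + 2) choose (m + 1))) = (n + 2) * (n + 1) * (n choose (m - 1))"
  proof -
    have absorb: "Suc k * (Suc n choose Suc k) = Suc n * (n choose k)" for n k
      using Suc_times_binomial_eq[of n k] by (simp only: mult.commute)
    obtain k where k: "m = Suc k" using assms by (cases m) auto
    have a: "Suc (Suc k) * (Suc (Suc n) choose Suc (Suc k)) = Suc (Suc n) * (Suc n choose Suc k)" by (rule absorb)
    have b: "Suc k * (Suc n choose Suc k) = Suc n * (n choose k)" by (rule absorb)
    have "(m + 1) * (m * ((n + 2) choose (m + 1))) = m * (Suc m * (Suc (Suc n) choose Suc m))"
      by (simp only: Suc_eq_plus1 add_2_eq_Suc' mult.left_commute)
    also have "\<dots> = Suc (Suc n) * (Suc k * (Suc n choose Suc k))" unfolding k a by (rule mult.left_commute)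
    also have "\<dots> = (n + 2) * (n + 1) * (n choose (m - 1))" unfolding b k by (simp add: algebra_simps)
    finally show ?thesis .
  qed
  moreover have "(real m + 1) * (real m * real C) = (real n + 2) * (real n + 1) * real D" if "(m + 1) * (m * C) = (n + 2) * (n + 1) * D" for C D
    using arg_cong[OF that, of real] by (simp add: algebra_simps)
  ultimately have "(real m + 1) * (real m * real ((n + 2) choose (m + 1))) = (real n + 2) * (real n + 1) * real (n choose (m - 1))"
    by blast
  moreover have "real (n choose (m - 1)) \<noteq> 0" using assms by simp
  moreover have "X / C = A / M" if "M * X = A * C" "C \<noteq> 0" "M \<noteq> 0" for X C A M :: real
    using that by (simp add: field_simps)
  ultimately show ?thesis unfolding avg_def N_def[symmetric] s by (metis add_eq_0_iff of_nat_Suc of_nat_neq_0 add.commute)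
qed

text \<open>For \<open>x = j / n\<close> in \<open>[0, 1]\<close> one has
  \<open>x powr q <= x powr (3/2) <= (x + x^2) / 2\<close>. Over the subtrees the terms
  \<open>x / 2\<close> add up to at most 1/2, and the terms \<open>x^2 / 2\<close> are replaced by
  binomials whose average is about \<open>1 / (m + 1) <= 1/3\<close>. The gap between 5/6 and 11/12
  absorbs the lower-order terms.\<close>

lemma avg_powr:
  assumes m: "2 \<le> m" and n: "m - 1 \<le> n" "24 \<le> n" and q: "q \<ge> 3 / 2"
  shows "avg m n (\<lambda>js. \<Sum>j\<leftarrow>js. real j powr q) \<le> 11 / 12 * real n powr q"
proof -
  have npos: "real n > 0" using n by simp
  have pt: "real j powr q \<le> real n powr q * (real j / (2 * real n) + real ((j + 2) choose 2) / (real n)\<^sup>2)" if "j \<le> n" for j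
  proof -
    define x where "x = real j / real n"
    have x: "0 \<le> x" "x \<le> 1" using that npos by (auto simp: x_def)
    have "x powr q \<le> x powr (3 / 2)" using x q by (cases "x = 0") (auto intro: powr_mono')
    also have "\<dots> \<le> (x + x\<^sup>2) / 2"
    proof (cases "x = 0")
      case False
      have "x powr (3 / 2) = x powr (1 / 2) * x powr 1" by (simp only: powr_add[symmetric]) simp
      then have e: "x powr (3 / 2) = sqrt x * x" using x False by (simp add: powr_half_sqrt)
      have "0 \<le> (1 - sqrt x)\<^sup>2" by simp
      then have "2 * sqrt x \<le> 1 + x" using x by (simp add: power2_eq_square algebra_simps)
      then have "2 * sqrt x * x \<le> (1 + x) * x" using x by (intro mult_right_mono) auto
      then show ?thesis unfolding e by (simp add: algebra_simps power2_eq_square)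
    qed simp
    finally have xq: "x powr q \<le> (x + x\<^sup>2) / 2" .
    have "(real j)\<^sup>2 / 2 \<le> real ((j + 2) choose 2)"
    proof -
      have "Suc 1 * (Suc (j + 1) choose Suc 1) = Suc (j + 1) * ((j + 1) choose 1)"
        using Suc_times_binomial_eq[of "j + 1" 1] by (simp only: mult.commute)
      then have "2 * ((j + 2) choose 2) = (j + 2) * (j + 1)" by (simp add: numeral_2_eq_2)
      then have "real (2 * ((j + 2) choose 2)) = real ((j + 2) * (j + 1))" by (rule arg_cong)
      then have "2 * real ((j + 2) choose 2) = (real j + 2) * (real j + 1)" by (simp del: binomial_Suc_Suc add: algebra_simps)
      then have "real ((j + 2) choose 2) = (real j + 2) * (real j + 1) / 2" by linarith
      then show ?thesis by (simp add: power2_eq_square algebra_simps)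
    qed
    then have "x\<^sup>2 / 2 \<le> real ((j + 2) choose 2) / (real n)\<^sup>2"
      using npos divide_right_mono[of "(real j)\<^sup>2 / 2" "real ((j + 2) choose 2)" "(real n)\<^sup>2"]
      by (simp add: x_def power_divide mult.commute)
    moreover have "x / 2 = real j / (2 * real n)" by (simp add: x_def)
    ultimately have "x powr q \<le> real j / (2 * real n) + real ((j + 2) choose 2) / (real n)\<^sup>2"
      using xq by (simp only: add_divide_distrib)
    then have "real n powr q * x powr q \<le> real n powr q * (real j / (2 * real n) + real ((j + 2) choose 2) / (real n)\<^sup>2)"
      by (intro mult_left_mono) auto
    moreover have "real n powr q * x powr q = real j powr q"
      using npos x by (simp add: powr_mult[symmetric] x_def)
    ultimately show ?thesis by simp
  qed
  have "avg m n (\<lambda>js. \<Sum>j\<leftarrow>js. real j powr q) \<le>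
    avg m n (\<lambda>js. real n powr q * (1 / 2 + 1 / (real n)\<^sup>2 * sum_list (map (\<lambda>j. real ((j + 2) choose 2)) js)))"
  proof (rule avg_mono)
    fix js assume js: "js \<in> comps m (n - (m - 1))"
    have "(\<Sum>j\<leftarrow>js. real j powr q) \<le> (\<Sum>j\<leftarrow>js. real n powr q * (real j / (2 * real n) + real ((j + 2) choose 2) / (real n)\<^sup>2))"
      using comps_member[OF js] by (intro sum_list_mono pt) auto
    also have "\<dots> = real n powr q * (real (sum_list js) / (2 * real n) + 1 / (real n)\<^sup>2 * sum_list (map (\<lambda>j. real ((j + 2) choose 2)) js))"
      by (induction js) (simp_all add: algebra_simps add_divide_distrib)
    also have "\<dots> \<le> real n powr q * (1 / 2 + 1 / (real n)\<^sup>2 * sum_list (map (\<lambda>j. real ((j + 2) choose 2)) js))"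
    proof (intro mult_left_mono add_right_mono)
      have "real (sum_list js) \<le> real n" using js by (simp add: comps_def)
      then show "real (sum_list js) / (2 * real n) \<le> 1 / 2" using npos by (simp add: field_simps)
    qed simp
    finally show "(\<Sum>j\<leftarrow>js. real j powr q) \<le> real n powr q * (1 / 2 + 1 / (real n)\<^sup>2 * sum_list (map (\<lambda>j. real ((j + 2) choose 2)) js))" .
  qed
  also have "\<dots> = real n powr q * (1 / 2 + 1 / (real n)\<^sup>2 * ((real n + 2) * (real n + 1) / (real m + 1)))"
    unfolding avg_mult avg_add avg_choose_2[OF m n(1)] using m n by (simp add: avg_const)
  also have "\<dots> \<le> real n powr q * (11 / 12)"
  proof (intro mult_left_mono)
    have "(real n + 2) * (real n + 1) / (real m + 1) \<le> (real n + 2) * (real n + 1) / 3"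
      using m by (intro divide_left_mono) auto
    also have "\<dots> \<le> 5 / 12 * (real n)\<^sup>2"
    proof -
      have "24 * real n \<le> real n * real n" using n by (intro mult_right_mono) auto
      moreover have "real n \<ge> 24" using n by simp
      moreover have "4 * ((real n + 2) * (real n + 1)) = 4 * (real n * real n) + 12 * real n + 8" by (simp add: algebra_simps)
      ultimately have "4 * ((real n + 2) * (real n + 1)) \<le> 5 * (real n * real n)" by linarith
      then show ?thesis unfolding power2_eq_square by linarith
    qed
    finally have "1 / (real n)\<^sup>2 * ((real n + 2) * (real n + 1) / (real m + 1)) \<le> 1 / (real n)\<^sup>2 * (5 / 12 * (real n)\<^sup>2)"
      by (intro mult_left_mono) auto
    also have "\<dots> = 5 / 12" using npos by simp
    finally show "1 / 2 + 1 / (real n)\<^sup>2 * ((real n + 2) * (real n + 1) / (real m + 1)) \<le> 11 / 12" by simp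
  qed simp
  finally show ?thesis by (simp only: mult.commute)
qed

lemma sum_list_const_mult: "(\<Sum>j\<leftarrow>js. c * f j) = c * (\<Sum>j\<leftarrow>js. f j :: real)"
  by (induction js) (simp_all add: distrib_left)

lemma sum_list_plus: "(\<Sum>j\<leftarrow>js. f j + g j) = (\<Sum>j\<leftarrow>js. f j) + (\<Sum>j\<leftarrow>js. g j :: real)"
  by (induction js) simp_all

lemma comps_member_less:
  assumes "2 \<le> m" "m - 1 \<le> n" "js \<in> comps m (n - (m - 1))" "j \<in> set js"
  shows "j < n"
proof -
  have "j \<le> sum_list js" using assms(4) by (auto intro: member_le_sum_list)
  then show ?thesis using assms by (auto simp: comps_def)
qed

lemma sum_list_mono_comps:
  fixes f g :: "nat \<Rightarrow> real"
  assumes "2 \<le> m" "m - 1 \<le> n" "js \<in> comps m (n - (m - 1))" "\<And>j. j < n \<Longrightarrow> f j \<le> g j"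
  shows "(\<Sum>j\<leftarrow>js. f j) \<le> (\<Sum>j\<leftarrow>js. g j)"
  using comps_member_less[OF assms(1-3)] assms(4) by (intro sum_list_mono) auto

text \<open>If \<open>|r| <= w * |s|\<close>, the sum is at most \<open>(1 + w) * |s|\<close> in
  modulus, and otherwise at most \<open>(1 + 1 / w) * |r|\<close>. A small \<open>w\<close> keeps
  the factor of the main term close to 1, a loss that a contraction can afford.\<close>

lemma add_power_even_le:
  fixes r s w :: real
  assumes "w > 0" "even K"
  shows "(r + s) ^ K \<le> (1 + w) ^ K * s ^ K + (1 + 1 / w) ^ K * r ^ K"
proof -
  have e: "(r + s) ^ K = \<bar>r + s\<bar> ^ K" "s ^ K = \<bar>s\<bar> ^ K" "r ^ K = \<bar>r\<bar> ^ K" using assms by (simp_all add: power_even_abs)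
  have n1: "0 \<le> (1 + w) ^ K * s ^ K" "0 \<le> (1 + 1 / w) ^ K * r ^ K" using assms by (auto simp: e)
  have t: "\<bar>r + s\<bar> \<le> \<bar>r\<bar> + \<bar>s\<bar>" by simp
  show ?thesis
  proof (cases "\<bar>r\<bar> \<le> w * \<bar>s\<bar>")
    case True
    then have "\<bar>r + s\<bar> \<le> (1 + w) * \<bar>s\<bar>" using t unfolding distrib_right by linarith
    then have "\<bar>r + s\<bar> ^ K \<le> ((1 + w) * \<bar>s\<bar>) ^ K" by (intro power_mono) auto
    then have "(r + s) ^ K \<le> (1 + w) ^ K * s ^ K" by (simp only: e power_mult_distrib)
    then show ?thesis using n1 by linarith
  next
    case False
    then have "\<bar>s\<bar> \<le> 1 / w * \<bar>r\<bar>" using assms by (simp add: pos_le_divide_eq mult.commute)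
    then have "\<bar>r + s\<bar> \<le> (1 + 1 / w) * \<bar>r\<bar>" using t unfolding distrib_right by linarith
    then have "\<bar>r + s\<bar> ^ K \<le> ((1 + 1 / w) * \<bar>r\<bar>) ^ K" by (intro power_mono) auto
    then have "(r + s) ^ K \<le> (1 + 1 / w) ^ K * r ^ K" by (simp only: e power_mult_distrib)
    then show ?thesis using n1 by linarith
  qed
qed

lemma expect_Y_avg:
  fixes f :: "real \<Rightarrow> real"
  assumes "2 \<le> m" "m - 1 \<le> n"
  shows "expect (Y_law m t n) f = avg m n (\<lambda>js. expect (conv_list (map (Y_law m t) js)) (\<lambda>s. f (resid m t n js + s)))"
  unfolding expect_Y_rec[OF assms] avg_def by (simp add: sum_distrib_left divide_inverse mult.commute del: One_nat_def)

section \<open>Contraction of the tree recurrence on superlinear scales\<close>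

context tree_asymp
begin

definition "rt n = sqrt (S2 n)"

lemma S2_nonneg: "S2 n \<ge> 0"
  by (simp add: S2_MM MM_nonneg)

lemma S2_mono: "j \<le> n \<Longrightarrow> S2 j \<le> S2 n"
  unfolding S2_MM using MM_mono MM_nonneg by (intro mult_mono) auto

lemma rt_pos: "n \<ge> 1 \<Longrightarrow> rt n > 0"
  using S2_pos by (simp add: rt_def)

lemma rt_nonneg: "rt n \<ge> 0"
  by (simp add: rt_def S2_nonneg)

lemma rt_mono: "j \<le> n \<Longrightarrow> rt j \<le> rt n"
  by (simp add: rt_def S2_mono)

lemma rt_sq: "(rt n)\<^sup>2 = S2 n"
  by (simp add: rt_def S2_nonneg)

lemma sqrt_power: "k \<ge> 1 \<Longrightarrow> sqrt (real n) ^ k = real n powr (real k / 2)"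
proof (cases "n = 0")
  case False
  then have "real n powr (real k / 2) = (real n powr (1 / 2)) powr real k" by (simp add: powr_powr)
  then show ?thesis using False by (simp add: powr_half_sqrt powr_realpow)
qed simp

text \<open>\<open>rt j ^ k\<close> is \<open>j powr (k / 2)\<close> times a nondecreasing factor,
  which is bounded by its value at \<open>n\<close>; \<open>k >= 3\<close> makes the exponent at
  least 3/2. From \<open>n = 25\<close> on, \<open>m - 1 <= n\<close> holds for every admissible
  \<open>m\<close>.\<close>

lemma rt_contract:
  assumes "k \<ge> 3" "n \<ge> 25"
  shows "avg m n (\<lambda>js. \<Sum>j\<leftarrow>js. rt j ^ k) \<le> 11 / 12 * rt n ^ k"
proof -
  have mn: "m - 1 \<le> n" using m26 assms by simp
  have r: "rt j ^ k = real j powr (real k / 2) * sqrt (MM j) ^ k" for j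
    using assms sqrt_power[of k j] by (simp add: rt_def S2_MM real_sqrt_mult power_mult_distrib)
  have "avg m n (\<lambda>js. \<Sum>j\<leftarrow>js. rt j ^ k) \<le> avg m n (\<lambda>js. sqrt (MM n) ^ k * (\<Sum>j\<leftarrow>js. real j powr (real k / 2)))"
  proof (rule avg_mono)
    fix js assume js: "js \<in> comps m (n - (m - 1))"
    have "(\<Sum>j\<leftarrow>js. rt j ^ k) \<le> (\<Sum>j\<leftarrow>js. sqrt (MM n) ^ k * real j powr (real k / 2))"
    proof (rule sum_list_mono_comps[OF m2 mn js])
      fix j assume "j < n"
      then have "sqrt (MM j) ^ k \<le> sqrt (MM n) ^ k" using MM_mono[of j n] by (intro power_mono) (auto simp: MM_nonneg)
      then show "rt j ^ k \<le> sqrt (MM n) ^ k * real j powr (real k / 2)"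
        unfolding r by (subst mult.commute, intro mult_right_mono) auto
    qed
    then show "(\<Sum>j\<leftarrow>js. rt j ^ k) \<le> sqrt (MM n) ^ k * (\<Sum>j\<leftarrow>js. real j powr (real k / 2))"
      by (simp only: sum_list_const_mult)
  qed
  also have "\<dots> \<le> sqrt (MM n) ^ k * (11 / 12 * real n powr (real k / 2))"
    unfolding avg_mult using assms mn by (intro mult_left_mono avg_powr m2) (auto simp: MM_nonneg)
  finally show ?thesis by (simp add: r mult_ac)
qed

lemma linear_rt:
  assumes "k \<ge> 3" "C \<ge> 0"
  shows "(\<lambda>n. C * (real n + 1) / rt n ^ k) \<longlonglongrightarrow> 0"
proof (rule tendsto_sandwich[of "\<lambda>_. 0" _ _ "\<lambda>n. C / sqrt (MM 1) ^ k * ((real n + 1) / (real n powr (3 / 2)))"])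
  have M: "sqrt (MM 1) > 0" using MM_pos[of 1] by simp
  show "\<forall>\<^sub>F n in sequentially. 0 \<le> C * (real n + 1) / rt n ^ k"
    using assms by (intro always_eventually) (simp add: rt_nonneg)
  show "\<forall>\<^sub>F n in sequentially. C * (real n + 1) / rt n ^ k \<le> C / sqrt (MM 1) ^ k * ((real n + 1) / (real n powr (3 / 2)))"
    using eventually_ge_at_top[of 1]
  proof eventually_elim
    case (elim n)
    have "real n powr (3 / 2) * sqrt (MM 1) ^ k \<le> real n powr (real k / 2) * sqrt (MM n) ^ k"
      using elim assms MM_mono[of 1 n] M by (intro mult_mono powr_mono power_mono) auto
    also have "\<dots> = rt n ^ k"
      using assms sqrt_power[of k n] by (simp add: rt_def S2_MM real_sqrt_mult power_mult_distrib)
    finally have le: "real n powr (3 / 2) * sqrt (MM 1) ^ k \<le> rt n ^ k" .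
    have p: "real n powr (3 / 2) * sqrt (MM 1) ^ k > 0" using elim M by simp
    have "C * (real n + 1) / rt n ^ k \<le> C * (real n + 1) / (real n powr (3 / 2) * sqrt (MM 1) ^ k)"
      using le p assms by (intro divide_left_mono mult_pos_pos[OF order_less_le_trans[OF p le] p]) auto
    then show ?case by (simp add: mult.commute)
  qed
  have "(\<lambda>n. C / sqrt (MM 1) ^ k * ((real n + 1) / (real n powr (3 / 2)))) \<longlonglongrightarrow> C / sqrt (MM 1) ^ k * 0"
    by (intro tendsto_mult tendsto_const) real_asymp
  then show "(\<lambda>n. C / sqrt (MM 1) ^ k * ((real n + 1) / (real n powr (3 / 2)))) \<longlonglongrightarrow> 0" by simp
qed simp

text \<open>The majorant \<open>12 * \<epsilon> * rt n ^ k\<close> reproduces itself, as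
  \<open>\<epsilon> + 11/12 * 12 * \<epsilon> = 12 * \<epsilon>\<close>. The initial values go into
  \<open>C * (n + 1)\<close>, which every root split preserves exactly and which is negligible
  against \<open>rt n ^ k\<close>.\<close>

lemma contraction_o:
  assumes k: "k \<ge> 3" and x: "\<And>n. x n \<ge> 0"
    and rec: "\<And>n. n \<ge> m - 1 \<Longrightarrow> x n \<le> e n + avg m n (\<lambda>js. \<Sum>j\<leftarrow>js. x j)"
    and e: "(\<lambda>n. e n / rt n ^ k) \<longlonglongrightarrow> 0"
  shows "(\<lambda>n. x n / rt n ^ k) \<longlonglongrightarrow> 0"
proof (rule LIMSEQ_I)
  fix d :: real assume "d > 0"
  define \<epsilon> where "\<epsilon> = d / 24"
  have "\<epsilon> > 0" using \<open>d > 0\<close> by (simp add: \<epsilon>_def)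
  obtain N0 where N0: "\<And>n. n \<ge> N0 \<Longrightarrow> e n / rt n ^ k < \<epsilon>"
    using order_tendstoD(2)[OF e \<open>\<epsilon> > 0\<close>] unfolding eventually_sequentially by blast
  define N where "N = max 25 N0"
  define C where "C = (\<Sum>j<N. x j)"
  have C: "C \<ge> 0" unfolding C_def by (intro sum_nonneg x)
  have claim: "x n \<le> 12 * \<epsilon> * rt n ^ k + C * (real n + 1)" for n
  proof (induction n rule: less_induct)
    case (less n)
    show ?case
    proof (cases "n < N")
      case True
      then have "x n \<le> C" unfolding C_def by (intro member_le_sum x) auto
      also have "C \<le> C * (real n + 1)" using C by (simp add: distrib_left)
      moreover have "12 * \<epsilon> * rt n ^ k \<ge> 0" using \<open>\<epsilon> > 0\<close> rt_nonneg by simp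
      ultimately show ?thesis by linarith
    next
      case False
      then have n: "n \<ge> 25" "n \<ge> N0" by (auto simp: N_def)
      have mn: "m - 1 \<le> n" using m26 n by simp
      have "rt n ^ k > 0" using rt_pos n by simp
      then have en: "e n \<le> \<epsilon> * rt n ^ k" using N0[OF n(2)] by (simp add: pos_divide_less_eq less_imp_le)
      have "avg m n (\<lambda>js. \<Sum>j\<leftarrow>js. x j) \<le> avg m n (\<lambda>js. 12 * \<epsilon> * (\<Sum>j\<leftarrow>js. rt j ^ k) + C * (real n + 1))"
      proof (rule avg_mono)
        fix js assume js: "js \<in> comps m (n - (m - 1))"
        have "(\<Sum>j\<leftarrow>js. x j) \<le> (\<Sum>j\<leftarrow>js. 12 * \<epsilon> * rt j ^ k + C * (real j + 1))"
          by (rule sum_list_mono_comps[OF m2 mn js]) (rule less)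
        then show "(\<Sum>j\<leftarrow>js. x j) \<le> 12 * \<epsilon> * (\<Sum>j\<leftarrow>js. rt j ^ k) + C * (real n + 1)"
          unfolding sum_list_plus comps_linear[OF m2 mn js] by (simp only: sum_list_const_mult)
      qed
      also have "\<dots> = 12 * \<epsilon> * avg m n (\<lambda>js. \<Sum>j\<leftarrow>js. rt j ^ k) + C * (real n + 1)"
        unfolding avg_add avg_mult using avg_const m2 mn by simp
      also have "12 * \<epsilon> * avg m n (\<lambda>js. \<Sum>j\<leftarrow>js. rt j ^ k) \<le> 12 * \<epsilon> * (11 / 12 * rt n ^ k)"
        using \<open>\<epsilon> > 0\<close> by (intro mult_left_mono rt_contract k n) auto
      finally show ?thesis using rec[OF mn] en by simp
    qed
  qed
  have "\<forall>\<^sub>F n in sequentially. C * (real n + 1) / rt n ^ k < d / 2"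
    using \<open>d > 0\<close> by (intro order_tendstoD(2)[OF linear_rt[OF k C]]) simp
  then obtain N1 where N1: "\<And>n. n \<ge> N1 \<Longrightarrow> C * (real n + 1) / rt n ^ k < d / 2" unfolding eventually_sequentially by blast
  have "norm (x n / rt n ^ k - 0) < d" if "n \<ge> max 1 N1" for n
  proof -
    have p: "rt n ^ k > 0" using rt_pos that by simp
    have "x n / rt n ^ k \<le> (12 * \<epsilon> * rt n ^ k + C * (real n + 1)) / rt n ^ k"
      using claim p by (intro divide_right_mono) auto
    also have "\<dots> = 12 * \<epsilon> + C * (real n + 1) / rt n ^ k" using p by (simp only: add_divide_distrib nonzero_mult_div_cancel_right less_irrefl)
    also have "\<dots> < d" using N1[of n] that unfolding \<epsilon>_def by linarith
    finally have "x n / rt n ^ k < d" .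
    moreover have "0 \<le> x n / rt n ^ k" using x p by simp
    ultimately show ?thesis by simp
  qed
  then show "\<exists>no. \<forall>n\<ge>no. norm (x n / rt n ^ k - 0) < d" by blast
qed

text \<open>Finitely many exceptions are absorbed into the constant. As \<open>rt 0 = 0\<close>, the
  index 0 has to be covered by the hypothesis on \<open>x 0\<close>.\<close>

lemma bounded_rt:
  assumes "x 0 \<le> 0" "\<And>n. n \<ge> N \<Longrightarrow> x n \<le> B * rt n ^ k"
  shows "\<exists>C\<ge>0. \<forall>n. x n \<le> C * rt n ^ k"
proof -
  define C where "C = \<bar>B\<bar> + (\<Sum>j=1..<N. \<bar>x j / rt j ^ k\<bar>)"
  have C: "C \<ge> \<bar>B\<bar>" unfolding C_def by (simp add: sum_nonneg)
  have "x n \<le> C * rt n ^ k" for n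
  proof (cases "n \<ge> N")
    case True
    have "x n \<le> B * rt n ^ k" using assms True by simp
    also have "\<dots> \<le> C * rt n ^ k" using C rt_nonneg by (intro mult_right_mono) auto
    finally show ?thesis .
  next
    case False
    show ?thesis
    proof (cases "n = 0")
      case True
      then have "x n \<le> 0" "0 \<le> C * rt n ^ k" using assms C rt_nonneg by auto
      then show ?thesis by linarith
    next
      case False
      then have p: "rt n ^ k > 0" using rt_pos by simp
      have "\<bar>x n / rt n ^ k\<bar> \<le> (\<Sum>j=1..<N. \<bar>x j / rt j ^ k\<bar>)"
        using \<open>\<not> n \<ge> N\<close> False by (intro member_le_sum[where f="\<lambda>j. \<bar>x j / rt j ^ k\<bar>"]) auto
      then have "x n / rt n ^ k \<le> C" unfolding C_def using abs_ge_self[of "x n / rt n ^ k"] abs_ge_zero[of B] by linarith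
      then show ?thesis using p by (simp add: pos_divide_le_eq)
    qed
  qed
  moreover have "C \<ge> 0" using C by linarith
  ultimately show ?thesis by blast
qed

text \<open>The factor 23/22 still leaves \<open>23/22 * 11/12 = 23/24 < 1\<close>. So a constant
  \<open>C >= 24 * |B|\<close> that also covers the initial values reproduces itself.\<close>

lemma contraction_O:
  assumes k: "k \<ge> 3" and x0: "x 0 \<le> 0" and x: "\<And>n. x n \<ge> 0"
    and rec: "\<And>n. n \<ge> N \<Longrightarrow> x n \<le> B * rt n ^ k + 23 / 22 * avg m n (\<lambda>js. \<Sum>j\<leftarrow>js. x j)"
  shows "\<exists>C\<ge>0. \<forall>n. x n \<le> C * rt n ^ k"
proof -
  define C where "C = 24 * \<bar>B\<bar> + (\<Sum>j=1..<max 25 N. \<bar>x j / rt j ^ k\<bar>)"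
  have C: "C \<ge> 24 * \<bar>B\<bar>" unfolding C_def by (simp add: sum_nonneg)
  have C0: "C \<ge> 0" using C by linarith
  have "x n \<le> C * rt n ^ k" for n
  proof (induction n rule: less_induct)
    case (less n)
    consider "n = 0" | "n \<ge> 1" "n < max 25 N" | "n \<ge> 25" "n \<ge> N" by linarith
    then show ?case
    proof cases
      case 1
      then have "x n \<le> 0" "0 \<le> C * rt n ^ k" using x0 C0 rt_nonneg by auto
      then show ?thesis by linarith
    next
      case 2
      then have p: "rt n ^ k > 0" using rt_pos by simp
      have "\<bar>x n / rt n ^ k\<bar> \<le> (\<Sum>j=1..<max 25 N. \<bar>x j / rt j ^ k\<bar>)"
        using 2 by (intro member_le_sum[where f="\<lambda>j. \<bar>x j / rt j ^ k\<bar>"]) auto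
      then have "x n / rt n ^ k \<le> C" unfolding C_def using abs_ge_self[of "x n / rt n ^ k"] abs_ge_zero[of B] by linarith
      then show ?thesis using p by (simp add: pos_divide_le_eq)
    next
      case 3
      have mn: "m - 1 \<le> n" using m26 3 by simp
      have "avg m n (\<lambda>js. \<Sum>j\<leftarrow>js. x j) \<le> avg m n (\<lambda>js. C * (\<Sum>j\<leftarrow>js. rt j ^ k))"
      proof (rule avg_mono)
        fix js assume js: "js \<in> comps m (n - (m - 1))"
        have "(\<Sum>j\<leftarrow>js. x j) \<le> (\<Sum>j\<leftarrow>js. C * rt j ^ k)"
          by (rule sum_list_mono_comps[OF m2 mn js]) (rule less)
        then show "(\<Sum>j\<leftarrow>js. x j) \<le> C * (\<Sum>j\<leftarrow>js. rt j ^ k)" by (simp only: sum_list_const_mult)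
      qed
      also have "\<dots> \<le> C * (11 / 12 * rt n ^ k)"
        unfolding avg_mult using C0 by (intro mult_left_mono rt_contract k 3) auto
      finally have "x n \<le> B * rt n ^ k + 23 / 22 * (C * (11 / 12 * rt n ^ k))" using rec[OF 3(2)] by simp
      also have "\<dots> = (B + 23 / 24 * C) * rt n ^ k" by (simp add: algebra_simps)
      also have "\<dots> \<le> C * rt n ^ k"
      proof (intro mult_right_mono)
        show "B + 23 / 24 * C \<le> C" using C abs_ge_self[of B] by linarith
      qed (simp add: rt_nonneg)
      finally show ?thesis .
    qed
  qed
  then show ?thesis using C0 by blast
qed

lemma S2_at_top: "filterlim S2 at_top at_top"
proof (rule filterlim_at_top_mono)
  show "filterlim (\<lambda>n. MM 1 * real n) at_top at_top"
    using MM_pos[of 1] by (intro filterlim_tendsto_pos_mult_at_top[OF tendsto_const] filterlim_real_sequentially) auto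
  show "\<forall>\<^sub>F n in sequentially. MM 1 * real n \<le> S2 n"
    using eventually_ge_at_top[of 1]
  proof eventually_elim
    case (elim n)
    then show ?case using MM_mono[of 1 n] by (simp add: S2_MM mult.commute mult_left_mono)
  qed
qed

text \<open>\<open>S2 n\<close> minus the sum over the subtrees equals \<open>(m - 1) * MM n\<close>
  plus the sum of the \<open>j * (MM n - MM j)\<close>. Subtrees with \<open>j < d * n\<close>
  contribute little because of the factor \<open>j\<close>, the larger ones because
  \<open>MM\<close> is locally almost constant.\<close>

lemma S2_defect:
  assumes "e > 0"
  shows "\<exists>N. \<forall>n\<ge>N. \<forall>js\<in>comps m (n - (m - 1)). \<bar>(\<Sum>j\<leftarrow>js. S2 j) - S2 n\<bar> \<le> e * S2 n"
proof -
  define d where "d = e / (real m + 1)"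
  have d: "d > 0" "(real m + 1) * d = e" using assms by (auto simp: d_def)
  obtain N0 where N0: "\<And>n j. n \<ge> N0 \<Longrightarrow> j \<le> n \<Longrightarrow> d * real n \<le> real j \<Longrightarrow> MM n - MM j \<le> d * MM n"
    using MM_local[OF d(1) d(1)] by blast
  obtain N1 :: nat where N1: "real N1 \<ge> real m / d" using real_arch_simple[of "real m / d"] by blast
  have "\<bar>(\<Sum>j\<leftarrow>js. S2 j) - S2 n\<bar> \<le> e * S2 n" if n: "n \<ge> max m (max N0 N1)" and js: "js \<in> comps m (n - (m - 1))" for n js
  proof -
    have mn: "m - 1 \<le> n" using n by linarith
    have len: "length js = m" and sm: "sum_list js = n - (m - 1)" using js by (auto simp: comps_def)
    have pt: "real j * (MM n - MM j) \<le> d * S2 n" if "j < n" for j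
    proof (cases "d * real n \<le> real j")
      case True
      have "real j * (MM n - MM j) \<le> real n * (d * MM n)"
        using N0[of n j] n that True MM_mono[of j n] by (intro mult_mono) auto
      then show ?thesis by (simp add: S2_MM mult_ac)
    next
      case False
      have "real j * (MM n - MM j) \<le> (d * real n) * MM n"
        using False MM_mono[of j n] MM_nonneg[of j] that by (intro mult_mono) auto
      then show ?thesis by (simp add: S2_MM mult_ac)
    qed
    have up: "(\<Sum>j\<leftarrow>js. real j * (MM n - MM j)) \<le> (\<Sum>j\<leftarrow>js. d * S2 n)"
      by (rule sum_list_mono_comps[OF m2 mn js]) (rule pt)
    have lo: "0 \<le> (\<Sum>j\<leftarrow>js. real j * (MM n - MM j))"
    proof -
      have "(\<Sum>j\<leftarrow>js. 0) \<le> (\<Sum>j\<leftarrow>js. real j * (MM n - MM j))"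
        by (rule sum_list_mono_comps[OF m2 mn js]) (simp add: MM_mono)
      then show ?thesis by simp
    qed
    have eq: "(\<Sum>j\<leftarrow>js. real j * (MM n - MM j)) = real (sum_list js) * MM n - (\<Sum>j\<leftarrow>js. S2 j)" for js
      by (induction js) (simp_all add: S2_MM algebra_simps)
    have rn: "real (sum_list js) = real n - (real m - 1)" unfolding sm using mn m2 by (simp add: of_nat_diff)
    have diff: "S2 n - (\<Sum>j\<leftarrow>js. S2 j) = (real m - 1) * MM n + (\<Sum>j\<leftarrow>js. real j * (MM n - MM j))"
      unfolding eq rn S2_MM[of n] by (simp add: algebra_simps)
    have "real m / d \<le> real n" using N1 n by simp
    then have "real m \<le> d * real n" using d by (simp add: pos_divide_le_eq mult.commute)
    then have "(real m - 1) * MM n \<le> (d * real n) * MM n" using MM_nonneg by (intro mult_right_mono) auto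
    then have a: "(real m - 1) * MM n \<le> d * S2 n" by (simp add: S2_MM mult_ac)
    have b: "0 \<le> (real m - 1) * MM n" using m2 MM_nonneg by simp
    have c: "(\<Sum>j\<leftarrow>js. d * S2 n) = real m * (d * S2 n)" using len by (simp add: sum_list_triv)
    have "d * S2 n + real m * (d * S2 n) = e * S2 n" unfolding d(2)[symmetric] by (simp add: algebra_simps)
    then show ?thesis using diff a b c up lo by linarith
  qed
  then show ?thesis by blast
qed

lemma var_uniform:
  assumes "e > 0"
  shows "\<exists>N. \<forall>n\<ge>N. \<forall>js\<in>comps m (n - (m - 1)). \<bar>(\<Sum>j\<leftarrow>js. var_X m t j) - var_X m t n\<bar> \<le> e * S2 n"
proof -
  define d where "d = e / (real m + 2)"
  have d: "d > 0" "(real m + 2) * d = e" using assms by (auto simp: d_def)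
  have "\<exists>N. \<forall>n\<ge>N. \<forall>j\<le>n. \<bar>var_X m t j - 1 * S2 j\<bar> \<le> d * S2 n"
  proof (rule uniform_approx[OF var_S2 S2_at_top _ d(1), of 0])
    fix n j :: nat assume "j \<le> n"
    then show "S2 j \<le> 2 * S2 n" using S2_mono[of j n] S2_nonneg[of n] by linarith
  qed
  then obtain N0 where N0: "\<And>n j. n \<ge> N0 \<Longrightarrow> j \<le> n \<Longrightarrow> \<bar>var_X m t j - S2 j\<bar> \<le> d * S2 n"
    unfolding mult_1 by blast
  obtain N1 where N1: "\<And>n js. n \<ge> N1 \<Longrightarrow> js \<in> comps m (n - (m - 1)) \<Longrightarrow> \<bar>(\<Sum>j\<leftarrow>js. S2 j) - S2 n\<bar> \<le> d * S2 n"
    using S2_defect[OF d(1)] by blast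
  have "\<bar>(\<Sum>j\<leftarrow>js. var_X m t j) - var_X m t n\<bar> \<le> e * S2 n" if n: "n \<ge> max N0 N1" and js: "js \<in> comps m (n - (m - 1))" for n js
  proof -
    have a: "\<bar>(\<Sum>j\<leftarrow>js. var_X m t j) - (\<Sum>j\<leftarrow>js. S2 j)\<bar> \<le> real m * (d * S2 n)"
      using n by (intro sum_list_comps_bound[OF js] N0) auto
    have b: "\<bar>var_X m t n - S2 n\<bar> \<le> d * S2 n" using n by (intro N0) auto
    have c: "\<bar>(\<Sum>j\<leftarrow>js. S2 j) - S2 n\<bar> \<le> d * S2 n" using n by (intro N1 js) auto
    have "real m * (d * S2 n) + d * S2 n + d * S2 n = e * S2 n" unfolding d(2)[symmetric] by (simp add: algebra_simps)
    then show ?thesis using a b c by linarith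
  qed
  then show ?thesis by blast
qed

text \<open>The residual is of order \<open>G n\<close>, and \<open>(G n)^2\<close> is negligible
  against \<open>S2 n\<close>. As in Lindeberg's condition, no single split contributes noticeably
  to the variance.\<close>

lemma resid_small:
  assumes "e > 0"
  shows "\<exists>N. \<forall>n\<ge>N. \<forall>js\<in>comps m (n - (m - 1)). \<bar>resid m t n js\<bar> \<le> e * rt n"
proof -
  obtain B N0 where B: "B > 0" and N0: "\<And>n js. n \<ge> N0 \<Longrightarrow> js \<in> comps m (n - (m - 1)) \<Longrightarrow> \<bar>resid m t n js\<bar> \<le> B * G n"
    using resid_bound by blast
  have "\<forall>\<^sub>F n in sequentially. (G n)\<^sup>2 / S2 n < (e / B)\<^sup>2"
    using assms B by (intro order_tendstoD(2)[OF G_sq_S2]) simp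
  then obtain N1 where N1: "\<And>n. n \<ge> N1 \<Longrightarrow> (G n)\<^sup>2 / S2 n < (e / B)\<^sup>2" unfolding eventually_sequentially by blast
  have "\<bar>resid m t n js\<bar> \<le> e * rt n" if n: "n \<ge> max 1 (max N0 N1)" and js: "js \<in> comps m (n - (m - 1))" for n js
  proof -
    have "S2 n > 0" using S2_pos n by simp
    then have "(G n)\<^sup>2 \<le> (e / B)\<^sup>2 * S2 n" using N1[of n] n by (simp add: pos_divide_less_eq less_imp_le)
    then have "(G n)\<^sup>2 \<le> (e / B * rt n)\<^sup>2" by (simp only: power_mult_distrib rt_sq)
    moreover have "0 \<le> e / B * rt n" using assms B rt_nonneg[of n] by simp
    ultimately have "G n \<le> e / B * rt n" by (rule power2_le_imp_le)
    then have "B * G n \<le> B * (e / B * rt n)" using B by (intro mult_left_mono) auto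
    also have "\<dots> = e * rt n" using B by simp
    finally show ?thesis using N0[of n js] n js by simp
  qed
  then show ?thesis by blast
qed

end

lemma small_bounds:
  fixes r d e R :: real
  assumes "\<bar>r\<bar> \<le> e * R" "0 \<le> d" "d \<le> e * R\<^sup>2" "0 \<le> e" "e \<le> 1" "0 \<le> R"
  shows "\<bar>r\<bar> ^ 3 + \<bar>r\<bar> * d \<le> 2 * e * R ^ 3" and "d\<^sup>2 + r\<^sup>2 * d \<le> 2 * e * R ^ 4"
proof -
  have e2: "e ^ 2 \<le> e" "e ^ 3 \<le> e" using power_decreasing[of 1 2 e] power_decreasing[of 1 3 e] assms by simp_all
  have r2: "r\<^sup>2 \<le> (e * R)\<^sup>2" using power_mono[OF assms(1), of 2] by simp
  have "\<bar>r\<bar> ^ 3 \<le> (e * R) ^ 3" using assms by (intro power_mono) auto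
  also have "\<dots> \<le> e * R ^ 3" unfolding power_mult_distrib using e2 assms by (intro mult_right_mono) auto
  finally have a: "\<bar>r\<bar> ^ 3 \<le> e * R ^ 3" .
  have "\<bar>r\<bar> * d \<le> (e * R) * (e * R\<^sup>2)" using assms by (intro mult_mono) auto
  also have "\<dots> = e ^ 2 * R ^ 3" by (simp add: power2_eq_square power3_eq_cube mult_ac)
  also have "\<dots> \<le> e * R ^ 3" using e2 assms by (intro mult_right_mono) auto
  finally show "\<bar>r\<bar> ^ 3 + \<bar>r\<bar> * d \<le> 2 * e * R ^ 3" using a by linarith
  have R4: "R ^ 4 \<ge> 0" by simp
  have "d\<^sup>2 \<le> (e * R\<^sup>2)\<^sup>2" using assms by (intro power_mono) auto
  also have "\<dots> = e ^ 2 * R ^ 4" by (simp add: power_mult_distrib flip: power_mult)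
  also have "\<dots> \<le> e * R ^ 4" using e2(1) R4 by (rule mult_right_mono)
  finally have b: "d\<^sup>2 \<le> e * R ^ 4" .
  have "r\<^sup>2 * d \<le> (e * R)\<^sup>2 * (e * R\<^sup>2)" using assms r2 by (intro mult_mono) auto
  also have "\<dots> = e ^ 3 * R ^ 4" by (simp add: power2_eq_square power3_eq_cube power4_eq_xxxx mult_ac)
  also have "\<dots> \<le> e * R ^ 4" using e2(2) R4 by (rule mult_right_mono)
  finally show "d\<^sup>2 + r\<^sup>2 * d \<le> 2 * e * R ^ 4" using b by linarith
qed

text \<open>The characteristic function at \<open>u\<close> of the centred normal law with variance
  \<open>v\<close>.\<close>

definition gauss :: "real \<Rightarrow> real \<Rightarrow> complex" where
  "gauss u v = of_real (exp (- u\<^sup>2 * v / 2))"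

lemma prod_list_gauss: "(\<Prod>j\<leftarrow>js. gauss u (f j)) = gauss u (\<Sum>j\<leftarrow>js. f j)"
proof (induction js)
  case (Cons j js)
  have "- u\<^sup>2 * (f j + (\<Sum>j\<leftarrow>js. f j)) / 2 = - u\<^sup>2 * f j / 2 + - u\<^sup>2 * (\<Sum>j\<leftarrow>js. f j) / 2"
    by (simp add: field_simps)
  then show ?case using Cons by (simp only: gauss_def list.map prod_list.Cons sum_list.Cons exp_add of_real_mult)
qed (simp add: gauss_def)

lemma var_X_nonneg: "var_X m t n \<ge> 0"
  unfolding var_X_law by (intro Bochner_Integration.integral_nonneg) simp

lemma norm_gauss_le_1: "v \<ge> 0 \<Longrightarrow> norm (gauss u v) \<le> 1"
  by (simp add: gauss_def)

definition phi_err :: "nat \<Rightarrow> (nat \<Rightarrow> real) \<Rightarrow> real \<Rightarrow> nat \<Rightarrow> real" where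
  "phi_err m t u n = norm (phi m t n u - gauss u (var_X m t n))"

definition var_dev :: "nat \<Rightarrow> (nat \<Rightarrow> real) \<Rightarrow> nat \<Rightarrow> nat list \<Rightarrow> real" where
  "var_dev m t n js = \<bar>(\<Sum>j\<leftarrow>js. var_X m t j) - var_X m t n\<bar>"

text \<open>The averaged remainder of \<open>char_pointwise\<close> belonging to
  \<open>|u| ^ 3\<close>, with the power of \<open>u\<close> stripped; \<open>errB\<close> is the
  one belonging to \<open>u ^ 4\<close>. Below \<open>m - 1\<close> the law is degenerate and there
  is no error.\<close>

definition errA :: "nat \<Rightarrow> (nat \<Rightarrow> real) \<Rightarrow> nat \<Rightarrow> real" where
  "errA m t n = (if n < m - 1 then 0 else
     avg m n (\<lambda>js. \<bar>resid m t n js\<bar> ^ 3 + \<bar>resid m t n js\<bar> * var_dev m t n js))"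

definition errB :: "nat \<Rightarrow> (nat \<Rightarrow> real) \<Rightarrow> nat \<Rightarrow> real" where
  "errB m t n = (if n < m - 1 then 0 else
     avg m n (\<lambda>js. (var_dev m t n js)\<^sup>2 + (resid m t n js)\<^sup>2 * var_dev m t n js))"

lemma avg_nonneg: "(\<And>js. f js \<ge> 0) \<Longrightarrow> avg m n f \<ge> 0"
  unfolding avg_def by (intro divide_nonneg_nonneg sum_nonneg) auto

lemma errA_nonneg: "errA m t n \<ge> 0" and errB_nonneg: "errB m t n \<ge> 0"
  by (auto simp: errA_def errB_def var_dev_def intro!: avg_nonneg add_nonneg_nonneg mult_nonneg_nonneg)

lemma phi_err_rec:
  assumes m: "2 \<le> m" and n: "m - 1 \<le> n"
  shows "phi_err m t u n \<le> \<bar>u\<bar> ^ 3 * errA m t n + u ^ 4 * errB m t n + avg m n (\<lambda>js. \<Sum>j\<leftarrow>js. phi_err m t u j)"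
proof -
  define I where "I = comps m (n - (m - 1))"
  define C where "C = real (n choose (m - 1))"
  define r where "r = resid m t n"
  define s where "s = var_X m t n"
  define v where "v js = (\<Sum>j\<leftarrow>js. var_X m t j)" for js
  define W where "W js = gauss u s * (1 - of_real (u\<^sup>2 / 2 * (v js - s)) + \<i> * of_real (u * r js) - of_real (u\<^sup>2 * (r js)\<^sup>2 / 2))" for js
  have C: "C > 0" using n by (simp add: C_def)
  have cardI: "(\<Sum>js\<in>I. 1) = C" using card_comps_choose[of m n] m n by (simp add: I_def C_def)
  have r0: "(\<Sum>js\<in>I. r js) = 0" unfolding I_def r_def by (rule sum_resid[OF m n])
  have "s = (\<Sum>js\<in>I. (r js)\<^sup>2) / C + (\<Sum>js\<in>I. v js) / C"
    using tree_rec_var[OF m, of t] n unfolding tree_rec_def var_toll_resid[OF n, symmetric] I_def r_def C_def v_def s_def by blast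
  then have "s * C = (\<Sum>js\<in>I. (r js)\<^sup>2) + (\<Sum>js\<in>I. v js)" using C by (simp add: field_simps)
  moreover have "(\<Sum>js\<in>I. (v js - s) + (r js)\<^sup>2) = (\<Sum>js\<in>I. v js) - s * (\<Sum>js\<in>I. 1) + (\<Sum>js\<in>I. (r js)\<^sup>2)"
    by (simp add: sum.distrib sum_subtractf)
  ultimately have v0: "(\<Sum>js\<in>I. (v js - s) + (r js)\<^sup>2) = 0" unfolding cardI by linarith
  have W_alt: "W js = gauss u s * (1 + \<i> * of_real u * of_real (r js) - of_real (u\<^sup>2 / 2) * of_real ((v js - s) + (r js)\<^sup>2))" for js
    unfolding W_def by (simp add: algebra_simps add_divide_distrib diff_divide_distrib)
  have "(\<Sum>js\<in>I. W js) = gauss u s * (of_real (\<Sum>js\<in>I. 1) + \<i> * of_real u * of_real (\<Sum>js\<in>I. r js) - of_real (u\<^sup>2 / 2) * of_real (\<Sum>js\<in>I. (v js - s) + (r js)\<^sup>2))"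
    unfolding W_alt of_real_sum sum_distrib_left sum.distrib[symmetric] sum_subtractf[symmetric] by simp
  also have "\<dots> = gauss u s * of_real C" unfolding r0 v0 cardI by simp
  finally have sumW: "(\<Sum>js\<in>I. W js) = gauss u s * of_real C" .
  have "phi m t n u - gauss u s = (\<Sum>js\<in>I. cis (u * r js) * (\<Prod>j\<leftarrow>js. phi m t j u) - W js) / of_real C"
    unfolding phi_rec[OF m n] sum_subtractf sumW using C by (simp add: diff_divide_distrib I_def r_def C_def)
  then have "phi_err m t u n = norm (\<Sum>js\<in>I. cis (u * r js) * (\<Prod>j\<leftarrow>js. phi m t j u) - W js) / C"
    using C by (simp add: phi_err_def s_def norm_divide)
  also have "\<dots> \<le> (\<Sum>js\<in>I. norm (cis (u * r js) * (\<Prod>j\<leftarrow>js. phi m t j u) - W js)) / C"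
    using C by (intro divide_right_mono norm_sum) auto
  also have "\<dots> = avg m n (\<lambda>js. norm (cis (u * r js) * (\<Prod>j\<leftarrow>js. phi m t j u) - W js))"
    by (simp only: avg_def I_def C_def)
  also have "\<dots> \<le> avg m n (\<lambda>js. \<bar>u\<bar> ^ 3 * (\<bar>r js\<bar> ^ 3 + \<bar>r js\<bar> * \<bar>v js - s\<bar>) + u ^ 4 * (\<bar>v js - s\<bar>\<^sup>2 + (r js)\<^sup>2 * \<bar>v js - s\<bar>)
      + (\<Sum>j\<leftarrow>js. phi_err m t u j))"
  \<comment> \<open>The characteristic functions of the subtrees are replaced by Gaussians, whose
    product is the Gaussian with the summed variance \<open>v js\<close>; that Gaussian is then
    expanded at the variance \<open>s\<close> of the whole tree.\<close>
  proof (rule avg_mono)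
    fix js
    have v_nonneg: "v js \<ge> 0" unfolding v_def by (intro sum_list_nonneg) (auto simp: var_X_nonneg)
    have s_nonneg: "s \<ge> 0" unfolding s_def by (rule var_X_nonneg)
    have "norm (cis (u * r js) * (\<Prod>j\<leftarrow>js. phi m t j u) - cis (u * r js) * (\<Prod>j\<leftarrow>js. gauss u (var_X m t j)))
       = norm ((\<Prod>j\<leftarrow>js. phi m t j u) - (\<Prod>j\<leftarrow>js. gauss u (var_X m t j)))"
      by (simp only: right_diff_distrib[symmetric] norm_mult norm_cis mult_1)
    also have "\<dots> \<le> (\<Sum>j\<leftarrow>js. norm (phi m t j u - gauss u (var_X m t j)))"
      by (intro norm_prod_list_diff norm_phi_le_1 norm_gauss_le_1 var_X_nonneg)
    finally have a: "norm (cis (u * r js) * (\<Prod>j\<leftarrow>js. phi m t j u) - cis (u * r js) * gauss u (v js)) \<le> (\<Sum>j\<leftarrow>js. phi_err m t u j)"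
      unfolding prod_list_gauss v_def phi_err_def .
    have b: "norm (cis (u * r js) * gauss u (v js) - W js) \<le> \<bar>u\<bar> ^ 3 * (\<bar>r js\<bar> ^ 3 + \<bar>r js\<bar> * \<bar>v js - s\<bar>) + u ^ 4 * (\<bar>v js - s\<bar>\<^sup>2 + (r js)\<^sup>2 * \<bar>v js - s\<bar>)"
      unfolding gauss_def W_def by (rule char_pointwise[OF v_nonneg s_nonneg])
    have "norm (X - Z) \<le> norm (X - Y) + norm (Y - Z)" for X Y Z :: complex using norm_triangle_ineq[of "X - Y" "Y - Z"] by simp
    from this[of "cis (u * r js) * (\<Prod>j\<leftarrow>js. phi m t j u)" "W js" "cis (u * r js) * gauss u (v js)"]
    show "norm (cis (u * r js) * (\<Prod>j\<leftarrow>js. phi m t j u) - W js) \<le> \<bar>u\<bar> ^ 3 * (\<bar>r js\<bar> ^ 3 + \<bar>r js\<bar> * \<bar>v js - s\<bar>)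
        + u ^ 4 * (\<bar>v js - s\<bar>\<^sup>2 + (r js)\<^sup>2 * \<bar>v js - s\<bar>) + (\<Sum>j\<leftarrow>js. phi_err m t u j)"
      using a b by linarith
  qed
  also have "\<dots> = \<bar>u\<bar> ^ 3 * errA m t n + u ^ 4 * errB m t n + avg m n (\<lambda>js. \<Sum>j\<leftarrow>js. phi_err m t u j)"
    using n by (simp add: avg_add avg_mult errA_def errB_def var_dev_def r_def v_def s_def)
  finally show ?thesis .
qed

lemma tree_solve_avg:
  assumes "2 \<le> m" "m - 1 \<le> n"
  shows "tree_solve m b n = b n + avg m n (\<lambda>js. \<Sum>j\<leftarrow>js. tree_solve m b j)"
  using tree_rec_solve[OF assms(1), of b] assms(2) unfolding tree_rec_def avg_def by blast

text \<open>The recursive inequality is linear and runs at a fixed \<open>u\<close>, so the powers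
  of \<open>u\<close> factor out and the coefficients are free of \<open>u\<close>. Only this makes
  it legitimate to insert a \<open>u\<close> that varies with \<open>n\<close> afterwards.\<close>

lemma phi_err_bound:
  assumes m: "2 \<le> m"
  shows "phi_err m t u n \<le> \<bar>u\<bar> ^ 3 * tree_solve m (errA m t) n + u ^ 4 * tree_solve m (errB m t) n"
proof (induction n rule: less_induct)
  case (less n)
  show ?case
  proof (cases "n < m - 1")
    case True
    have "phi_err m t u n = 0" using Y_law_small[OF m True] by (simp add: phi_err_def phi_def gauss_def var_X_law)
    moreover have "0 \<le> \<bar>u\<bar> ^ 3 * tree_solve m (errA m t) n" "0 \<le> u ^ 4 * tree_solve m (errB m t) n"
      by (auto intro!: mult_nonneg_nonneg tree_solve_nonneg errA_nonneg errB_nonneg)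
    ultimately show ?thesis by linarith
  next
    case False
    then have n: "m - 1 \<le> n" by simp
    have "avg m n (\<lambda>js. \<Sum>j\<leftarrow>js. phi_err m t u j) \<le>
      avg m n (\<lambda>js. \<bar>u\<bar> ^ 3 * (\<Sum>j\<leftarrow>js. tree_solve m (errA m t) j) + u ^ 4 * (\<Sum>j\<leftarrow>js. tree_solve m (errB m t) j))"
    proof (rule avg_mono)
      fix js assume js: "js \<in> comps m (n - (m - 1))"
      have "(\<Sum>j\<leftarrow>js. phi_err m t u j) \<le> (\<Sum>j\<leftarrow>js. \<bar>u\<bar> ^ 3 * tree_solve m (errA m t) j + u ^ 4 * tree_solve m (errB m t) j)"
        by (rule sum_list_mono_comps[OF m n js]) (rule less)
      then show "(\<Sum>j\<leftarrow>js. phi_err m t u j) \<le> \<bar>u\<bar> ^ 3 * (\<Sum>j\<leftarrow>js. tree_solve m (errA m t) j) + u ^ 4 * (\<Sum>j\<leftarrow>js. tree_solve m (errB m t) j)"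
        by (simp only: sum_list_plus sum_list_const_mult)
    qed
    also have "\<dots> = \<bar>u\<bar> ^ 3 * avg m n (\<lambda>js. \<Sum>j\<leftarrow>js. tree_solve m (errA m t) j) + u ^ 4 * avg m n (\<lambda>js. \<Sum>j\<leftarrow>js. tree_solve m (errB m t) j)"
      by (simp only: avg_add avg_mult)
    finally show ?thesis using phi_err_rec[OF m n, of t u]
      unfolding tree_solve_avg[OF m n] distrib_left by linarith
  qed
qed

context tree_asymp
begin

lemma err_small:
  assumes "e > 0"
  shows "\<exists>N. \<forall>n\<ge>N. errA m t n \<le> e * rt n ^ 3 \<and> errB m t n \<le> e * rt n ^ 4"
proof -
  define d where "d = min 1 (e / 2)"
  have d: "d > 0" "d \<le> 1" "2 * d \<le> e" using assms by (auto simp: d_def)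
  obtain N0 where N0: "\<And>n js. n \<ge> N0 \<Longrightarrow> js \<in> comps m (n - (m - 1)) \<Longrightarrow> \<bar>resid m t n js\<bar> \<le> d * rt n"
    using resid_small[OF d(1)] by blast
  obtain N1 where N1: "\<And>n js. n \<ge> N1 \<Longrightarrow> js \<in> comps m (n - (m - 1)) \<Longrightarrow> \<bar>(\<Sum>j\<leftarrow>js. var_X m t j) - var_X m t n\<bar> \<le> d * S2 n"
    using var_uniform[OF d(1)] by blast
  have "errA m t n \<le> e * rt n ^ 3 \<and> errB m t n \<le> e * rt n ^ 4" if n: "n \<ge> max (m - 1) (max N0 N1)" for n
  proof -
    have mn: "m - 1 \<le> n" using n by linarith
    have m1: "1 \<le> m" using m2 by linarith
    have pt: "\<bar>resid m t n js\<bar> ^ 3 + \<bar>resid m t n js\<bar> * var_dev m t n js \<le> 2 * d * rt n ^ 3"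
      "(var_dev m t n js)\<^sup>2 + (resid m t n js)\<^sup>2 * var_dev m t n js \<le> 2 * d * rt n ^ 4"
      if js: "js \<in> comps m (n - (m - 1))" for js
    proof -
      have "\<bar>resid m t n js\<bar> \<le> d * rt n" using n by (intro N0 js) linarith
      moreover have "var_dev m t n js \<le> d * (rt n)\<^sup>2" unfolding var_dev_def rt_sq using n by (intro N1 js) linarith
      moreover have "0 \<le> var_dev m t n js" by (simp add: var_dev_def)
      ultimately show "\<bar>resid m t n js\<bar> ^ 3 + \<bar>resid m t n js\<bar> * var_dev m t n js \<le> 2 * d * rt n ^ 3"
        "(var_dev m t n js)\<^sup>2 + (resid m t n js)\<^sup>2 * var_dev m t n js \<le> 2 * d * rt n ^ 4"
        using small_bounds[of "resid m t n js" d "rt n" "var_dev m t n js"] d rt_nonneg[of n] by (simp_all add: less_imp_le)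
    qed
    have A: "errA m t n \<le> avg m n (\<lambda>js. 2 * d * rt n ^ 3)" and B: "errB m t n \<le> avg m n (\<lambda>js. 2 * d * rt n ^ 4)"
      unfolding errA_def errB_def using mn by (auto intro!: avg_mono pt)
    have "2 * d * rt n ^ 3 \<le> e * rt n ^ 3" "2 * d * rt n ^ 4 \<le> e * rt n ^ 4"
      by (rule mult_right_mono[OF d(3)], simp add: rt_nonneg)+
    then show ?thesis using A B unfolding avg_const[OF m1 mn] by linarith
  qed
  then show ?thesis by blast
qed

lemma err_lim: "(\<lambda>n. errA m t n / rt n ^ 3) \<longlonglongrightarrow> 0" "(\<lambda>n. errB m t n / rt n ^ 4) \<longlonglongrightarrow> 0"
proof -
  have gen: "(\<lambda>n. E n / rt n ^ k) \<longlonglongrightarrow> 0" if E0: "\<And>n. E n \<ge> 0" and E: "\<And>e. e > 0 \<Longrightarrow> \<exists>N. \<forall>n\<ge>N. E n \<le> e * rt n ^ k" for E k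
  proof (rule LIMSEQ_I)
    fix e :: real assume "e > 0"
    then obtain N where N: "\<And>n. n \<ge> N \<Longrightarrow> E n \<le> e / 2 * rt n ^ k" using E[of "e / 2"] by (meson half_gt_zero)
    have "norm (E n / rt n ^ k - 0) < e" if n: "n \<ge> max 1 N" for n
    proof -
      have p: "rt n ^ k > 0" using rt_pos n by simp
      have "E n / rt n ^ k \<le> e / 2" using N[of n] n p by (simp add: pos_divide_le_eq)
      moreover have "0 \<le> E n / rt n ^ k" using E0 p by simp
      ultimately show ?thesis using \<open>e > 0\<close> unfolding real_norm_def by linarith
    qed
    then show "\<exists>no. \<forall>n\<ge>no. norm (E n / rt n ^ k - 0) < e" by blast
  qed
  show "(\<lambda>n. errA m t n / rt n ^ 3) \<longlonglongrightarrow> 0" by (rule gen[OF errA_nonneg]) (use err_small in blast)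
  show "(\<lambda>n. errB m t n / rt n ^ 4) \<longlonglongrightarrow> 0" by (rule gen[OF errB_nonneg]) (use err_small in blast)
qed

text \<open>At \<open>u = w / rt n\<close> the powers of \<open>u\<close> become the inverse scales
  \<open>rt n ^ 3\<close> and \<open>rt n ^ 4\<close>, on which \<open>contraction_o\<close> makes
  the solutions negligible.\<close>

lemma phi_lim: "(\<lambda>n. phi m t n (w / rt n)) \<longlonglongrightarrow> of_real (exp (- w\<^sup>2 / 2))"
proof -
  have sA: "(\<lambda>n. tree_solve m (errA m t) n / rt n ^ 3) \<longlonglongrightarrow> 0"
    by (rule contraction_o[OF _ tree_solve_nonneg[OF errA_nonneg] _ err_lim(1)]) (simp_all add: tree_solve_avg[OF m2] del: One_nat_def)
  have sB: "(\<lambda>n. tree_solve m (errB m t) n / rt n ^ 4) \<longlonglongrightarrow> 0"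
    by (rule contraction_o[OF _ tree_solve_nonneg[OF errB_nonneg] _ err_lim(2)]) (simp_all add: tree_solve_avg[OF m2] del: One_nat_def)
  have "(\<lambda>n. \<bar>w\<bar> ^ 3 * (tree_solve m (errA m t) n / rt n ^ 3) + w ^ 4 * (tree_solve m (errB m t) n / rt n ^ 4)) \<longlonglongrightarrow> \<bar>w\<bar> ^ 3 * 0 + w ^ 4 * 0"
    by (intro tendsto_intros sA sB)
  then have lim0: "(\<lambda>n. \<bar>w\<bar> ^ 3 * (tree_solve m (errA m t) n / rt n ^ 3) + w ^ 4 * (tree_solve m (errB m t) n / rt n ^ 4)) \<longlonglongrightarrow> 0" by simp
  have "phi_err m t (w / rt n) n \<le> \<bar>w\<bar> ^ 3 * (tree_solve m (errA m t) n / rt n ^ 3) + w ^ 4 * (tree_solve m (errB m t) n / rt n ^ 4)" for n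
    using phi_err_bound[OF m2, of t "w / rt n" n] rt_nonneg[of n] by (simp add: abs_divide power_divide)
  then have "(\<lambda>n. phi m t n (w / rt n) - gauss (w / rt n) (var_X m t n)) \<longlonglongrightarrow> 0"
    by (intro Lim_null_comparison[OF _ lim0] always_eventually allI) (simp add: phi_err_def)
  moreover have "(\<lambda>n. gauss (w / rt n) (var_X m t n)) \<longlonglongrightarrow> of_real (exp (- w\<^sup>2 / 2))"
  proof -
    have "(\<lambda>n. complex_of_real (exp (- w\<^sup>2 * (var_X m t n / S2 n) / 2))) \<longlonglongrightarrow> of_real (exp (- w\<^sup>2 * 1 / 2))"
      by (intro tendsto_intros var_S2) simp
    then show ?thesis by (simp add: gauss_def power_divide rt_sq)
  qed
  ultimately have "(\<lambda>n. (phi m t n (w / rt n) - gauss (w / rt n) (var_X m t n)) + gauss (w / rt n) (var_X m t n)) \<longlonglongrightarrow> 0 + of_real (exp (- w\<^sup>2 / 2))"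
    by (rule tendsto_add)
  then show ?thesis by simp
qed

text \<open>The normalisation subtracts the linear part of the mean and not the mean itself. The
  discrepancy is of order \<open>G n\<close> and vanishes on the scale \<open>rt n\<close>.\<close>

definition "dshift n = (mean_X m t n - mean_slope m t * real n) / rt n"

lemma dshift_lim: "dshift \<longlonglongrightarrow> 0"
proof -
  have "(\<lambda>n. (mean_X m t n - mean_slope m t * real n) / G n * sqrt ((G n)\<^sup>2 / S2 n)) \<longlonglongrightarrow> kappa * sqrt 0"
    by (intro tendsto_intros mean_lim G_sq_S2)
  then have "(\<lambda>n. (mean_X m t n - mean_slope m t * real n) / G n * sqrt ((G n)\<^sup>2 / S2 n)) \<longlonglongrightarrow> 0" by simp
  then show ?thesis
  proof (rule Lim_transform_eventually)
    show "\<forall>\<^sub>F n in sequentially. (mean_X m t n - mean_slope m t * real n) / G n * sqrt ((G n)\<^sup>2 / S2 n) = dshift n"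
      using eventually_G_pos by eventually_elim (simp add: dshift_def rt_def real_sqrt_divide)
  qed
qed

text \<open>The law of \<open>X_normalized\<close>, written through the centred law to which the
  recurrences apply.\<close>

definition "Zlaw n = distr (measure_pmf (Y_law m t n)) borel (\<lambda>y. y / rt n + dshift n)"

lemma real_distribution_Zlaw: "real_distribution (Zlaw n)"
  unfolding Zlaw_def real_distribution_def real_distribution_axioms_def
  by (simp add: prob_space.prob_space_distr measure_pmf.prob_space_axioms)

lemma Zlaw_weak_conv: "weak_conv_m Zlaw std_normal_distribution"
proof (rule levy_continuity[OF real_distribution_Zlaw real_dist_normal_dist])
  fix w :: real
  have "char (Zlaw n) w = cis (w * dshift n) * phi m t n (w / rt n)" for n
  proof -
    have "char (Zlaw n) w = expect (Y_law m t n) (\<lambda>y. iexp (w * (y / rt n + dshift n)))"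
      unfolding char_def Zlaw_def by (subst integral_distr) simp_all
    also have "\<dots> = expect (Y_law m t n) (\<lambda>y. cis (w * dshift n) * cis (w / rt n * y))"
    proof (intro arg_cong[where f="expect (Y_law m t n)"] ext)
      fix y
      have "w * (y / rt n + dshift n) = w * dshift n + w / rt n * y" by (simp add: distrib_left)
      then show "iexp (w * (y / rt n + dshift n)) = cis (w * dshift n) * cis (w / rt n * y)"
        by (simp only: cis_conv_exp[symmetric] cis_mult)
    qed
    finally show ?thesis by (simp add: phi_def)
  qed
  moreover have "(\<lambda>n. cis (w * dshift n) * phi m t n (w / rt n)) \<longlonglongrightarrow> cis (w * 0) * of_real (exp (- w\<^sup>2 / 2))"
    by (intro tendsto_intros phi_lim dshift_lim)
  ultimately show "(\<lambda>n. char (Zlaw n) w) \<longlonglongrightarrow> char std_normal_distribution w"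
    by (simp add: char_std_normal_distribution)
qed

text \<open>The bound at order \<open>2 * k\<close> controls everything in the moment of order
  \<open>2 * k + 2\<close> except the sum over the subtrees, and that sum contracts. The variance is
  the base case: on the scale \<open>rt n ^ 2\<close> the split is nearly additive and does not
  contract, so its known asymptotics is used.\<close>

lemma Y_moment:
  assumes "k \<ge> 1"
  shows "\<exists>C\<ge>0. \<forall>n. expect (Y_law m t n) (\<lambda>x. x ^ (2 * k)) \<le> C * rt n ^ (2 * k)"
  using assms
proof (induction k rule: nat_induct_at_least)
  case base
  have "\<forall>\<^sub>F n in sequentially. var_X m t n / S2 n < 2" by (rule order_tendstoD(2)[OF var_S2]) simp
  then obtain N where N: "\<And>n. n \<ge> N \<Longrightarrow> var_X m t n / S2 n < 2" unfolding eventually_sequentially by blast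
  show ?case
  proof (rule bounded_rt)
    have "0 < m - 1" using m2 by simp
    then show "expect (Y_law m t 0) (\<lambda>x. x ^ (2 * 1)) \<le> 0" using Y_law_small[OF m2, of 0 t] by simp
    show "expect (Y_law m t n) (\<lambda>x. x ^ (2 * 1)) \<le> 2 * rt n ^ (2 * 1)" if "n \<ge> max 1 N" for n
    proof -
      have "S2 n > 0" using S2_pos that by simp
      then have "var_X m t n \<le> 2 * S2 n" using N[of n] that by (simp add: pos_divide_less_eq)
      then show ?thesis by (simp add: var_X_law rt_sq)
    qed
  qed
next
  case (Suc k)
  obtain C where C: "C \<ge> 0" "\<And>n. expect (Y_law m t n) (\<lambda>x. x ^ (2 * k)) \<le> C * rt n ^ (2 * k)" using Suc.IH by blast
  obtain D where D: "D \<ge> 0" and D': "\<forall>ps T. length ps = m \<longrightarrow> T > 0 \<longrightarrow>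
    (\<forall>p\<in>set ps. finite (set_pmf p) \<and> expect p (\<lambda>x. x) = 0 \<and> expect p (\<lambda>x. x ^ (2 * k)) \<le> C * T ^ (2 * k)) \<longrightarrow>
    expect (conv_list ps) (\<lambda>x. x ^ (2 * k)) \<le> D * T ^ (2 * k) \<and>
    expect (conv_list ps) (\<lambda>x. x ^ (2 * k + 2)) \<le> (\<Sum>p\<leftarrow>ps. expect p (\<lambda>x. x ^ (2 * k + 2))) + D * T ^ (2 * k + 2)"
    using conv_list_moment[OF Suc.hyps, of m C] by blast
  define K where "K = 2 * k + 2"
  have K: "even K" "K \<ge> 3" "2 * Suc k = K" using Suc.hyps by (simp_all add: K_def)
  have "((\<lambda>w::real. (1 + w) ^ K) \<longlongrightarrow> (1 + 0) ^ K) (at_right 0)" by (intro tendsto_intros)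
  then have "\<forall>\<^sub>F w :: real in at_right 0. (1 + w) ^ K < 23 / 22 \<and> w > 0"
    by (intro eventually_conj order_tendstoD(2) eventually_at_right_less) auto
  \<comment> \<open>The residual is absorbed at the cost of a factor \<open>(1 + w) ^ K\<close>,
    which has to stay below the 23/22 tolerated by \<open>contraction_O\<close>.\<close>
  then obtain w :: real where w: "(1 + w) ^ K < 23 / 22" "w > 0"
    using eventually_happens'[OF trivial_limit_at_right_real] by blast
  define B where "B = 23 / 22 * D + (1 + 1 / w) ^ K"
  obtain N0 where N0: "\<And>n js. n \<ge> N0 \<Longrightarrow> js \<in> comps m (n - (m - 1)) \<Longrightarrow> \<bar>resid m t n js\<bar> \<le> 1 * rt n"
    using resid_small[of 1] by (metis zero_less_one)
  show ?case unfolding K(3)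
  proof (rule contraction_O[OF K(2)])
    have "0 < m - 1" using m2 by simp
    then show "expect (Y_law m t 0) (\<lambda>x. x ^ K) \<le> 0" using Y_law_small[OF m2, of 0 t] K(2) by (simp add: power_0_left)
    show "expect (Y_law m t n) (\<lambda>x. x ^ K) \<ge> 0" for n
      using K(1) by (intro Bochner_Integration.integral_nonneg) (simp add: zero_le_even_power)
  next
    fix n assume n: "n \<ge> max m N0"
    have mn: "m - 1 \<le> n" and n1: "n \<ge> 1" and nN: "n \<ge> N0" using n m2 by linarith+
    have m1: "1 \<le> m" using m2 by linarith
    have R: "rt n > 0" by (rule rt_pos[OF n1])
    have "expect (Y_law m t n) (\<lambda>x. x ^ K) = avg m n (\<lambda>js. expect (conv_list (map (Y_law m t) js)) (\<lambda>s. (resid m t n js + s) ^ K))"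
      by (rule expect_Y_avg[OF m2 mn])
    also have "\<dots> \<le> avg m n (\<lambda>js. B * rt n ^ K + 23 / 22 * (\<Sum>j\<leftarrow>js. expect (Y_law m t j) (\<lambda>x. x ^ K)))"
    proof (rule avg_mono)
      fix js assume js: "js \<in> comps m (n - (m - 1))"
      define Q where "Q = conv_list (map (Y_law m t) js)"
      have fin: "finite (set_pmf Q)" unfolding Q_def by (auto intro!: finite_conv_list finite_Y_law)
      have "expect Q (\<lambda>x. x ^ K) \<le> (\<Sum>p\<leftarrow>map (Y_law m t) js. expect p (\<lambda>x. x ^ K)) + D * rt n ^ K"
      proof -
        have "length (map (Y_law m t) js) = m" using js by (simp add: comps_def)
        moreover have "\<forall>p\<in>set (map (Y_law m t) js). finite (set_pmf p) \<and> expect p (\<lambda>x. x) = 0 \<and> expect p (\<lambda>x. x ^ (2 * k)) \<le> C * rt n ^ (2 * k)"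
        proof
          fix p assume "p \<in> set (map (Y_law m t) js)"
          then obtain j where j: "j \<in> set js" "p = Y_law m t j" by auto
          have "rt j ^ (2 * k) \<le> rt n ^ (2 * k)" using comps_member[OF js j(1)] by (intro power_mono rt_mono rt_nonneg)
          then have "C * rt j ^ (2 * k) \<le> C * rt n ^ (2 * k)" using C(1) by (rule mult_left_mono)
          then show "finite (set_pmf p) \<and> expect p (\<lambda>x. x) = 0 \<and> expect p (\<lambda>x. x ^ (2 * k)) \<le> C * rt n ^ (2 * k)"
            using C(2)[of j] unfolding j(2) by (simp add: finite_Y_law Y_law_mean)
        qed
        ultimately show ?thesis using D' R unfolding Q_def K_def by blast
      qed
      then have Qm: "expect Q (\<lambda>x. x ^ K) \<le> (\<Sum>j\<leftarrow>js. expect (Y_law m t j) (\<lambda>x. x ^ K)) + D * rt n ^ K"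
        by (simp add: o_def)
      have Q0: "expect Q (\<lambda>x. x ^ K) \<ge> 0"
        using K(1) by (intro Bochner_Integration.integral_nonneg) (simp add: zero_le_even_power)
      have rK: "(resid m t n js) ^ K \<le> rt n ^ K"
      proof -
        have "\<bar>resid m t n js\<bar> ^ K \<le> rt n ^ K" using N0[OF nN js] by (intro power_mono) auto
        then show ?thesis using K(1) by (simp add: power_even_abs)
      qed
      have "expect Q (\<lambda>s. (resid m t n js + s) ^ K) \<le> expect Q (\<lambda>s. (1 + w) ^ K * s ^ K + (1 + 1 / w) ^ K * (resid m t n js) ^ K)"
        by (intro expect_mono fin add_power_even_le w K)
      also have "\<dots> = (1 + w) ^ K * expect Q (\<lambda>s. s ^ K) + (1 + 1 / w) ^ K * (resid m t n js) ^ K"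
        by (simp add: expect_add[OF fin])
      also have "\<dots> \<le> 23 / 22 * ((\<Sum>j\<leftarrow>js. expect (Y_law m t j) (\<lambda>x. x ^ K)) + D * rt n ^ K) + (1 + 1 / w) ^ K * rt n ^ K"
      proof (intro add_mono mult_left_mono rK)
        have "(1 + w) ^ K * expect Q (\<lambda>s. s ^ K) \<le> 23 / 22 * expect Q (\<lambda>s. s ^ K)" using w Q0 by (intro mult_right_mono) auto
        also have "\<dots> \<le> 23 / 22 * ((\<Sum>j\<leftarrow>js. expect (Y_law m t j) (\<lambda>x. x ^ K)) + D * rt n ^ K)" using Qm by (intro mult_left_mono) auto
        finally show "(1 + w) ^ K * expect Q (\<lambda>s. s ^ K) \<le> 23 / 22 * ((\<Sum>j\<leftarrow>js. expect (Y_law m t j) (\<lambda>x. x ^ K)) + D * rt n ^ K)" .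
      qed (use w in simp)
      also have "\<dots> = B * rt n ^ K + 23 / 22 * (\<Sum>j\<leftarrow>js. expect (Y_law m t j) (\<lambda>x. x ^ K))"
        unfolding B_def by (simp add: algebra_simps)
      finally show "expect (conv_list (map (Y_law m t) js)) (\<lambda>s. (resid m t n js + s) ^ K) \<le> B * rt n ^ K + 23 / 22 * (\<Sum>j\<leftarrow>js. expect (Y_law m t j) (\<lambda>x. x ^ K))"
        unfolding Q_def .
    qed
    also have "\<dots> = B * rt n ^ K + 23 / 22 * avg m n (\<lambda>js. \<Sum>j\<leftarrow>js. expect (Y_law m t j) (\<lambda>x. x ^ K))"
      by (simp only: avg_add avg_mult avg_const[OF m1 mn])
    finally show "expect (Y_law m t n) (\<lambda>x. x ^ K) \<le> B * rt n ^ K + 23 / 22 * avg m n (\<lambda>js. \<Sum>j\<leftarrow>js. expect (Y_law m t j) (\<lambda>x. x ^ K))" .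
  qed
qed

lemma integral_Zlaw_power: "(LINT x|Zlaw n. x ^ k) = expect (Y_law m t n) (\<lambda>y. (y / rt n + dshift n) ^ k)"
  unfolding Zlaw_def by (subst integral_distr) simp_all

text \<open>The centred moments of order \<open>2 * k\<close> are bounded on the scale
  \<open>rt n\<close>, and adding the bounded shift \<open>dshift n\<close> costs at most a
  constant. This is the uniform bound that \<open>weak_conv_moments\<close> asks for.\<close>

lemma Zlaw_moments: "(\<lambda>n. LINT x|Zlaw n. x ^ k) \<longlonglongrightarrow> (LINT x|std_normal_distribution. x ^ k)"
proof (cases "k = 0")
  case True
  have "(LINT x|Zlaw n. x ^ k) = 1" for n unfolding integral_Zlaw_power using True by simp
  moreover have "(LINT x|std_normal_distribution. x ^ k) = 1"
    using std_normal_distribution_even_moments(1)[of 0] True by simp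
  ultimately show ?thesis by simp
next
  case False
  then obtain C where C: "C \<ge> 0" "\<And>n. expect (Y_law m t n) (\<lambda>x. x ^ (2 * k)) \<le> C * rt n ^ (2 * k)"
    using Y_moment[of k] by (metis One_nat_def Suc_leI neq0_conv)
  show ?thesis
  proof (rule weak_conv_moments[OF real_distribution_Zlaw real_dist_normal_dist Zlaw_weak_conv _ integrable_std_normal_distribution_moment])
    show "integrable (Zlaw n) (\<lambda>x. x ^ k)" for n k
      unfolding Zlaw_def by (subst integrable_distr_eq) (simp_all add: integrable_measure_pmf_finite finite_Y_law)
    have "\<forall>\<^sub>F n in sequentially. \<bar>dshift n\<bar> < 1" using tendsto_rabs[OF dshift_lim] by (intro order_tendstoD(2)) auto
    then show "\<forall>\<^sub>F n in sequentially. (LINT x|Zlaw n. x ^ (2 * k)) \<le> 2 ^ (2 * k) * C + 2 ^ (2 * k)"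
      using eventually_ge_at_top[of 1]
    proof eventually_elim
      case (elim n)
      have R: "rt n ^ (2 * k) > 0" using rt_pos elim by simp
      have "expect (Y_law m t n) (\<lambda>y. (y / rt n + dshift n) ^ (2 * k)) \<le> expect (Y_law m t n) (\<lambda>y. (2 ^ (2 * k) / rt n ^ (2 * k)) * y ^ (2 * k) + 2 ^ (2 * k))"
      proof (rule expect_mono[OF finite_Y_law])
        fix y
        have "(y / rt n + dshift n) ^ (2 * k) = (dshift n + y / rt n) ^ (2 * k)" by (simp add: add.commute)
        also have "\<dots> \<le> (1 + 1) ^ (2 * k) * (y / rt n) ^ (2 * k) + (1 + 1 / 1) ^ (2 * k) * (dshift n) ^ (2 * k)"
          by (rule add_power_even_le) simp_all
        also have "\<dots> \<le> (1 + 1) ^ (2 * k) * (y / rt n) ^ (2 * k) + (1 + 1 / 1) ^ (2 * k) * 1"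
        proof (intro add_left_mono mult_left_mono)
          have "\<bar>dshift n\<bar> ^ (2 * k) \<le> 1" using elim by (intro power_le_one) auto
          then show "dshift n ^ (2 * k) \<le> 1" by (simp add: power_even_abs)
        qed simp
        finally show "(y / rt n + dshift n) ^ (2 * k) \<le> (2 ^ (2 * k) / rt n ^ (2 * k)) * y ^ (2 * k) + 2 ^ (2 * k)"
          by (simp add: power_divide)
      qed
      also have "\<dots> = (2 ^ (2 * k) / rt n ^ (2 * k)) * expect (Y_law m t n) (\<lambda>y. y ^ (2 * k)) + 2 ^ (2 * k)"
        by (simp add: expect_add[OF finite_Y_law])
      also have "\<dots> \<le> (2 ^ (2 * k) / rt n ^ (2 * k)) * (C * rt n ^ (2 * k)) + 2 ^ (2 * k)"
        using R C(2) by (intro add_right_mono mult_left_mono) auto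
      also have "\<dots> = 2 ^ (2 * k) * C + 2 ^ (2 * k)"
      proof -
        have "a / r * (C * r) + a = a * C + a" if "r > 0" for a r :: real using that by simp
        then show ?thesis using R by blast
      qed
      finally show ?case unfolding integral_Zlaw_power .
    qed
  qed
qed

end

lemma (in tree_asymp) Zlaw_altdef:
  assumes "\<And>n. s2 m t L n = S2 n"
  shows "Zlaw n = distr (measure_pmf (random_perm n)) borel (X_normalized m t L n)"
proof -
  have "X_normalized m t L n = (\<lambda>y. y / rt n + dshift n) \<circ> (\<lambda>x. x - mean_X m t n) \<circ> X_fun m t"
    by (simp add: fun_eq_iff X_normalized_def assms rt_def dshift_def diff_divide_distrib)
  then show ?thesis
    by (simp add: Zlaw_def Y_law_def X_law_def map_pmf_rep_eq distr_distr o_def)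
qed

theorem theorem5p4:
  fixes m :: nat and t :: "nat \<Rightarrow> real" and L :: "real \<Rightarrow> real"
  assumes "2 \<le> m" and "m \<le> 26"
    and "slowly_varying L"
    and "t \<sim>[at_top] (\<lambda>n. sqrt (real n) * L (real n))"
  shows "summable (K1_term t) \<and>
    (\<lambda>n. mean_X m t n -
           (mean_slope m t * real n - rho m / (fact m - rho m) * (sqrt (real n) * L (real n))))
      \<in> o[at_top](\<lambda>n. sqrt (real n) * L (real n)) \<and>
    (summable (L2_term L) \<longrightarrow>
      summable (var_term m t) \<and>
      (\<lambda>n. var_X m t n - sigma2_conv m t * real n) \<in> o[at_top](\<lambda>n. real n)) \<and>
    (\<not> summable (L2_term L) \<longrightarrow>
      var_X m t \<sim>[at_top] (\<lambda>n. sigma2_div m * real n * (\<Sum>k<n. L2_term L k))) \<and>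
    weak_conv_m (\<lambda>n. distr (measure_pmf (random_perm n)) borel (X_normalized m t L n))
      std_normal_distribution \<and>
    (\<forall>k::nat. (\<lambda>n. measure_pmf.expectation (random_perm n) (\<lambda>ks. X_normalized m t L n ks ^ k))
      \<longlonglongrightarrow> (LINT x|std_normal_distribution. x ^ k))"
proof -
  \<comment> \<open>From here on only the values of \<open>L\<close> at the integers enter; its
    behaviour between them has been used in deriving Potter's bound.\<close>
  define l where "l = (\<lambda>n. L (real n))"
  have G: "svg l = (\<lambda>n. sqrt (real n) * L (real n))" by (simp add: fun_eq_iff svg_def l_def)
  interpret tree_asymp m t l
    by unfold_locales (use assms slowly_varying_imp_sv_seq[OF assms(3)] in \<open>simp_all add: G, simp add: l_def\<close>)
  have L2: "L2_term L = L2sum" by (simp add: fun_eq_iff L2_term_def l_def)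
  have s2: "s2 m t L n = S2 n" for n by (simp add: s2_def S2_def L2 sv_sum_def)
  have 1: "(\<lambda>n. mean_X m t n - (mean_slope m t * real n - rho m / (fact m - rho m) * (sqrt (real n) * L (real n))))
      \<in> o[at_top](\<lambda>n. sqrt (real n) * L (real n))"
    using mean_expansion by (simp only: G)
  have 2: "(\<lambda>n. var_X m t n - sigma2_conv m t * real n) \<in> o[at_top](\<lambda>n. real n)" if "summable (L2_term L)"
  proof (rule smalloI_tendsto)
    show "(\<lambda>n. (var_X m t n - sigma2_conv m t * real n) / real n) \<longlonglongrightarrow> 0"
      using that by (intro var_conv(2)) (simp only: L2)
    show "\<forall>\<^sub>F n in sequentially. real n \<noteq> 0" using eventually_gt_at_top[of 0] by eventually_elim simp
  qed
  have 3: "var_X m t \<sim>[at_top] (\<lambda>n. sigma2_div m * real n * (\<Sum>k<n. L2_term L k))" if "\<not> summable (L2_term L)"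
  proof (rule asymp_equivI')
    show "(\<lambda>n. var_X m t n / (sigma2_div m * real n * (\<Sum>k<n. L2_term L k))) \<longlonglongrightarrow> 1"
      using var_S2 that by (simp add: S2_def L2 sv_sum_def)
  qed
  have 4: "(\<lambda>n. distr (measure_pmf (random_perm n)) borel (X_normalized m t L n)) = Zlaw"
    by (simp only: Zlaw_altdef[OF s2, symmetric])
  have 5: "measure_pmf.expectation (random_perm n) (\<lambda>ks. X_normalized m t L n ks ^ k) = (LINT x|Zlaw n. x ^ k)" for n k
    unfolding Zlaw_altdef[OF s2] by (subst integral_distr) simp_all
  show ?thesis
    unfolding 4 5
    using summable_K1 1 2 3 var_conv(1) Zlaw_weak_conv Zlaw_moments by (auto simp: L2)
qed

end
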